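(* Let $N\in\mathbb{N}^*$, let $A=\{a_j\}_{j\le N}\subset(0,1)$, and let $\mu\in H^1(A)$. For $u_0\in\mathbb{R}$ consider the problem $$i\partial_t\psi=-\Delta\psi+u_0P\psi+u_1(t)\mu(x)\psi\ \ (x\in(0,1)),\quad \psi(t,0)=\psi(t,1),\quad \partial_x\psi(t,0)=\partial_x\psi(t,1),\quad \psi(0,\cdot)=\psi_0. \qquad (P)$$ **1.** Let $T>0$, $\psi_0\in H^1_p$, $u_0\in\mathbb{R}$ and $u_1\in L^2((0,T),\mathbb{R})$. Then there is a unique mild solution $\psi\in C([0,T],H^1_p)$ of (P), i.e. a unique $\psi\in C([0,T],H^1_p)$ satisfying $$\psi(t)=e^{-i(-\Delta+u_0P)t}\psi_0-i\int_0^te^{-i(-\Delta+u_0P)(t-s)}u_1(s)\mu\psi(s)\,ds,\qquad t\in[0,T].$$ **2.** Let $u_0\in\mathbb{R}\setminus2\pi\mathbb{Q}$ and $l\in\mathbb{Z}$. Assume there exists a constant $C>0$ such that $|\langle\mu\phi_l,\phi_k\rangle_{L^2}|\ge\frac{C}{|k|+1}$ for all $k\in\mathbb{Z}$. Then for any $T>0$ there exists $\delta>0$ such that, for any $\psi_0,\psi_1\in H^1_p$ with $\|\psi_0\|_{L^2}=\|\psi_1\|_{L^2}=1$ and $$\|\psi_0-\phi_l\|_{H^1_p}<\delta,\qquad\|\psi_1-\phi_l(T)\|_{H^1_p}<\delta,$$ there exists a control $u_1\in L^2((0,T),\mathbb{R})$ such that the corresponding mild solution $\psi$ of (P) with $\psi(0)=\psi_0$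 satisfies $\psi(T)=\psi_1$.
   Context: $\mathbb{N}^*=\{1,2,\dots\}$, $\mathbb{Z}^*=\mathbb{Z}\setminus\{0\}$. $L^2=L^2((0,1),\mathbb{C})$ with $\langle f,g\rangle_{L^2}=\int_0^1 f\overline{g}\,dx$. $\Delta$ is the Laplacian on $(0,1)$ with periodic boundary conditions and $P=i\partial_x$. The self-adjoint operator $-\Delta+u_0P$ has the Hilbert basis of eigenfunctions $\phi_k(x)=e^{2i\pi kx}$, $k\in\mathbb{Z}$, with eigenvalues $\lambda_k=4\pi^2k^2-2\pi u_0k$; thus $e^{-i(-\Delta+u_0P)t}\phi_k=e^{-i\lambda_kt}\phi_k$. Eigensolutions: $\phi_l(t)=e^{-i\lambda_lt}\phi_l$. $H^1_p=\{\psi\in H^1((0,1),\mathbb{C}):\psi(0)=\psi(1)\}$ is endowed with the norm $\|\psi\|_{H^1_p}=\big(|\langle\phi_0,\psi\rangle_{L^2}|^2+\sum_{k\in\mathbb{Z}^*}|k\langle\phi_k,\psi\rangle_{L^2}|^2\big)^{1/2}$. For $A=\{a_1<\dots<a_N\}\subset(0,1)$, $H^1(A)$ is the space of real-valued $L^2$ functions on $(0,1)$ that are $H^1$ up to the discontinuities $a_j$, i.e. $H^1(A)=H^1((0,a_1),\mathbb{R})\times\prod_{j=1}^{N-1}H^1((a_j,a_{j+1}),\mathbb{R})\times H^1((a_N,1),\mathbb{R})$. *)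

theory Defs
  imports "HOL-Analysis.Analysis"
begin

section \<open>Square-integrable functions and $H^1$ on an interval\<close>

definition L2_fun :: "real \<Rightarrow> real \<Rightarrow> (real \<Rightarrow> 'a::euclidean_space) set" where
  "L2_fun a b = {f \<in> borel_measurable (lebesgue_on {a<..<b}).
                   integrable (lebesgue_on {a<..<b}) (\<lambda>x. (norm (f x))\<^sup>2)}"

lemma L2_funD:
  assumes "f \<in> L2_fun a b"
  shows "f \<in> borel_measurable (lebesgue_on {a<..<b})"
    and "integrable (lebesgue_on {a<..<b}) (\<lambda>x. (norm (f x))\<^sup>2)"
  using assms by (auto simp: L2_fun_def)

lemma L2_fun_add:
  assumes f: "f \<in> L2_fun a b" and g: "g \<in> L2_fun a b"
  shows "(\<lambda>x. f x + g x) \<in> L2_fun a b"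
proof -
  note [measurable] = L2_funD(1)[OF f] L2_funD(1)[OF g]
  have "integrable (lebesgue_on {a<..<b}) (\<lambda>x. (norm (f x + g x))\<^sup>2)"
  proof (rule Bochner_Integration.integrable_bound)
    show "integrable (lebesgue_on {a<..<b}) (\<lambda>x. 2 * (norm (f x))\<^sup>2 + 2 * (norm (g x))\<^sup>2)"
      using L2_funD(2)[OF f] L2_funD(2)[OF g] by auto
    have "(norm (f x + g x))\<^sup>2 \<le> 2 * (norm (f x))\<^sup>2 + 2 * (norm (g x))\<^sup>2" for x
    proof -
      have "(norm (f x + g x))\<^sup>2 \<le> (norm (f x) + norm (g x))\<^sup>2"
        by (intro power_mono norm_triangle_ineq) auto
      also have "\<dots> \<le> 2 * (norm (f x))\<^sup>2 + 2 * (norm (g x))\<^sup>2"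
        using sum_squares_bound[of "norm (f x)" "norm (g x)"] by (simp add: power2_sum)
      finally show ?thesis .
    qed
    then show "AE x in lebesgue_on {a<..<b}. norm ((norm (f x + g x))\<^sup>2)
                 \<le> norm (2 * (norm (f x))\<^sup>2 + 2 * (norm (g x))\<^sup>2)"
      by auto
  qed measurable
  then show ?thesis by (simp add: L2_fun_def)
qed

lemma L2_fun_bound:
  assumes f: "f \<in> L2_fun a b" and "g \<in> borel_measurable (lebesgue_on {a<..<b})"
    and "AE x in lebesgue_on {a<..<b}. norm (g x) \<le> C * norm (f x)"
  shows "g \<in> L2_fun a b"
proof -
  note [measurable] = L2_funD(1)[OF f] assms(2)
  have "integrable (lebesgue_on {a<..<b}) (\<lambda>x. (norm (g x))\<^sup>2)"
  proof (rule Bochner_Integration.integrable_bound)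
    show "integrable (lebesgue_on {a<..<b}) (\<lambda>x. C\<^sup>2 * (norm (f x))\<^sup>2)"
      using L2_funD(2)[OF f] by auto
    show "AE x in lebesgue_on {a<..<b}. norm ((norm (g x))\<^sup>2) \<le> norm (C\<^sup>2 * (norm (f x))\<^sup>2)"
      using assms(3)
    proof eventually_elim
      case (elim x)
      have "(norm (g x))\<^sup>2 \<le> (C * norm (f x))\<^sup>2"
        using elim by (intro power_mono) auto
      then show ?case by (simp add: power_mult_distrib)
    qed
  qed measurable
  then show ?thesis using assms(2) by (simp add: L2_fun_def)
qed

lemma L2_fun_scaleR:
  assumes f: "f \<in> L2_fun a b"
  shows "(\<lambda>x. c *\<^sub>R f x) \<in> L2_fun a b"
  using L2_funD(1)[OF f] by (intro L2_fun_bound[OF f, where C = "\<bar>c\<bar>"]) auto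

lemma L2_fun_cmult:
  fixes f :: "real \<Rightarrow> complex"
  assumes f: "f \<in> L2_fun a b"
  shows "(\<lambda>x. c * f x) \<in> L2_fun a b"
  using L2_funD(1)[OF f] by (intro L2_fun_bound[OF f, where C = "norm c"]) (auto simp: norm_mult)

lemma L2_fun_uminus:
  assumes f: "f \<in> L2_fun a b"
  shows "(\<lambda>x. - f x) \<in> L2_fun a b"
  using L2_fun_scaleR[OF f, of "-1"] by simp

lemma L2_fun_zero: "(\<lambda>x. 0) \<in> L2_fun a b"
  by (simp add: L2_fun_def)

lemma L2_fun_cong_AE:
  assumes "f \<in> L2_fun a b" "g \<in> borel_measurable (lebesgue_on {a<..<b})"
    and "AE x in lebesgue_on {a<..<b}. f x = g x"
  shows "g \<in> L2_fun a b"
  using assms(3) by (intro L2_fun_bound[OF assms(1,2), where C = 1]) auto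

lemma L2_fun_prod_integrable:
  fixes f g :: "real \<Rightarrow> complex"
  assumes f: "f \<in> L2_fun a b" and g: "g \<in> L2_fun a b"
  shows "integrable (lebesgue_on {a<..<b}) (\<lambda>x. f x * cnj (g x))"
proof -
  note [measurable] = L2_funD(1)[OF f] L2_funD(1)[OF g]
  show ?thesis
  proof (rule Bochner_Integration.integrable_bound)
    show "integrable (lebesgue_on {a<..<b}) (\<lambda>x. (norm (f x))\<^sup>2 + (norm (g x))\<^sup>2)"
      using L2_funD(2)[OF f] L2_funD(2)[OF g] by auto
    have "norm (f x * cnj (g x)) \<le> (norm (f x))\<^sup>2 + (norm (g x))\<^sup>2" for x
    proof -
      have "0 \<le> norm (f x) * norm (g x)" by simp
      then show ?thesis
        using sum_squares_bound[of "norm (f x)" "norm (g x)"] unfolding norm_mult complex_mod_cnj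
        by linarith
    qed
    then show "AE x in lebesgue_on {a<..<b}. norm (f x * cnj (g x))
                 \<le> norm ((norm (f x))\<^sup>2 + (norm (g x))\<^sup>2)"
      by auto
    have "(\<lambda>x. cnj (g x)) \<in> borel_measurable (lebesgue_on {a<..<b})"
      by (intro borel_measurable_continuous_on[OF continuous_on_cnj[OF continuous_on_id]]) measurable
    then show "(\<lambda>x. f x * cnj (g x)) \<in> borel_measurable (lebesgue_on {a<..<b})"
      by measurable
  qed
qed

definition C1_test :: "real \<Rightarrow> real \<Rightarrow> (real \<Rightarrow> real) set" where
  "C1_test a b = {\<phi>. (\<forall>x. \<phi> differentiable (at x)) \<and> continuous_on UNIV (deriv \<phi>) \<and>
                     (\<exists>c d. a < c \<and> d < b \<and> (\<forall>x. x \<notin> {c..d} \<longrightarrow> \<phi> x = 0))}"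

text \<open>$H^1((a,b))$ through weak derivatives. In dimension one the test functions
  $C^1_c((a,b))$ and $C^\infty_c((a,b))$ give the same space.\<close>

definition H1_fun :: "real \<Rightarrow> real \<Rightarrow> (real \<Rightarrow> 'a::euclidean_space) set" where
  "H1_fun a b = {f \<in> L2_fun a b. \<exists>g \<in> L2_fun a b. \<forall>\<phi> \<in> C1_test a b.
     (LINT x|lebesgue_on {a<..<b}. deriv \<phi> x *\<^sub>R f x)
       = - (LINT x|lebesgue_on {a<..<b}. \<phi> x *\<^sub>R g x)}"

text \<open>The pairs \<open>(a, b)\<close> below are the pairs of consecutive points of $\{0\} \cup A \cup \{1\}$.\<close>

definition H1_pw :: "real set \<Rightarrow> (real \<Rightarrow> real) set" where
  "H1_pw A = {f \<in> L2_fun 0 1. \<forall>a \<in> insert 0 (insert 1 A). \<forall>b \<in> insert 0 (insert 1 A).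
     a < b \<and> A \<inter> {a<..<b} = {} \<longrightarrow> f \<in> H1_fun a b}"


section \<open>The Hilbert space $L^2((0,1),\mathbb{C})$\<close>

definition L2_rel :: "(real \<Rightarrow> complex) \<Rightarrow> (real \<Rightarrow> complex) \<Rightarrow> bool" where
  "L2_rel f g \<longleftrightarrow> f \<in> L2_fun 0 1 \<and> g \<in> L2_fun 0 1 \<and> (AE x in lebesgue_on {0<..<1}. f x = g x)"

lemma L2_rel_part_equivp: "part_equivp L2_rel"
proof (rule part_equivpI)
  show "\<exists>f. L2_rel f f"
    by (rule exI[of _ "\<lambda>x. 0"]) (simp add: L2_rel_def L2_fun_zero)
  show "symp L2_rel"
    by (rule sympI) (auto simp: L2_rel_def eq_commute)
  show "transp L2_rel"
    by (rule transpI) (auto simp: L2_rel_def elim: AE_mp)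
qed

quotient_type l2 = "real \<Rightarrow> complex" / partial: L2_rel
  by (rule L2_rel_part_equivp)

text \<open>\<open>l2_of f\<close> is the class of a square-integrable function \<open>f\<close>.\<close>

definition l2_of :: "(real \<Rightarrow> complex) \<Rightarrow> l2" where
  "l2_of f = abs_l2 f"

definition fun_of :: "l2 \<Rightarrow> real \<Rightarrow> complex" where
  "fun_of \<psi> = rep_l2 \<psi>"

lemma fun_of_L2: "fun_of \<psi> \<in> L2_fun 0 1"
  using Quotient3_rep_reflp[OF Quotient3_l2] by (auto simp: fun_of_def L2_rel_def)

lemma l2_of_fun_of [simp]: "l2_of (fun_of \<psi>) = \<psi>"
  using Quotient3_abs_rep[OF Quotient3_l2] by (simp add: l2_of_def fun_of_def)

lemma l2_of_eq_iff:
  assumes "f \<in> L2_fun 0 1" "g \<in> L2_fun 0 1"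
  shows "l2_of f = l2_of g \<longleftrightarrow> (AE x in lebesgue_on {0<..<1}. f x = g x)"
  using Quotient3_rel[OF Quotient3_l2, of f g] assms by (auto simp: l2_of_def L2_rel_def)

lemma fun_of_l2_of:
  assumes "f \<in> L2_fun 0 1"
  shows "AE x in lebesgue_on {0<..<1}. fun_of (l2_of f) x = f x"
  using l2_of_eq_iff[OF fun_of_L2[of "l2_of f"] assms] by simp

definition cinner :: "l2 \<Rightarrow> l2 \<Rightarrow> complex" where
  "cinner \<psi> \<eta> = (LINT x|lebesgue_on {0<..<1}. fun_of \<psi> x * cnj (fun_of \<eta> x))"

definition cscale :: "complex \<Rightarrow> l2 \<Rightarrow> l2" where
  "cscale c \<psi> = l2_of (\<lambda>x. c * fun_of \<psi> x)"

lemma L2_fun_borel [measurable_dest]: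
  "f \<in> L2_fun a b \<Longrightarrow> f \<in> borel_measurable (lebesgue_on {a<..<b})"
  by (rule L2_funD)

lemma fun_of_borel [measurable]: "fun_of \<psi> \<in> borel_measurable (lebesgue_on {0<..<1})"
  by (rule L2_funD[OF fun_of_L2])

lemma fun_of_cscale: "AE x in lebesgue_on {0<..<1}. fun_of (cscale c \<psi>) x = c * fun_of \<psi> x"
  unfolding cscale_def by (intro fun_of_l2_of L2_fun_cmult fun_of_L2)

lemma l2_eqI:
  assumes "AE x in lebesgue_on {0<..<1}. fun_of \<psi> x = fun_of \<eta> x"
  shows "\<psi> = \<eta>"
  using l2_of_eq_iff[OF fun_of_L2 fun_of_L2, of \<psi> \<eta>] assms by simp

instantiation l2 :: real_inner
begin

definition "0 = l2_of (\<lambda>x. 0)"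
definition "\<psi> + \<eta> = l2_of (\<lambda>x. fun_of \<psi> x + fun_of \<eta> x)"
definition "\<psi> - \<eta> = l2_of (\<lambda>x. fun_of \<psi> x - fun_of \<eta> x)"
definition "- \<psi> = l2_of (\<lambda>x. - fun_of \<psi> x)"
definition "c *\<^sub>R \<psi> = cscale (complex_of_real c) \<psi>"
definition "inner \<psi> \<eta> = Re (cinner \<psi> \<eta>)"
definition "norm (\<psi>::l2) = sqrt (inner \<psi> \<psi>)"
definition "sgn (\<psi>::l2) = inverse (norm \<psi>) *\<^sub>R \<psi>"
definition "dist (\<psi>::l2) \<eta> = norm (\<psi> - \<eta>)"
definition "(uniformity :: (l2 \<times> l2) filter) = (INF e\<in>{0<..}. principal {(x, y). dist x y < e})"
definition "open (U :: l2 set) \<longleftrightarrow> (\<forall>x\<in>U. eventually (\<lambda>(x', y). x' = x \<longrightarrow> y \<in> U) uniformity)"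

lemma fun_of_zero: "AE x in lebesgue_on {0<..<1}. fun_of 0 x = 0"
  unfolding zero_l2_def by (intro fun_of_l2_of L2_fun_zero)

lemma fun_of_add: "AE x in lebesgue_on {0<..<1}. fun_of (\<psi> + \<eta>) x = fun_of \<psi> x + fun_of \<eta> x"
  unfolding plus_l2_def by (intro fun_of_l2_of L2_fun_add fun_of_L2)

lemma fun_of_uminus: "AE x in lebesgue_on {0<..<1}. fun_of (- \<psi>) x = - fun_of \<psi> x"
  unfolding uminus_l2_def by (intro fun_of_l2_of L2_fun_uminus fun_of_L2)

lemma fun_of_diff: "AE x in lebesgue_on {0<..<1}. fun_of (\<psi> - \<eta>) x = fun_of \<psi> x - fun_of \<eta> x"
  unfolding minus_l2_def
  using L2_fun_add[OF fun_of_L2[of \<psi>] L2_fun_uminus[OF fun_of_L2[of \<eta>]]]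
  by (intro fun_of_l2_of) simp

lemma fun_of_scaleR: "AE x in lebesgue_on {0<..<1}. fun_of (c *\<^sub>R \<psi>) x = c *\<^sub>R fun_of \<psi> x"
  unfolding scaleR_l2_def using fun_of_cscale[of "complex_of_real c" \<psi>]
  by (simp add: scaleR_conv_of_real)

lemma integrable_cinner:
  "integrable (lebesgue_on {0<..<1}) (\<lambda>x. fun_of \<psi> x * cnj (fun_of \<eta> x))"
  by (intro L2_fun_prod_integrable fun_of_L2)

lemma cnj_borel_measurable [measurable (raw)]:
  "f \<in> borel_measurable M \<Longrightarrow> (\<lambda>x. cnj (f x)) \<in> borel_measurable M"
  by (intro borel_measurable_continuous_on[OF continuous_on_cnj[OF continuous_on_id]])

lemma cinner_add_left: "cinner (\<psi> + \<eta>) \<xi> = cinner \<psi> \<xi> + cinner \<eta> \<xi>"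
proof -
  have "cinner (\<psi> + \<eta>) \<xi> = (LINT x|lebesgue_on {0<..<1}. fun_of \<psi> x * cnj (fun_of \<xi> x)
           + fun_of \<eta> x * cnj (fun_of \<xi> x))"
    unfolding cinner_def using fun_of_add[of \<psi> \<eta>]
    by (intro integral_cong_AE) (auto simp: algebra_simps elim!: eventually_mono)
  then show ?thesis
    by (simp add: cinner_def integrable_cinner)
qed

lemma cinner_cscale_left: "cinner (cscale c \<psi>) \<eta> = c * cinner \<psi> \<eta>"
proof -
  have "cinner (cscale c \<psi>) \<eta> = (LINT x|lebesgue_on {0<..<1}. c * (fun_of \<psi> x * cnj (fun_of \<eta> x)))"
    unfolding cinner_def using fun_of_cscale[of c \<psi>]
    by (intro integral_cong_AE) (auto simp: algebra_simps elim!: eventually_mono)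
  then show ?thesis
    by (simp add: cinner_def)
qed

lemma cinner_commute: "cinner \<psi> \<eta> = cnj (cinner \<eta> \<psi>)"
  by (simp add: cinner_def mult.commute flip: Bochner_Integration.integral_cnj)

lemma inner_l2_self: "inner \<psi> \<psi> = (LINT x|lebesgue_on {0<..<1}. (norm (fun_of \<psi> x))\<^sup>2)"
  unfolding inner_l2_def cinner_def complex_norm_square[symmetric] of_real_power[symmetric]
  by (simp only: integral_complex_of_real Re_complex_of_real)

instance
proof
  fix \<psi> \<eta> \<xi> :: l2 and r s :: real
  show "\<psi> + \<eta> + \<xi> = \<psi> + (\<eta> + \<xi>)"
    using fun_of_add[of "\<psi> + \<eta>" \<xi>] fun_of_add[of \<psi> \<eta>] fun_of_add[of \<psi> "\<eta> + \<xi>"] fun_of_add[of \<eta> \<xi>]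
    by (intro l2_eqI, eventually_elim) simp
  show "\<psi> + \<eta> = \<eta> + \<psi>"
    by (simp add: plus_l2_def add.commute)
  show "0 + \<psi> = \<psi>"
    using fun_of_add[of 0 \<psi>] fun_of_zero by (intro l2_eqI, eventually_elim) simp
  show "- \<psi> + \<psi> = 0"
    using fun_of_add[of "-\<psi>" \<psi>] fun_of_uminus[of \<psi>] fun_of_zero
    by (intro l2_eqI, eventually_elim) simp
  show "\<psi> - \<eta> = \<psi> + - \<eta>"
    using fun_of_add[of \<psi> "-\<eta>"] fun_of_uminus[of \<eta>] fun_of_diff[of \<psi> \<eta>]
    by (intro l2_eqI, eventually_elim) simp
  show "r *\<^sub>R (\<psi> + \<eta>) = r *\<^sub>R \<psi> + r *\<^sub>R \<eta>"
    using fun_of_add[of \<psi> \<eta>] fun_of_add[of "r *\<^sub>R \<psi>" "r *\<^sub>R \<eta>"]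
      fun_of_scaleR[of r "\<psi> + \<eta>"] fun_of_scaleR[of r \<psi>] fun_of_scaleR[of r \<eta>]
    by (intro l2_eqI, eventually_elim) (simp add: algebra_simps)
  show "(r + s) *\<^sub>R \<psi> = r *\<^sub>R \<psi> + s *\<^sub>R \<psi>"
    using fun_of_add[of "r *\<^sub>R \<psi>" "s *\<^sub>R \<psi>"]
      fun_of_scaleR[of "r + s" \<psi>] fun_of_scaleR[of r \<psi>] fun_of_scaleR[of s \<psi>]
    by (intro l2_eqI, eventually_elim) (simp add: algebra_simps)
  show "r *\<^sub>R s *\<^sub>R \<psi> = (r * s) *\<^sub>R \<psi>"
    using fun_of_scaleR[of "r * s" \<psi>] fun_of_scaleR[of r "s *\<^sub>R \<psi>"] fun_of_scaleR[of s \<psi>]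
    by (intro l2_eqI, eventually_elim) (simp add: algebra_simps)
  show "1 *\<^sub>R \<psi> = \<psi>"
    using fun_of_scaleR[of 1 \<psi>] by (intro l2_eqI, eventually_elim) simp
  show "sgn \<psi> = inverse (norm \<psi>) *\<^sub>R \<psi>" by (rule sgn_l2_def)
  show "dist \<psi> \<eta> = norm (\<psi> - \<eta>)" by (rule dist_l2_def)
  show "uniformity = (INF e\<in>{0<..}. principal {(x, y). dist (x::l2) y < e})"
    by (rule uniformity_l2_def)
  show "open U = (\<forall>x\<in>U. \<forall>\<^sub>F (x', y) in uniformity. x' = x \<longrightarrow> y \<in> U)" for U :: "l2 set"
    by (rule open_l2_def)
  show "inner \<psi> \<eta> = inner \<eta> \<psi>"
    by (subst (1 2) inner_l2_def, subst cinner_commute) simp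
  show "inner (\<psi> + \<eta>) \<xi> = inner \<psi> \<xi> + inner \<eta> \<xi>"
    by (simp add: inner_l2_def cinner_add_left)
  show "inner (r *\<^sub>R \<psi>) \<eta> = r * inner \<psi> \<eta>"
    by (simp add: inner_l2_def scaleR_l2_def cinner_cscale_left)
  show "0 \<le> inner \<psi> \<psi>"
    by (simp add: inner_l2_self)
  show "inner \<psi> \<psi> = 0 \<longleftrightarrow> \<psi> = 0"
  proof -
    have "inner \<psi> \<psi> = 0 \<longleftrightarrow> (AE x in lebesgue_on {0<..<1}. (norm (fun_of \<psi> x))\<^sup>2 = 0)"
      unfolding inner_l2_self
      by (rule integral_nonneg_eq_0_iff_AE) (auto intro: L2_funD(2)[OF fun_of_L2])
    also have "\<dots> \<longleftrightarrow> (AE x in lebesgue_on {0<..<1}. fun_of \<psi> x = 0)" by simp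
    also have "\<dots> \<longleftrightarrow> \<psi> = 0"
      using l2_of_eq_iff[OF fun_of_L2 L2_fun_zero, of \<psi>] by (simp add: zero_l2_def)
    finally show ?thesis .
  qed
  show "norm \<psi> = sqrt (inner \<psi> \<psi>)" by (rule norm_l2_def)
qed

end

lemma norm_l2_sq: "(norm \<psi>)\<^sup>2 = (LINT x|lebesgue_on {0<..<1}. (norm (fun_of \<psi> x))\<^sup>2)"
  by (simp add: power2_norm_eq_inner inner_l2_self)

lemma norm_l2_of_sq:
  assumes "f \<in> L2_fun 0 1"
  shows "(norm (l2_of f))\<^sup>2 = (LINT x|lebesgue_on {0<..<1}. (norm (f x))\<^sup>2)"
  unfolding norm_l2_sq using fun_of_l2_of[OF assms] assms
  by (intro integral_cong_AE) (auto elim!: eventually_mono)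

lemma cinner_l2_of:
  assumes "f \<in> L2_fun 0 1" "g \<in> L2_fun 0 1"
  shows "cinner (l2_of f) (l2_of g) = (LINT x|lebesgue_on {0<..<1}. f x * cnj (g x))"
  unfolding cinner_def using fun_of_l2_of[OF assms(1)] fun_of_l2_of[OF assms(2)] assms
  by (intro integral_cong_AE) (auto elim: AE_mp)

lemma l2_of_add:
  assumes "f \<in> L2_fun 0 1" "g \<in> L2_fun 0 1"
  shows "l2_of (\<lambda>x. f x + g x) = l2_of f + l2_of g"
  using fun_of_l2_of[OF assms(1)] fun_of_l2_of[OF assms(2)] fun_of_add[of "l2_of f" "l2_of g"]
    fun_of_l2_of[OF L2_fun_add[OF assms]]
  by (intro l2_eqI, eventually_elim) simp

lemma l2_of_cmult:
  assumes "f \<in> L2_fun 0 1"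
  shows "l2_of (\<lambda>x. c * f x) = cscale c (l2_of f)"
  using fun_of_l2_of[OF assms] fun_of_cscale[of c "l2_of f"] fun_of_l2_of[OF L2_fun_cmult[OF assms]]
  by (intro l2_eqI, eventually_elim) simp

lemma l2_of_diff:
  assumes "f \<in> L2_fun 0 1" "g \<in> L2_fun 0 1"
  shows "l2_of (\<lambda>x. f x - g x) = l2_of f - l2_of g"
proof -
  have "l2_of (\<lambda>x. f x + (-1) * g x) = l2_of f + l2_of (\<lambda>x. (-1) * g x)"
    by (intro l2_of_add assms L2_fun_cmult)
  also have "l2_of (\<lambda>x. (-1) * g x) = (-1) *\<^sub>R l2_of g"
    unfolding scaleR_l2_def by (subst l2_of_cmult) (simp_all add: assms)
  finally show ?thesis by simp
qed

abbreviation M01 :: "real measure" where "M01 \<equiv> lebesgue_on {0<..<1}"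

lemma finite_measure_M01: "finite_measure M01"
  by (rule finite_measureI) (simp add: emeasure_restrict_space)

lemma measure_M01: "measure M01 (space M01) = 1"
  by (simp add: measure_restrict_space)

lemma L2_fun_bounded:
  assumes "f \<in> borel_measurable M01" "AE x in M01. norm (f x) \<le> C"
  shows "f \<in> L2_fun 0 1"
proof -
  have "(\<lambda>x. 1::real) \<in> L2_fun 0 1"
    using finite_measure_M01 by (simp add: L2_fun_def finite_measure.integrable_const)
  then show ?thesis
    using assms by (rule_tac L2_fun_bound[where f = "\<lambda>x. 1::real" and C = C]) auto
qed

lemma l2_tendsto_dominated:
  fixes w :: "real \<Rightarrow> real"
  assumes w: "w \<in> L2_fun 0 1"
    and [measurable]: "\<And>n. f n \<in> borel_measurable M01" "g \<in> borel_measurable M01"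
    and lim: "AE x in M01. (\<lambda>n. f n x) \<longlonglongrightarrow> g x"
    and bound: "\<And>n. AE x in M01. norm (f n x) \<le> w x"
  shows "(\<lambda>n. l2_of (f n)) \<longlonglongrightarrow> l2_of g"
proof -
  have all: "AE x in M01. \<forall>n. norm (f n x) \<le> w x"
    using bound by (simp add: AE_all_countable)
  have g: "AE x in M01. norm (g x) \<le> w x"
    using lim all
  proof eventually_elim
    case (elim x)
    then show ?case by (intro LIMSEQ_le_const2[OF tendsto_norm[OF elim(1)]]) auto
  qed
  have fL: "f n \<in> L2_fun 0 1" for n
    using bound[of n] by (intro L2_fun_bound[OF w, where C = 1]) (auto elim!: eventually_mono)
  have gL: "g \<in> L2_fun 0 1"
    using g by (intro L2_fun_bound[OF w, where C = 1]) (auto elim!: eventually_mono)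
  have dL: "(\<lambda>x. f n x - g x) \<in> L2_fun 0 1" for n
    using L2_fun_add[OF fL[of n] L2_fun_uminus[OF gL]] by simp
  note [measurable] = L2_funD(1)[OF w]
  have "(\<lambda>n. LINT x|M01. (norm (f n x - g x))\<^sup>2) \<longlonglongrightarrow> (LINT x|M01. 0)"
  proof (rule integral_dominated_convergence[where w = "\<lambda>x. 4 * (norm (w x))\<^sup>2"])
    show "integrable M01 (\<lambda>x. 4 * (norm (w x))\<^sup>2)"
      using L2_funD(2)[OF w] by auto
    show "AE x in M01. (\<lambda>n. (norm (f n x - g x))\<^sup>2) \<longlonglongrightarrow> 0"
      using lim
    proof eventually_elim
      case (elim x)
      then have "(\<lambda>n. f n x - g x) \<longlonglongrightarrow> 0" by (simp add: LIM_zero)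
      then have "(\<lambda>n. (norm (f n x - g x))\<^sup>2) \<longlonglongrightarrow> (norm (0::complex))\<^sup>2"
        by (intro tendsto_intros)
      then show ?case by simp
    qed
    show "AE x in M01. norm ((norm (f n x - g x))\<^sup>2) \<le> 4 * (norm (w x))\<^sup>2" for n
      using bound[of n] g
    proof eventually_elim
      case (elim x)
      have "norm (f n x - g x) \<le> 2 * norm (w x)"
        using norm_triangle_ineq4[of "f n x" "g x"] elim by auto
      then have "(norm (f n x - g x))\<^sup>2 \<le> (2 * norm (w x))\<^sup>2"
        by (intro power_mono) auto
      then show ?case by (simp add: power_mult_distrib)
    qed
  qed measurable
  then have "(\<lambda>n. (norm (l2_of (f n) - l2_of g))\<^sup>2) \<longlonglongrightarrow> 0"
    by (simp add: norm_l2_of_sq[OF dL, symmetric] l2_of_diff[OF fL gL])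
  then have "(\<lambda>n. sqrt ((norm (l2_of (f n) - l2_of g))\<^sup>2)) \<longlonglongrightarrow> sqrt 0"
    by (intro tendsto_intros)
  then show ?thesis
    by (simp add: tendsto_norm_zero_iff LIM_zero_iff)
qed

instance l2 :: banach
proof
  fix X :: "nat \<Rightarrow> l2" assume X: "Cauchy X"
  have "\<exists>r. \<forall>n. (\<forall>m\<ge>r n. dist (X m) (X (r n)) < (1/2)^n) \<and> (r n < r (Suc n))"
  proof (rule dependent_nat_choice)
    have *: "\<exists>N>k. \<forall>m\<ge>N. dist (X m) (X N) < (1/2)^n" for n k
    proof -
      obtain N where N: "\<And>m p. m \<ge> N \<Longrightarrow> p \<ge> N \<Longrightarrow> dist (X m) (X p) < (1/2)^n"
        using metric_CauchyD[OF X, of "(1/2)^n"] by auto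
      then show ?thesis by (intro exI[of _ "N + k + 1"]) auto
    qed
    show "\<exists>N. \<forall>m\<ge>N. dist (X m) (X N) < (1/2)^0" using *[of 0 0] by auto
    show "\<exists>N. (\<forall>m\<ge>N. dist (X m) (X N) < (1/2)^Suc n) \<and> k < N" for k n
      using *[of k "Suc n"] by auto
  qed
  then obtain r where r: "\<And>n m. m \<ge> r n \<Longrightarrow> dist (X m) (X (r n)) < (1/2)^n"
      and r_Suc: "\<And>n. r n < r (Suc n)"
    by blast
  have r_mono: "strict_mono r" using r_Suc by (simp add: strict_mono_Suc_iff)
  define f where "f n = fun_of (X (r n))" for n
  have fL: "f n \<in> L2_fun 0 1" for n by (simp add: f_def fun_of_L2)
  have X_eq: "X (r n) = l2_of (f n)" for n by (simp add: f_def)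
  note [measurable] = L2_funD(1)[OF fL]
  have dL: "(\<lambda>x. f m x - f n x) \<in> L2_fun 0 1" for m n
    using L2_fun_add[OF fL[of m] L2_fun_uminus[OF fL[of n]]] by simp
  have d_int: "(LINT x|M01. (norm (f m x - f n x))\<^sup>2) \<le> ((1/2)^n)\<^sup>2" if "m \<ge> n" for m n
  proof -
    have "r m \<ge> r n" using that r_mono by (simp add: strict_mono_less_eq)
    then have "norm (l2_of (f m) - l2_of (f n)) \<le> (1/2)^n"
      using r[of n "r m"] by (simp add: X_eq dist_norm)
    then have "(norm (l2_of (f m) - l2_of (f n)))\<^sup>2 \<le> ((1/2)^n)\<^sup>2"
      by (intro power_mono) auto
    then show ?thesis
      by (simp add: norm_l2_of_sq[OF dL, symmetric] l2_of_diff[OF fL fL])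
  qed
  have d1: "integrable M01 (\<lambda>x. norm (f (Suc n) x - f n x))"
       "(LINT x|M01. norm (f (Suc n) x - f n x)) \<le> (1/2)^n" for n
  proof -
    let ?e = "(1/2)^n :: real"
    interpret finite_measure M01 by (rule finite_measure_M01)
    have I: "integrable M01 (\<lambda>x. ?e / 2 + (norm (f (Suc n) x - f n x))\<^sup>2 / (2 * ?e))"
      using L2_funD(2)[OF dL[of "Suc n" n]] by auto
    have le: "norm (f (Suc n) x - f n x) \<le> ?e / 2 + (norm (f (Suc n) x - f n x))\<^sup>2 / (2 * ?e)" for x
      using sum_squares_bound[of ?e "norm (f (Suc n) x - f n x)"]
      by (simp add: field_simps power2_eq_square)
    show 1: "integrable M01 (\<lambda>x. norm (f (Suc n) x - f n x))"
      by (rule Bochner_Integration.integrable_bound[OF I])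
        (auto intro!: AE_I2 order_trans[OF le])
    have "(LINT x|M01. norm (f (Suc n) x - f n x))
          \<le> (LINT x|M01. ?e / 2 + (norm (f (Suc n) x - f n x))\<^sup>2 / (2 * ?e))"
      using le by (intro integral_mono 1 I)
    also have "\<dots> = ?e / 2 + (LINT x|M01. (norm (f (Suc n) x - f n x))\<^sup>2) / (2 * ?e)"
      using L2_funD(2)[OF dL[of "Suc n" n]] measure_M01 by simp
    also have "\<dots> \<le> ?e / 2 + ?e\<^sup>2 / (2 * ?e)"
      using d_int[of n "Suc n"] by (intro add_left_mono divide_right_mono) auto
    also have "\<dots> = ?e" by (simp add: power2_eq_square)
    finally show "(LINT x|M01. norm (f (Suc n) x - f n x)) \<le> ?e" .
  qed
  have "(\<integral>\<^sup>+x. (\<Sum>n. ennreal (norm (f (Suc n) x - f n x))) \<partial>M01)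
        = (\<Sum>n. \<integral>\<^sup>+x. ennreal (norm (f (Suc n) x - f n x)) \<partial>M01)"
    by (intro nn_integral_suminf) measurable
  also have "\<dots> = (\<Sum>n. ennreal (LINT x|M01. norm (f (Suc n) x - f n x)))"
    using d1(1) by (subst nn_integral_eq_integral) auto
  also have "\<dots> \<le> (\<Sum>n. ennreal ((1/2)^n))"
    using d1(2) by (intro suminf_le) (auto intro: ennreal_leI)
  also have "\<dots> < \<infinity>"
    by (subst suminf_ennreal2) (auto simp: summable_geometric)
  finally have "AE x in M01. (\<Sum>n. ennreal (norm (f (Suc n) x - f n x))) \<noteq> \<infinity>"
    by (intro nn_integral_PInf_AE) auto
  then have conv: "AE x in M01. convergent (\<lambda>n. f n x)"
  proof eventually_elim
    case (elim x)
    then have "summable (\<lambda>n. norm (f (Suc n) x - f n x))"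
      by (intro summable_suminf_not_top) auto
    then have "summable (\<lambda>n. f (Suc n) x - f n x)" by (rule summable_norm_cancel)
    then have "convergent (\<lambda>n. \<Sum>i<n. f (Suc i) x - f i x)"
      by (simp add: summable_iff_convergent)
    then have "convergent (\<lambda>n. f n x - f 0 x)"
      by (simp add: sum_lessThan_telescope[of "\<lambda>n. f n x"])
    then show ?case using convergent_add_const_right_iff[of "\<lambda>n. f n x" "- f 0 x"] by simp
  qed
  define g where "g x = lim (\<lambda>n. f n x)" for x
  have [measurable]: "g \<in> borel_measurable M01" unfolding g_def by measurable
  have lim: "AE x in M01. (\<lambda>n. f n x) \<longlonglongrightarrow> g x"
    using conv by eventually_elim (simp add: g_def convergent_LIMSEQ_iff)
  have bound: "(\<integral>\<^sup>+x. ennreal ((norm (g x - f n x))\<^sup>2) \<partial>M01) \<le> ennreal (((1/2)^n)\<^sup>2)" for n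
  proof -
    have "(\<integral>\<^sup>+x. ennreal ((norm (g x - f n x))\<^sup>2) \<partial>M01)
        = (\<integral>\<^sup>+x. liminf (\<lambda>m. ennreal ((norm (f m x - f n x))\<^sup>2)) \<partial>M01)"
    proof (rule nn_integral_cong_AE)
      show "AE x in M01. ennreal ((norm (g x - f n x))\<^sup>2)
              = liminf (\<lambda>m. ennreal ((norm (f m x - f n x))\<^sup>2))"
        using lim
      proof eventually_elim
        case (elim x)
        have L: "(\<lambda>m. ennreal ((norm (f m x - f n x))\<^sup>2)) \<longlonglongrightarrow> ennreal ((norm (g x - f n x))\<^sup>2)"
          by (intro tendsto_ennrealI tendsto_intros elim)
        show ?case using lim_imp_Liminf[OF trivial_limit_sequentially L] by simp
      qed
    qed
    also have "\<dots> \<le> liminf (\<lambda>m. \<integral>\<^sup>+x. ennreal ((norm (f m x - f n x))\<^sup>2) \<partial>M01)"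
      by (intro nn_integral_liminf) measurable
    also have "\<dots> = liminf (\<lambda>m. ennreal (LINT x|M01. (norm (f m x - f n x))\<^sup>2))"
      using L2_funD(2)[OF dL] by (subst nn_integral_eq_integral) auto
    also have "\<dots> \<le> ennreal (((1/2)^n)\<^sup>2)"
      by (intro Liminf_le) (auto intro!: eventually_sequentiallyI[of n] ennreal_leI d_int)
    finally show ?thesis .
  qed
  have gfL: "(\<lambda>x. g x - f n x) \<in> L2_fun 0 1" for n
    using bound[of n] by (auto simp: L2_fun_def integrable_iff_bounded intro: le_less_trans)
  have gL: "g \<in> L2_fun 0 1"
    using L2_fun_add[OF gfL[of 0] fL[of 0]] by simp
  have "dist (X (r n)) (l2_of g) \<le> (1/2)^n" for n
  proof -
    have "(norm (l2_of g - l2_of (f n)))\<^sup>2 = (LINT x|M01. (norm (g x - f n x))\<^sup>2)"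
      by (simp add: norm_l2_of_sq[OF gfL, symmetric] l2_of_diff[OF gL fL])
    also have "\<dots> \<le> ((1/2)^n)\<^sup>2"
      using bound[of n] L2_funD(2)[OF gfL[of n]]
      by (subst (asm) nn_integral_eq_integral) auto
    finally have "norm (l2_of g - l2_of (f n)) \<le> (1/2)^n"
      by (rule power2_le_imp_le) simp
    then show ?thesis by (simp add: X_eq dist_norm norm_minus_commute)
  qed
  then have "(\<lambda>n. dist (X (r n)) (l2_of g)) \<longlonglongrightarrow> 0"
    by (intro tendsto_sandwich[OF _ _ tendsto_const LIMSEQ_realpow_zero[of "1/2"]]) auto
  then have "(X \<circ> r) \<longlonglongrightarrow> l2_of g"
    by (subst tendsto_dist_iff) (simp add: o_def)
  from Cauchy_converges_subseq[OF X r_mono this] show "convergent X"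
    by (auto simp: convergent_def)
qed

lemma l2_real_part_in_closed:
  fixes V :: "l2 set" and c :: complex
  assumes V: "closed V" and add: "\<And>x y. x \<in> V \<Longrightarrow> y \<in> V \<Longrightarrow> x + y \<in> V"
    and scale: "\<And>(t::real) x. x \<in> V \<Longrightarrow> t *\<^sub>R x \<in> V"
    and ind: "\<And>q. q \<in> \<rat> \<Longrightarrow> l2_of (\<lambda>x. c * indicator {..q} x) \<in> V"
    and u: "u \<in> L2_fun 0 1" "\<And>x. 0 \<le> u x"
  shows "l2_of (\<lambda>x. c * complex_of_real (u x)) \<in> V"
proof -
  have indL: "(\<lambda>x. c * indicator S x) \<in> L2_fun 0 1" if "S \<in> sets lebesgue" for S
  proof (rule L2_fun_bounded)
    have "S \<inter> {0<..<1} \<in> sets M01" using that by (auto simp: sets_restrict_space_iff)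
    then have "(\<lambda>x. c * indicator (S \<inter> {0<..<1}) x) \<in> borel_measurable M01"
      by measurable
    then show "(\<lambda>x. c * indicator S x) \<in> borel_measurable M01"
      by (rule measurable_cong[THEN iffD1, rotated]) (auto simp: indicator_def)
    show "AE x in M01. norm (c * indicator S x) \<le> norm c"
      by (auto simp: indicator_def)
  qed
  have cb: "norm (c * indicator S x) \<le> norm c" for S :: "real set" and x
    by (auto simp: indicator_def)
  have cL: "(\<lambda>x. norm c) \<in> L2_fun 0 1"
    by (rule L2_fun_bounded[where C = "norm c"]) auto
  have lim: "l2_of f \<in> V" if "\<And>n. l2_of (F n) \<in> V" "(\<lambda>n. l2_of (F n)) \<longlonglongrightarrow> l2_of f" for F f
    by (rule closed_sequentially[OF V that])
  have diff: "x - y \<in> V" if "x \<in> V" "y \<in> V" for x y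
    using add[OF that(1) scale[OF that(2), of "-1"]] by simp
  have atMost: "l2_of (\<lambda>x. c * indicator {..a} x) \<in> V" for a :: real
  proof -
    have "\<exists>q\<in>\<rat>. a < q \<and> q < a + 1 / Suc n" for n by (rule Rats_dense_in_real) simp
    then obtain q where q: "\<And>n. q n \<in> \<rat>" "\<And>n. a < q n" "\<And>n. q n < a + 1 / Suc n"
      by metis
    have ql: "q \<longlonglongrightarrow> a"
    proof (rule tendsto_sandwich[of "\<lambda>_. a" q sequentially "\<lambda>n. a + 1 / Suc n"])
      show "(\<lambda>n. a + 1 / Suc n) \<longlonglongrightarrow> a"
        using tendsto_add[OF tendsto_const[of a] LIMSEQ_inverse_real_of_nat]
        by (simp add: field_simps)
    qed (use q in \<open>auto intro!: always_eventually less_imp_le\<close>)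
    show ?thesis
    proof (rule lim)
      show "l2_of (\<lambda>x. c * indicator {..q n} x) \<in> V" for n by (rule ind[OF q(1)])
      show "(\<lambda>n. l2_of (\<lambda>x. c * indicator {..q n} x)) \<longlonglongrightarrow> l2_of (\<lambda>x. c * indicator {..a} x)"
      proof (rule l2_tendsto_dominated[OF cL])
        have "(\<lambda>n. indicator {..q n} x) \<longlonglongrightarrow> (indicator {..a} x :: complex)" for x
        proof (rule tendsto_eventually)
          show "\<forall>\<^sub>F n in sequentially. indicator {..q n} x = (indicator {..a} x :: complex)"
          proof (cases "x \<le> a")
            case True
            then show ?thesis
              using q(2) by (intro always_eventually) (auto simp: indicator_def intro: less_imp_le le_less_trans)
          next
            case False
            then have "\<forall>\<^sub>F n in sequentially. q n < x"
              by (intro order_tendstoD(2)[OF ql]) auto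
            then show ?thesis
              by (rule eventually_mono) (use False in \<open>auto simp: indicator_def\<close>)
          qed
        qed
        then show "AE x in M01. (\<lambda>n. c * indicator {..q n} x) \<longlonglongrightarrow> c * indicator {..a} x"
          by (intro AE_I2 tendsto_mult tendsto_const)
      qed (rule L2_funD(1)[OF indL] AE_I2[OF cb]; simp)+
    qed
  qed
  have one: "l2_of (\<lambda>x. c * indicator UNIV x) \<in> V"
  proof -
    have "l2_of (\<lambda>x. c * indicator UNIV x) = l2_of (\<lambda>x. c * indicator {..1} x)"
      by (subst l2_of_eq_iff[OF indL indL]) (auto simp: indicator_def intro!: AE_I2)
    then show ?thesis using atMost by simp
  qed
  have borel: "l2_of (\<lambda>x. c * indicator S x) \<in> V" if "S \<in> sets borel" for S :: "real set"
  proof -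
    have I: "Int_stable (range (\<lambda>a::real. {..a}))"
      by (auto simp: Int_stable_def)
    have S: "sets borel = sigma_sets UNIV (range (\<lambda>a::real. {..a}))"
      by (subst borel_eq_atMost) simp
    have P: "range (\<lambda>a::real. {..a}) \<subseteq> Pow UNIV" by simp
    from that have "S \<in> sigma_sets UNIV (range (\<lambda>a::real. {..a}))" by (simp add: S)
    from I P this show ?thesis
    proof (induction rule: sigma_sets_induct_disjoint)
      case (basic A)
      then show ?case using atMost by auto
    next
      case empty
      then show ?case using scale[OF one, of 0] by (simp add: zero_l2_def)
    next
      case (compl A)
      then have [measurable]: "A \<in> sets borel" by (simp add: S)
      have "l2_of (\<lambda>x. c * indicator (UNIV - A) x)
          = l2_of (\<lambda>x. c * indicator UNIV x - c * indicator A x)"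
        by (rule arg_cong[of _ _ l2_of]) (auto simp: indicator_def fun_eq_iff)
      also have "\<dots> = l2_of (\<lambda>x. c * indicator UNIV x) - l2_of (\<lambda>x. c * indicator A x)"
        by (intro l2_of_diff indL) auto
      finally show ?case using diff[OF one compl(2)] by simp
    next
      case (union A)
      then have A: "A i \<in> sets borel" for i by (auto simp: S)
      have fin: "l2_of (\<lambda>x. c * indicator (\<Union>i<n. A i) x) \<in> V" for n :: nat
      proof (induction n)
        case 0
        then show ?case using scale[OF one, of 0] by (simp add: zero_l2_def)
      next
        case (Suc n)
        have "A n \<inter> A i = {}" if "i < n" for i
          using union(1) that by (intro disjoint_family_onD[of A UNIV]) auto
        then have disj: "A n \<inter> (\<Union>i<n. A i) = {}" by blast
        have "l2_of (\<lambda>x. c * indicator (\<Union>i<Suc n. A i) x)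
            = l2_of (\<lambda>x. c * indicator (A n) x + c * indicator (\<Union>i<n. A i) x)"
          using disj by (intro arg_cong[of _ _ l2_of])
            (auto simp: indicator_def fun_eq_iff lessThan_Suc)
        also have "\<dots> = l2_of (\<lambda>x. c * indicator (A n) x) + l2_of (\<lambda>x. c * indicator (\<Union>i<n. A i) x)"
          using A by (intro l2_of_add indL) auto
        finally show ?case using add[OF union(3) Suc] by simp
      qed
      show ?case
      proof (rule lim[OF fin l2_tendsto_dominated[OF cL]])
        have "(\<lambda>n. indicator (\<Union>i<n. A i) x) \<longlonglongrightarrow> (indicator (\<Union>i. A i) x :: complex)" for x
          by (rule LIMSEQ_indicator_UN)
        then show "AE x in M01. (\<lambda>n. c * indicator (\<Union>i<n. A i) x) \<longlonglongrightarrow> c * indicator (\<Union>i. A i) x"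
          by (intro AE_I2 tendsto_mult tendsto_const)
      qed (rule L2_funD(1)[OF indL] AE_I2[OF cb]; (use A in auto)?)+
    qed
  qed
  have leb: "l2_of (\<lambda>x. c * indicator S x) \<in> V" if "S \<in> sets lebesgue" for S
  proof -
    from that obtain B N N' where S: "S = B \<union> N" "N \<subseteq> N'" "N' \<in> null_sets lborel" "B \<in> sets lborel"
      by (rule sets_completionE)
    have "AE x in lebesgue. x \<notin> N'"
      using S(3) by (intro AE_not_in null_sets_completionI)
    then have "AE x in M01. x \<notin> N'"
      by (subst AE_restrict_space_iff) (auto elim!: eventually_mono)
    then have "AE x in M01. c * indicator S x = c * indicator B x"
      by eventually_elim (use S in \<open>auto simp: indicator_def\<close>)
    then have "l2_of (\<lambda>x. c * indicator S x) = l2_of (\<lambda>x. c * indicator B x)"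
      using that S by (subst l2_of_eq_iff[OF indL indL]) auto
    then show ?thesis using borel[of B] S by simp
  qed
  have "u \<in> L2_fun 0 1 \<longrightarrow> l2_of (\<lambda>x. c * complex_of_real (u x)) \<in> V"
    using L2_funD(1)[OF u(1)] u(2)
  proof (induction rule: borel_measurable_induct_real)
    case (set A)
    then have "A \<in> sets lebesgue" by (simp add: sets_restrict_space_iff)
    from leb[OF this] show ?case by (simp add: of_real_indicator)
  next
    case (mult u t)
    show ?case
    proof (cases "t = 0")
      case True
      then show ?thesis using scale[OF one, of 0] by (simp add: zero_l2_def)
    next
      case False
      show ?thesis
      proof
        assume "(\<lambda>x. t * u x) \<in> L2_fun 0 1"
        from L2_fun_scaleR[OF this, of "inverse t"] False have uL: "u \<in> L2_fun 0 1"
          by (simp add: mult.assoc[symmetric])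
        then have L: "(\<lambda>x. c * complex_of_real (u x)) \<in> L2_fun 0 1"
          using mult(2) by (intro L2_fun_bound[OF uL, where C = "norm c"]) (auto simp: norm_mult)
        have "l2_of (\<lambda>x. c * complex_of_real (t * u x))
            = l2_of (\<lambda>x. complex_of_real t * (c * complex_of_real (u x)))"
          by (simp add: algebra_simps)
        also have "\<dots> = t *\<^sub>R l2_of (\<lambda>x. c * complex_of_real (u x))"
          by (simp only: scaleR_l2_def l2_of_cmult[OF L])
        finally show "l2_of (\<lambda>x. c * complex_of_real (t * u x)) \<in> V"
          using mult.IH uL scale by simp
      qed
    qed
  next
    case (add u v)
    show ?case
    proof
      assume uv: "(\<lambda>x. v x + u x) \<in> L2_fun 0 1"
      have uL: "u \<in> L2_fun 0 1" and vL: "v \<in> L2_fun 0 1"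
        using add.hyps(1-4) by (auto intro!: L2_fun_bound[OF uv, where C = 1])
      have "(\<lambda>x. c * complex_of_real (u x)) \<in> L2_fun 0 1"
        using add.hyps(1) by (intro L2_fun_bound[OF uL, where C = "norm c"]) (auto simp: norm_mult)
      moreover have "(\<lambda>x. c * complex_of_real (v x)) \<in> L2_fun 0 1"
        using add.hyps(3) by (intro L2_fun_bound[OF vL, where C = "norm c"]) (auto simp: norm_mult)
      ultimately have "l2_of (\<lambda>x. c * complex_of_real (v x + u x))
          = l2_of (\<lambda>x. c * complex_of_real (v x)) + l2_of (\<lambda>x. c * complex_of_real (u x))"
        by (subst l2_of_add[symmetric]) (auto simp: algebra_simps)
      then show "l2_of (\<lambda>x. c * complex_of_real (v x + u x)) \<in> V"
        using add.IH uL vL assms(2) by simp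
    qed
  next
    case (seq U)
    have le: "U n x \<le> u x" if "x \<in> space M01" for n x
      using seq.hyps(3) by (intro LIMSEQ_le_const[OF seq.hyps(4)[OF that]] exI[of _ n])
        (auto simp: incseq_def le_fun_def)
    show ?case
    proof
      assume uL': "u \<in> L2_fun 0 1"
      have UL: "U n \<in> L2_fun 0 1" for n
        using seq.hyps(1,2) le[of _ n] by (intro L2_fun_bound[OF uL', where C = 1]) (auto intro!: AE_I2 simp: u(2))
      have uc: "(\<lambda>x. norm c * u x) \<in> L2_fun 0 1"
        using L2_fun_scaleR[OF uL', of "norm c"] by simp
      note [measurable] = seq.hyps(1) L2_funD(1)[OF uL']
      have "(\<lambda>n. l2_of (\<lambda>x. c * complex_of_real (U n x))) \<longlonglongrightarrow> l2_of (\<lambda>x. c * complex_of_real (u x))"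
      proof (rule l2_tendsto_dominated[OF uc])
        show "AE x in M01. (\<lambda>n. c * complex_of_real (U n x)) \<longlonglongrightarrow> c * complex_of_real (u x)"
          using seq.hyps(4) by (intro AE_I2 tendsto_mult tendsto_of_real tendsto_const)
        show "AE x in M01. norm (c * complex_of_real (U n x)) \<le> norm c * u x" for n
          using seq.hyps(2) le by (auto simp: norm_mult intro!: AE_I2 mult_left_mono)
      qed measurable
      moreover have "l2_of (\<lambda>x. c * complex_of_real (U n x)) \<in> V" for n
        using seq.IH UL by simp
      ultimately show "l2_of (\<lambda>x. c * complex_of_real (u x)) \<in> V"
        by (rule lim[rotated, where F = "\<lambda>n x. c * complex_of_real (U n x)"])
    qed
  qed
  then show ?thesis using u by blast
qed

lemma l2_separable: "\<exists>D :: l2 set. countable D \<and> closure D = UNIV"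
proof -
  define B where "B = (\<lambda>(c, q). l2_of (\<lambda>x. c * indicator {..q} x)) ` ({1, \<i>} \<times> (\<rat> :: real set))"
  define D where "D = (\<lambda>l. \<Sum>(q, b)\<leftarrow>l. q *\<^sub>R b) ` lists ((\<rat> :: real set) \<times> B)"
  have countB: "countable B" unfolding B_def
    by (intro countable_image countable_SIGMA countable_rat) auto
  have countD: "countable D" unfolding D_def
    by (intro countable_image countable_lists countable_SIGMA countable_rat countB)
  have D_add: "x + y \<in> D" if "x \<in> D" "y \<in> D" for x y
  proof -
    from that obtain l k where l: "l \<in> lists (\<rat> \<times> B)" "x = (\<Sum>(q, b)\<leftarrow>l. q *\<^sub>R b)"
      and k: "k \<in> lists (\<rat> \<times> B)" "y = (\<Sum>(q, b)\<leftarrow>k. q *\<^sub>R b)"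
      unfolding D_def by blast
    show ?thesis unfolding D_def
      by (rule image_eqI[of _ _ "l @ k"]) (use l k in auto)
  qed
  have D_scale: "t *\<^sub>R x \<in> D" if "t \<in> \<rat>" "x \<in> D" for t x
  proof -
    from that(2) obtain l where l: "l \<in> lists (\<rat> \<times> B)" "x = (\<Sum>(q, b)\<leftarrow>l. q *\<^sub>R b)"
      unfolding D_def by blast
    have "t *\<^sub>R (\<Sum>(q, b)\<leftarrow>l. q *\<^sub>R b) = (\<Sum>(q, b)\<leftarrow>map (\<lambda>(q, b). (t * q, b)) l. q *\<^sub>R b)"
      by (induction l) (auto simp: scaleR_add_right)
    then show ?thesis unfolding D_def
      by (intro image_eqI[of _ _ "map (\<lambda>(q, b). (t * q, b)) l"])
        (use l that(1) in \<open>auto simp: lists_eq_set subset_iff intro!: Rats_mult\<close>)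
  qed
  define V where "V = closure D"
  have V: "closed V" by (simp add: V_def)
  have add: "x + y \<in> V" if "x \<in> V" "y \<in> V" for x y
  proof -
    from that obtain X Y where "\<And>n. X n \<in> D" "X \<longlonglongrightarrow> x" "\<And>n. Y n \<in> D" "Y \<longlonglongrightarrow> y"
      unfolding V_def closure_sequential by blast
    then show ?thesis unfolding V_def closure_sequential
      by (intro exI[of _ "\<lambda>n. X n + Y n"]) (auto intro: D_add tendsto_add)
  qed
  have scale: "t *\<^sub>R x \<in> V" if "x \<in> V" for t :: real and x
  proof -
    have "t \<in> closure \<rat>" by (simp add: Rats_closure_real)
    then obtain T where T: "\<And>n. T n \<in> \<rat>" "T \<longlonglongrightarrow> t"
      unfolding closure_sequential by blast
    from that obtain X where "\<And>n. X n \<in> D" "X \<longlonglongrightarrow> x"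
      unfolding V_def closure_sequential by blast
    with T show ?thesis unfolding V_def closure_sequential
      by (intro exI[of _ "\<lambda>n. T n *\<^sub>R X n"]) (auto intro: D_scale tendsto_scaleR)
  qed
  have "b \<in> V" if "b \<in> B" for b
  proof -
    have "b \<in> D" unfolding D_def by (rule image_eqI[of _ _ "[(1, b)]"]) (use that in auto)
    then show ?thesis unfolding V_def using closure_subset by blast
  qed
  then have ind: "l2_of (\<lambda>x. c * indicator {..q} x) \<in> V" if "c \<in> {1, \<i>}" "q \<in> \<rat>" for c q
    using that unfolding B_def by blast
  have nonneg: "l2_of (\<lambda>x. c * complex_of_real (u x)) \<in> V"
    if "c \<in> {1, \<i>}" "u \<in> L2_fun 0 1" "\<And>x. 0 \<le> u x" for c u
    using l2_real_part_in_closed[OF V add scale ind[OF that(1)]] that by blast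
  have real: "l2_of (\<lambda>x. c * complex_of_real (u x)) \<in> V"
    if c: "c \<in> {1, \<i>}" and u: "u \<in> L2_fun 0 1" for c and u :: "real \<Rightarrow> real"
  proof -
    note [measurable] = L2_funD(1)[OF u]
    have p: "(\<lambda>x. max 0 (u x)) \<in> L2_fun 0 1" and m: "(\<lambda>x. max 0 (- u x)) \<in> L2_fun 0 1"
      by (rule L2_fun_bound[OF u, where C = 1]; auto)+
    have cp: "(\<lambda>x. c * complex_of_real (max 0 (u x))) \<in> L2_fun 0 1"
      by (rule L2_fun_bound[OF p, where C = "norm c"]) (auto simp: norm_mult)
    have cm: "(\<lambda>x. c * complex_of_real (max 0 (- u x))) \<in> L2_fun 0 1"
      by (rule L2_fun_bound[OF m, where C = "norm c"]) (auto simp: norm_mult)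
    have "l2_of (\<lambda>x. c * complex_of_real (u x))
        = l2_of (\<lambda>x. c * complex_of_real (max 0 (u x)) - c * complex_of_real (max 0 (- u x)))"
      by (intro arg_cong[of _ _ l2_of]) (auto simp: fun_eq_iff max_def)
    also have "\<dots> = l2_of (\<lambda>x. c * complex_of_real (max 0 (u x)))
                  + (-1) *\<^sub>R l2_of (\<lambda>x. c * complex_of_real (max 0 (- u x)))"
      by (simp add: l2_of_diff[OF cp cm])
    also have "\<dots> \<in> V"
      by (intro add scale nonneg[OF c] p m) auto
    finally show ?thesis .
  qed
  have "\<psi> \<in> V" for \<psi>
  proof -
    note L = fun_of_L2[of \<psi>]
    have re: "(\<lambda>x. Re (fun_of \<psi> x)) \<in> L2_fun 0 1"
      by (rule L2_fun_bound[OF L, where C = 1]) (auto simp: abs_Re_le_cmod)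
    have im: "(\<lambda>x. Im (fun_of \<psi> x)) \<in> L2_fun 0 1"
      by (rule L2_fun_bound[OF L, where C = 1]) (auto simp: abs_Im_le_cmod)
    have cre: "(\<lambda>x. 1 * complex_of_real (Re (fun_of \<psi> x))) \<in> L2_fun 0 1"
      by (rule L2_fun_bound[OF re, where C = 1]) auto
    have cim: "(\<lambda>x. \<i> * complex_of_real (Im (fun_of \<psi> x))) \<in> L2_fun 0 1"
      by (rule L2_fun_bound[OF im, where C = 1]) (auto simp: norm_mult)
    have "\<psi> = l2_of (fun_of \<psi>)" by simp
    also have "\<dots> = l2_of (\<lambda>x. 1 * complex_of_real (Re (fun_of \<psi> x)) + \<i> * complex_of_real (Im (fun_of \<psi> x)))"
      by (intro arg_cong[of _ _ l2_of]) (auto simp: fun_eq_iff complex_eq_iff)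
    also have "\<dots> \<in> V"
      by (subst l2_of_add[OF cre cim], intro add real re im) auto
    finally show ?thesis .
  qed
  then show ?thesis using countD by (intro exI[of _ D]) (auto simp: V_def)
qed

instance l2 :: second_countable_topology
proof
  obtain D :: "l2 set" where D: "countable D" "closure D = UNIV"
    using l2_separable by blast
  define B where "B = (\<lambda>(x, n). ball x (1 / real (Suc n))) ` (D \<times> (UNIV :: nat set))"
  have "topological_basis B"
  proof (rule topological_basisI)
    fix S :: "l2 set" and x assume "open S" "x \<in> S"
    then obtain e where e: "e > 0" "ball x e \<subseteq> S" by (auto simp: open_contains_ball)
    obtain n where n: "1 / real (Suc n) < e / 2"
      using reals_Archimedean[of "e / 2"] e by (auto simp: inverse_eq_divide)
    have "x \<in> closure D" using D by simp
    then obtain y where y: "y \<in> D" "dist y x < 1 / real (Suc n)"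
      unfolding closure_approachable by (metis of_nat_0_less_iff zero_less_Suc zero_less_divide_1_iff)
    have "ball y (1 / real (Suc n)) \<subseteq> ball x e"
    proof
      fix z assume "z \<in> ball y (1 / real (Suc n))"
      then show "z \<in> ball x e"
        using y n dist_triangle[of x z y] by (auto simp: dist_commute)
    qed
    then show "\<exists>b\<in>B. x \<in> b \<and> b \<subseteq> S"
      using y e unfolding B_def
      by (intro bexI[of _ "ball y (1 / real (Suc n))"]) (auto simp: dist_commute)
  qed (auto simp: B_def)
  then show "\<exists>B::l2 set set. countable B \<and> open = generate_topology B"
    using D(1) unfolding B_def
    by (intro exI[of _ B]) (auto simp: B_def topological_basis_imp_subbasis)
qed


section \<open>The free evolution on the torus\<close>

definition phi_fun :: "int \<Rightarrow> real \<Rightarrow> complex" where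
  "phi_fun k x = exp (2 * \<i> * of_real pi * of_int k * of_real x)"

definition phi :: "int \<Rightarrow> l2" where
  "phi k = l2_of (phi_fun k)"

definition eigval :: "real \<Rightarrow> int \<Rightarrow> real" where
  "eigval u0 k = 4 * pi\<^sup>2 * (of_int k)\<^sup>2 - 2 * pi * u0 * of_int k"

text \<open>\<open>free_evol u0 t\<close> is $e^{-i(-\Delta + u_0 P)t}$, defined by the functional calculus in the
  Hilbert basis of eigenfunctions of $-\Delta + u_0 P$.\<close>

definition free_evol :: "real \<Rightarrow> real \<Rightarrow> l2 \<Rightarrow> l2" where
  "free_evol u0 t \<psi> =
     (\<Sum>\<^sub>\<infinity>k. cscale (exp (- (\<i> * of_real (eigval u0 k * t)))) (cscale (cinner \<psi> (phi k)) (phi k)))"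

definition eigensol :: "real \<Rightarrow> int \<Rightarrow> real \<Rightarrow> l2" where
  "eigensol u0 l t = cscale (exp (- (\<i> * of_real (eigval u0 l * t)))) (phi l)"

lemma phi_fun_eigenfunction:
  fixes D :: "(real \<Rightarrow> complex) \<Rightarrow> real \<Rightarrow> complex"
  defines "D \<equiv> \<lambda>f x. vector_derivative f (at x)"
  shows "- D (D (phi_fun k)) x + of_real u0 * (\<i> * D (phi_fun k) x)
     = of_real (eigval u0 k) * phi_fun k x"
proof -
  let ?c = "2 * \<i> * of_real pi * of_int k :: complex"
  have d: "(phi_fun k has_vector_derivative (?c * phi_fun k x)) (at x)" for x
    unfolding phi_fun_def by (rule has_vector_derivative_real_field) (auto intro!: derivative_eq_intros)
  have d2: "((\<lambda>x. ?c * phi_fun k x) has_vector_derivative (?c * (?c * phi_fun k x))) (at x)" for x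
    by (intro has_vector_derivative_mult_right d)
  have 1: "D (phi_fun k) = (\<lambda>x. ?c * phi_fun k x)"
    using d by (auto simp: D_def vector_derivative_at)
  have 2: "D (D (phi_fun k)) x = ?c * (?c * phi_fun k x)"
    unfolding 1 using d2 by (simp add: D_def vector_derivative_at)
  show ?thesis
    unfolding 2 unfolding 1 by (simp add: eigval_def algebra_simps power2_eq_square)
qed

lemma norm_phi_fun [simp]: "norm (phi_fun k x) = 1"
  by (simp add: phi_fun_def norm_exp_eq_Re)

lemma continuous_phi_fun: "continuous_on S (phi_fun k)"
  unfolding phi_fun_def by (intro continuous_intros)

lemma phi_fun_L2: "phi_fun k \<in> L2_fun 0 1"
  by (rule L2_fun_bounded[where C = 1])
    (auto intro: continuous_imp_measurable_on_sets_lebesgue continuous_phi_fun)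

lemma cinner_phi: "cinner (phi j) (phi k) = (if j = k then 1 else 0)"
proof -
  have eq: "phi_fun j x * cnj (phi_fun k x) = phi_fun (j - k) x" for x
    by (simp add: phi_fun_def exp_cnj exp_add[symmetric] algebra_simps)
  have "cinner (phi j) (phi k) = (LINT x|M01. phi_fun (j - k) x)"
    unfolding phi_def cinner_l2_of[OF phi_fun_L2 phi_fun_L2] eq ..
  also have "\<dots> = integral {0<..<1} (phi_fun (j - k))"
    using L2_fun_prod_integrable[OF phi_fun_L2[of j] phi_fun_L2[of k]]
    by (intro lebesgue_integral_eq_integral) (simp_all add: eq)
  also have "\<dots> = integral {0..1} (phi_fun (j - k))"
    by (simp add: integral_open_interval_real)
  also have "\<dots> = (if j = k then 1 else 0)"
  proof (cases "j = k")
    case True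
    then have "phi_fun (j - k) = (\<lambda>x. 1)" by (simp add: phi_fun_def fun_eq_iff)
    then show ?thesis using True by simp
  next
    case False
    let ?c = "2 * \<i> * of_real pi * of_int (j - k) :: complex"
    have c: "?c \<noteq> 0" using False by simp
    have "((\<lambda>x. exp (?c * of_real x) / ?c) has_vector_derivative phi_fun (j - k) x) (at x within {0..1})" for x
      unfolding phi_fun_def using c
      by (intro has_vector_derivative_real_field) (auto intro!: derivative_eq_intros)
    then have "(phi_fun (j - k) has_integral
        (exp (?c * of_real 1) / ?c - exp (?c * of_real 0) / ?c)) {0..1}"
      by (intro fundamental_theorem_of_calculus) auto
    moreover have "exp (?c * of_real 1) = 1"
      using exp_integer_2pi[of "of_int (j - k)"] by (simp add: mult_ac)
    ultimately show ?thesis using False by (simp add: integral_unique)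
  qed
  finally show ?thesis .
qed

lemma cinner_cscale_right: "cinner \<psi> (cscale c \<eta>) = cnj c * cinner \<psi> \<eta>"
  by (subst (1 2) cinner_commute) (simp add: cinner_cscale_left)

lemma norm_cscale: "norm (cscale c \<psi>) = norm c * norm \<psi>"
proof (rule power2_eq_imp_eq)
  have "cinner (cscale c \<psi>) (cscale c \<psi>) = of_real ((norm c)\<^sup>2) * cinner \<psi> \<psi>"
    by (subst complex_norm_square) (simp add: cinner_cscale_left cinner_cscale_right mult_ac)
  then have "inner (cscale c \<psi>) (cscale c \<psi>) = (norm c)\<^sup>2 * inner \<psi> \<psi>"
    unfolding inner_l2_def by (metis Re_complex_of_real Im_complex_of_real mult_zero_left diff_zero times_complex.sel(1))
  then show "(norm (cscale c \<psi>))\<^sup>2 = (norm c * norm \<psi>)\<^sup>2"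
    unfolding power_mult_distrib dot_square_norm by simp
qed auto

lemma cscale_cscale: "cscale c (cscale d \<psi>) = cscale (c * d) \<psi>"
  using fun_of_cscale[of c "cscale d \<psi>"] fun_of_cscale[of d \<psi>] fun_of_cscale[of "c * d" \<psi>]
  by (intro l2_eqI, eventually_elim) (simp add: mult_ac)

lemma cscale_zero_left [simp]: "cscale 0 \<psi> = 0"
  by (simp add: cscale_def zero_l2_def)

lemma cscale_zero_right [simp]: "cscale c 0 = 0"
  using norm_cscale[of c 0] by simp

lemma cscale_one [simp]: "cscale 1 \<psi> = \<psi>"
  by (simp add: cscale_def)

lemma norm_phi [simp]: "norm (phi k) = 1"
  by (simp add: norm_l2_def inner_l2_def cinner_phi)

lemma bessel: "finite F \<Longrightarrow> (\<Sum>k\<in>F. (norm (cinner \<psi> (phi k)))\<^sup>2) \<le> (norm \<psi>)\<^sup>2"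
proof -
  assume F: "finite F"
  let ?f = "\<lambda>k. cscale (cinner \<psi> (phi k)) (phi k)"
  let ?S = "\<Sum>k\<in>F. (norm (cinner \<psi> (phi k)))\<^sup>2"
  have "inner \<psi> (?f k) = (norm (cinner \<psi> (phi k)))\<^sup>2" for k
    by (simp add: inner_l2_def cinner_cscale_right mult.commute[of "cnj _"] flip: complex_norm_square of_real_power)
  then have 1: "inner \<psi> (sum ?f F) = ?S" by (simp add: inner_sum_right)
  have "(norm (sum ?f F))\<^sup>2 = (\<Sum>k\<in>F. (norm (?f k))\<^sup>2)"
    by (rule norm_sum_Pythagorean[OF F])
      (auto simp: pairwise_def orthogonal_def inner_l2_def cinner_cscale_left cinner_cscale_right cinner_phi)
  then have 2: "(norm (sum ?f F))\<^sup>2 = ?S" by (simp add: norm_cscale)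
  have "0 \<le> (norm (\<psi> - sum ?f F))\<^sup>2" by simp
  also have "\<dots> = (norm \<psi>)\<^sup>2 - 2 * inner \<psi> (sum ?f F) + (norm (sum ?f F))\<^sup>2"
    by (simp add: power2_norm_eq_inner inner_diff_left inner_diff_right inner_commute)
  finally show ?thesis using 1 2 by simp
qed

text \<open>The series defining \<open>free_evol\<close> converges unconditionally in $L^2$.\<close>

lemma free_evol_summable:
  "(\<lambda>k. cscale (exp (- (\<i> * of_real (eigval u0 k * t)))) (cscale (cinner \<psi> (phi k)) (phi k))) summable_on UNIV"
  (is "?f summable_on UNIV")
proof -
  let ?a = "\<lambda>k. (norm (cinner \<psi> (phi k)))\<^sup>2"
  have nf: "(norm (?f k))\<^sup>2 = ?a k" for k
    by (simp add: norm_cscale norm_exp_eq_Re)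
  have pyth: "(norm (sum ?f F))\<^sup>2 = sum ?a F" if "finite F" for F
    unfolding nf[symmetric]
    by (rule norm_sum_Pythagorean[OF that])
      (auto simp: pairwise_def orthogonal_def inner_l2_def cinner_cscale_left cinner_cscale_right cinner_phi)
  have "?a summable_on UNIV"
    by (rule nonneg_bdd_above_summable_on) (auto intro!: bdd_aboveI[of _ "(norm \<psi>)\<^sup>2"] bessel)
  then obtain L where L: "(?a has_sum L) UNIV" by (auto simp: summable_on_def)
  have "\<exists>P. eventually P (finite_subsets_at_top UNIV) \<and>
          (\<forall>F F'. P F \<and> P F' \<longrightarrow> dist (sum ?f F) (sum ?f F') < e)" if "e > 0" for e
  proof -
    define P where "P F \<longleftrightarrow> finite F \<and> dist (sum ?a F) L < (e / 2)\<^sup>2" for F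
    have "eventually P (finite_subsets_at_top UNIV)"
      using L that unfolding P_def has_sum_def tendsto_iff
      by (auto simp: eventually_conj_iff eventually_finite_subsets_at_top_weakI)
    moreover have "dist (sum ?f F) (sum ?f F') < e" if P: "P F" "P F'" for F F'
    proof -
      have half: "dist (sum ?f (F \<union> F')) (sum ?f G) < e / 2" if G: "P G" "G \<subseteq> F \<union> F'" for G
      proof -
        have fin: "finite (F \<union> F')" using P by (auto simp: P_def)
        have "(dist (sum ?f (F \<union> F')) (sum ?f G))\<^sup>2 = (norm (sum ?f (F \<union> F' - G)))\<^sup>2"
          unfolding dist_norm using fin G by (subst sum_diff) auto
        also have "\<dots> = sum ?a (F \<union> F' - G)" using fin by (intro pyth) auto
        also have "\<dots> = sum ?a (F \<union> F') - sum ?a G" using fin G by (intro sum_diff) auto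
        also have "\<dots> < (e / 2)\<^sup>2"
        proof -
          have "sum ?a (F \<union> F') \<le> L"
            using fin by (intro finite_sum_le_has_sum[OF L]) auto
          then show ?thesis using G by (auto simp: P_def dist_real_def)
        qed
        finally show ?thesis
          by (rule power2_less_imp_less) (use \<open>e > 0\<close> in auto)
      qed
      show ?thesis
        using half[OF P(1)] half[OF P(2)] dist_triangle3[of "sum ?f F" "sum ?f F'" "sum ?f (F \<union> F')"]
        by auto
    qed
    ultimately show ?thesis by blast
  qed
  then have "cauchy_filter (filtermap (sum ?f) (finite_subsets_at_top UNIV))"
    by (simp add: cauchy_filter_metric_filtermap)
  moreover have "complete (UNIV :: l2 set)"
    by (meson Cauchy_convergent UNIV_I complete_def convergent_def)
  ultimately obtain L' where "(sum ?f \<longlongrightarrow> L') (finite_subsets_at_top UNIV)"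
    using complete_uniform[where S = UNIV] by (force simp add: filterlim_def)
  then show ?thesis
    using summable_on_def has_sum_def by blast
qed

lemma free_evol_phi: "free_evol u0 t (phi l) = eigensol u0 l t"
proof -
  have "free_evol u0 t (phi l) = (\<Sum>\<^sub>\<infinity>k\<in>{l}. eigensol u0 k t)"
    unfolding free_evol_def eigensol_def
    by (intro infsum_cong_neutral) (auto simp: cinner_phi)
  then show ?thesis by simp
qed


section \<open>Mild solutions\<close>

text \<open>The condition $\psi(0) = \psi(1)$ refers to the continuous representative on $[0,1]$ of an
  $H^1$ class.\<close>

definition H1p :: "l2 set" where
  "H1p = {\<psi>. \<exists>f \<in> H1_fun 0 1. continuous_on {0..1} f \<and> f 0 = f 1 \<and> \<psi> = l2_of f}"

definition H1p_norm :: "l2 \<Rightarrow> real" where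
  "H1p_norm \<psi> = sqrt ((norm (cinner (phi 0) \<psi>))\<^sup>2
     + (\<Sum>\<^sub>\<infinity>k\<in>- {0}. (norm (of_int k * cinner (phi k) \<psi>))\<^sup>2))"

text \<open>Multiplication by \<open>\<mu>\<close>. It is only used for \<open>\<mu> \<in> H1_pw A\<close> with \<open>A\<close> finite; such \<open>\<mu>\<close> are
  essentially bounded, so that \<open>\<mu> \<psi>\<close> is square integrable.\<close>

definition mult_op :: "(real \<Rightarrow> real) \<Rightarrow> l2 \<Rightarrow> l2" where
  "mult_op \<mu> \<psi> = l2_of (\<lambda>x. complex_of_real (\<mu> x) * fun_of \<psi> x)"

lemma fun_of_mult_op:
  assumes [measurable]: "\<mu> \<in> borel_measurable M01" and bd: "AE x in M01. \<bar>\<mu> x\<bar> \<le> C"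
  shows "AE x in M01. fun_of (mult_op \<mu> \<psi>) x = complex_of_real (\<mu> x) * fun_of \<psi> x"
  unfolding mult_op_def
proof (rule fun_of_l2_of, rule L2_fun_bound[OF fun_of_L2[of \<psi>]])
  show "AE x in M01. norm (complex_of_real (\<mu> x) * fun_of \<psi> x) \<le> C * norm (fun_of \<psi> x)"
    using bd by eventually_elim (auto simp: norm_mult intro: mult_right_mono)
qed measurable

text \<open>$C([0,T], H^1_p)$; functions are made \<open>undefined\<close> outside $[0,T]$, so that equality of
  elements is equality on $[0,T]$.\<close>

definition C_H1p :: "real \<Rightarrow> (real \<Rightarrow> l2) set" where
  "C_H1p T = {\<psi> \<in> extensional {0..T}. (\<forall>t\<in>{0..T}. \<psi> t \<in> H1p) \<and>
     (\<forall>t\<in>{0..T}. ((\<lambda>s. H1p_norm (\<psi> s - \<psi> t)) \<longlongrightarrow> 0) (at t within {0..T}))}"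

text \<open>The Duhamel term is a Bochner integral with values in $L^2$, as \<open>\<mu> \<psi>(s)\<close> need not be in
  $H^1_p$.\<close>

definition mild_solution ::
    "real \<Rightarrow> real \<Rightarrow> (real \<Rightarrow> real) \<Rightarrow> (real \<Rightarrow> real) \<Rightarrow> l2 \<Rightarrow> (real \<Rightarrow> l2) \<Rightarrow> bool" where
  "mild_solution T u0 u1 \<mu> \<psi>0 \<psi> \<longleftrightarrow> \<psi> \<in> C_H1p T \<and>
     (\<forall>t\<in>{0..T}. \<psi> t = free_evol u0 t \<psi>0
        - cscale \<i> (LINT s|lebesgue_on {0<..<t}. free_evol u0 (t - s) (u1 s *\<^sub>R mult_op \<mu> (\<psi> s))))"

end

theory Submission
  imports Defs
begin

text \<open>Write $\psi(t) = \Lambda e^{-i(-\Delta + u_0 P)t} z(t)$, where the Fourier multiplier $\Lambda$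
  (division by $\max(1, |k|)$) is an isometry from $L^2$ onto $H^1_p$. The Duhamel term becomes an
  operator with values in $L^2$: integrating $\langle \mu\psi, \phi_k\rangle$ by parts on the
  pieces leaves an $L^2$ term and jump terms of order $1/k$ at finitely many points, and since the
  gaps of the spectrum grow linearly, the exponential integrals $\int_0^T e^{i\lambda_k s} g(s)\,ds$ of
  the boundary values $g \in L^2$ are square summable. This hidden regularity gives the mild solutions by
  a fixed point in a weighted norm. For the control, the linearised equation around \<open>phi l\<close> is a
  moment problem with frequencies $\nu_k = \lambda_l - \lambda_k$ and real controls. As $u_0 / 2\pi$ is
  irrational, $\nu_k$ and $-\nu_k$ together have no coincidences apart from $\nu_l = 0$; an
  Ingham inequality for the high frequencies and Haraux's
  argument for the low ones solve the moment problem in any positive time, and a contraction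
  argument transfers controllability to the equation. The one missing real direction, along
  \<open>phi l\<close>, is fixed by the conservation of the $L^2$ norm.\<close>

section \<open>Fourier coefficients in $L^2(0,1)$\<close>

text \<open>The obstacle is that \<open>\<mu> \<psi>(s)\<close> may jump at the points of
  \<open>A\<close> and across the ends of the period. It then leaves H^1_p, and no bound pointwise
  in time closes the fixed point: one derivative must be gained from the integral in time. The gain
  rests on \<lambda>_j - \<lambda>_k = 4 pi^2 (j - k) (j + k - u0 / (2 pi)). For fixed k the last
  factor is below 1/2 in modulus for at most one j, so the rows of the Gram matrix of the
  exponentials are summable uniformly in k. Such estimates carry the weight (s - a) (b - s): it
  vanishes at the ends, so its transform decays like \<omega>^(-2), which is summable over the gaps,
  whereas a sharp cutoff would give only 1/\<omega>. Controls are real, so the moment problem is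
  linear over the reals only: inner products, adjoints and subspaces of \<open>l2\<close> are the
  real ones, and the conjugate frequencies -\<nu>_k come in through the real part. Functions of time
  are placed in the same space L^2(0,1) as functions of x, so the control is active on (0, min T 1)
  and zero afterwards.\<close>

lemma cinner_add_right: "cinner x (y + z) = cinner x y + cinner x z"
  by (subst (1 2 3) cinner_commute) (simp add: cinner_add_left)

lemma cinner_zero_left [simp]: "cinner 0 x = 0"
  using cinner_cscale_left[of 0 x x] by simp

lemma cinner_zero_right [simp]: "cinner x 0 = 0"
  using cinner_cscale_right[of x 0 x] by simp

lemma scaleR_eq_cscale: "r *\<^sub>R x = cscale (complex_of_real r) x"
  by (simp add: scaleR_l2_def)

lemma cinner_self: "cinner x x = complex_of_real ((norm x)\<^sup>2)"
proof (rule complex_eqI)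
  show "Re (cinner x x) = Re (complex_of_real ((norm x)\<^sup>2))"
    by (simp add: power2_norm_eq_inner inner_l2_def)
  have "cnj (cinner x x) = cinner x x" by (rule cinner_commute[symmetric])
  then show "Im (cinner x x) = Im (complex_of_real ((norm x)\<^sup>2))"
    by (simp add: complex_eq_iff)
qed

text \<open>Multiplying \<open>x\<close> by the conjugate of \<open>cinner x y\<close> makes the
  product real and nonnegative, so that the real Cauchy-Schwarz inequality applies without
  loss.\<close>

lemma norm_cinner_le: "norm (cinner x y) \<le> norm x * norm y"
proof (cases "cinner x y = 0")
  case False
  let ?c = "cinner x y"
  have "inner (cscale (cnj ?c) x) y = Re (of_real ((norm ?c)\<^sup>2))"
    unfolding inner_l2_def cinner_cscale_left by (subst complex_norm_square) (simp add: mult.commute)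
  then have "(norm ?c)\<^sup>2 = inner (cscale (cnj ?c) x) y" by simp
  also have "\<dots> \<le> norm (cscale (cnj ?c) x) * norm y" by (rule norm_cauchy_schwarz)
  also have "\<dots> = norm ?c * (norm x * norm y)" by (simp add: norm_cscale)
  finally show ?thesis using False by (simp add: power2_eq_square)
qed auto

lemma bounded_linear_cinner_left: "bounded_linear (\<lambda>x. cinner x y)"
  by (rule bounded_linear_intro[where K = "norm y"])
    (auto simp: cinner_add_left scaleR_eq_cscale cinner_cscale_left norm_cinner_le scaleR_conv_of_real)

lemma bounded_linear_cinner_right: "bounded_linear (\<lambda>y. cinner x y)"
  by (rule bounded_linear_intro[where K = "norm x"])
    (auto simp: cinner_add_right scaleR_eq_cscale cinner_cscale_right norm_cinner_le
      scaleR_conv_of_real mult.commute[of "norm x"] intro: order_trans[OF norm_cinner_le])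

lemma cscale_add_right: "cscale c (x + y) = cscale c x + cscale c y"
  using fun_of_cscale[of c "x + y"] fun_of_cscale[of c x] fun_of_cscale[of c y]
    fun_of_add[of x y] fun_of_add[of "cscale c x" "cscale c y"]
  by (intro l2_eqI, eventually_elim) (simp add: algebra_simps)

lemma cscale_add_left: "cscale (c + d) x = cscale c x + cscale d x"
  using fun_of_cscale[of "c + d" x] fun_of_cscale[of c x] fun_of_cscale[of d x]
    fun_of_add[of "cscale c x" "cscale d x"]
  by (intro l2_eqI, eventually_elim) (simp add: algebra_simps)

lemma bounded_linear_cscale: "bounded_linear (cscale c)"
  by (rule bounded_linear_intro[where K = "norm c"])
    (auto simp: cscale_add_right scaleR_eq_cscale cscale_cscale norm_cscale mult.commute)

lemmas cinner_diff_left = linear_diff[OF bounded_linear.linear[OF bounded_linear_cinner_left]]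
lemmas cinner_diff_right = linear_diff[OF bounded_linear.linear[OF bounded_linear_cinner_right]]
lemmas cinner_minus_left = linear_neg[OF bounded_linear.linear[OF bounded_linear_cinner_left]]
lemmas cinner_sum_left = linear_sum[OF bounded_linear.linear[OF bounded_linear_cinner_left]]
lemmas cinner_sum_right = linear_sum[OF bounded_linear.linear[OF bounded_linear_cinner_right]]
lemmas cscale_diff_right = linear_diff[OF bounded_linear.linear[OF bounded_linear_cscale]]
lemmas cscale_sum_right = linear_sum[OF bounded_linear.linear[OF bounded_linear_cscale]]

section \<open>Totality of the trigonometric system\<close>

inductive trig_poly :: "(real \<Rightarrow> complex) \<Rightarrow> bool" where
  mono: "trig_poly (\<lambda>x. c * phi_fun k x)"
| add: "trig_poly f \<Longrightarrow> trig_poly g \<Longrightarrow> trig_poly (\<lambda>x. f x + g x)"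

lemma phi_fun_mult: "phi_fun j x * phi_fun k x = phi_fun (j + k) x"
  by (simp add: phi_fun_def exp_add[symmetric] algebra_simps)

lemma phi_fun_0 [simp]: "phi_fun 0 x = 1"
  by (simp add: phi_fun_def)

lemma trig_poly_mult_mono:
  assumes "trig_poly f"
  shows "trig_poly (\<lambda>x. f x * (c * phi_fun k x))"
  using assms
proof induction
  case (mono d j)
  have "(\<lambda>x. d * phi_fun j x * (c * phi_fun k x)) = (\<lambda>x. (d * c) * phi_fun (j + k) x)"
    by (simp add: phi_fun_mult[symmetric] fun_eq_iff)
  then show ?case using trig_poly.mono by simp
next
  case (add f g)
  then show ?case using trig_poly.add by (simp add: algebra_simps)
qed

lemma trig_poly_mult:
  assumes "trig_poly f" "trig_poly g"
  shows "trig_poly (\<lambda>x. f x * g x)"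
  using assms(2)
proof induction
  case (mono c k)
  show ?case by (rule trig_poly_mult_mono[OF assms(1)])
next
  case (add f g)
  then show ?case using trig_poly.add by (simp add: algebra_simps)
qed

lemma trig_poly_const: "trig_poly (\<lambda>x. c)"
  using trig_poly.mono[of c 0] by simp

lemma trig_poly_L2:
  assumes "trig_poly f"
  shows "f \<in> L2_fun 0 1"
  using assms by induction (auto intro: L2_fun_add L2_fun_cmult phi_fun_L2)

lemma trig_poly_in_subspace:
  assumes "trig_poly f" "subspace V" "\<And>c k. cscale c (phi k) \<in> V"
  shows "l2_of f \<in> V"
  using assms(1)
proof induction
  case (mono c k)
  then show ?case using assms(3)[of c k] by (simp add: l2_of_cmult phi_fun_L2 phi_def)
next
  case (add f g)
  then show ?case using subspace_add[OF assms(2)] by (simp add: l2_of_add trig_poly_L2)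
qed

lemma cnj_phi_fun: "cnj (phi_fun k x) = phi_fun (- k) x"
  by (simp add: phi_fun_def exp_cnj)

text \<open>On the unit circle the conjugate of z = \<open>phi_fun 1 x\<close> is
  \<open>phi_fun (-1) x\<close>, and every real-linear functional of z is a complex combination of z
  and its conjugate. So the polynomials in Re z and Im z that Stone-Weierstrass provides are
  trigonometric.\<close>

lemma trig_poly_real_polynomial:
  assumes "real_polynomial_function p"
  shows "trig_poly (\<lambda>x. complex_of_real (p (phi_fun 1 x)))"
  using assms
proof induction
  case (linear f)
  interpret bounded_linear f by fact
  have "complex_of_real (f z) = (f 1 / 2 - \<i> * (f \<i> / 2)) * z + (f 1 / 2 + \<i> * (f \<i> / 2)) * cnj z" for z
  proof -
    have "z = Re z *\<^sub>R 1 + Im z *\<^sub>R \<i>" by (simp add: complex_eq_iff)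
    then have "f z = Re z * f 1 + Im z * f \<i>" by (metis add scaleR real_scaleR_def)
    then show ?thesis by (simp add: complex_eq_iff algebra_simps)
  qed
  then show ?case
    by (simp only: cnj_phi_fun) (intro trig_poly.intros)
qed (auto intro: trig_poly_const trig_poly.add trig_poly_mult)

lemma phi_fun_1_eq:
  assumes "phi_fun 1 x = phi_fun 1 y" "\<bar>x - y\<bar> < 1"
  shows "x = y"
proof -
  from assms(1) obtain n :: int where
    "2 * \<i> * of_real pi * of_int 1 * of_real x
      = 2 * \<i> * of_real pi * of_int 1 * of_real y + (of_int (2 * n) * pi) * \<i>"
    unfolding phi_fun_def exp_eq by blast
  then have "2 * pi * x = 2 * pi * (y + of_int n)"
    by (simp add: complex_eq_iff algebra_simps)
  then have e: "x - y = of_int n" by simp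
  with assms(2) have "\<bar>real_of_int n\<bar> < 1" by simp
  then have "n = 0" by linarith
  then show ?thesis using e by simp
qed

text \<open>Real and imaginary parts split into nonnegative functions, which are reached from
  indicators by sums and limits. The closed subspace \<open>V\<close> is arbitrary because the lemma
  serves twice: for trigonometric polynomials in x, and in \<open>Xop_eq_0I\<close> for primitives
  in time.\<close>

lemma indicator_total:
  assumes V: "closed V" "subspace V"
    and ind: "\<And>c q. l2_of (\<lambda>x. c * indicator {..q} x) \<in> V"
  shows "x \<in> V"
proof -
  note add = subspace_add[OF V(2)] and scale = subspace_scale[OF V(2)]
  have nonneg: "l2_of (\<lambda>x. c * complex_of_real (u x)) \<in> V"
    if "u \<in> L2_fun 0 1" "\<And>x. 0 \<le> u x" for c u
    using l2_real_part_in_closed[OF V(1) add scale ind] that by blast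
  have real: "l2_of (\<lambda>x. c * complex_of_real (u x)) \<in> V"
    if u: "u \<in> L2_fun 0 1" for c and u :: "real \<Rightarrow> real"
  proof -
    note [measurable] = L2_funD(1)[OF u]
    have p: "(\<lambda>x. max 0 (u x)) \<in> L2_fun 0 1" and m: "(\<lambda>x. max 0 (- u x)) \<in> L2_fun 0 1"
      by (rule L2_fun_bound[OF u, where C = 1]; auto)+
    have cp: "(\<lambda>x. c * complex_of_real (max 0 (u x))) \<in> L2_fun 0 1"
      by (rule L2_fun_bound[OF p, where C = "norm c"]) (auto simp: norm_mult)
    have cm: "(\<lambda>x. c * complex_of_real (max 0 (- u x))) \<in> L2_fun 0 1"
      by (rule L2_fun_bound[OF m, where C = "norm c"]) (auto simp: norm_mult)
    have "l2_of (\<lambda>x. c * complex_of_real (u x))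
        = l2_of (\<lambda>x. c * complex_of_real (max 0 (u x)) - c * complex_of_real (max 0 (- u x)))"
      by (intro arg_cong[of _ _ l2_of]) (auto simp: fun_eq_iff max_def)
    also have "\<dots> = l2_of (\<lambda>x. c * complex_of_real (max 0 (u x)))
                  - l2_of (\<lambda>x. c * complex_of_real (max 0 (- u x)))"
      by (simp add: l2_of_diff[OF cp cm])
    also have "\<dots> \<in> V"
      by (intro subspace_diff[OF V(2)] nonneg p m) auto
    finally show ?thesis .
  qed
  note L = fun_of_L2[of x]
  have re: "(\<lambda>t. Re (fun_of x t)) \<in> L2_fun 0 1"
    by (rule L2_fun_bound[OF L, where C = 1]) (auto simp: abs_Re_le_cmod)
  have im: "(\<lambda>t. Im (fun_of x t)) \<in> L2_fun 0 1"
    by (rule L2_fun_bound[OF L, where C = 1]) (auto simp: abs_Im_le_cmod)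
  have cre: "(\<lambda>t. 1 * complex_of_real (Re (fun_of x t))) \<in> L2_fun 0 1"
    by (rule L2_fun_bound[OF re, where C = 1]) auto
  have cim: "(\<lambda>t. \<i> * complex_of_real (Im (fun_of x t))) \<in> L2_fun 0 1"
    by (rule L2_fun_bound[OF im, where C = 1]) (auto simp: norm_mult)
  have "x = l2_of (fun_of x)" by simp
  also have "\<dots> = l2_of (\<lambda>t. 1 * complex_of_real (Re (fun_of x t)) + \<i> * complex_of_real (Im (fun_of x t)))"
    by (intro arg_cong[of _ _ l2_of]) (auto simp: fun_eq_iff complex_eq_iff)
  also have "\<dots> \<in> V"
    by (subst l2_of_add[OF cre cim], intro add real re im)
  finally show ?thesis .
qed

text \<open>Indicators of intervals are limits of continuous functions on the circle, hence by
  Stone--Weierstrass of trigonometric polynomials.\<close>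

lemma phi_total:
  assumes V: "closed V" "subspace V" "\<And>c k. cscale c (phi k) \<in> V"
  shows "x \<in> V"
proof -
  have ind1: "l2_of (\<lambda>x. c * indicator {..q} x) \<in> V" if q: "0 < q" "q < 1" for c :: complex and q :: real
  proof -
    \<comment> \<open>\<open>C\<close> is the arc over [q, 1]. Each \<open>h n\<close> below is
      continuous, zero on \<open>C\<close>, and increases to 1 off it, so
      \<open>h n (phi_fun 1 x)\<close> tends to the indicator of x < q for 0 < x < 1.\<close>
    define C where "C = phi_fun 1 ` {q..1}"
    have C: "compact C" "C \<noteq> {}" unfolding C_def
      using q by (auto intro: compact_continuous_image continuous_phi_fun)
    define h where "h n z = min 1 (real n * infdist z C)" for n z
    have "\<exists>p. real_polynomial_function p \<and> (\<forall>z\<in>sphere 0 1. \<bar>h n z - p z\<bar> < 1 / Suc n)" for n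
    proof -
      have "continuous_on (sphere 0 1) (h n)"
        unfolding h_def by (intro continuous_intros)
      from Stone_Weierstrass_real_polynomial_function[OF compact_sphere this, of "1 / Suc n"]
      show ?thesis by (metis divide_pos_pos of_nat_0_less_iff zero_less_Suc zero_less_one)
    qed
    then obtain p where p: "\<And>n. real_polynomial_function (p n)"
      "\<And>n z. z \<in> sphere 0 1 \<Longrightarrow> \<bar>h n z - p n z\<bar> < 1 / Suc n" by metis
    define f where "f n x = c * complex_of_real (p n (phi_fun 1 x))" for n x
    have tp: "trig_poly (f n)" for n unfolding f_def
      by (intro trig_poly_mult trig_poly_const trig_poly_real_polynomial p)
    have near: "\<bar>h n (phi_fun 1 x) - p n (phi_fun 1 x)\<bar> < 1 / Suc n" for n x
      by (rule p) auto
    have h01: "0 \<le> h n z" "h n z \<le> 1" for n z by (auto simp: h_def infdist_nonneg)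
    have bd: "norm (f n x) \<le> norm c * 2" for n x
    proof -
      have "\<bar>p n (phi_fun 1 x)\<bar> \<le> 1 + 1 / Suc n"
        using near[of n x] h01[of n "phi_fun 1 x"] by linarith
      also have "\<dots> \<le> 2" by simp
      finally show ?thesis unfolding f_def norm_mult norm_of_real by (intro mult_left_mono) auto
    qed
    have hlim: "(\<lambda>n. h n (phi_fun 1 x)) \<longlonglongrightarrow> indicator {..q} x" if x: "0 < x" "x < 1" "x \<noteq> q" for x
    proof (cases "x < q")
      case True
      have "phi_fun 1 x \<notin> C"
        unfolding C_def using phi_fun_1_eq[of x] True x q by fastforce
      then have pos: "infdist (phi_fun 1 x) C > 0"
        using C by (simp add: infdist_pos_not_in_closed compact_imp_closed)
      obtain n0 :: nat where n0: "real n0 * infdist (phi_fun 1 x) C > 1"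
        using reals_Archimedean3[OF pos] by blast
      have "h n (phi_fun 1 x) = 1" if "n \<ge> n0" for n
      proof -
        have "real n0 * infdist (phi_fun 1 x) C \<le> real n * infdist (phi_fun 1 x) C"
          using that pos by (intro mult_right_mono) auto
        then show ?thesis using n0 by (simp add: h_def)
      qed
      then have "\<forall>\<^sub>F n in sequentially. h n (phi_fun 1 x) = indicator {..q} x"
        using True by (auto simp: eventually_sequentially)
      then show ?thesis by (rule tendsto_eventually)
    next
      case False
      then have "phi_fun 1 x \<in> C" using x by (auto simp: C_def)
      then show ?thesis using False x by (simp add: h_def)
    qed
    have lim: "(\<lambda>n. f n x) \<longlonglongrightarrow> c * indicator {..q} x" if x: "0 < x" "x < 1" "x \<noteq> q" for x
    proof -
      have "(\<lambda>n. p n (phi_fun 1 x) - h n (phi_fun 1 x)) \<longlonglongrightarrow> 0"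
      proof (rule Lim_null_comparison)
        show "\<forall>\<^sub>F n in sequentially. norm (p n (phi_fun 1 x) - h n (phi_fun 1 x)) \<le> inverse (real (Suc n))"
          using near[of _ x] by (intro always_eventually allI less_imp_le)
            (simp add: inverse_eq_divide abs_minus_commute del: of_nat_Suc)
      qed (rule LIMSEQ_inverse_real_of_nat)
      from tendsto_add[OF this hlim[OF x]]
      have "(\<lambda>n. p n (phi_fun 1 x)) \<longlonglongrightarrow> indicator {..q} x" by simp
      then have "(\<lambda>n. f n x) \<longlonglongrightarrow> c * complex_of_real (indicator {..q} x)"
        unfolding f_def by (intro tendsto_intros)
      then show ?thesis by (simp add: of_real_indicator)
    qed
    show ?thesis
    proof (rule closed_sequentially[OF V(1)])
      show "l2_of (f n) \<in> V" for n by (rule trig_poly_in_subspace[OF tp V(2,3)])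
      show "(\<lambda>n. l2_of (f n)) \<longlonglongrightarrow> l2_of (\<lambda>x. c * indicator {..q} x)"
      proof (rule l2_tendsto_dominated)
        show "(\<lambda>x. norm c * 2) \<in> L2_fun 0 1"
          by (rule L2_fun_bounded[where C = "norm c * 2"]) auto
        show "f n \<in> borel_measurable M01" for n by (rule L2_funD[OF trig_poly_L2[OF tp]])
        show "(\<lambda>x. c * indicator {..q} x) \<in> borel_measurable M01"
        proof -
          have "(\<lambda>x. c * indicator ({..q} :: real set) x) \<in> borel_measurable borel" by measurable
          then show ?thesis by (metis borel_measurable_if_D measurable_completion measurable_lborel2 measurable_restrict_space1)
        qed
        have "AE x in lebesgue. x \<noteq> q"
          using AE_not_in[of "{q}" lebesgue] by (simp add: null_sets_def)
        then show "AE x in M01. (\<lambda>n. f n x) \<longlonglongrightarrow> c * indicator {..q} x"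
          by (subst AE_restrict_space_iff) (auto elim!: eventually_mono intro: lim)
        show "AE x in M01. norm (f n x) \<le> norm c * 2" for n using bd by auto
      qed
    qed
  qed
  have ind: "l2_of (\<lambda>x. c * indicator {..q} x) \<in> V" for c :: complex and q :: real
  proof -
    consider "q \<le> 0" | "q \<ge> 1" | "0 < q" "q < 1" by linarith
    then show ?thesis
    proof cases
      case 1
      have L: "(\<lambda>x. 0 :: complex) \<in> L2_fun 0 1" by (rule L2_fun_zero)
      have m: "(\<lambda>x. c * indicator {..q} x) \<in> borel_measurable M01"
        using 1 by (subst measurable_cong[of M01 _ "\<lambda>x. 0"]) auto
      have "l2_of (\<lambda>x. c * indicator {..q} x) = l2_of (\<lambda>x. 0)"
        using 1 L m by (subst l2_of_eq_iff)
          (auto intro!: L2_fun_bounded[where C = "norm c"] AE_I2 simp: indicator_def)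
      then show ?thesis using subspace_0[OF V(2)] by (simp add: zero_l2_def)
    next
      case 2
      have L: "(\<lambda>x. c) \<in> L2_fun 0 1" by (rule L2_fun_bounded[where C = "norm c"]) auto
      have m: "(\<lambda>x. c * indicator {..q} x) \<in> borel_measurable M01"
        using 2 by (subst measurable_cong[of M01 _ "\<lambda>x. c"]) auto
      have "l2_of (\<lambda>x. c * indicator {..q} x) = l2_of (\<lambda>x. c)"
        using 2 L m by (subst l2_of_eq_iff)
          (auto intro!: L2_fun_bounded[where C = "norm c"] AE_I2 simp: indicator_def)
      also have "\<dots> \<in> V"
        by (rule trig_poly_in_subspace[OF trig_poly_const V(2,3)])
      finally show ?thesis .
    qed (rule ind1)
  qed
  show ?thesis by (rule indicator_total[OF V(1,2) ind])
qed

text \<open>The set where \<open>f\<close> and \<open>g\<close> agree is a closed real subspace, so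
  totality of the modes applies. Complex multiples \<open>c\<close> are tested because
  \<open>f\<close> and \<open>g\<close> are linear over the reals only.\<close>

lemma bounded_linear_eqI:
  assumes f: "bounded_linear f" and g: "bounded_linear (g :: l2 \<Rightarrow> 'a::real_normed_vector)"
    and eq: "\<And>c k. f (cscale c (phi k)) = g (cscale c (phi k))"
  shows "f x = g x"
proof -
  have "x \<in> {x. f x = g x}"
  proof (rule phi_total)
    show "closed {x. f x = g x}"
      by (intro closed_Collect_eq linear_continuous_on f g)
    show "subspace {x. f x = g x}"
      unfolding subspace_def
      by (auto simp: bounded_linear.linear[OF f] bounded_linear.linear[OF g] linear_0 linear_add linear_scale)
  qed (use eq in auto)
  then show ?thesis by simp
qed

section \<open>Riesz-Fischer and Parseval\<close>

lemma l2_coef_eqI: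
  assumes "\<And>k. cinner x (phi k) = cinner y (phi k)"
  shows "x = y"
proof -
  have "inner v (x - y) = 0" for v
  proof (rule bounded_linear_eqI[of "\<lambda>v. inner v (x - y)" "\<lambda>_. 0"])
    show "inner (cscale c (phi k)) (x - y) = 0" for c k
    proof -
      have "cinner (phi k) (x - y) = 0"
        using assms[of k] by (subst cinner_commute) (simp add: cinner_diff_left)
      then show ?thesis by (simp add: inner_l2_def cinner_cscale_left)
    qed
  qed (auto intro: bounded_linear_inner_left bounded_linear_zero)
  from this[of "x - y"] show ?thesis by simp
qed

lemma coef_sum_phi:
  assumes "finite F"
  shows "cinner (\<Sum>j\<in>F. cscale (c j) (phi j)) (phi k) = (if k \<in> F then c k else 0)"
  using assms by (simp add: cinner_sum_left cinner_cscale_left cinner_phi if_distrib sum.delta cong: if_cong)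

lemma norm_sum_phi:
  assumes "finite F"
  shows "(norm (\<Sum>k\<in>F. cscale (c k) (phi k)))\<^sup>2 = (\<Sum>k\<in>F. (norm (c k))\<^sup>2)"
proof -
  have "(norm (\<Sum>k\<in>F. cscale (c k) (phi k)))\<^sup>2 = (\<Sum>k\<in>F. (norm (cscale (c k) (phi k)))\<^sup>2)"
    by (rule norm_sum_Pythagorean[OF assms])
      (auto simp: pairwise_def orthogonal_def inner_l2_def cinner_cscale_left cinner_cscale_right cinner_phi)
  then show ?thesis by (simp add: norm_cscale)
qed

text \<open>By orthogonality the squared distance of two symmetric partial sums is a difference of
  the bounded increasing sums \<open>s\<close>, so the partial sums are Cauchy. The explicit
  sequence in the last conclusion serves later passages to the limit.\<close>

lemma riesz_fischer:
  assumes bd: "\<And>F. finite F \<Longrightarrow> (\<Sum>k\<in>F. (norm (c k))\<^sup>2) \<le> B"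
  obtains x where "\<And>k. cinner x (phi k) = c k" "(norm x)\<^sup>2 \<le> B"
    "(\<lambda>n. \<Sum>k\<in>{- int n..int n}. cscale (c k) (phi k)) \<longlonglongrightarrow> x"
proof -
  define X where "X n = (\<Sum>k\<in>{- int n..int n}. cscale (c k) (phi k))" for n :: nat
  define s where "s n = (\<Sum>k\<in>{- int n..int n}. (norm (c k))\<^sup>2)" for n :: nat
  have s_mono: "s n \<le> s m" if "n \<le> m" for n m
    unfolding s_def using that by (intro sum_mono2) auto
  have "convergent s"
  proof (rule Bseq_monoseq_convergent)
    show "Bseq s"
      by (rule BseqI'[of _ B]) (simp add: s_def bd sum_nonneg)
    show "monoseq s" using s_mono by (auto simp: monoseq_def)
  qed
  then have "Cauchy s" by (rule convergent_Cauchy)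
  have d: "(norm (X m - X n))\<^sup>2 = s m - s n" if "n \<le> m" for n m
  proof -
    have "X m - X n = (\<Sum>k\<in>{- int m..int m} - {- int n..int n}. cscale (c k) (phi k))"
      unfolding X_def using that by (subst sum_diff) auto
    also have "(norm \<dots>)\<^sup>2 = (\<Sum>k\<in>{- int m..int m} - {- int n..int n}. (norm (c k))\<^sup>2)"
      by (rule norm_sum_phi) auto
    also have "\<dots> = s m - s n"
      unfolding s_def using that by (subst sum_diff) auto
    finally show ?thesis .
  qed
  have "Cauchy X"
  proof (rule metric_CauchyI)
    fix e :: real assume e: "e > 0"
    then obtain N where N: "\<And>m n. m \<ge> N \<Longrightarrow> n \<ge> N \<Longrightarrow> dist (s m) (s n) < e\<^sup>2"
      using metric_CauchyD[OF \<open>Cauchy s\<close>, of "e\<^sup>2"] by auto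
    have *: "dist (X m) (X n) < e" if "m \<ge> N" "n \<ge> N" "n \<le> m" for m n
    proof -
      have "(dist (X m) (X n))\<^sup>2 = s m - s n" by (simp only: dist_norm d[OF that(3)])
      also have "\<dots> \<le> dist (s m) (s n)" by (simp only: dist_real_def abs_ge_self)
      also have "\<dots> < e\<^sup>2" by (rule N[OF that(1,2)])
      finally have "(dist (X m) (X n))\<^sup>2 < e\<^sup>2" .
      then show ?thesis by (rule power2_less_imp_less) (use e in simp)
    qed
    show "\<exists>M. \<forall>m\<ge>M. \<forall>n\<ge>M. dist (X m) (X n) < e"
    proof (intro exI allI impI)
      fix m n assume "m \<ge> N" "n \<ge> N"
      then show "dist (X m) (X n) < e"
        using *[of m n] *[of n m] by (cases "n \<le> m") (auto simp: dist_commute)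
    qed
  qed
  then obtain x where x: "X \<longlonglongrightarrow> x" using Cauchy_convergent convergent_def by blast
  show ?thesis
  proof
    show "cinner x (phi k) = c k" for k
    proof (rule LIMSEQ_unique)
      show "(\<lambda>n. cinner (X n) (phi k)) \<longlonglongrightarrow> cinner x (phi k)"
        by (rule bounded_linear.tendsto[OF bounded_linear_cinner_left x])
      have "\<forall>\<^sub>F n in sequentially. cinner (X n) (phi k) = c k"
        by (rule eventually_sequentiallyI[of "nat \<bar>k\<bar>"]) (auto simp: X_def coef_sum_phi)
      then show "(\<lambda>n. cinner (X n) (phi k)) \<longlonglongrightarrow> c k" by (rule tendsto_eventually)
    qed
    show "(norm x)\<^sup>2 \<le> B"
    proof (rule LIMSEQ_le_const2)
      show "(\<lambda>n. (norm (X n))\<^sup>2) \<longlonglongrightarrow> (norm x)\<^sup>2" by (intro tendsto_intros x)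
      show "\<exists>N. \<forall>n\<ge>N. (norm (X n))\<^sup>2 \<le> B" by (auto simp: X_def norm_sum_phi bd)
    qed
    show "(\<lambda>n. \<Sum>k\<in>{- int n..int n}. cscale (c k) (phi k)) \<longlonglongrightarrow> x"
      using x by (simp add: X_def[abs_def])
  qed
qed

text \<open>Riesz-Fischer builds an element with these coefficients and this bound, and coefficients
  determine the element.\<close>

lemma norm_le_coefI:
  assumes "\<And>F. finite F \<Longrightarrow> (\<Sum>k\<in>F. (norm (cinner x (phi k)))\<^sup>2) \<le> B"
  shows "(norm x)\<^sup>2 \<le> B"
proof -
  obtain y where "\<And>k. cinner y (phi k) = cinner x (phi k)" "(norm y)\<^sup>2 \<le> B"
    using riesz_fischer[OF assms] by blast
  then show ?thesis using l2_coef_eqI[of y x] by simp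
qed

lemma fourier_partial_sums:
  "(\<lambda>n. \<Sum>k\<in>{- int n..int n}. cscale (cinner x (phi k)) (phi k)) \<longlonglongrightarrow> x"
proof -
  obtain y where "\<And>k. cinner y (phi k) = cinner x (phi k)"
     "(\<lambda>n. \<Sum>k\<in>{- int n..int n}. cscale (cinner x (phi k)) (phi k)) \<longlonglongrightarrow> y"
    using riesz_fischer[OF bessel, of x] by blast
  then show ?thesis using l2_coef_eqI[of y x] by simp
qed

lemma parseval: "((\<lambda>k. (norm (cinner x (phi k)))\<^sup>2) has_sum (norm x)\<^sup>2) UNIV"
proof -
  let ?a = "\<lambda>k. (norm (cinner x (phi k)))\<^sup>2"
  have s: "?a summable_on UNIV"
    by (rule nonneg_bdd_above_summable_on) (auto intro!: bdd_aboveI[of _ "(norm x)\<^sup>2"] bessel)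
  then obtain L where L: "(?a has_sum L) UNIV" by (auto simp: summable_on_def)
  have "L \<le> (norm x)\<^sup>2"
    by (rule has_sum_le_finite_sums[OF L]) (auto intro: bessel)
  moreover have "(norm x)\<^sup>2 \<le> L"
    by (rule norm_le_coefI) (auto intro!: finite_sum_le_has_sum[OF L])
  ultimately show ?thesis using L by simp
qed

section \<open>Fourier multipliers\<close>

text \<open>Meaningful for square-summable \<open>c\<close>, where the element exists and is unique;
  for other families the choice is arbitrary.\<close>

definition of_coef :: "(int \<Rightarrow> complex) \<Rightarrow> l2" where
  "of_coef c = (SOME x. \<forall>k. cinner x (phi k) = c k)"

lemma of_coef:
  assumes "\<And>F. finite F \<Longrightarrow> (\<Sum>k\<in>F. (norm (c k))\<^sup>2) \<le> B"
  shows coef_of_coef: "cinner (of_coef c) (phi k) = c k"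
    and norm_of_coef: "(norm (of_coef c))\<^sup>2 \<le> B"
proof -
  obtain x where "\<And>k. cinner x (phi k) = c k"
    using riesz_fischer[OF assms] by blast
  then have *: "\<forall>k. cinner (of_coef c) (phi k) = c k"
    unfolding of_coef_def by (intro someI_ex[of "\<lambda>x. \<forall>k. cinner x (phi k) = c k"]) blast
  then show "cinner (of_coef c) (phi k) = c k" by blast
  show "(norm (of_coef c))\<^sup>2 \<le> B"
    by (rule norm_le_coefI) (simp add: * assms)
qed

definition dmult :: "(int \<Rightarrow> complex) \<Rightarrow> l2 \<Rightarrow> l2" where
  "dmult m x = of_coef (\<lambda>k. m k * cinner x (phi k))"

lemma dmult:
  assumes m: "\<And>k. norm (m k) \<le> B"
  shows coef_dmult: "cinner (dmult m x) (phi k) = m k * cinner x (phi k)"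
    and norm_dmult: "norm (dmult m x) \<le> B * norm x"
proof -
  have bd: "(\<Sum>k\<in>F. (norm (m k * cinner x (phi k)))\<^sup>2) \<le> (B * norm x)\<^sup>2" if "finite F" for F
  proof -
    have "(\<Sum>k\<in>F. (norm (m k * cinner x (phi k)))\<^sup>2) \<le> (\<Sum>k\<in>F. B\<^sup>2 * (norm (cinner x (phi k)))\<^sup>2)"
      unfolding norm_mult power_mult_distrib
      by (intro sum_mono mult_right_mono power_mono m) auto
    also have "\<dots> \<le> B\<^sup>2 * (norm x)\<^sup>2"
      unfolding sum_distrib_left[symmetric] by (intro mult_left_mono bessel that) auto
    finally show ?thesis by (simp add: power_mult_distrib)
  qed
  show "cinner (dmult m x) (phi k) = m k * cinner x (phi k)"
    unfolding dmult_def by (rule coef_of_coef[OF bd])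
  have "0 \<le> B" using m[of 0] norm_ge_zero[of "m 0"] by linarith
  have "(norm (dmult m x))\<^sup>2 \<le> (B * norm x)\<^sup>2"
    unfolding dmult_def by (rule norm_of_coef[OF bd])
  then show "norm (dmult m x) \<le> B * norm x"
    by (rule power2_le_imp_le) (use \<open>0 \<le> B\<close> in simp)
qed

lemma bounded_linear_dmult:
  assumes m: "\<And>k. norm (m k) \<le> B"
  shows "bounded_linear (dmult m)"
proof (rule bounded_linear_intro[where K = B])
  show "dmult m (x + y) = dmult m x + dmult m y" for x y
    by (rule l2_coef_eqI) (simp add: coef_dmult[OF m] cinner_add_left algebra_simps)
  show "dmult m (r *\<^sub>R x) = r *\<^sub>R dmult m x" for r x
    by (rule l2_coef_eqI) (simp add: coef_dmult[OF m] scaleR_eq_cscale cinner_cscale_left)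
  show "norm (dmult m x) \<le> norm x * B" for x
    using norm_dmult[of m B x, OF m] by (simp add: mult.commute)
qed

lemma dmult_cscale:
  assumes m: "\<And>k. norm (m k) \<le> B"
  shows "dmult m (cscale c x) = cscale c (dmult m x)"
  by (rule l2_coef_eqI) (simp add: coef_dmult[OF m] cinner_cscale_left)

lemma dmult_phi:
  assumes m: "\<And>k. norm (m k) \<le> B"
  shows "dmult m (phi k) = cscale (m k) (phi k)"
  by (rule l2_coef_eqI) (simp add: coef_dmult[OF m] cinner_cscale_left cinner_phi)

lemma bounded_linear_cscale_left: "bounded_linear (\<lambda>c. cscale c x)"
proof (rule bounded_linear_intro[where K = "norm x"])
  show "cscale (r *\<^sub>R c) x = r *\<^sub>R cscale c x" for r c
    by (simp add: scaleR_eq_cscale cscale_cscale scaleR_conv_of_real)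
qed (simp_all add: cscale_add_left norm_cscale)

text \<open>The phases \<open>\<theta>\<close> stay general because two groups are of this form: the
  free evolution, with the eigenvalues, and translation in x, with
  \<open>\<theta> k = 2 * pi * k\<close>, which produces \<open>rho\<close>.\<close>

definition evol :: "(int \<Rightarrow> real) \<Rightarrow> real \<Rightarrow> l2 \<Rightarrow> l2" where
  "evol \<theta> t = dmult (\<lambda>k. exp (- (\<i> * of_real (\<theta> k * t))))"

lemma norm_phase [simp]: "norm (exp (- (\<i> * complex_of_real r))) = 1"
  by (simp add: norm_exp_eq_Re)

lemma coef_evol: "cinner (evol \<theta> t x) (phi k) = exp (- (\<i> * of_real (\<theta> k * t))) * cinner x (phi k)"
  unfolding evol_def by (rule coef_dmult[where B = 1]) (simp only: norm_phase order_refl)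

lemma bounded_linear_evol: "bounded_linear (evol \<theta> t)"
  unfolding evol_def by (rule bounded_linear_dmult[where B = 1]) (simp only: norm_phase order_refl)

lemma evol_phi: "evol \<theta> t (phi k) = cscale (exp (- (\<i> * of_real (\<theta> k * t)))) (phi k)"
  unfolding evol_def by (rule dmult_phi[where B = 1]) (simp only: norm_phase order_refl)

lemma evol_cscale: "evol \<theta> t (cscale c x) = cscale c (evol \<theta> t x)"
  unfolding evol_def by (rule dmult_cscale[where B = 1]) (simp only: norm_phase order_refl)

lemma evol_0 [simp]: "evol \<theta> 0 x = x"
  by (rule l2_coef_eqI) (simp add: coef_evol)

lemma evol_evol: "evol \<theta> s (evol \<theta> t x) = evol \<theta> (s + t) x"
proof (rule l2_coef_eqI)
  fix k
  have "exp (- (\<i> * of_real (\<theta> k * s))) * exp (- (\<i> * of_real (\<theta> k * t)))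
      = exp (- (\<i> * complex_of_real (\<theta> k * (s + t))))"
    by (simp add: exp_add[symmetric] algebra_simps)
  then show "cinner (evol \<theta> s (evol \<theta> t x)) (phi k) = cinner (evol \<theta> (s + t) x) (phi k)"
    by (simp only: coef_evol mult.assoc[symmetric])
qed

lemma norm_evol [simp]: "norm (evol \<theta> t x) = norm x"
proof -
  have le: "norm (evol \<theta> t x) \<le> norm x" for t x
    unfolding evol_def using norm_dmult[of "\<lambda>k. exp (- (\<i> * of_real (\<theta> k * t)))" 1 x]
    by (simp only: norm_phase order_refl mult_1)
  have "norm x \<le> norm (evol \<theta> t x)"
    using le[of "- t" "evol \<theta> t x"] by (simp add: evol_evol)
  with le show ?thesis by (simp add: order_antisym)
qed

lemmas evol_diff = linear_diff[OF bounded_linear.linear[OF bounded_linear_evol]]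
lemmas evol_add_right = linear_add[OF bounded_linear.linear[OF bounded_linear_evol]]
lemmas evol_scaleR = linear_scale[OF bounded_linear.linear[OF bounded_linear_evol]]

text \<open>Each mode moves continuously, and the elements with continuous orbit form a closed
  subspace: \<open>evol\<close> is isometric for every t, so orbits of a convergent sequence
  converge uniformly in t.\<close>

lemma continuous_on_evol: "continuous_on S (\<lambda>t. evol \<theta> t x)"
proof -
  have "x \<in> {x. continuous_on UNIV (\<lambda>t. evol \<theta> t x)}"
  proof (rule phi_total)
    show "subspace {x. continuous_on UNIV (\<lambda>t. evol \<theta> t x)}"
      unfolding subspace_def
      by (auto simp: evol_add_right evol_scaleR linear_0[OF bounded_linear.linear[OF bounded_linear_evol]]
            intro: continuous_on_add continuous_on_scaleR continuous_on_const)
    show "closed {x. continuous_on UNIV (\<lambda>t. evol \<theta> t x)}"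
      unfolding closed_sequential_limits
    proof (intro allI impI)
      fix X l assume X: "(\<forall>n. X n \<in> {x. continuous_on UNIV (\<lambda>t. evol \<theta> t x)}) \<and> X \<longlonglongrightarrow> l"
      have "continuous_on UNIV (\<lambda>t. evol \<theta> t l)"
      proof (rule uniform_limit_theorem[where F = sequentially and f = "\<lambda>n t. evol \<theta> t (X n)"])
        show "\<forall>\<^sub>F n in sequentially. continuous_on UNIV (\<lambda>t. evol \<theta> t (X n))"
          using X by (intro always_eventually) simp
        show "uniform_limit UNIV (\<lambda>n t. evol \<theta> t (X n)) (\<lambda>t. evol \<theta> t l) sequentially"
        proof (rule uniform_limitI)
          fix e :: real assume "e > 0"
          then have "\<forall>\<^sub>F n in sequentially. dist (X n) l < e" using X by (simp add: tendstoD)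
          then show "\<forall>\<^sub>F n in sequentially. \<forall>t\<in>UNIV. dist (evol \<theta> t (X n)) (evol \<theta> t l) < e"
            by eventually_elim (simp add: dist_norm evol_diff[symmetric])
        qed
      qed simp
      then show "l \<in> {x. continuous_on UNIV (\<lambda>t. evol \<theta> t x)}" by simp
    qed
    show "cscale c (phi k) \<in> {x. continuous_on UNIV (\<lambda>t. evol \<theta> t x)}" for c k
      by (simp add: evol_cscale evol_phi cscale_cscale)
        (intro bounded_linear.continuous_on[OF bounded_linear_cscale_left] continuous_intros)
  qed
  then show ?thesis using continuous_on_subset by blast
qed

lemma tendsto_evol:
  assumes f: "(f \<longlongrightarrow> a) F" and g: "(g \<longlongrightarrow> b) F"
  shows "((\<lambda>x. evol \<theta> (f x) (g x)) \<longlongrightarrow> evol \<theta> a b) F"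
proof (rule Lim_transform)
  have "isCont (\<lambda>t. evol \<theta> t b) a"
    using continuous_on_evol[of UNIV] by (simp add: continuous_on_eq_continuous_at)
  then show "((\<lambda>x. evol \<theta> (f x) b) \<longlongrightarrow> evol \<theta> a b) F"
    by (rule isCont_tendsto_compose[OF _ f])
  show "((\<lambda>x. evol \<theta> (f x) (g x) - evol \<theta> (f x) b) \<longlongrightarrow> 0) F"
    using tendsto_norm[OF LIM_zero[OF g]]
    by (intro tendsto_norm_zero_cancel[of "\<lambda>x. evol \<theta> (f x) (g x) - evol \<theta> (f x) b"])
      (simp add: evol_diff[symmetric])
qed

lemma continuous_on_evol_compose:
  assumes "continuous_on S f" "continuous_on S g"
  shows "continuous_on S (\<lambda>x. evol \<theta> (f x) (g x))"
  using assms by (simp add: continuous_on_def tendsto_evol)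

lemma free_evol_eq: "free_evol u0 t = evol (eigval u0) t"
proof (rule ext, rule l2_coef_eqI)
  fix x k
  let ?f = "\<lambda>j. cscale (exp (- (\<i> * of_real (eigval u0 j * t)))) (cscale (cinner x (phi j)) (phi j))"
  have "((\<lambda>j. cinner (?f j) (phi k)) has_sum cinner (free_evol u0 t x) (phi k)) UNIV"
    unfolding free_evol_def
    by (rule has_sum_bounded_linear[OF bounded_linear_cinner_left has_sum_infsum[OF free_evol_summable]])
  moreover have "((\<lambda>j. cinner (?f j) (phi k)) has_sum cinner (?f k) (phi k)) UNIV"
    by (rule has_sum_finite_neutralI[where B = "{k}"])
      (auto simp: cinner_cscale_left cinner_phi)
  ultimately have "cinner (free_evol u0 t x) (phi k) = cinner (?f k) (phi k)"
    by (rule has_sum_unique)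
  then show "cinner (free_evol u0 t x) (phi k) = cinner (evol (eigval u0) t x) (phi k)"
    by (simp add: coef_evol cinner_cscale_left cinner_phi)
qed


section \<open>Point evaluation on the Sobolev scale\<close>

text \<open>The Sobolev weight that belongs to \<open>H1p_norm\<close>: 1 at k = 0 and |k|
  elsewhere, so that dividing the coefficients by it is exactly isometric.\<close>

definition jb :: "int \<Rightarrow> real" where "jb k = max 1 \<bar>real_of_int k\<bar>"

lemma jb_ge_1: "1 \<le> jb k" and jb_pos [simp]: "0 < jb k" and jb_nonzero [simp]: "jb k \<noteq> 0"
  by (auto simp: jb_def)

lemma abs_le_jb: "\<bar>real_of_int k\<bar> \<le> jb k"
  by (simp add: jb_def)

text \<open>The factor 2 counts the two signs of k.\<close>

definition jb_const :: real where "jb_const = 2 * (\<Sum>n. 1 / (max 1 (real n))\<^sup>2)"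

lemma sum_jb_le:
  assumes "finite F"
  shows "(\<Sum>k\<in>F. 1 / (jb k)\<^sup>2) \<le> jb_const"
proof -
  let ?g = "\<lambda>n. 1 / (max 1 (real n))\<^sup>2"
  have g: "summable ?g"
  proof (rule summable_comparison_test_ev)
    show "summable (\<lambda>n. inverse ((real n)\<^sup>2))"
      by (rule inverse_power_summable) simp
    show "\<forall>\<^sub>F n in sequentially. norm (?g n) \<le> inverse ((real n)\<^sup>2)"
      by (rule eventually_sequentiallyI[of 1]) (auto simp: max_def inverse_eq_divide)
  qed
  have half: "(\<Sum>k\<in>G. 1 / (jb k)\<^sup>2) \<le> suminf ?g"
    if "finite G" "inj_on (\<lambda>k. nat \<bar>k\<bar>) G" for G
  proof -
    have "(\<Sum>k\<in>G. 1 / (jb k)\<^sup>2) = (\<Sum>k\<in>G. ?g (nat \<bar>k\<bar>))"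
      by (simp add: jb_def)
    also have "\<dots> = (\<Sum>n\<in>(\<lambda>k. nat \<bar>k\<bar>) ` G. ?g n)"
      using sum.reindex[OF that(2), of ?g] by simp
    also have "\<dots> \<le> suminf ?g"
      using that by (intro sum_le_suminf g) auto
    finally show ?thesis .
  qed
  have "(\<Sum>k\<in>F. 1 / (jb k)\<^sup>2) = (\<Sum>k\<in>F \<inter> {0..}. 1 / (jb k)\<^sup>2) + (\<Sum>k\<in>F - {0..}. 1 / (jb k)\<^sup>2)"
    using assms by (simp add: sum.Int_Diff)
  also have "\<dots> \<le> suminf ?g + suminf ?g"
    using assms by (intro add_mono half) (auto simp: inj_on_def)
  finally show ?thesis by (simp add: jb_const_def)
qed

definition Lam :: "l2 \<Rightarrow> l2" where "Lam = dmult (\<lambda>k. of_real (1 / jb k))"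

lemma norm_inverse_jb: "norm (complex_of_real (1 / jb k)) \<le> 1"
  using jb_ge_1[of k] by (simp add: norm_divide)

lemma coef_Lam: "cinner (Lam x) (phi k) = cinner x (phi k) / of_real (jb k)"
  unfolding Lam_def using coef_dmult[of "\<lambda>k. of_real (1 / jb k)" 1 x k, OF norm_inverse_jb] by simp

lemma norm_Lam_le: "norm (Lam x) \<le> norm x"
  unfolding Lam_def using norm_dmult[of "\<lambda>k. of_real (1 / jb k)" 1 x, OF norm_inverse_jb] by simp

lemma bounded_linear_Lam: "bounded_linear Lam"
  unfolding Lam_def by (rule bounded_linear_dmult[OF norm_inverse_jb])

lemmas Lam_diff = linear_diff[OF bounded_linear.linear[OF bounded_linear_Lam]]

lemma Lam_cscale: "Lam (cscale c x) = cscale c (Lam x)"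
  unfolding Lam_def by (rule dmult_cscale[OF norm_inverse_jb])

lemma Lam_phi: "Lam (phi k) = cscale (of_real (1 / jb k)) (phi k)"
  unfolding Lam_def by (rule dmult_phi[OF norm_inverse_jb])

lemma Lam_evol: "Lam (evol \<theta> t x) = evol \<theta> t (Lam x)"
  by (rule l2_coef_eqI) (simp add: coef_Lam coef_evol)

lemma Lam_eq_iff [simp]: "Lam x = Lam y \<longleftrightarrow> x = y"
proof
  assume e: "Lam x = Lam y"
  show "x = y"
    using arg_cong[OF e, of "\<lambda>z. cinner z (phi k)" for k]
    by (intro l2_coef_eqI) (simp add: coef_Lam)
qed auto

text \<open>The derivative composed with \<open>Lam\<close>, bounded because k / jb k is; that it is
  the weak derivative is shown in \<open>weak_deriv_ev\<close>.\<close>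

definition Dop :: "l2 \<Rightarrow> l2" where "Dop = dmult (\<lambda>k. 2 * pi * \<i> * of_int k / of_real (jb k))"

lemma norm_Dop_symbol: "norm (2 * pi * \<i> * of_int k / of_real (jb k)) \<le> 2 * pi"
  using abs_le_jb[of k] by (simp add: norm_divide norm_mult divide_simps)

lemma bounded_linear_Dop: "bounded_linear Dop"
  unfolding Dop_def by (rule bounded_linear_dmult[OF norm_Dop_symbol])

lemma Dop_cscale: "Dop (cscale c x) = cscale c (Dop x)"
  unfolding Dop_def by (rule dmult_cscale[OF norm_Dop_symbol])

lemma Dop_phi: "Dop (phi k) = cscale (2 * pi * \<i> * of_int k / of_real (jb k)) (phi k)"
  unfolding Dop_def by (rule dmult_phi[OF norm_Dop_symbol])

text \<open>\<open>rho x\<close> represents the functional $\eta \mapsto (\Lambda\eta)(x)$.\<close>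

definition rho :: "real \<Rightarrow> l2" where
  "rho x = evol (\<lambda>k. 2 * pi * of_int k) x (of_coef (\<lambda>k. of_real (1 / jb k)))"

definition ev :: "l2 \<Rightarrow> real \<Rightarrow> complex" where
  "ev \<eta> x = cinner \<eta> (rho x)"

lemma coef_rho: "cinner (rho x) (phi k) = cnj (phi_fun k x) / of_real (jb k)"
proof -
  have "cinner (of_coef (\<lambda>k. of_real (1 / jb k))) (phi k) = of_real (1 / jb k)"
    by (rule coef_of_coef[where B = jb_const])
      (auto simp: norm_divide power_divide intro: sum_jb_le)
  then show ?thesis
    by (simp add: rho_def coef_evol phi_fun_def exp_cnj mult_ac)
qed

lemma ev_phi: "ev (phi k) x = phi_fun k x / of_real (jb k)"
  unfolding ev_def by (subst cinner_commute) (simp add: coef_rho)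

lemma bounded_linear_ev: "bounded_linear (\<lambda>\<eta>. ev \<eta> x)"
  unfolding ev_def by (rule bounded_linear_cinner_left)

lemma ev_cscale: "ev (cscale c \<eta>) x = c * ev \<eta> x"
  by (simp add: ev_def cinner_cscale_left)

lemma norm_ev_le: "norm (ev \<eta> x) \<le> norm (rho 0) * norm \<eta>"
  using norm_cinner_le[of \<eta> "rho x"] by (simp add: ev_def rho_def mult.commute)

text \<open>\<open>rho\<close> is an orbit of the translation group, so strong continuity of
  \<open>evol\<close> gives continuity of point evaluation.\<close>

lemma continuous_on_ev: "continuous_on S (ev \<eta>)"
  unfolding ev_def rho_def
  by (intro bounded_linear.continuous_on[OF bounded_linear_cinner_right] continuous_on_evol)

lemma ev_0_1: "ev \<eta> 0 = ev \<eta> 1"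
proof -
  have "rho 0 = rho 1"
    using exp_integer_2pi[of "of_int _"]
    by (intro l2_coef_eqI) (simp add: coef_rho phi_fun_def mult_ac)
  then show ?thesis by (simp add: ev_def)
qed

lemma ev_L2: "ev \<eta> \<in> L2_fun 0 1"
  by (rule L2_fun_bounded[where C = "norm (rho 0) * norm \<eta>"])
    (auto intro: continuous_imp_measurable_on_sets_lebesgue continuous_on_ev norm_ev_le)

lemma norm_l2_of_le:
  assumes "f \<in> borel_measurable M01" "\<And>x. norm (f x) \<le> B"
  shows "norm (l2_of f) \<le> B"
proof -
  have L: "f \<in> L2_fun 0 1" using assms by (intro L2_fun_bounded[where C = B]) auto
  have "(norm (l2_of f))\<^sup>2 = (LINT x|M01. (norm (f x))\<^sup>2)" by (rule norm_l2_of_sq[OF L])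
  also have "\<dots> \<le> (LINT x|M01. B\<^sup>2)"
    using L2_funD(2)[OF L] finite_measure.integrable_const[OF finite_measure_M01]
    by (intro integral_mono power_mono assms) auto
  also have "\<dots> = B\<^sup>2" using measure_M01 by simp
  finally show ?thesis
    using order_trans[OF norm_ge_zero assms(2)] by (rule power2_le_imp_le)
qed

text \<open>Both sides are bounded and linear in \<open>\<eta>\<close>, so it is enough to compare
  them on modes. This makes \<open>ev \<eta>\<close> the continuous periodic representative of
  \<open>Lam \<eta>\<close>.\<close>

lemma l2_of_ev: "l2_of (ev \<eta>) = Lam \<eta>"
proof (rule bounded_linear_eqI[OF _ bounded_linear_Lam])
  have m: "ev \<eta> \<in> borel_measurable M01" for \<eta> by (rule L2_funD(1)[OF ev_L2])
  show "bounded_linear (\<lambda>\<eta>. l2_of (ev \<eta>))"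
  proof (rule bounded_linear_intro[where K = "norm (rho 0)"])
    show "l2_of (ev (x + y)) = l2_of (ev x) + l2_of (ev y)" for x y
    proof -
      have "ev (x + y) = (\<lambda>t. ev x t + ev y t)" by (simp add: fun_eq_iff ev_def cinner_add_left)
      then show ?thesis by (simp add: l2_of_add ev_L2)
    qed
    show "l2_of (ev (r *\<^sub>R x)) = r *\<^sub>R l2_of (ev x)" for r x
    proof -
      have "ev (r *\<^sub>R x) = (\<lambda>t. of_real r * ev x t)"
        by (simp add: fun_eq_iff scaleR_eq_cscale ev_cscale)
      then show ?thesis by (simp add: scaleR_eq_cscale l2_of_cmult ev_L2)
    qed
    show "norm (l2_of (ev x)) \<le> norm x * norm (rho 0)" for x
      using norm_l2_of_le[OF m norm_ev_le] by (simp add: mult.commute)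
  qed
  show "l2_of (ev (cscale c (phi k))) = Lam (cscale c (phi k))" for c k
  proof -
    have "ev (cscale c (phi k)) = (\<lambda>t. (c / of_real (jb k)) * phi_fun k t)"
      by (simp add: fun_eq_iff ev_cscale ev_phi)
    then show ?thesis
      by (simp only: l2_of_cmult[OF phi_fun_L2] Lam_cscale Lam_phi cscale_cscale phi_def[symmetric]) simp
  qed
qed

section \<open>Weak derivatives tested against functions that do not vanish at the end points\<close>

lemma finite_measure_lebesgue_on: "finite_measure (lebesgue_on {a<..<b::real})"
  by (rule finite_measureI, cases "a \<le> b") (simp_all add: emeasure_restrict_space)

lemma L2_fun_integrable:
  assumes f: "f \<in> L2_fun a b"
  shows "integrable (lebesgue_on {a<..<b}) f"
proof (rule Bochner_Integration.integrable_bound)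
  show "integrable (lebesgue_on {a<..<b}) (\<lambda>x. 1 + (norm (f x))\<^sup>2)"
    by (intro Bochner_Integration.integrable_add L2_funD(2)[OF f]
        finite_measure.integrable_const[OF finite_measure_lebesgue_on])
  have "norm y \<le> 1 + (norm y)\<^sup>2" for y :: 'a
    using sum_squares_bound[of 1 "norm y"] norm_ge_zero[of y]
    unfolding power_one mult_1_right by linarith
  then have "norm y \<le> norm (1 + (norm y)\<^sup>2)" for y :: 'a
    by simp
  then show "AE x in lebesgue_on {a<..<b}. norm (f x) \<le> norm (1 + (norm (f x))\<^sup>2)" by auto
qed (rule L2_funD(1)[OF f])

lemma continuous_measurable_on:
  fixes h :: "real \<Rightarrow> 'a::euclidean_space"
  assumes "continuous_on UNIV h"
  shows "h \<in> borel_measurable (lebesgue_on {a<..<b})"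
  by (rule continuous_imp_measurable_on_sets_lebesgue) (auto intro: continuous_on_subset[OF assms])

lemma continuous_bounded_on:
  fixes h :: "real \<Rightarrow> 'a::euclidean_space"
  assumes "continuous_on UNIV h"
  obtains C where "\<And>x. x \<in> {a..b} \<Longrightarrow> norm (h x) \<le> C" "0 \<le> C"
proof -
  have "compact (h ` {a..b})"
    by (intro compact_continuous_image continuous_on_subset[OF assms]) auto
  then obtain C where C: "\<And>y. y \<in> h ` {a..b} \<Longrightarrow> norm y \<le> C"
    using compact_imp_bounded bounded_iff by metis
  show ?thesis by (rule that[of "max 0 C"]) (use C in \<open>auto simp: le_max_iff_disj\<close>)
qed

lemma L2_fun_continuous_scaleR:
  fixes h :: "real \<Rightarrow> real"
  assumes h: "continuous_on UNIV h" and f: "f \<in> L2_fun a b"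
  shows "(\<lambda>x. h x *\<^sub>R f x) \<in> L2_fun a b"
proof -
  obtain C where C: "\<And>x. x \<in> {a..b} \<Longrightarrow> norm (h x) \<le> C"
    using continuous_bounded_on[OF h] by metis
  note [measurable] = L2_funD(1)[OF f] continuous_measurable_on[OF h]
  show ?thesis
    by (rule L2_fun_bound[OF f, where C = C]) (auto intro!: AE_I2 mult_right_mono C[unfolded real_norm_def])
qed

lemma continuous_integrable_open:
  fixes f :: "real \<Rightarrow> 'a::euclidean_space"
  assumes f: "continuous_on UNIV f"
  shows "integrable (lebesgue_on {a<..<b}) f"
proof -
  obtain C where "\<And>x. x \<in> {a..b} \<Longrightarrow> norm (f x) \<le> C"
    using continuous_bounded_on[OF f] by metis
  then show ?thesis
    using continuous_measurable_on[OF f] finite_measure_lebesgue_on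
    by (intro finite_measure.integrable_const_bound[where B = C]) (auto intro!: AE_I2)
qed

lemma ftc_open:
  fixes F f :: "real \<Rightarrow> 'a::euclidean_space"
  assumes "a \<le> b" and F: "\<And>x. (F has_vector_derivative f x) (at x)" and f: "continuous_on UNIV f"
  shows "(LINT x|lebesgue_on {a<..<b}. f x) = F b - F a"
proof -
  have "integrable (lebesgue_on {a<..<b}) f"
    by (rule continuous_integrable_open[OF f])
  then have "(LINT x|lebesgue_on {a<..<b}. f x) = integral {a<..<b} f"
    by (intro lebesgue_integral_eq_integral) auto
  also have "\<dots> = integral {a..b} f" by (simp add: integral_open_interval_real)
  also have "\<dots> = F b - F a"
    using F by (intro integral_unique fundamental_theorem_of_calculus assms)
      (auto intro: has_vector_derivative_at_within)
  finally show ?thesis .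
qed

section \<open>Cutoffs of class C^1 and their boundary layers\<close>

definition sq_pos :: "real \<Rightarrow> real" where "sq_pos y = (max 0 y)\<^sup>2"

lemma sq_pos_derivative: "(sq_pos has_real_derivative 2 * max 0 y) (at y)"
proof -
  consider "y > 0" | "y < 0" | "y = 0" by linarith
  then show ?thesis
  proof cases
    case 1
    have "((\<lambda>y. y\<^sup>2) has_real_derivative 2 * max 0 y) (at y)"
      using 1 by (auto intro!: derivative_eq_intros)
    then show ?thesis
      by (rule has_field_derivative_transform_within_open[of _ _ _ "{0<..}"])
        (use 1 in \<open>auto simp: sq_pos_def\<close>)
  next
    case 2
    have "((\<lambda>y. 0) has_real_derivative 2 * max 0 y) (at y)"
      using 2 by (auto intro!: derivative_eq_intros)
    then show ?thesis
      by (rule has_field_derivative_transform_within_open[of _ _ _ "{..<0}"])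
        (use 2 in \<open>auto simp: sq_pos_def\<close>)
  next
    case 3
    have "((\<lambda>h. (sq_pos (0 + h) - sq_pos 0) / h) \<longlongrightarrow> 0) (at 0)"
    proof (rule Lim_null_comparison)
      show "\<forall>\<^sub>F h in at 0. norm ((sq_pos (0 + h) - sq_pos 0) / h) \<le> \<bar>h\<bar>"
        by (rule always_eventually) (auto simp: sq_pos_def max_def power2_eq_square)
      show "((\<lambda>h::real. \<bar>h\<bar>) \<longlongrightarrow> 0) (at 0)"
        using tendsto_rabs[OF tendsto_ident_at, of 0] by simp
    qed
    then show ?thesis using 3 by (simp add: DERIV_def)
  qed
qed

text \<open>A C^1 transition from 0 on y <= 0 to 1 on y >= 1. Squares of positive parts are smooth
  enough, since test functions are only C^1, and the two terms of the denominator never vanish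
  together.\<close>

definition step :: "real \<Rightarrow> real" where
  "step y = sq_pos y / (sq_pos y + sq_pos (1 - y))"

definition step' :: "real \<Rightarrow> real" where
  "step' y = (2 * max 0 y * (sq_pos y + sq_pos (1 - y)) - sq_pos y * (2 * max 0 y - 2 * max 0 (1 - y)))
     / (sq_pos y + sq_pos (1 - y))\<^sup>2"

lemma step_denom_pos: "sq_pos y + sq_pos (1 - y) > 0"
proof (cases "y > 0")
  case True
  then show ?thesis by (auto simp: sq_pos_def intro!: add_pos_nonneg)
next
  case False
  then show ?thesis by (auto simp: sq_pos_def intro!: add_nonneg_pos)
qed

lemma step_derivative: "(step has_real_derivative step' y) (at y)"
proof -
  have 1: "((\<lambda>y. sq_pos (1 - y)) has_real_derivative - (2 * max 0 (1 - y))) (at y)"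
    by (rule DERIV_cong[OF DERIV_chain2[where f = sq_pos and g = "\<lambda>y. 1 - y" and Db = "-1", OF sq_pos_derivative]])
      (auto intro!: derivative_eq_intros)
  show ?thesis
    unfolding step_def[abs_def] step'_def
    using step_denom_pos[of y]
    by (intro DERIV_cong[OF DERIV_divide[OF sq_pos_derivative DERIV_add[OF sq_pos_derivative 1]]])
      (auto simp: power2_eq_square)
qed

lemma continuous_on_sq_pos [continuous_intros]: "continuous_on S f \<Longrightarrow> continuous_on S (\<lambda>x. sq_pos (f x))"
  unfolding sq_pos_def by (intro continuous_intros)

lemma continuous_on_step' [continuous_intros]: "continuous_on S f \<Longrightarrow> continuous_on S (\<lambda>x. step' (f x))"
  unfolding step'_def using step_denom_pos
  by (intro continuous_intros) (auto simp: less_imp_neq[symmetric])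

lemma continuous_on_step [continuous_intros]: "continuous_on S f \<Longrightarrow> continuous_on S (\<lambda>x. step (f x))"
  unfolding step_def using step_denom_pos
  by (intro continuous_intros) (auto simp: less_imp_neq[symmetric])

lemma step_bounds: "0 \<le> step y" "step y \<le> 1"
  using step_denom_pos[of y] by (auto simp: step_def sq_pos_def divide_simps)

lemma step_left: "y \<le> 0 \<Longrightarrow> step y = 0" and step_right: "1 \<le> y \<Longrightarrow> step y = 1"
  and step'_left: "y \<le> 0 \<Longrightarrow> step' y = 0" and step'_right: "1 \<le> y \<Longrightarrow> step' y = 0"
  by (auto simp: step_def step'_def sq_pos_def)

lemma step'_bound: "\<exists>C\<ge>0. \<forall>y. \<bar>step' y\<bar> \<le> C"
proof -
  obtain C where C: "\<And>x. x \<in> {0..1} \<Longrightarrow> norm (step' x) \<le> C" "0 \<le> C"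
    using continuous_bounded_on[of step' 0 1] continuous_on_step'[OF continuous_on_id] by metis
  then have "\<bar>step' y\<bar> \<le> C" for y
    using step'_left[of y] step'_right[of y] by (cases "y \<in> {0..1}") auto
  then show ?thesis using C by blast
qed

text \<open>Zero within 1 / (n + 1) of the end points and 1 at distance at least 2 / (n + 1) from
  both. The shift by 1 keeps the support in a compact subinterval of (a, b), as
  \<open>C1_test\<close> demands.\<close>

definition cutoff :: "real \<Rightarrow> real \<Rightarrow> nat \<Rightarrow> real \<Rightarrow> real" where
  "cutoff a b n x = step (real (Suc n) * (x - a) - 1) * step (real (Suc n) * (b - x) - 1)"

definition cutoff' :: "real \<Rightarrow> real \<Rightarrow> nat \<Rightarrow> real \<Rightarrow> real" where
  "cutoff' a b n x = real (Suc n) * (step' (real (Suc n) * (x - a) - 1) * step (real (Suc n) * (b - x) - 1)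
     - step (real (Suc n) * (x - a) - 1) * step' (real (Suc n) * (b - x) - 1))"

lemma cutoff_derivative: "(cutoff a b n has_real_derivative cutoff' a b n x) (at x)"
proof -
  have 1: "((\<lambda>x. step (real (Suc n) * (x - a) - 1)) has_real_derivative step' (real (Suc n) * (x - a) - 1) * real (Suc n)) (at x)"
    by (rule DERIV_chain2[OF step_derivative]) (auto intro!: derivative_eq_intros)
  have 2: "((\<lambda>x. step (real (Suc n) * (b - x) - 1)) has_real_derivative step' (real (Suc n) * (b - x) - 1) * - real (Suc n)) (at x)"
    by (rule DERIV_chain2[OF step_derivative]) (auto intro!: derivative_eq_intros)
  show ?thesis
    unfolding cutoff_def[abs_def] cutoff'_def
    by (rule DERIV_cong[OF DERIV_mult[OF 1 2]]) (simp add: algebra_simps)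
qed

lemma continuous_on_cutoff: "continuous_on S (cutoff a b n)"
  and continuous_on_cutoff': "continuous_on S (cutoff' a b n)"
  unfolding cutoff_def[abs_def] cutoff'_def[abs_def] by (intro continuous_intros)+

lemma cutoff_bounds: "0 \<le> cutoff a b n x" "cutoff a b n x \<le> 1"
  unfolding cutoff_def using step_bounds by (auto intro: mult_le_one)

lemma cutoff_support: "x \<notin> {a + 1 / real (Suc n)..b - 1 / real (Suc n)} \<Longrightarrow> cutoff a b n x = 0"
  unfolding cutoff_def by (auto simp: step_left field_simps simp del: of_nat_Suc)

lemma cutoff'_eq_0:
  assumes "a + 2 / real (Suc n) \<le> x" "x \<le> b - 2 / real (Suc n)"
  shows "cutoff' a b n x = 0" "cutoff a b n x = 1"
proof -
  have "1 \<le> real (Suc n) * (x - a) - 1" "1 \<le> real (Suc n) * (b - x) - 1"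
    using assms by (auto simp: field_simps simp del: of_nat_Suc)
  then show "cutoff' a b n x = 0" "cutoff a b n x = 1"
    unfolding cutoff_def cutoff'_def by (simp_all add: step_right step'_right)
qed

lemma cutoff'_bound: "\<exists>C\<ge>0. \<forall>a b n x. \<bar>cutoff' a b n x\<bar> \<le> real (Suc n) * C"
proof -
  obtain C where C: "0 \<le> C" "\<And>y. \<bar>step' y\<bar> \<le> C" using step'_bound by blast
  have "\<bar>cutoff' a b n x\<bar> \<le> real (Suc n) * (2 * C)" for a b n x
  proof -
    have "\<bar>step' y * step z - step y' * step' z'\<bar> \<le> C * 1 + 1 * C" for y z y' z'
      by (rule order_trans[OF abs_triangle_ineq4], rule add_mono; unfold abs_mult; intro mult_mono)
        (use C step_bounds in auto)
    then show ?thesis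
      unfolding cutoff'_def abs_mult by (intro mult_mono) auto
  qed
  then show ?thesis using C(1) by (intro exI[of _ "2 * C"]) auto
qed

lemma eventually_cutoff:
  assumes "x \<in> {a<..<b}"
  shows "\<forall>\<^sub>F n in sequentially. cutoff' a b n x = 0 \<and> cutoff a b n x = 1"
proof -
  have "(\<lambda>n. 2 * inverse (real (Suc n))) \<longlonglongrightarrow> 2 * 0"
    by (intro tendsto_mult tendsto_const LIMSEQ_inverse_real_of_nat)
  then have lim: "(\<lambda>n. 2 / real (Suc n)) \<longlonglongrightarrow> 0" by (simp add: divide_inverse)
  have "\<forall>\<^sub>F n in sequentially. 2 / real (Suc n) < x - a" "\<forall>\<^sub>F n in sequentially. 2 / real (Suc n) < b - x"
    by (rule order_tendstoD(2)[OF lim]; use assms in simp)+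
  then show ?thesis
    by eventually_elim (auto intro!: cutoff'_eq_0 simp del: of_nat_Suc)
qed

definition weak_deriv :: "real \<Rightarrow> real \<Rightarrow> (real \<Rightarrow> 'a::euclidean_space) \<Rightarrow> (real \<Rightarrow> 'a) \<Rightarrow> bool" where
  "weak_deriv a b f g \<longleftrightarrow> f \<in> L2_fun a b \<and> g \<in> L2_fun a b \<and> (\<forall>\<phi> \<in> C1_test a b.
     (LINT x|lebesgue_on {a<..<b}. deriv \<phi> x *\<^sub>R f x)
       = - (LINT x|lebesgue_on {a<..<b}. \<phi> x *\<^sub>R g x))"

lemma H1_fun_iff: "f \<in> H1_fun a b \<longleftrightarrow> (\<exists>g. weak_deriv a b f g)"
  by (auto simp: H1_fun_def weak_deriv_def)

context
  fixes a b :: real and f g :: "real \<Rightarrow> 'a::euclidean_space" and e e' :: "real \<Rightarrow> real"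
  assumes w: "weak_deriv a b f g" and ab: "a < b"
    and e: "\<And>x. (e has_real_derivative e' x) (at x)" and e': "continuous_on UNIV e'"
begin

private lemma fg: "f \<in> L2_fun a b" "g \<in> L2_fun a b"
  using w by (auto simp: weak_deriv_def)

private lemma e_cont: "continuous_on UNIV e"
  using e by (meson DERIV_isCont continuous_at_imp_continuous_on)

private lemma cutoff_identity:
  "(LINT x|lebesgue_on {a<..<b}. (cutoff' a b n x * e x) *\<^sub>R f x)
     + (LINT x|lebesgue_on {a<..<b}. (cutoff a b n x * e' x) *\<^sub>R f x)
   = - (LINT x|lebesgue_on {a<..<b}. (cutoff a b n x * e x) *\<^sub>R g x)"
proof -
  let ?\<phi> = "\<lambda>x. cutoff a b n x * e x" and ?\<phi>' = "\<lambda>x. cutoff' a b n x * e x + cutoff a b n x * e' x"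
  have d: "(?\<phi> has_real_derivative ?\<phi>' x) (at x)" for x
    by (rule DERIV_cong[OF DERIV_mult[OF cutoff_derivative e]]) simp
  then have dd: "deriv ?\<phi> = ?\<phi>'" by (auto intro: DERIV_imp_deriv)
  have "?\<phi> \<in> C1_test a b"
    unfolding C1_test_def
  proof (intro CollectI conjI allI)
    have "a < a + 1 / real (Suc n) \<and> b - 1 / real (Suc n) < b
        \<and> (\<forall>x. x \<notin> {a + 1 / real (Suc n)..b - 1 / real (Suc n)} \<longrightarrow> ?\<phi> x = 0)"
      by (simp add: cutoff_support del: of_nat_Suc)
    then show "\<exists>c d. a < c \<and> d < b \<and> (\<forall>x. x \<notin> {c..d} \<longrightarrow> ?\<phi> x = 0)" by blast
    show "?\<phi> differentiable at x" for x using d real_differentiable_def by blast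
    show "continuous_on UNIV (deriv ?\<phi>)"
      unfolding dd by (intro continuous_intros continuous_on_cutoff continuous_on_cutoff' e_cont e')
  qed
  then have "(LINT x|lebesgue_on {a<..<b}. ?\<phi>' x *\<^sub>R f x) = - (LINT x|lebesgue_on {a<..<b}. ?\<phi> x *\<^sub>R g x)"
    using w dd unfolding weak_deriv_def by force
  moreover have "(LINT x|lebesgue_on {a<..<b}. ?\<phi>' x *\<^sub>R f x)
     = (LINT x|lebesgue_on {a<..<b}. (cutoff' a b n x * e x) *\<^sub>R f x)
     + (LINT x|lebesgue_on {a<..<b}. (cutoff a b n x * e' x) *\<^sub>R f x)"
    unfolding scaleR_add_left
    by (intro Bochner_Integration.integral_add L2_fun_integrable L2_fun_continuous_scaleR fg
        continuous_intros continuous_on_cutoff continuous_on_cutoff' e_cont e')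
  ultimately show ?thesis by simp
qed

private lemma cutoff_lim:
  fixes h :: "real \<Rightarrow> real" and F :: "real \<Rightarrow> 'a"
  assumes h: "continuous_on UNIV h" and F: "F \<in> L2_fun a b"
  shows "(\<lambda>n. LINT x|lebesgue_on {a<..<b}. (cutoff a b n x * h x) *\<^sub>R F x)
     \<longlonglongrightarrow> (LINT x|lebesgue_on {a<..<b}. h x *\<^sub>R F x)"
proof (rule integral_dominated_convergence)
  note hF = L2_fun_continuous_scaleR[OF h F]
  show "integrable (lebesgue_on {a<..<b}) (\<lambda>x. norm (h x *\<^sub>R F x))"
    by (intro integrable_norm L2_fun_integrable hF)
  show "(\<lambda>x. h x *\<^sub>R F x) \<in> borel_measurable (lebesgue_on {a<..<b})"
    by (rule L2_funD(1)[OF hF])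
  show "(\<lambda>x. (cutoff a b n x * h x) *\<^sub>R F x) \<in> borel_measurable (lebesgue_on {a<..<b})" for n
    by (intro L2_funD(1) L2_fun_continuous_scaleR continuous_intros continuous_on_cutoff h F)
  show "AE x in lebesgue_on {a<..<b}. (\<lambda>n. (cutoff a b n x * h x) *\<^sub>R F x) \<longlonglongrightarrow> h x *\<^sub>R F x"
  proof (rule AE_I2)
    fix x assume "x \<in> space (lebesgue_on {a<..<b})"
    then have "\<forall>\<^sub>F n in sequentially. cutoff' a b n x = 0 \<and> cutoff a b n x = 1"
      by (intro eventually_cutoff) simp
    then show "(\<lambda>n. (cutoff a b n x * h x) *\<^sub>R F x) \<longlonglongrightarrow> h x *\<^sub>R F x"
      by (intro tendsto_eventually) (auto elim!: eventually_mono)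
  qed
  show "AE x in lebesgue_on {a<..<b}. norm ((cutoff a b n x * h x) *\<^sub>R F x) \<le> norm (h x *\<^sub>R F x)" for n
    using cutoff_bounds by (auto simp: abs_mult intro!: AE_I2 mult_right_mono mult_left_le_one_le)
qed

text \<open>Multiplied by the cutoff, \<open>e\<close> is an admissible test function, and all terms
  but the one with \<open>cutoff'\<close> converge by domination. What remains is to show that this
  boundary layer term vanishes, either because \<open>e\<close> is small there or because
  \<open>f\<close> is.\<close>

private lemma weak_deriv_of_lim:
  assumes "(\<lambda>n. LINT x|lebesgue_on {a<..<b}. (cutoff' a b n x * e x) *\<^sub>R f x) \<longlonglongrightarrow> 0"
  shows "(LINT x|lebesgue_on {a<..<b}. e' x *\<^sub>R f x) = - (LINT x|lebesgue_on {a<..<b}. e x *\<^sub>R g x)"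
proof -
  have "(\<lambda>n. (LINT x|lebesgue_on {a<..<b}. (cutoff' a b n x * e x) *\<^sub>R f x)
     + (LINT x|lebesgue_on {a<..<b}. (cutoff a b n x * e' x) *\<^sub>R f x))
     \<longlonglongrightarrow> 0 + (LINT x|lebesgue_on {a<..<b}. e' x *\<^sub>R f x)"
    by (intro tendsto_add assms cutoff_lim e' fg)
  moreover have "(\<lambda>n. - (LINT x|lebesgue_on {a<..<b}. (cutoff a b n x * e x) *\<^sub>R g x))
      \<longlonglongrightarrow> - (LINT x|lebesgue_on {a<..<b}. e x *\<^sub>R g x)"
    by (intro tendsto_minus cutoff_lim e_cont fg)
  ultimately show ?thesis
    unfolding cutoff_identity using LIMSEQ_unique by fastforce
qed

text \<open>In the layers of width 2 / (n + 1) at the ends, \<open>e\<close> is at most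
  \<open>L\<close> times that width while \<open>cutoff'\<close> is of size n + 1, so their product
  stays bounded. It tends to 0 at every interior point, and \<open>f\<close> is integrable.\<close>

lemma weak_deriv_C1_zero:
  assumes "e a = 0" "e b = 0"
  shows "(LINT x|lebesgue_on {a<..<b}. e' x *\<^sub>R f x) = - (LINT x|lebesgue_on {a<..<b}. e x *\<^sub>R g x)"
proof (rule weak_deriv_of_lim)
  obtain L where L: "\<And>x. x \<in> {a..b} \<Longrightarrow> norm (e' x) \<le> L" "0 \<le> L"
    using continuous_bounded_on[OF e'] by metis
  obtain C where C: "0 \<le> C" "\<And>n x. \<bar>cutoff' a b n x\<bar> \<le> real (Suc n) * C"
    using cutoff'_bound by metis
  have lip: "\<bar>e x - e y\<bar> \<le> L * \<bar>x - y\<bar>" if "x \<in> {a..b}" "y \<in> {a..b}" for x y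
    using field_differentiable_bound[of "{a..b}" e e' L x y] that L e
    by (auto intro: has_field_derivative_at_within)
  have bound: "\<bar>cutoff' a b n x * e x\<bar> \<le> 2 * L * C" if x: "x \<in> {a<..<b}" for n x
  proof (cases "cutoff' a b n x = 0")
    case False
    then have "x < a + 2 / real (Suc n) \<or> b - 2 / real (Suc n) < x" using cutoff'_eq_0(1)[of a n x b] by force
    then have "\<bar>e x\<bar> \<le> L * (2 / real (Suc n))"
    proof
      assume "x < a + 2 / real (Suc n)"
      then have "\<bar>e x - e a\<bar> \<le> L * \<bar>x - a\<bar>" "L * \<bar>x - a\<bar> \<le> L * (2 / real (Suc n))"
        using x L(2) by (intro lip mult_left_mono; simp)+
      then show ?thesis using assms by simp
    next
      assume "b - 2 / real (Suc n) < x"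
      then have "\<bar>e x - e b\<bar> \<le> L * \<bar>x - b\<bar>" "L * \<bar>x - b\<bar> \<le> L * (2 / real (Suc n))"
        using x L(2) by (intro lip mult_left_mono; simp)+
      then show ?thesis using assms by simp
    qed
    then have "\<bar>cutoff' a b n x\<bar> * \<bar>e x\<bar> \<le> (real (Suc n) * C) * (L * (2 / real (Suc n)))"
      using C L(2) by (intro mult_mono) auto
    then show ?thesis by (simp add: abs_mult field_simps del: of_nat_Suc)
  qed (use C L in auto)
  have "(\<lambda>n. LINT x|lebesgue_on {a<..<b}. (cutoff' a b n x * e x) *\<^sub>R f x)
      \<longlonglongrightarrow> (LINT x|lebesgue_on {a<..<b}. 0)"
  proof (rule integral_dominated_convergence)
    show "integrable (lebesgue_on {a<..<b}) (\<lambda>x. 2 * L * C * norm (f x))"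
      by (intro integrable_mult_right integrable_norm L2_fun_integrable fg)
    show "(\<lambda>x. (cutoff' a b n x * e x) *\<^sub>R f x) \<in> borel_measurable (lebesgue_on {a<..<b})" for n
      by (intro L2_funD(1) L2_fun_continuous_scaleR continuous_intros continuous_on_cutoff' e_cont fg)
    show "AE x in lebesgue_on {a<..<b}. (\<lambda>n. (cutoff' a b n x * e x) *\<^sub>R f x) \<longlonglongrightarrow> 0"
    proof (rule AE_I2)
      fix x assume "x \<in> space (lebesgue_on {a<..<b})"
      then have "\<forall>\<^sub>F n in sequentially. cutoff' a b n x = 0 \<and> cutoff a b n x = 1"
        by (intro eventually_cutoff) simp
      then show "(\<lambda>n. (cutoff' a b n x * e x) *\<^sub>R f x) \<longlonglongrightarrow> 0"
        by (intro tendsto_eventually) (auto elim!: eventually_mono)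
    qed
    show "AE x in lebesgue_on {a<..<b}. norm ((cutoff' a b n x * e x) *\<^sub>R f x) \<le> 2 * L * C * norm (f x)" for n
      using bound by (auto intro!: AE_I2 mult_right_mono)
  qed simp
  then show "(\<lambda>n. LINT x|lebesgue_on {a<..<b}. (cutoff' a b n x * e x) *\<^sub>R f x) \<longlonglongrightarrow> 0" by simp
qed

text \<open>Here the layer is controlled by \<open>f\<close>: the two layers have total length at
  most 4 / (n + 1), \<open>cutoff'\<close> is at most (n + 1) C, and \<open>f\<close> is below
  \<open>\<eta>\<close> near the ends, which gives 4 C \<open>\<eta>\<close>.\<close>

lemma weak_deriv_const_zero:
  assumes f: "continuous_on {a..b} f" "f a = 0" "f b = 0" and e1: "e = (\<lambda>x. 1)"
  shows "(LINT x|lebesgue_on {a<..<b}. e' x *\<^sub>R f x) = - (LINT x|lebesgue_on {a<..<b}. e x *\<^sub>R g x)"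
proof (rule weak_deriv_of_lim, rule tendstoI)
  fix \<epsilon> :: real assume "\<epsilon> > 0"
  obtain C where C: "0 \<le> C" "\<And>n x. \<bar>cutoff' a b n x\<bar> \<le> real (Suc n) * C"
    using cutoff'_bound by metis
  \<comment> \<open>With this \<open>\<eta>\<close> the final bound 4 C \<open>\<eta>\<close> is
    below \<open>\<epsilon>\<close>; C + 1 in the denominator covers C = 0.\<close>
  define \<eta> where "\<eta> = \<epsilon> / (8 * (C + 1))"
  have \<eta>: "\<eta> > 0" using \<open>\<epsilon> > 0\<close> C(1) by (simp add: \<eta>_def)
  obtain d where d: "d > 0" "\<And>x. x \<in> {a..b} \<Longrightarrow> x < a + d \<or> b - d < x \<Longrightarrow> norm (f x) < \<eta>"
  proof -
    obtain d1 where d1: "d1 > 0" "\<And>x. x \<in> {a..b} \<Longrightarrow> dist x a < d1 \<Longrightarrow> dist (f x) (f a) < \<eta>"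
      using f(1) \<eta> ab unfolding continuous_on_iff by (metis atLeastAtMost_iff less_imp_le order_refl)
    obtain d2 where d2: "d2 > 0" "\<And>x. x \<in> {a..b} \<Longrightarrow> dist x b < d2 \<Longrightarrow> dist (f x) (f b) < \<eta>"
      using f(1) \<eta> ab unfolding continuous_on_iff by (metis atLeastAtMost_iff less_imp_le order_refl)
    show ?thesis
      by (rule that[of "min d1 d2"]) (use d1 d2 f in \<open>force simp: dist_real_def\<close>)+
  qed
  have "(\<lambda>n. 2 * inverse (real (Suc n))) \<longlonglongrightarrow> 2 * 0"
    by (intro tendsto_mult tendsto_const LIMSEQ_inverse_real_of_nat)
  then have "\<forall>\<^sub>F n in sequentially. 2 * inverse (real (Suc n)) < d"
    using d(1) by (intro order_tendstoD(2)) auto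
  then show "\<forall>\<^sub>F n in sequentially. dist (LINT x|lebesgue_on {a<..<b}. (cutoff' a b n x * e x) *\<^sub>R f x) 0 < \<epsilon>"
  proof eventually_elim
    case (elim n)
    then have n: "2 / real (Suc n) < d" by (simp add: divide_inverse)
    let ?S = "{a<..<a + 2 / real (Suc n)} \<union> {b - 2 / real (Suc n)<..<b}"
    have pt: "norm ((cutoff' a b n x * e x) *\<^sub>R f x) \<le> real (Suc n) * C * \<eta> * indicator ?S x" if x: "x \<in> {a<..<b}" for x
    proof (cases "cutoff' a b n x = 0")
      case False
      then have "x < a + 2 / real (Suc n) \<or> b - 2 / real (Suc n) < x" using cutoff'_eq_0(1)[of a n x b] by force
      then have "x \<in> ?S" "norm (f x) < \<eta>" using x d(2)[of x] n by auto
      then show ?thesis using C(2)[of n x] C(1)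
        by (auto simp: e1 intro!: mult_mono)
    qed (use C \<eta> in auto)
    have m: "integrable (lebesgue_on {a<..<b}) (\<lambda>x. real (Suc n) * C * \<eta> * indicator ?S x)"
    proof -
      have "(indicator ?S :: real \<Rightarrow> real) \<in> borel_measurable (lebesgue_on {a<..<b})"
        by (intro measurable_restrict_space1 borel_measurable_indicator) auto
      then have "integrable (lebesgue_on {a<..<b}) (indicator ?S :: real \<Rightarrow> real)"
        by (intro finite_measure.integrable_const_bound[OF finite_measure_lebesgue_on, where B = 1])
          (auto simp: indicator_def)
      then show ?thesis by (rule integrable_mult_right)
    qed
    have "norm (LINT x|lebesgue_on {a<..<b}. (cutoff' a b n x * e x) *\<^sub>R f x)
        \<le> (LINT x|lebesgue_on {a<..<b}. real (Suc n) * C * \<eta> * indicator ?S x)"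
      using m by (rule Bochner_Integration.integral_norm_bound_integral[rotated])
        (use pt in \<open>auto intro!: L2_fun_integrable L2_fun_continuous_scaleR fg
           continuous_intros continuous_on_cutoff' e_cont simp del: of_nat_Suc\<close>)
    also have "\<dots> = real (Suc n) * C * \<eta> * measure lebesgue (?S \<inter> {a<..<b})"
    proof -
      have "(LINT x|lebesgue_on {a<..<b}. indicator ?S x :: real) = measure lebesgue (?S \<inter> {a<..<b})"
        by (subst integral_restrict_space) (auto simp: indicator_inter_arith[symmetric] Int_commute)
      then show ?thesis by simp
    qed
    also have "\<dots> \<le> real (Suc n) * C * \<eta> * (4 / real (Suc n))"
    proof (intro mult_left_mono)
      have "measure lebesgue (?S \<inter> {a<..<b}) \<le> measure lebesgue ?S"
        by (intro measure_mono_fmeasurable) auto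
      also have "\<dots> \<le> measure lebesgue {a<..<a + 2 / real (Suc n)} + measure lebesgue {b - 2 / real (Suc n)<..<b}"
        by (rule measure_Un_le) auto
      also have "\<dots> = 4 / real (Suc n)" by simp
      finally show "measure lebesgue (?S \<inter> {a<..<b}) \<le> 4 / real (Suc n)" .
    qed (use C \<eta> in auto)
    also have "\<dots> = 4 * C * \<eta>" by (simp add: field_simps del: of_nat_Suc)
    also have "\<dots> < \<epsilon>"
    proof -
      have "4 * C * \<epsilon> < \<epsilon> * (8 * (C + 1))" using \<open>\<epsilon> > 0\<close> C(1) by (simp add: algebra_simps) (smt (verit) mult_nonneg_nonneg)
      then show ?thesis using C(1) by (simp add: \<eta>_def field_simps)
    qed
    finally show ?case by simp
  qed
qed

end

section \<open>Fourier coefficients of weak derivatives\<close>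

lemma phi_fun_derivative: "(phi_fun k has_vector_derivative (2 * pi * \<i> * of_int k) * phi_fun k x) (at x)"
  unfolding phi_fun_def by (rule has_vector_derivative_real_field) (auto intro!: derivative_eq_intros)

lemma C1_testD:
  assumes "\<phi> \<in> C1_test a b"
  shows "(\<phi> has_real_derivative deriv \<phi> x) (at x)" "continuous_on UNIV (deriv \<phi>)"
    "continuous_on UNIV \<phi>" "\<phi> a = 0" "\<phi> b = 0"
proof -
  show d: "(\<phi> has_real_derivative deriv \<phi> x) (at x)" for x
    using assms by (simp add: C1_test_def DERIV_deriv_iff_real_differentiable)
  show "continuous_on UNIV \<phi>"
    using d by (meson DERIV_isCont continuous_at_imp_continuous_on)
qed (use assms in \<open>auto simp: C1_test_def\<close>)

lemma of_real_continuous_L2: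
  fixes h :: "real \<Rightarrow> real"
  assumes "continuous_on UNIV h"
  shows "(\<lambda>x. complex_of_real (h x)) \<in> L2_fun 0 1"
proof -
  obtain C where "\<And>x. x \<in> {0..1} \<Longrightarrow> norm (h x) \<le> C" using continuous_bounded_on[OF assms] by metis
  then show ?thesis
    by (intro L2_fun_bounded[where C = C] continuous_measurable_on continuous_intros assms)
      (auto intro!: AE_I2)
qed

text \<open>For a fixed test function both sides are bounded and linear in \<open>\<eta>\<close>, so
  the identity reduces to classical integration by parts for a single mode, whose boundary terms
  vanish with \<open>\<phi>\<close>.\<close>

lemma weak_deriv_ev: "weak_deriv 0 1 (ev \<eta>) (fun_of (Dop \<eta>))"
  unfolding weak_deriv_def
proof (intro conjI ballI ev_L2 fun_of_L2)
  fix \<phi> assume \<phi>: "\<phi> \<in> C1_test 0 1"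
  note D = C1_testD[OF \<phi>]
  let ?p = "l2_of (\<lambda>x. of_real (\<phi> x))" and ?p' = "l2_of (\<lambda>x. of_real (deriv \<phi> x))"
  have pL: "(\<lambda>x. complex_of_real (\<phi> x)) \<in> L2_fun 0 1" "(\<lambda>x. complex_of_real (deriv \<phi> x)) \<in> L2_fun 0 1"
    by (intro of_real_continuous_L2 D)+
  have phi: "cinner (phi k) ?p' = - (2 * pi * \<i> * of_int k * cinner (phi k) ?p)" for k
  proof -
    have 1: "cinner (phi k) ?p' = (LINT x|M01. phi_fun k x * of_real (deriv \<phi> x))"
      and 2: "cinner (phi k) ?p = (LINT x|M01. phi_fun k x * of_real (\<phi> x))"
      unfolding phi_def by (simp_all add: cinner_l2_of pL phi_fun_L2)
    have int: "integrable M01 (\<lambda>x. phi_fun k x * of_real (deriv \<phi> x))"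
      "integrable M01 (\<lambda>x. phi_fun k x * of_real (\<phi> x))"
      using L2_fun_prod_integrable[OF phi_fun_L2 pL(1)] L2_fun_prod_integrable[OF phi_fun_L2 pL(2)] by simp_all
    have "(LINT x|M01. phi_fun k x * of_real (deriv \<phi> x) + ((2 * pi * \<i> * of_int k) * phi_fun k x) * of_real (\<phi> x))
       = phi_fun k 1 * of_real (\<phi> 1) - phi_fun k 0 * of_real (\<phi> 0)"
    proof (rule ftc_open)
      have "((\<lambda>x. complex_of_real (\<phi> x)) has_vector_derivative of_real (deriv \<phi> x)) (at x)" for x
        using D(1) by (intro has_vector_derivative_of_real) (simp add: has_real_derivative_iff_has_vector_derivative)
      then show "((\<lambda>x. phi_fun k x * of_real (\<phi> x)) has_vector_derivative
          phi_fun k x * of_real (deriv \<phi> x) + ((2 * pi * \<i> * of_int k) * phi_fun k x) * of_real (\<phi> x)) (at x)" for x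
        by (intro has_vector_derivative_mult phi_fun_derivative)
      show "continuous_on UNIV (\<lambda>x. phi_fun k x * of_real (deriv \<phi> x)
          + ((2 * pi * \<i> * of_int k) * phi_fun k x) * of_real (\<phi> x))"
        by (intro continuous_intros continuous_phi_fun D)
    qed simp
    moreover have "(LINT x|M01. phi_fun k x * of_real (deriv \<phi> x) + ((2 * pi * \<i> * of_int k) * phi_fun k x) * of_real (\<phi> x))
       = cinner (phi k) ?p' + (2 * pi * \<i> * of_int k) * cinner (phi k) ?p"
      using int by (simp add: 1 2 mult.assoc)
    ultimately show ?thesis using D by (simp add: eq_neg_iff_add_eq_0)
  qed
  have "cinner (Lam \<eta>) ?p' = - cinner (Dop \<eta>) ?p"
  proof (rule bounded_linear_eqI[where f = "\<lambda>\<eta>. cinner (Lam \<eta>) ?p'" and g = "\<lambda>\<eta>. - cinner (Dop \<eta>) ?p"])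
    show "bounded_linear (\<lambda>\<eta>. cinner (Lam \<eta>) ?p')"
      by (rule bounded_linear_compose[OF bounded_linear_cinner_left bounded_linear_Lam])
    show "bounded_linear (\<lambda>\<eta>. - cinner (Dop \<eta>) ?p)"
      by (intro bounded_linear_minus bounded_linear_compose[OF bounded_linear_cinner_left bounded_linear_Dop])
  qed (simp add: Lam_cscale Dop_cscale Lam_phi Dop_phi cinner_cscale_left phi)
  moreover have "(LINT x|M01. deriv \<phi> x *\<^sub>R ev \<eta> x) = cinner (Lam \<eta>) ?p'"
    by (simp add: l2_of_ev[symmetric] cinner_l2_of ev_L2 pL scaleR_conv_of_real mult.commute)
  moreover have "(LINT x|M01. \<phi> x *\<^sub>R fun_of (Dop \<eta>) x) = cinner (Dop \<eta>) ?p"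
    using cinner_l2_of[OF fun_of_L2[of "Dop \<eta>"] pL(1)] by (simp add: scaleR_conv_of_real mult.commute)
  ultimately show "(LINT x|M01. deriv \<phi> x *\<^sub>R ev \<eta> x) = - (LINT x|M01. \<phi> x *\<^sub>R fun_of (Dop \<eta>) x)"
    by simp
qed

lemma L2_fun_const: "(\<lambda>x. c) \<in> L2_fun a b"
  using finite_measure.integrable_const[OF finite_measure_lebesgue_on] by (simp add: L2_fun_def)

lemma weak_deriv_diff_const:
  assumes w: "weak_deriv a b f g" and ab: "a < b"
  shows "weak_deriv a b (\<lambda>x. f x - c) g"
  unfolding weak_deriv_def
proof (intro conjI ballI)
  show "(\<lambda>x. f x - c) \<in> L2_fun a b"
  proof -
    have "f \<in> L2_fun a b" using w by (simp add: weak_deriv_def)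
    from L2_fun_add[OF this L2_fun_const[of "- c"]] show ?thesis by simp
  qed
  show "g \<in> L2_fun a b" using w by (simp add: weak_deriv_def)
  fix \<phi> assume \<phi>: "\<phi> \<in> C1_test a b"
  note D = C1_testD[OF \<phi>]
  have 0: "(LINT x|lebesgue_on {a<..<b}. deriv \<phi> x *\<^sub>R c) = 0"
  proof -
    have "((\<lambda>x. \<phi> x *\<^sub>R c) has_vector_derivative deriv \<phi> x *\<^sub>R c) (at x)" for x
      using has_vector_derivative_scaleR[OF D(1)[of x] has_vector_derivative_const, of c] by simp
    from ftc_open[OF _ this continuous_on_scaleR[OF D(2) continuous_on_const]] show ?thesis
      using ab D by simp
  qed
  have "(LINT x|lebesgue_on {a<..<b}. deriv \<phi> x *\<^sub>R (f x - c))
      = (LINT x|lebesgue_on {a<..<b}. deriv \<phi> x *\<^sub>R f x) - (LINT x|lebesgue_on {a<..<b}. deriv \<phi> x *\<^sub>R c)"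
    unfolding scaleR_diff_right using w
    by (intro Bochner_Integration.integral_diff L2_fun_integrable L2_fun_continuous_scaleR D L2_fun_const)
      (simp add: weak_deriv_def)
  then show "(LINT x|lebesgue_on {a<..<b}. deriv \<phi> x *\<^sub>R (f x - c)) = - (LINT x|lebesgue_on {a<..<b}. \<phi> x *\<^sub>R g x)"
    using w \<phi> by (simp add: 0 weak_deriv_def)
qed

text \<open>The functions put in for \<open>e\<close> are real and have to vanish at both ends. The
  sine does; the cosine does after subtracting 1, and the integral of \<open>g\<close> that this
  costs is zero because \<open>f\<close> takes the same value at 0 and 1.\<close>

lemma periodic_weak_deriv_coef:
  assumes w: "weak_deriv 0 1 f g" and f: "continuous_on {0..1} f" "f 0 = f 1"
  shows "2 * pi * \<i> * of_int k * cinner (l2_of f) (phi k) = cinner (l2_of g) (phi k)"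
proof -
  have fg: "f \<in> L2_fun 0 1" "g \<in> L2_fun 0 1" using w by (auto simp: weak_deriv_def)
  have g0: "(LINT x|M01. g x) = 0"
  proof -
    \<comment> \<open>\<open>f\<close> minus \<open>f 0\<close> vanishes at both ends, so the
      constant 1 may be tested against it.\<close>
    have "(LINT x|M01. 0 *\<^sub>R (f x - f 0)) = - (LINT x|M01. 1 *\<^sub>R g x)"
      by (rule weak_deriv_const_zero[OF weak_deriv_diff_const[OF w, of "f 0"], where e = "\<lambda>x. 1" and e' = "\<lambda>x. 0"])
        (use f in \<open>auto intro!: continuous_intros\<close>)
    then show ?thesis by simp
  qed
  let ?w = "2 * pi * real_of_int k"
  define c where "c h = (LINT x|M01. cos (?w * x) *\<^sub>R h x)" for h :: "real \<Rightarrow> complex"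
  define s where "s h = (LINT x|M01. sin (?w * x) *\<^sub>R h x)" for h :: "real \<Rightarrow> complex"
  have int: "integrable M01 (\<lambda>x. cos (?w * x) *\<^sub>R h x)" "integrable M01 (\<lambda>x. sin (?w * x) *\<^sub>R h x)"
    if "h \<in> L2_fun 0 1" for h :: "real \<Rightarrow> complex"
    by (intro L2_fun_integrable L2_fun_continuous_scaleR continuous_intros that)+
  have w1: "cos ?w = 1" "sin ?w = 0"
    using sin_int_2pin[of k] cos_int_2pin[of k] by (simp_all add: mult_ac)
  have coef: "cinner (l2_of h) (phi k) = c h - \<i> * s h" if h: "h \<in> L2_fun 0 1" for h
  proof -
    have "h x * cnj (phi_fun k x) = cos (?w * x) *\<^sub>R h x - \<i> * (sin (?w * x) *\<^sub>R h x)" for x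
    proof -
      have "cnj (phi_fun k x) = cis (- (?w * x))" unfolding cnj_phi_fun by (simp add: phi_fun_def cis_conv_exp mult_ac)
      then show ?thesis by (simp add: scaleR_conv_of_real complex_eq_iff algebra_simps)
    qed
    then show ?thesis unfolding phi_def cinner_l2_of[OF h phi_fun_L2] c_def s_def
      using int[OF h] by (simp only: Bochner_Integration.integral_diff integrable_mult_right integral_mult_right_zero)
  qed
  have pull: "(LINT x|M01. (r * h x) *\<^sub>R f x) = of_real r * (LINT x|M01. h x *\<^sub>R f x)" for r h
    unfolding scaleR_scaleR[symmetric] integral_scaleR_right by (rule scaleR_conv_of_real)
  have "(LINT x|M01. (- ?w * sin (?w * x)) *\<^sub>R f x) = - (LINT x|M01. (cos (?w * x) - 1) *\<^sub>R g x)"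
    by (rule weak_deriv_C1_zero[OF w]) (auto intro!: derivative_eq_intros continuous_intros simp: w1)
  moreover have "(LINT x|M01. (- ?w * sin (?w * x)) *\<^sub>R f x) = - of_real ?w * s f"
    using pull[of "- ?w"] by (simp add: s_def)
  moreover have "(LINT x|M01. (cos (?w * x) - 1) *\<^sub>R g x) = c g"
    using int(1)[OF fg(2)] L2_fun_integrable[OF fg(2)] by (simp add: scaleR_diff_left g0 c_def)
  ultimately have 1: "of_real ?w * s f = c g" by simp
  have "(LINT x|M01. (?w * cos (?w * x)) *\<^sub>R f x) = - (LINT x|M01. sin (?w * x) *\<^sub>R g x)"
    by (rule weak_deriv_C1_zero[OF w]) (auto intro!: derivative_eq_intros continuous_intros simp: w1)
  moreover have "(LINT x|M01. (?w * cos (?w * x)) *\<^sub>R f x) = of_real ?w * c f"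
    using pull[of ?w] by (simp add: c_def)
  ultimately have 2: "of_real ?w * c f = - s g" by (simp add: s_def)
  have "2 * pi * \<i> * of_int k * cinner (l2_of f) (phi k) = \<i> * (of_real ?w * c f) + of_real ?w * s f"
    by (simp add: coef fg algebra_simps)
  also have "\<dots> = cinner (l2_of g) (phi k)" unfolding 1 2 by (simp add: coef fg)
  finally show ?thesis .
qed

text \<open>Periodicity turns the weak derivative into multiplication of the coefficients by 2 pi
  \<i> k, so \<open>jb k\<close> times the coefficients is square summable and \<open>Lam\<close>
  can be undone. Conversely \<open>ev \<eta>\<close> is a continuous periodic representative of
  \<open>Lam \<eta>\<close> with weak derivative \<open>Dop \<eta>\<close>.\<close>

lemma H1p_eq: "H1p = range Lam"
proof (intro equalityI subsetI)
  fix \<psi> assume "\<psi> \<in> H1p"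
  then obtain f where "f \<in> H1_fun 0 1" and f: "continuous_on {0..1} f" "f 0 = f 1"
    and \<psi>: "\<psi> = l2_of f"
    unfolding H1p_def by blast
  then obtain g where w: "weak_deriv 0 1 f g"
    unfolding H1_fun_iff by blast
  define c where "c k = of_real (jb k) * cinner \<psi> (phi k)" for k
  have "norm (c k) \<le> norm (cinner \<psi> (phi k)) + norm (cinner (l2_of g) (phi k))" for k
  proof (cases "k = 0")
    case False
    then have "jb k = \<bar>real_of_int k\<bar>" by (simp add: jb_def)
    moreover have "norm (2 * pi * \<i> * of_int k * cinner \<psi> (phi k)) = norm (cinner (l2_of g) (phi k))"
      using periodic_weak_deriv_coef[OF w f, of k] \<psi> by simp
    moreover have "norm (2 * pi * \<i> * of_int k * cinner \<psi> (phi k)) = (2 * pi) * (\<bar>real_of_int k\<bar> * norm (cinner \<psi> (phi k)))"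
      by (simp add: norm_mult)
    moreover have "1 * (\<bar>real_of_int k\<bar> * norm (cinner \<psi> (phi k))) \<le> (2 * pi) * (\<bar>real_of_int k\<bar> * norm (cinner \<psi> (phi k)))"
      using pi_ge_two by (intro mult_right_mono) auto
    ultimately have "jb k * norm (cinner \<psi> (phi k)) \<le> norm (cinner (l2_of g) (phi k))"
      by simp
    then show ?thesis using norm_ge_zero[of "cinner \<psi> (phi k)"]
      unfolding c_def norm_mult norm_of_real abs_of_pos[OF jb_pos] by linarith
  qed (simp add: c_def jb_def)
  then have sq: "(norm (c k))\<^sup>2 \<le> 2 * (norm (cinner \<psi> (phi k)))\<^sup>2 + 2 * (norm (cinner (l2_of g) (phi k)))\<^sup>2" for k
  proof -
    let ?a = "norm (cinner \<psi> (phi k))" and ?b = "norm (cinner (l2_of g) (phi k))"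
    have "(norm (c k))\<^sup>2 \<le> (?a + ?b)\<^sup>2" by (rule power_mono) (fact, simp)
    also have "\<dots> \<le> 2 * ?a\<^sup>2 + 2 * ?b\<^sup>2" using sum_squares_bound[of ?a ?b] by (simp add: power2_sum)
    finally show ?thesis .
  qed
  have "(\<Sum>k\<in>F. (norm (c k))\<^sup>2) \<le> 2 * (norm \<psi>)\<^sup>2 + 2 * (norm (l2_of g))\<^sup>2" if "finite F" for F
  proof -
    have "(\<Sum>k\<in>F. (norm (c k))\<^sup>2)
        \<le> (\<Sum>k\<in>F. 2 * (norm (cinner \<psi> (phi k)))\<^sup>2 + 2 * (norm (cinner (l2_of g) (phi k)))\<^sup>2)"
      by (rule sum_mono) (rule sq)
    then show ?thesis
      using bessel[OF that, of \<psi>] bessel[OF that, of "l2_of g"]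
      by (simp add: sum.distrib sum_distrib_left[symmetric])
  qed
  then have "cinner (of_coef c) (phi k) = c k" for k by (rule coef_of_coef)
  then have "\<psi> = Lam (of_coef c)" by (intro l2_coef_eqI) (simp add: coef_Lam c_def)
  then show "\<psi> \<in> range Lam" by blast
next
  fix \<psi> assume "\<psi> \<in> range Lam"
  then obtain \<eta> where "\<psi> = Lam \<eta>" by blast
  then show "\<psi> \<in> H1p"
    unfolding H1p_def H1_fun_iff
    by (intro CollectI bexI[of _ "ev \<eta>"])
      (auto simp: ev_0_1 l2_of_ev H1_fun_iff intro: continuous_on_ev weak_deriv_ev)
qed

lemma H1p_norm_Lam: "H1p_norm (Lam \<eta>) = norm \<eta>"
proof -
  let ?a = "\<lambda>k. (norm (cinner \<eta> (phi k)))\<^sup>2"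
  have "(?a has_sum (norm \<eta>)\<^sup>2 - ?a 0) (UNIV - {0})"
    by (rule has_sum_Diff[OF parseval]) (auto simp: has_sum_finiteI)
  then have "(\<Sum>\<^sub>\<infinity>k\<in>- {0}. ?a k) = (norm \<eta>)\<^sup>2 - ?a 0"
    by (simp add: Compl_eq_Diff_UNIV infsumI)
  moreover have "(\<Sum>\<^sub>\<infinity>k\<in>- {0}. (norm (of_int k * cinner (phi k) (Lam \<eta>)))\<^sup>2) = (\<Sum>\<^sub>\<infinity>k\<in>- {0}. ?a k)"
  proof (rule infsum_cong)
    fix k :: int assume "k \<in> - {0}"
    then have "jb k = \<bar>real_of_int k\<bar>" "k \<noteq> 0" by (auto simp: jb_def)
    then show "(norm (of_int k * cinner (phi k) (Lam \<eta>)))\<^sup>2 = ?a k"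
      by (subst cinner_commute) (simp add: coef_Lam norm_mult norm_divide)
  qed
  moreover have "norm (cinner (phi 0) (Lam \<eta>)) = norm (cinner \<eta> (phi 0))"
    by (subst cinner_commute) (simp add: coef_Lam jb_def)
  ultimately show ?thesis by (simp add: H1p_norm_def)
qed

text \<open>Subtracting from \<open>e\<close> the affine function with the same end values leaves a
  function vanishing at a and b, for which there is no boundary term. So the left side depends on
  \<open>e\<close> only through \<open>e a\<close> and \<open>e b\<close>; \<open>\<alpha>\<close>
  and \<open>\<beta>\<close> play the part of the one-sided boundary values of
  \<open>f\<close>.\<close>

lemma weak_deriv_traces:
  fixes f g :: "real \<Rightarrow> real"
  assumes w: "weak_deriv a b f g" and ab: "a < b"
  obtains \<alpha> \<beta> where "\<forall>e e'. (\<forall>x. (e has_real_derivative e' x) (at x)) \<longrightarrow> continuous_on UNIV e' \<longrightarrow>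
     (LINT x|lebesgue_on {a<..<b}. e' x * f x + e x * g x) = \<beta> * e b - \<alpha> * e a"
proof -
  have fg: "f \<in> L2_fun a b" "g \<in> L2_fun a b" using w by (auto simp: weak_deriv_def)
  define L where "L e e' = (LINT x|lebesgue_on {a<..<b}. e' x * f x + e x * g x)" for e e' :: "real \<Rightarrow> real"
  have int: "integrable (lebesgue_on {a<..<b}) (\<lambda>x. h x * F x)"
    if "continuous_on UNIV h" "F \<in> L2_fun a b" for h F :: "real \<Rightarrow> real"
    using L2_fun_integrable[OF L2_fun_continuous_scaleR[OF that]] by simp
  let ?l = "\<lambda>x. (b - x) / (b - a)" and ?l' = "- 1 / (b - a)"
  let ?r = "\<lambda>x. (x - a) / (b - a)" and ?r' = "1 / (b - a)"
  have "L e e' = L ?r (\<lambda>x. ?r') * e b - (- L ?l (\<lambda>x. ?l')) * e a"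
    if e: "\<And>x. (e has_real_derivative e' x) (at x)" and e': "continuous_on UNIV e'" for e e'
  proof -
    have ec: "continuous_on UNIV e" using e by (meson DERIV_isCont continuous_at_imp_continuous_on)
    let ?z = "\<lambda>x. e x - e a * ?l x - e b * ?r x" and ?z' = "\<lambda>x. e' x - e a * ?l' - e b * ?r'"
    have c: "continuous_on UNIV ?z'" "continuous_on UNIV ?z" using ab
      by (auto intro!: continuous_intros e' ec)
    have "(LINT x|lebesgue_on {a<..<b}. ?z' x *\<^sub>R f x) = - (LINT x|lebesgue_on {a<..<b}. ?z x *\<^sub>R g x)"
    proof (rule weak_deriv_C1_zero[OF w ab _ c(1)])
      have "(?l has_real_derivative ?l') (at x)" "(?r has_real_derivative ?r') (at x)" for x
        by (rule DERIV_cdivide; auto intro!: derivative_eq_intros)+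
      then show "(?z has_real_derivative ?z' x) (at x)" for x
        by (intro DERIV_diff DERIV_cmult e)
    qed (use ab in auto)
    then have "L ?z ?z' = 0"
      unfolding L_def Bochner_Integration.integral_add[OF int[OF c(1) fg(1)] int[OF c(2) fg(2)]]
        real_scaleR_def by simp
    moreover have "L ?z ?z' = L e e' - e a * L ?l (\<lambda>x. ?l') - e b * L ?r (\<lambda>x. ?r')"
    proof -
      have I: "integrable (lebesgue_on {a<..<b}) (\<lambda>x. e' x * f x + e x * g x)"
        "integrable (lebesgue_on {a<..<b}) (\<lambda>x. ?l' * f x + ?l x * g x)"
        "integrable (lebesgue_on {a<..<b}) (\<lambda>x. ?r' * f x + ?r x * g x)"
        using ab by (intro Bochner_Integration.integrable_add int fg continuous_intros e' ec; simp)+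
      have eq: "?z' x * f x + ?z x * g x = (e' x * f x + e x * g x)
          - e a * (?l' * f x + ?l x * g x) - e b * (?r' * f x + ?r x * g x)" for x
        by (simp add: algebra_simps)
      have lin: "(LINT x|M. A x - p * B x - q * C x) = integral\<^sup>L M A - p * integral\<^sup>L M B - q * integral\<^sup>L M C"
        if "integrable M A" "integrable M B" "integrable M C" for A B C :: "real \<Rightarrow> real" and p q M
        using that by simp
      show ?thesis unfolding L_def eq by (rule lin[OF I])
    qed
    ultimately show ?thesis by (simp add: algebra_simps)
  qed
  note main = this
  show ?thesis
    by (rule that[of "L ?r (\<lambda>x. ?r')" "- L ?l (\<lambda>x. ?l')"], intro allI impI, fold L_def, rule main) auto
qed

lemma weak_deriv_traces_complex:
  fixes f g :: "real \<Rightarrow> real"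
  assumes w: "weak_deriv a b f g" and ab: "a < b"
  obtains \<alpha> \<beta> :: real where "\<forall>e e' :: real \<Rightarrow> complex. (\<forall>x. (e has_vector_derivative e' x) (at x)) \<longrightarrow> continuous_on UNIV e' \<longrightarrow>
     (LINT x|lebesgue_on {a<..<b}. e' x * complex_of_real (f x) + e x * complex_of_real (g x))
        = complex_of_real \<beta> * e b - complex_of_real \<alpha> * e a"
proof -
  have fg: "f \<in> L2_fun a b" "g \<in> L2_fun a b" using w by (auto simp: weak_deriv_def)
  obtain \<alpha> \<beta> where T: "\<forall>e e'. (\<forall>x. (e has_real_derivative e' x) (at x)) \<longrightarrow> continuous_on UNIV e' \<longrightarrow>
     (LINT x|lebesgue_on {a<..<b}. e' x * f x + e x * g x) = \<beta> * e b - \<alpha> * e a"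
    by (rule weak_deriv_traces[OF w ab])
  have int: "integrable (lebesgue_on {a<..<b}) (\<lambda>x. h x * F x)"
    if "continuous_on UNIV h" "F \<in> L2_fun a b" for h F :: "real \<Rightarrow> real"
    using L2_fun_integrable[OF L2_fun_continuous_scaleR[OF that]] by simp
  have "(LINT x|lebesgue_on {a<..<b}. e' x * complex_of_real (f x) + e x * complex_of_real (g x)) = complex_of_real \<beta> * e b - complex_of_real \<alpha> * e a"
    if e: "\<And>x. (e has_vector_derivative e' x) (at x)" and e': "continuous_on UNIV e'" for e e' :: "real \<Rightarrow> complex"
  proof -
    have re: "((\<lambda>x. Re (e x)) has_real_derivative Re (e' x)) (at x)" for x
      using bounded_linear.has_vector_derivative[OF bounded_linear_Re e]
      by (simp add: has_real_derivative_iff_has_vector_derivative)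
    have im: "((\<lambda>x. Im (e x)) has_real_derivative Im (e' x)) (at x)" for x
      using bounded_linear.has_vector_derivative[OF bounded_linear_Im e]
      by (simp add: has_real_derivative_iff_has_vector_derivative)
    have c: "continuous_on UNIV (\<lambda>x. Re (e' x))" "continuous_on UNIV (\<lambda>x. Im (e' x))"
      "continuous_on UNIV (\<lambda>x. Re (e x))" "continuous_on UNIV (\<lambda>x. Im (e x))"
      using re im by (intro continuous_intros e', intro continuous_intros e',
        (meson DERIV_isCont continuous_at_imp_continuous_on)+)
    have I: "integrable (lebesgue_on {a<..<b}) (\<lambda>x. Re (e' x) * f x + Re (e x) * g x)"
      "integrable (lebesgue_on {a<..<b}) (\<lambda>x. Im (e' x) * f x + Im (e x) * g x)"
      by (intro Bochner_Integration.integrable_add int fg c)+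
    have eq: "e' x * complex_of_real (f x) + e x * complex_of_real (g x) = complex_of_real (Re (e' x) * f x + Re (e x) * g x)
      + \<i> * complex_of_real (Im (e' x) * f x + Im (e x) * g x)" for x
      by (simp add: complex_eq_iff)
    have "(LINT x|lebesgue_on {a<..<b}. e' x * complex_of_real (f x) + e x * complex_of_real (g x))
      = (LINT x|lebesgue_on {a<..<b}. complex_of_real (Re (e' x) * f x + Re (e x) * g x))
       + \<i> * (LINT x|lebesgue_on {a<..<b}. complex_of_real (Im (e' x) * f x + Im (e x) * g x))"
      unfolding eq using I
      by (subst Bochner_Integration.integral_add) (auto simp del: of_real_add of_real_mult)
    also have "\<dots> = complex_of_real \<beta> * e b - complex_of_real \<alpha> * e a"
      by (simp only: integral_complex_of_real T[rule_format, OF re c(1)] T[rule_format, OF im c(2)]) (simp add: complex_eq_iff)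
    finally show ?thesis .
  qed
  note main = this
  show ?thesis
  proof (rule that, intro allI impI)
    fix e e' :: "real \<Rightarrow> complex"
    assume "\<forall>x. (e has_vector_derivative e' x) (at x)" "continuous_on UNIV e'"
    then show "(LINT x|lebesgue_on {a<..<b}. e' x * complex_of_real (f x) + e x * complex_of_real (g x)) = complex_of_real \<beta> * e b - complex_of_real \<alpha> * e a"
      by (intro main) auto
  qed
qed

section \<open>Multiplication by a piecewise $H^1$ function\<close>

lemma trig_poly_continuous:
  assumes "trig_poly h"
  shows "continuous_on UNIV h"
  using assms by induction (auto intro!: continuous_intros continuous_phi_fun)

lemma trig_poly_antideriv:
  assumes "trig_poly h"
  shows "\<exists>H. \<forall>x. (H has_vector_derivative h x) (at x)"
  using assms
proof induction
  case (mono c k)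
  show ?case
  proof (cases "k = 0")
    case True
    have "((\<lambda>x. of_real x * c) has_vector_derivative c) (at x)" for x
      using has_vector_derivative_mult_left[OF has_vector_derivative_of_real[OF DERIV_ident[of "at x"]], of c]
      by simp
    then show ?thesis using True by (intro exI[of _ "\<lambda>x. of_real x * c"]) simp
  next
    case False
    let ?w = "2 * pi * \<i> * of_int k :: complex"
    have "((\<lambda>x. (c / ?w) * phi_fun k x) has_vector_derivative (c / ?w) * (?w * phi_fun k x)) (at x)" for x
      by (intro has_vector_derivative_mult_right phi_fun_derivative)
    then show ?thesis using False by (intro exI[of _ "\<lambda>x. (c / ?w) * phi_fun k x"]) simp
  qed
next
  case (add f g)
  then obtain F G where "\<forall>x. (F has_vector_derivative f x) (at x)" "\<forall>x. (G has_vector_derivative g x) (at x)"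
    by blast
  then show ?case by (intro exI[of _ "\<lambda>x. F x + G x"]) (auto intro: has_vector_derivative_add)
qed

lemma trig_poly_partial_sum: "trig_poly (\<lambda>x. \<Sum>k\<in>F. c k * phi_fun k x)"
proof (cases "finite F")
  case True
  then show ?thesis by induction (auto intro: trig_poly.intros trig_poly_const)
qed (auto intro: trig_poly_const)

lemma l2_of_partial_sum:
  assumes "finite F"
  shows "l2_of (\<lambda>x. \<Sum>k\<in>F. c k * phi_fun k x) = (\<Sum>k\<in>F. cscale (c k) (phi k))"
  using assms
proof induction
  case (insert j F)
  have "l2_of (\<lambda>x. \<Sum>k\<in>insert j F. c k * phi_fun k x) = l2_of (\<lambda>x. c j * phi_fun j x + (\<Sum>k\<in>F. c k * phi_fun k x))"
    using insert by simp
  also have "\<dots> = cscale (c j) (phi j) + l2_of (\<lambda>x. \<Sum>k\<in>F. c k * phi_fun k x)"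
    by (subst l2_of_add) (auto intro: L2_fun_cmult phi_fun_L2 trig_poly_L2 trig_poly_partial_sum
        simp: l2_of_cmult phi_fun_L2 phi_def)
  finally show ?case using insert by simp
qed (simp add: zero_l2_def)

lemma restrict_M01:
  fixes F :: "real \<Rightarrow> 'a::euclidean_space"
  assumes ab: "0 \<le> a" "b \<le> 1"
  shows integral_restrict_M01:
      "(LINT x|lebesgue_on {a<..<b}. F x) = (LINT x|M01. indicator {a<..<b} x *\<^sub>R F x)"
    and integrable_restrict_M01:
      "integrable (lebesgue_on {a<..<b}) F \<longleftrightarrow> integrable M01 (\<lambda>x. indicator {a<..<b} x *\<^sub>R F x)"
    and measurable_restrict_M01:
      "F \<in> borel_measurable (lebesgue_on {a<..<b}) \<longleftrightarrow> (\<lambda>x. indicator {a<..<b} x *\<^sub>R F x) \<in> borel_measurable M01"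
proof -
  have *: "indicator {0<..<1} x * indicator {a<..<b} x = (indicator {a<..<b} x :: real)" for x
    using ab by (auto simp: indicator_def)
  show "(LINT x|lebesgue_on {a<..<b}. F x) = (LINT x|M01. indicator {a<..<b} x *\<^sub>R F x)"
    by (subst (1 2) integral_restrict_space) (auto simp: *)
  show "integrable (lebesgue_on {a<..<b}) F \<longleftrightarrow> integrable M01 (\<lambda>x. indicator {a<..<b} x *\<^sub>R F x)"
    by (subst (1 2) integrable_restrict_space) (auto simp: *)
  show "F \<in> borel_measurable (lebesgue_on {a<..<b}) \<longleftrightarrow> (\<lambda>x. indicator {a<..<b} x *\<^sub>R F x) \<in> borel_measurable M01"
    by (subst (1 2) borel_measurable_restrict_space_iff) (auto simp: *)
qed

lemma L2_fun_extend:
  fixes F :: "real \<Rightarrow> 'a::euclidean_space"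
  assumes ab: "0 \<le> a" "b \<le> 1" and F: "F \<in> L2_fun a b"
  shows "(\<lambda>x. indicator {a<..<b} x *\<^sub>R F x) \<in> L2_fun 0 1"
proof -
  have "(\<lambda>x. (norm (indicator {a<..<b} x *\<^sub>R F x))\<^sup>2) = (\<lambda>x. indicator {a<..<b} x *\<^sub>R (norm (F x))\<^sup>2)"
    by (auto simp: fun_eq_iff indicator_def)
  then show ?thesis
    using L2_funD[OF F] measurable_restrict_M01[OF ab, of F]
      integrable_restrict_M01[OF ab, of "\<lambda>x. (norm (F x))\<^sup>2"]
    by (simp add: L2_fun_def)
qed

lemma L2_fun_of_real:
  assumes F: "F \<in> L2_fun a b"
  shows "(\<lambda>x. complex_of_real (F x)) \<in> L2_fun a b"
  using L2_funD(1)[OF F] by (intro L2_fun_bound[OF F, where C = 1] borel_measurable_of_real) auto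

text \<open>Pairing \<open>z\<close> with its own phase, a function of modulus at most 1, turns the
  L^1 norm into an inner product.\<close>

lemma integral_norm_fun_of_le: "(LINT x|M01. norm (fun_of z x)) \<le> norm z"
proof -
  let ?s = "\<lambda>x. sgn (fun_of z x)"
  have m: "?s \<in> borel_measurable M01" unfolding sgn_div_norm by measurable
  have s: "norm (?s x) \<le> 1" for x by (simp add: norm_sgn)
  have sL: "?s \<in> L2_fun 0 1" using m s by (intro L2_fun_bounded[where C = 1]) auto
  have sgn: "w * cnj (sgn w) = complex_of_real (norm w)" for w
  proof (cases "w = 0")
    case False
    have "w * cnj (sgn w) = (w * cnj w) / of_real (norm w)"
      by (simp only: sgn_eq complex_cnj_divide complex_cnj_complex_of_real times_divide_eq_right)
    also have "\<dots> = of_real (norm w)"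
      unfolding complex_norm_square[symmetric] using False by (simp add: power2_eq_square)
    finally show ?thesis .
  qed simp
  have "cinner z (l2_of ?s) = complex_of_real (LINT x|M01. norm (fun_of z x))"
    using cinner_l2_of[OF fun_of_L2[of z] sL] unfolding l2_of_fun_of sgn integral_complex_of_real .
  then have "(LINT x|M01. norm (fun_of z x)) = Re (cinner z (l2_of ?s))" by simp
  also have "\<dots> \<le> norm z * norm (l2_of ?s)"
    by (rule order_trans[OF complex_Re_le_cmod norm_cinner_le])
  also have "\<dots> \<le> norm z * 1" by (intro mult_left_mono norm_l2_of_le m s) auto
  finally show ?thesis by simp
qed

lemma integrable_norm_fun_of: "integrable M01 (\<lambda>x. norm (fun_of z x))"
  by (intro integrable_norm L2_fun_integrable fun_of_L2)

text \<open>The trace identity bounds $\int_a^b h f$ by a multiple of the $L^1$ norm of \<open>h\<close>, for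
  trigonometric polynomials and then for all square-integrable \<open>h\<close>; hence \<open>f\<close> is bounded.\<close>

lemma weak_deriv_bounded:
  fixes f g :: "real \<Rightarrow> real"
  assumes w: "weak_deriv a b f g" and ab: "0 \<le> a" "a < b" "b \<le> 1"
  obtains K where "AE x in M01. \<bar>indicator {a<..<b} x * f x\<bar> \<le> K"
proof -
  have fg: "f \<in> L2_fun a b" "g \<in> L2_fun a b" using w by (auto simp: weak_deriv_def)
  let ?I = "\<lambda>x. indicator {a<..<b} x :: real"
  have [measurable]: "?I \<in> borel_measurable M01"
    by (intro measurable_restrict_space1 borel_measurable_indicator) auto
  obtain \<alpha> \<beta> :: real where T: "\<forall>e e' :: real \<Rightarrow> complex. (\<forall>x. (e has_vector_derivative e' x) (at x)) \<longrightarrow> continuous_on UNIV e' \<longrightarrow>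
     (LINT x|lebesgue_on {a<..<b}. e' x * complex_of_real (f x) + e x * complex_of_real (g x))
        = complex_of_real \<beta> * e b - complex_of_real \<alpha> * e a"
    by (rule weak_deriv_traces_complex[OF w ab(2)])
  \<comment> \<open>The primitives used below vanish at a, which removes the \<open>\<alpha>\<close>
    term. A primitive is at most the L^1 norm of its derivative, and that leaves these two
    contributions.\<close>
  define K where "K = \<bar>\<beta>\<bar> + (LINT x|lebesgue_on {a<..<b}. \<bar>g x\<bar>)"
  define fa where "fa = l2_of (\<lambda>x. of_real (?I x * f x))"
  have f1: "(\<lambda>x. ?I x * f x) \<in> L2_fun 0 1" using L2_fun_extend[OF ab(1,3) fg(1)] by simp
  note [measurable] = L2_funD(1)[OF f1]
  have faL: "(\<lambda>x. complex_of_real (?I x * f x)) \<in> L2_fun 0 1"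
    by (rule L2_fun_of_real[OF f1])
  \<comment> \<open>The L^1 norm over (a, b). By \<open>N_le\<close> it is continuous for the L^2
    norm, which lets the bound pass from trigonometric polynomials to all of L^2.\<close>
  define N where "N z = (LINT x|M01. ?I x * norm (fun_of z x))" for z
  have NI: "integrable M01 (\<lambda>x. ?I x * norm (fun_of z x))" for z
    by (rule Bochner_Integration.integrable_bound[OF integrable_norm_fun_of[of z]])
      (measurable, auto simp: indicator_def)
  have N_le: "N x \<le> N y + norm (x - y)" for x y
  proof -
    have "N x \<le> (LINT t|M01. ?I t * norm (fun_of y t) + norm (fun_of (x - y) t))"
      unfolding N_def
    proof (rule integral_mono_AE[OF NI Bochner_Integration.integrable_add[OF NI integrable_norm_fun_of]])
      show "AE t in M01. ?I t * norm (fun_of x t) \<le> ?I t * norm (fun_of y t) + norm (fun_of (x - y) t)"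
        using fun_of_diff[of x y]
      proof eventually_elim
        case (elim t)
        then show ?case using norm_triangle_sub[of "fun_of x t" "fun_of y t"] by (simp add: indicator_def)
      qed
    qed
    also have "\<dots> = N y + (LINT t|M01. norm (fun_of (x - y) t))"
      using NI[of y] integrable_norm_fun_of by (simp add: N_def)
    finally show ?thesis using integral_norm_fun_of_le[of "x - y"] by simp
  qed
  have poly: "norm (cinner (l2_of h) fa) \<le> K * N (l2_of h)" if h: "trig_poly h" for h
  proof -
    note hL = trig_poly_L2[OF h] and hc = trig_poly_continuous[OF h]
    note [measurable] = L2_funD(1)[OF hL]
    obtain H where H: "\<And>x. (H has_vector_derivative h x) (at x)" using trig_poly_antideriv[OF h] by blast
    let ?e = "\<lambda>x. H x - H a"
    have e: "(?e has_vector_derivative h x) (at x)" for x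
      by (rule has_vector_derivative_eq_rhs[OF has_vector_derivative_diff[OF H has_vector_derivative_const]]) simp
    have ec: "continuous_on UNIV ?e"
      using e by (meson continuous_at_imp_continuous_on has_vector_derivative_continuous)
    have N_eq: "N (l2_of h) = (LINT x|M01. ?I x * norm (h x))"
      unfolding N_def using fun_of_l2_of[OF hL] by (intro integral_cong_AE) (auto elim!: eventually_mono)
    have hI: "integrable M01 (\<lambda>x. ?I x * norm (h x))"
      by (rule Bochner_Integration.integrable_bound[OF integrable_norm[OF L2_fun_integrable[OF hL]]])
        (measurable, auto simp: indicator_def)
    have e_le: "norm (?e x) \<le> N (l2_of h)" if x: "x \<in> {a..b}" for x
    proof -
      have "?e x = (LINT t|lebesgue_on {a<..<x}. h t)"
        using x by (subst ftc_open[OF _ H hc]) auto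
      also have "\<dots> = (LINT t|M01. indicator {a<..<x} t *\<^sub>R h t)"
        using x ab by (intro integral_restrict_M01) auto
      also have "norm \<dots> \<le> (LINT t|M01. ?I t * norm (h t))"
      proof (rule Bochner_Integration.integral_norm_bound_integral[OF _ hI])
        have "integrable (lebesgue_on {a<..<x}) h"
          by (rule continuous_integrable_open[OF hc])
        then show "integrable M01 (\<lambda>t. indicator {a<..<x} t *\<^sub>R h t)"
          using x ab by (subst integrable_restrict_M01[symmetric]) auto
      qed (use x in \<open>auto simp: indicator_def\<close>)
      finally show ?thesis by (simp add: N_eq)
    qed
    have L2c: "(\<lambda>x. c x * complex_of_real (F x)) \<in> L2_fun a b"
      if c: "continuous_on UNIV c" and F: "F \<in> L2_fun a b" for c and F :: "real \<Rightarrow> real"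
    proof -
      obtain C where C: "\<And>x. x \<in> {a..b} \<Longrightarrow> norm (c x) \<le> C" using continuous_bounded_on[OF c] by metis
      note [measurable] = L2_funD(1)[OF F] continuous_measurable_on[OF c]
      show ?thesis
        by (rule L2_fun_bound[OF F, where C = C])
          (auto intro!: AE_I2 mult_right_mono C simp: norm_mult)
    qed
    note I = L2_fun_integrable[OF L2c[OF hc fg(1)]] L2_fun_integrable[OF L2c[OF ec fg(2)]]
    have "cinner (l2_of h) fa = (LINT x|M01. h x * cnj (complex_of_real (?I x * f x)))"
      unfolding fa_def by (rule cinner_l2_of[OF hL faL])
    also have "\<dots> = (LINT x|M01. ?I x *\<^sub>R (h x * complex_of_real (f x)))"
      by (simp add: scaleR_conv_of_real mult_ac)
    also have "\<dots> = (LINT x|lebesgue_on {a<..<b}. h x * complex_of_real (f x))"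
      by (rule integral_restrict_M01[symmetric]) (use ab in auto)
    also have "\<dots> = of_real \<beta> * ?e b - (LINT x|lebesgue_on {a<..<b}. ?e x * complex_of_real (g x))"
      using T[rule_format, of ?e h, OF e hc] I by (simp add: eq_diff_eq)
    also have "norm \<dots> \<le> \<bar>\<beta>\<bar> * N (l2_of h) + N (l2_of h) * (LINT x|lebesgue_on {a<..<b}. \<bar>g x\<bar>)"
    proof (rule order_trans[OF norm_triangle_ineq4 add_mono])
      show "norm (of_real \<beta> * ?e b) \<le> \<bar>\<beta>\<bar> * N (l2_of h)"
        unfolding norm_mult norm_of_real using ab by (intro mult_left_mono e_le) auto
      have "norm (LINT x|lebesgue_on {a<..<b}. ?e x * complex_of_real (g x))
          \<le> (LINT x|lebesgue_on {a<..<b}. N (l2_of h) * \<bar>g x\<bar>)"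
        using I(2) L2_fun_integrable[OF fg(2)]
        by (intro Bochner_Integration.integral_norm_bound_integral)
          (auto simp: norm_mult intro!: mult_right_mono e_le)
      then show "norm (LINT x|lebesgue_on {a<..<b}. ?e x * complex_of_real (g x))
          \<le> N (l2_of h) * (LINT x|lebesgue_on {a<..<b}. \<bar>g x\<bar>)" by simp
    qed
    finally show ?thesis by (simp add: K_def algebra_simps)
  qed
  have K0: "0 \<le> K" by (simp add: K_def)
  have all: "norm (cinner z fa) \<le> K * N z" for z
  proof -
    let ?X = "\<lambda>n. \<Sum>k\<in>{- int n..int n}. cscale (cinner z (phi k)) (phi k)"
    have X: "?X \<longlonglongrightarrow> z" by (rule fourier_partial_sums)
    have le: "norm (cinner (?X n) fa) \<le> K * (N z + norm (?X n - z))" for n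
    proof -
      have "norm (cinner (?X n) fa) \<le> K * N (?X n)"
        using poly[OF trig_poly_partial_sum[where F = "{- int n..int n}" and c = "\<lambda>k. cinner z (phi k)"]]
        by (simp add: l2_of_partial_sum)
      also have "\<dots> \<le> K * (N z + norm (?X n - z))"
        by (intro mult_left_mono N_le K0)
      finally show ?thesis .
    qed
    have "(\<lambda>n. K * (N z + norm (?X n - z))) \<longlonglongrightarrow> K * (N z + norm (z - z))"
      by (intro tendsto_intros X)
    have "(\<lambda>n. norm (cinner (?X n) fa)) \<longlonglongrightarrow> norm (cinner z fa)"
      by (intro tendsto_norm bounded_linear.tendsto[OF bounded_linear_cinner_left] X)
    from LIMSEQ_le[OF this \<open>_ \<longlonglongrightarrow> K * (N z + norm (z - z))\<close>]
    have "norm (cinner z fa) \<le> K * (N z + norm (z - z))" using le by blast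
    then show ?thesis by simp
  qed
  \<comment> \<open>Testing with the sign of \<open>f\<close> on \<open>S\<close> gives (K + 1) |S|
    <= K |S|, so \<open>S\<close> is a null set.\<close>
  define S where "S = {x \<in> space M01. \<bar>?I x * f x\<bar> > K + 1}"
  have [measurable]: "S \<in> sets M01" unfolding S_def by measurable
  let ?q1 = "\<lambda>x. complex_of_real (indicator S x * sgn (?I x * f x))"
  have qm: "?q1 \<in> borel_measurable M01" unfolding sgn_div_norm by measurable
  have qL: "?q1 \<in> L2_fun 0 1"
    by (rule L2_fun_bounded[OF qm, where C = 1]) (auto simp: indicator_def abs_sgn_eq)
  have SI: "integrable M01 (indicator S :: real \<Rightarrow> real)"
    by (intro finite_measure.integrable_const_bound[OF finite_measure_M01, where B = 1]) auto
  have fI: "integrable M01 (\<lambda>x. indicator S x * \<bar>?I x * f x\<bar>)"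
    by (rule Bochner_Integration.integrable_bound[OF integrable_norm[OF L2_fun_integrable[OF f1]]])
      (measurable, auto simp: indicator_def)
  have "cinner (l2_of ?q1) fa = (LINT x|M01. ?q1 x * cnj (complex_of_real (?I x * f x)))"
    unfolding fa_def by (rule cinner_l2_of[OF qL faL])
  also have "\<dots> = (LINT x|M01. complex_of_real (indicator S x * \<bar>?I x * f x\<bar>))"
    by (intro Bochner_Integration.integral_cong) (auto simp: sgn_if abs_if)
  finally have 1: "norm (cinner (l2_of ?q1) fa) = \<bar>LINT x|M01. indicator S x * \<bar>?I x * f x\<bar>\<bar>"
    by (simp only: integral_complex_of_real norm_of_real)
  have pt: "?I x * norm (?q1 x) = indicator S x" for x
  proof (cases "x \<in> S")
    case True
    then have "?I x * f x \<noteq> 0" using K0 by (auto simp: S_def)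
    then have "?I x = 1" "\<bar>sgn (?I x * f x)\<bar> = 1" by (auto simp: indicator_def abs_sgn_eq)
    then show ?thesis using True by (simp only: norm_of_real abs_mult indicator_simps abs_one mult_1)
  qed simp
  have "N (l2_of ?q1) = (LINT x|M01. indicator S x)"
    unfolding N_def
  proof (rule integral_cong_AE)
    show "AE x in M01. ?I x * norm (fun_of (l2_of ?q1) x) = indicator S x"
      using fun_of_l2_of[OF qL]
    proof eventually_elim
      case (elim x)
      then show ?case by (simp only: pt)
    qed
  qed measurable
  with all[of "l2_of ?q1"] 1 have 2: "(LINT x|M01. indicator S x * \<bar>?I x * f x\<bar>) \<le> K * (LINT x|M01. indicator S x)"
    by simp
  have "(LINT x|M01. (K + 1) * indicator S x) \<le> (LINT x|M01. indicator S x * \<bar>?I x * f x\<bar>)"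
    by (rule integral_mono[OF integrable_mult_right[OF SI] fI]) (auto simp: S_def indicator_def)
  with 2 have "(K + 1) * (LINT x|M01. indicator S x) \<le> K * (LINT x|M01. indicator S x)"
    unfolding integral_mult_right_zero by linarith
  then have "(LINT x|M01. indicator S x :: real) \<le> 0" unfolding distrib_right by linarith
  then have "(LINT x|M01. indicator S x :: real) = 0"
    by (intro order_antisym Bochner_Integration.integral_nonneg) auto
  then have "AE x in M01. indicator S x = (0::real)"
    by (subst (asm) integral_nonneg_eq_0_iff_AE[OF SI]) auto
  then have "AE x in M01. \<bar>?I x * f x\<bar> \<le> K + 1"
    using AE_space by eventually_elim (auto simp: S_def indicator_def split: if_splits)
  then show ?thesis by (rule that)
qed

lemma gap_exists:
  fixes x :: real
  assumes A: "finite A" "A \<subseteq> {0<..<1}" and x: "x \<in> {0<..<1}" "x \<notin> A"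
  shows "\<exists>a b. a \<in> insert 0 (insert 1 A) \<and> b \<in> insert 0 (insert 1 A) \<and> a < x \<and> x < b \<and> A \<inter> {a<..<b} = {}"
proof -
  let ?P = "insert 0 (insert 1 A)"
  let ?L = "{p \<in> ?P. p < x}" and ?R = "{p \<in> ?P. x < p}"
  have L: "finite ?L" "?L \<noteq> {}" and R: "finite ?R" "?R \<noteq> {}" using A x by auto
  have "A \<inter> {Max ?L<..<Min ?R} = {}"
  proof -
    have False if "p \<in> A" "Max ?L < p" "p < Min ?R" for p
    proof (cases "p < x")
      case True
      then show False using Max_ge[OF L(1), of p] that by auto
    next
      case False
      then have "x < p" using x that by (cases "p = x") auto
      then show False using Min_le[OF R(1), of p] that by auto
    qed
    then show ?thesis by auto
  qed
  then show ?thesis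
    using Max_in[OF L] Min_in[OF R] by (intro exI[of _ "Max ?L"] exI[of _ "Min ?R"]) auto
qed

text \<open>If two gaps share the point x but differ at one end, that end of one of them lies
  strictly inside the other, which contains no partition point.\<close>

lemma gap_unique:
  fixes x :: real
  assumes A: "A \<subseteq> {0<..<1}"
    and "a \<in> insert 0 (insert 1 A)" "b \<in> insert 0 (insert 1 A)" "a < x" "x < b" "A \<inter> {a<..<b} = {}"
    and "a' \<in> insert 0 (insert 1 A)" "b' \<in> insert 0 (insert 1 A)" "a' < x" "x < b'" "A \<inter> {a'<..<b'} = {}"
  shows "a = a' \<and> b = b'"
proof -
  have in01: "0 \<le> p \<and> p \<le> 1" if "p \<in> insert 0 (insert 1 A)" for p
    using that A by (auto simp: less_imp_le)
  have *: "\<not> (p < q \<and> q < r)" if "A \<inter> {p<..<r} = {}" "q \<in> insert 0 (insert 1 A)"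
      "p \<in> insert 0 (insert 1 A)" "r \<in> insert 0 (insert 1 A)" for p q r
    using that in01[OF that(3)] in01[OF that(4)] by auto
  show ?thesis
    using assms *[of a b a'] *[of a b b'] *[of a' b' a] *[of a' b' b] by argo
qed

text \<open>The trace identities of the gaps between neighbouring points of 0, \<open>A\<close> and
  1 are added. An index in \<open>I\<close> is a gap with one of its two ends, so a point of
  \<open>A\<close> occurs twice, and its two coefficients combine to the jump of
  \<open>\<mu>\<close> there up to sign.\<close>

lemma H1_pw_traces:
  fixes A :: "real set"
  assumes A: "finite A" "A \<subseteq> {0<..<1}" and \<mu>: "\<mu> \<in> H1_pw A"
  obtains G and C :: real and I :: "((real \<times> real) \<times> bool) set" and cf :: "(real \<times> real) \<times> bool \<Rightarrow> complex" and pt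
  where "G \<in> L2_fun 0 1" "AE x in M01. \<bar>\<mu> x\<bar> \<le> C" "finite I"
    "\<forall>e e' :: real \<Rightarrow> complex. (\<forall>x. (e has_vector_derivative e' x) (at x)) \<longrightarrow> continuous_on UNIV e' \<longrightarrow>
       (LINT x|M01. e' x * of_real (\<mu> x) + e x * of_real (G x)) = (\<Sum>i\<in>I. cf i * e (pt i))"
proof -
  let ?P = "insert 0 (insert 1 A)"
  define J where "J = {p \<in> ?P \<times> ?P. fst p < snd p \<and> A \<inter> {fst p<..<snd p} = {}}"
  have J: "finite J" unfolding J_def using A by (intro finite_subset[OF _ finite_cartesian_product[of ?P ?P]]) auto
  have in01: "0 \<le> p \<and> p \<le> 1" if "p \<in> ?P" for p
    using that A by (auto simp: less_imp_le)
  have "\<exists>g. weak_deriv (fst p) (snd p) \<mu> g" if "p \<in> J" for p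
    using \<mu> that unfolding H1_pw_def H1_fun_iff[symmetric] J_def by fastforce
  then obtain g where g: "\<And>p. p \<in> J \<Longrightarrow> weak_deriv (fst p) (snd p) \<mu> (g p)" by metis
  have le: "0 \<le> fst p" "fst p < snd p" "snd p \<le> 1" if "p \<in> J" for p
    using that in01 by (auto simp: J_def)
  let ?I = "\<lambda>p x. indicator {fst p<..<snd p} x :: real"
  have uniq: "\<exists>p\<in>J. x \<in> {fst p<..<snd p} \<and> (\<forall>q\<in>J. q \<noteq> p \<longrightarrow> x \<notin> {fst q<..<snd q})"
    if x: "x \<in> {0<..<1}" "x \<notin> A" for x
  proof -
    obtain a b where ab: "a \<in> ?P" "b \<in> ?P" "a < x" "x < b" "A \<inter> {a<..<b} = {}"
      using gap_exists[OF A x] by blast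
    show ?thesis
    proof (intro bexI[of _ "(a, b)"] conjI ballI impI notI)
      show "(a, b) \<in> J"
        unfolding J_def mem_Collect_eq mem_Times_iff fst_conv snd_conv using ab by (intro conjI) auto
      show "x \<in> {fst (a, b)<..<snd (a, b)}" using ab by simp
      fix q assume q: "q \<in> J" "q \<noteq> (a, b)" "x \<in> {fst q<..<snd q}"
      from q(1) have "fst q \<in> ?P" "snd q \<in> ?P" "A \<inter> {fst q<..<snd q} = {}"
        unfolding J_def mem_Collect_eq mem_Times_iff by blast+
      moreover have "fst q < x" "x < snd q" using q(3) by simp_all
      ultimately have "a = fst q \<and> b = snd q"
        by (intro gap_unique[OF A(2) ab])
      then show False using q(2) by auto
    qed
  qed
  have nA: "AE x in M01. x \<notin> A"
  proof -
    have "A \<in> null_sets lebesgue"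
      using A(1) by (simp add: negligible_finite negligible_iff_null_sets[symmetric])
    then have "AE x in lebesgue. x \<notin> A" by (rule AE_not_in)
    then show ?thesis by (subst AE_restrict_space_iff) (auto elim!: eventually_mono)
  qed
  \<comment> \<open>Outside the null set \<open>A\<close> exactly one indicator equals 1, and
    \<open>THE\<close> picks its gap.\<close>
  have split: "AE x in M01. (\<Sum>p\<in>J. ?I p x *\<^sub>R F p x) = F (THE p. p \<in> J \<and> x \<in> {fst p<..<snd p}) x"
    for F :: "real \<times> real \<Rightarrow> real \<Rightarrow> 'x::real_vector"
    using nA AE_space
  proof eventually_elim
    case (elim x)
    then obtain p where p: "p \<in> J" "x \<in> {fst p<..<snd p}" "\<forall>q\<in>J. q \<noteq> p \<longrightarrow> x \<notin> {fst q<..<snd q}"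
      using uniq[of x] by auto
    have "(THE p. p \<in> J \<and> x \<in> {fst p<..<snd p}) = p"
      by (rule the_equality) (use p in blast)+
    moreover have "(\<Sum>p\<in>J. ?I p x *\<^sub>R F p x) = (\<Sum>q\<in>J. if q = p then F p x else 0)"
      by (rule sum.cong) (use p in \<open>auto simp: indicator_def\<close>)
    ultimately show ?case using p(1) J by simp
  qed
  define G where "G x = (\<Sum>p\<in>J. ?I p x *\<^sub>R g p x)" for x
  have gL: "(\<lambda>x. ?I p x *\<^sub>R g p x) \<in> L2_fun 0 1" if "p \<in> J" for p
    using that g[OF that] le[OF that] by (intro L2_fun_extend) (auto simp: weak_deriv_def)
  have GL: "G \<in> L2_fun 0 1"
  proof -
    have "(\<lambda>x. \<Sum>p\<in>K. ?I p x *\<^sub>R g p x) \<in> L2_fun 0 1" if "finite K" "K \<subseteq> J" for K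
      using that
    proof induction
      case (insert p K)
      then have "(\<lambda>x. ?I p x *\<^sub>R g p x + (\<Sum>p\<in>K. ?I p x *\<^sub>R g p x)) \<in> L2_fun 0 1"
        by (intro L2_fun_add gL) simp_all
      then show ?case using insert by (simp only: sum.insert not_False_eq_True)
    qed (simp only: sum.empty L2_fun_zero)
    then show ?thesis using J by (simp add: G_def[abs_def])
  qed
  have "\<exists>K. AE x in M01. \<bar>?I p x * \<mu> x\<bar> \<le> K" if "p \<in> J" for p
    using weak_deriv_bounded[OF g[OF that] le[OF that]] by blast
  then obtain K where K: "\<And>p. p \<in> J \<Longrightarrow> AE x in M01. \<bar>?I p x * \<mu> x\<bar> \<le> K p" by metis
  have bdd: "AE x in M01. \<bar>\<mu> x\<bar> \<le> (\<Sum>p\<in>J. \<bar>K p\<bar>)"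
  proof -
    have "AE x in M01. \<forall>p\<in>J. \<bar>?I p x * \<mu> x\<bar> \<le> K p" using K J by (simp add: AE_finite_all)
    with nA AE_space show ?thesis
    proof eventually_elim
      case (elim x)
      then obtain p where p: "p \<in> J" "x \<in> {fst p<..<snd p}" using uniq[of x] by auto
      then have "\<bar>\<mu> x\<bar> \<le> \<bar>K p\<bar>" using elim by force
      also have "\<dots> \<le> (\<Sum>p\<in>J. \<bar>K p\<bar>)" using p J by (intro member_le_sum) auto
      finally show ?case .
    qed
  qed
  define Tr where "Tr p \<alpha> \<beta> \<longleftrightarrow> (\<forall>e e' :: real \<Rightarrow> complex. (\<forall>x. (e has_vector_derivative e' x) (at x)) \<longrightarrow> continuous_on UNIV e' \<longrightarrow>
     (LINT x|lebesgue_on {fst p<..<snd p}. e' x * complex_of_real (\<mu> x) + e x * complex_of_real (g p x))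
        = complex_of_real \<beta> * e (snd p) - complex_of_real \<alpha> * e (fst p))" for p :: "real \<times> real" and \<alpha> \<beta> :: real
  have "\<exists>\<alpha> \<beta>. Tr p \<alpha> \<beta>" if "p \<in> J" for p
    unfolding Tr_def by (rule weak_deriv_traces_complex[OF g[OF that] le(2)[OF that]]) (intro exI)
  then obtain \<alpha> \<beta> where T: "\<And>p. p \<in> J \<Longrightarrow> Tr p (\<alpha> p) (\<beta> p)" by metis
  define cf where "cf i = complex_of_real (if snd i then \<beta> (fst i) else - \<alpha> (fst i))" for i :: "(real \<times> real) \<times> bool"
  define pt where "pt i = (if snd i then snd (fst i) else fst (fst i))" for i :: "(real \<times> real) \<times> bool"
  have formula: "(LINT x|M01. e' x * of_real (\<mu> x) + e x * of_real (G x)) = (\<Sum>i\<in>J \<times> UNIV. cf i * e (pt i))"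
    if e: "\<forall>x. (e has_vector_derivative e' x) (at x)" and e': "continuous_on UNIV e'" for e e' :: "real \<Rightarrow> complex"
  proof -
    have ec: "continuous_on UNIV e"
      using e by (meson continuous_at_imp_continuous_on has_vector_derivative_continuous)
    have L2c: "(\<lambda>x. c x * complex_of_real (F x)) \<in> L2_fun a b"
      if c: "continuous_on UNIV c" and F: "F \<in> L2_fun a b" for c and F :: "real \<Rightarrow> real" and a b
    proof -
      obtain C where C: "\<And>x. x \<in> {a..b} \<Longrightarrow> norm (c x) \<le> C" using continuous_bounded_on[OF c] by metis
      note [measurable] = L2_funD(1)[OF F] continuous_measurable_on[OF c]
      show ?thesis
        by (rule L2_fun_bound[OF F, where C = C])
          (auto intro!: AE_I2 mult_right_mono C simp: norm_mult)
    qed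
    let ?F = "\<lambda>p x. e' x * complex_of_real (\<mu> x) + e x * complex_of_real (g p x)"
    have FI: "integrable (lebesgue_on {fst p<..<snd p}) (?F p)" if "p \<in> J" for p
      using g[OF that] by (intro Bochner_Integration.integrable_add L2_fun_integrable L2c e' ec) (auto simp: weak_deriv_def)
    have FI1: "integrable M01 (\<lambda>x. ?I p x *\<^sub>R ?F p x)" if "p \<in> J" for p
      using FI[OF that] le[OF that] by (subst integrable_restrict_M01[symmetric]) auto
    have mu: "\<mu> \<in> L2_fun 0 1" using \<mu> by (simp add: H1_pw_def)
    have LI: "integrable M01 (\<lambda>x. e' x * of_real (\<mu> x) + e x * of_real (G x))"
      by (intro Bochner_Integration.integrable_add L2_fun_integrable L2c e' ec mu GL)
    have "(LINT x|M01. e' x * of_real (\<mu> x) + e x * of_real (G x)) = (LINT x|M01. (\<Sum>p\<in>J. ?I p x *\<^sub>R ?F p x))"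
    proof (rule integral_cong_AE)
      show "AE x in M01. e' x * of_real (\<mu> x) + e x * of_real (G x) = (\<Sum>p\<in>J. ?I p x *\<^sub>R ?F p x)"
        using split[of ?F] split[of g]
      proof eventually_elim
        case (elim x)
        then show ?case unfolding G_def by simp
      qed
      show "(\<lambda>x. \<Sum>p\<in>J. ?I p x *\<^sub>R ?F p x) \<in> borel_measurable M01"
        by (intro borel_measurable_sum borel_measurable_integrable FI1)
    qed (rule borel_measurable_integrable[OF LI])
    also have "\<dots> = (\<Sum>p\<in>J. LINT x|M01. ?I p x *\<^sub>R ?F p x)"
      by (intro Bochner_Integration.integral_sum FI1)
    also have "\<dots> = (\<Sum>p\<in>J. complex_of_real (\<beta> p) * e (snd p) - complex_of_real (\<alpha> p) * e (fst p))"
    proof (rule sum.cong[OF refl])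
      fix p assume p: "p \<in> J"
      have "(LINT x|M01. ?I p x *\<^sub>R ?F p x) = (LINT x|lebesgue_on {fst p<..<snd p}. ?F p x)"
        using le[OF p] by (subst integral_restrict_M01) auto
      then show "(LINT x|M01. ?I p x *\<^sub>R ?F p x) = complex_of_real (\<beta> p) * e (snd p) - complex_of_real (\<alpha> p) * e (fst p)"
        using T[OF p] e e' unfolding Tr_def by simp
    qed
    also have "\<dots> = (\<Sum>p\<in>J. \<Sum>b\<in>UNIV. cf (p, b) * e (pt (p, b)))"
      by (simp add: UNIV_bool cf_def pt_def)
    also have "\<dots> = (\<Sum>i\<in>J \<times> UNIV. cf i * e (pt i))"
      by (subst sum.cartesian_product) (auto intro!: sum.cong)
    finally show ?thesis .
  qed
  show ?thesis
    by (rule that[OF GL bdd finite_cartesian_product[OF J finite], of cf pt], intro allI impI, rule formula)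
qed

text \<open>Symmetry holds because \<open>\<mu>\<close> is real; it is behind the conservation of
  the L^2 norm.\<close>

lemma mult_op_props:
  assumes m [measurable]: "\<mu> \<in> borel_measurable M01" and bd: "AE x in M01. \<bar>\<mu> x\<bar> \<le> C"
  shows bounded_linear_mult_op: "bounded_linear (mult_op \<mu>)"
    and mult_op_cscale: "mult_op \<mu> (cscale c \<psi>) = cscale c (mult_op \<mu> \<psi>)"
    and mult_op_symmetric: "cinner (mult_op \<mu> \<psi>) \<eta> = cinner \<psi> (mult_op \<mu> \<eta>)"
proof -
  note F = fun_of_mult_op[OF m bd]
  show sc: "mult_op \<mu> (cscale c \<psi>) = cscale c (mult_op \<mu> \<psi>)" for c \<psi>
    using F[of "cscale c \<psi>"] F[of \<psi>] fun_of_cscale[of c \<psi>] fun_of_cscale[of c "mult_op \<mu> \<psi>"]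
    by (intro l2_eqI, eventually_elim) simp
  show "bounded_linear (mult_op \<mu>)"
  proof (rule bounded_linear_intro[where K = "\<bar>C\<bar>"])
    show "mult_op \<mu> (x + y) = mult_op \<mu> x + mult_op \<mu> y" for x y
      using F[of "x + y"] F[of x] F[of y] fun_of_add[of x y] fun_of_add[of "mult_op \<mu> x" "mult_op \<mu> y"]
      by (intro l2_eqI, eventually_elim) (simp add: algebra_simps)
    show "mult_op \<mu> (r *\<^sub>R x) = r *\<^sub>R mult_op \<mu> x" for r x by (simp add: scaleR_eq_cscale sc)
    show "norm (mult_op \<mu> x) \<le> norm x * \<bar>C\<bar>" for x
    proof -
      have "(norm (mult_op \<mu> x))\<^sup>2 \<le> (LINT t|M01. C\<^sup>2 * (norm (fun_of x t))\<^sup>2)"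
        unfolding norm_l2_sq
      proof (rule integral_mono_AE)
        show "AE t in M01. (norm (fun_of (mult_op \<mu> x) t))\<^sup>2 \<le> C\<^sup>2 * (norm (fun_of x t))\<^sup>2"
          using F[of x] bd
        proof eventually_elim
          case (elim t)
          then have "(norm (fun_of (mult_op \<mu> x) t))\<^sup>2 \<le> (C * norm (fun_of x t))\<^sup>2"
            by (intro power_mono) (auto simp: norm_mult intro!: mult_right_mono)
          then show ?case by (simp add: power_mult_distrib)
        qed
      qed (auto intro: L2_funD(2)[OF fun_of_L2])
      then have "(norm (mult_op \<mu> x))\<^sup>2 \<le> (norm x * \<bar>C\<bar>)\<^sup>2"
        by (simp add: norm_l2_sq[of x, symmetric] power_mult_distrib mult.commute)
      then show ?thesis by (rule power2_le_imp_le) simp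
    qed
  qed
  show "cinner (mult_op \<mu> \<psi>) \<eta> = cinner \<psi> (mult_op \<mu> \<eta>)"
    unfolding cinner_def using F[of \<psi>] F[of \<eta>]
    by (intro integral_cong_AE) (auto elim: AE_mp)
qed

text \<open>Integration by parts of \<open>\<mu>\<close> times \<open>Lam \<eta>\<close> against
  mode k: the derivative of the product, with \<open>G\<close> for the piecewise derivative of
  \<open>\<mu>\<close>, is the bounded term \<open>Gop\<close>, and the point values at the ends of
  the gaps carry all jumps. By linearity in \<open>\<eta>\<close> only e =
  \<open>phi_fun (j - k)\<close> has to be put into the trace identity.\<close>

lemma mult_op_phi_deriv:
  fixes A :: "real set"
  assumes A: "finite A" "A \<subseteq> {0<..<1}" and \<mu>: "\<mu> \<in> H1_pw A"
  obtains Gop and I :: "((real \<times> real) \<times> bool) set" and cf pt where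
    "bounded_linear Gop" "finite I"
    "\<forall>\<eta> k. 2 * pi * \<i> * of_int k * cinner (mult_op \<mu> (Lam \<eta>)) (phi k)
       = cinner (Gop \<eta>) (phi k) - (\<Sum>i\<in>I. cf i * (ev \<eta> (pt i) * cnj (phi_fun k (pt i))))"
proof -
  obtain G C and I :: "((real \<times> real) \<times> bool) set" and cf :: "(real \<times> real) \<times> bool \<Rightarrow> complex" and pt where
    G: "G \<in> L2_fun 0 1" and bd: "AE x in M01. \<bar>\<mu> x\<bar> \<le> C" and I: "finite I" and
    T: "\<forall>e e' :: real \<Rightarrow> complex. (\<forall>x. (e has_vector_derivative e' x) (at x)) \<longrightarrow> continuous_on UNIV e' \<longrightarrow>
       (LINT x|M01. e' x * of_real (\<mu> x) + e x * of_real (G x)) = (\<Sum>i\<in>I. cf i * e (pt i))"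
    by (rule H1_pw_traces[OF A \<mu>])
  have mL: "\<mu> \<in> L2_fun 0 1" using \<mu> by (simp add: H1_pw_def)
  note [measurable] = L2_funD(1)[OF mL] L2_funD(1)[OF G]
  note M = mult_op_props[OF L2_funD(1)[OF mL] bd]
  define Q where "Q \<eta> = l2_of (\<lambda>x. of_real (G x) * ev \<eta> x)" for \<eta>
  let ?B = "norm (rho 0)"
  have [measurable]: "ev \<eta> \<in> borel_measurable M01" for \<eta> by (rule L2_funD(1)[OF ev_L2])
  have QL: "(\<lambda>x. of_real (G x) * ev \<eta> x) \<in> L2_fun 0 1" for \<eta>
  proof (rule L2_fun_bound[OF G, where C = "?B * norm \<eta>"])
    show "AE x in M01. norm (of_real (G x) * ev \<eta> x) \<le> ?B * norm \<eta> * norm (G x)"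
      by (auto simp: norm_mult mult.commute[of "\<bar>_\<bar>"] intro!: AE_I2 mult_right_mono norm_ev_le)
  qed measurable
  have Q: "bounded_linear Q"
  proof (rule bounded_linear_intro[where K = "?B * norm (l2_of (\<lambda>x. of_real (G x)))"])
    show "Q (x + y) = Q x + Q y" for x y
      unfolding Q_def l2_of_add[OF QL QL, symmetric] by (simp add: ev_def cinner_add_left algebra_simps)
    show "Q (r *\<^sub>R x) = r *\<^sub>R Q x" for r x
      unfolding Q_def scaleR_eq_cscale l2_of_cmult[OF QL, symmetric] ev_cscale by (simp add: mult_ac)
    show "norm (Q x) \<le> norm x * (?B * norm (l2_of (\<lambda>x. of_real (G x))))" for x
    proof -
      have "(norm (Q x))\<^sup>2 = (LINT t|M01. (norm (of_real (G t) * ev x t))\<^sup>2)"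
        unfolding Q_def by (rule norm_l2_of_sq[OF QL])
      also have "\<dots> \<le> (LINT t|M01. (?B * norm x)\<^sup>2 * (norm (complex_of_real (G t)))\<^sup>2)"
      proof (rule integral_mono)
        show "(norm (of_real (G t) * ev x t))\<^sup>2 \<le> (?B * norm x)\<^sup>2 * (norm (complex_of_real (G t)))\<^sup>2" for t
          unfolding norm_mult power_mult_distrib[symmetric] mult.commute[of "norm (of_real (G t))"]
          by (intro power_mono mult_right_mono norm_ev_le) auto
      qed (use L2_funD(2)[OF QL[of x]] L2_funD(2)[OF L2_fun_of_real[OF G]] in auto)
      also have "\<dots> = (norm x * (?B * norm (l2_of (\<lambda>x. of_real (G x)))))\<^sup>2"
        by (simp add: norm_l2_of_sq[OF L2_fun_of_real[OF G]] power_mult_distrib mult_ac)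
      finally show ?thesis by (rule power2_le_imp_le) simp
    qed
  qed
  define Gop where "Gop \<eta> = mult_op \<mu> (Dop \<eta>) + Q \<eta>" for \<eta>
  have Gop: "bounded_linear Gop"
    unfolding Gop_def by (intro bounded_linear_add Q bounded_linear_compose[OF M(1) bounded_linear_Dop])
  have "2 * pi * \<i> * of_int k * cinner (mult_op \<mu> (Lam \<eta>)) (phi k)
       = cinner (Gop \<eta>) (phi k) - (\<Sum>i\<in>I. cf i * (ev \<eta> (pt i) * cnj (phi_fun k (pt i))))" for \<eta> k
  proof (rule bounded_linear_eqI[where f = "\<lambda>\<eta>. 2 * pi * \<i> * of_int k * cinner (mult_op \<mu> (Lam \<eta>)) (phi k)"
        and g = "\<lambda>\<eta>. cinner (Gop \<eta>) (phi k) - (\<Sum>i\<in>I. cf i * (ev \<eta> (pt i) * cnj (phi_fun k (pt i))))"])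
    show "bounded_linear (\<lambda>\<eta>. 2 * pi * \<i> * of_int k * cinner (mult_op \<mu> (Lam \<eta>)) (phi k))"
      by (intro bounded_linear_compose[OF bounded_linear_mult_right]
          bounded_linear_compose[OF bounded_linear_cinner_left] bounded_linear_compose[OF M(1) bounded_linear_Lam])
    show "bounded_linear (\<lambda>\<eta>. cinner (Gop \<eta>) (phi k) - (\<Sum>i\<in>I. cf i * (ev \<eta> (pt i) * cnj (phi_fun k (pt i)))))"
      by (intro bounded_linear_sub bounded_linear_sum bounded_linear_compose[OF bounded_linear_mult_right]
          bounded_linear_compose[OF bounded_linear_mult_left] bounded_linear_ev
          bounded_linear_compose[OF bounded_linear_cinner_left Gop])
    fix c j
    have L: "(\<lambda>x. of_real (\<mu> x) * phi_fun j x) \<in> L2_fun 0 1" 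
      using bd by (intro L2_fun_bound[OF phi_fun_L2[of j], where C = C])
        (auto simp: norm_mult elim!: eventually_mono intro!: borel_measurable_times L2_funD(1)[OF phi_fun_L2])
    have "AE x in M01. fun_of (mult_op \<mu> (phi j)) x = of_real (\<mu> x) * phi_fun j x"
      using fun_of_mult_op[OF L2_funD(1)[OF mL] bd, of "phi j"] fun_of_l2_of[OF phi_fun_L2[of j]]
      by eventually_elim (simp add: phi_def)
    then have "mult_op \<mu> (phi j) = l2_of (\<lambda>x. of_real (\<mu> x) * phi_fun j x)"
      using fun_of_l2_of[OF L] by (intro l2_eqI, eventually_elim) simp
    moreover have prod_phi: "r * phi_fun j x * cnj (phi_fun k x) = phi_fun (j - k) x * r" for r x
      unfolding cnj_phi_fun mult.assoc phi_fun_mult by (simp add: mult.commute)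
    ultimately have 1: "cinner (mult_op \<mu> (phi j)) (phi k) = (LINT x|M01. phi_fun (j - k) x * of_real (\<mu> x))"
      unfolding phi_def[of k] using L
      by (simp add: cinner_l2_of phi_fun_L2 prod_phi)
    have L': "(\<lambda>x. of_real (G x) * ev (phi j) x) \<in> L2_fun 0 1" by (rule QL)
    have 2: "cinner (Q (phi j)) (phi k) = (LINT x|M01. phi_fun (j - k) x * of_real (G x)) / of_real (jb j)"
      unfolding Q_def phi_def[of k] cinner_l2_of[OF L' phi_fun_L2]
      by (simp add: ev_phi prod_phi)
    let ?w = "2 * pi * \<i> * of_int (j - k) :: complex"
    have i1: "integrable M01 (\<lambda>x. phi_fun (j - k) x * of_real (\<mu> x))"
      using L2_fun_prod_integrable[OF L2_fun_of_real[OF mL] phi_fun_L2[of "k - j"]]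
      by (simp add: cnj_phi_fun mult.commute)
    have i2: "integrable M01 (\<lambda>x. phi_fun (j - k) x * of_real (G x))"
      using L2_fun_prod_integrable[OF L2_fun_of_real[OF G] phi_fun_L2[of "k - j"]]
      by (simp add: cnj_phi_fun mult.commute)
    have "?w * cinner (mult_op \<mu> (phi j)) (phi k) + of_real (jb j) * cinner (Q (phi j)) (phi k)
        = (LINT x|M01. (?w * phi_fun (j - k) x) * of_real (\<mu> x) + phi_fun (j - k) x * of_real (G x))"
      unfolding 1 2 mult.assoc using i1 i2 by simp
    also have "\<dots> = (\<Sum>i\<in>I. cf i * phi_fun (j - k) (pt i))"
      by (rule T[rule_format], rule phi_fun_derivative,
          rule continuous_on_mult[OF continuous_on_const continuous_phi_fun])
    finally have 3: "?w * cinner (mult_op \<mu> (phi j)) (phi k) + of_real (jb j) * cinner (Q (phi j)) (phi k)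
        = (\<Sum>i\<in>I. cf i * phi_fun (j - k) (pt i))" .
    have 4: "cf i * (ev (phi j) p * cnj (phi_fun k p)) = cf i * phi_fun (j - k) p / of_real (jb j)" for i p
      by (simp add: ev_phi cnj_phi_fun phi_fun_mult)
    have "2 * pi * \<i> * of_int k * cinner (mult_op \<mu> (Lam (phi j))) (phi k)
       = cinner (Gop (phi j)) (phi k) - (\<Sum>i\<in>I. cf i * (ev (phi j) (pt i) * cnj (phi_fun k (pt i))))"
      unfolding 4 sum_divide_distrib[symmetric] 3[symmetric]
      by (simp add: Gop_def Lam_phi Dop_phi M(2) cinner_add_left cinner_cscale_left field_simps)
    then have "c * (2 * pi * \<i> * of_int k * cinner (mult_op \<mu> (Lam (phi j))) (phi k))
       = c * (cinner (Gop (phi j)) (phi k) - (\<Sum>i\<in>I. cf i * (ev (phi j) (pt i) * cnj (phi_fun k (pt i)))))"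
      by simp
    moreover have "Gop (cscale c (phi j)) = cscale c (Gop (phi j))"
    proof -
      have "Q (cscale c (phi j)) = cscale c (Q (phi j))"
        unfolding Q_def l2_of_cmult[OF QL, symmetric] ev_cscale by (simp add: mult_ac)
      then show ?thesis by (simp add: Gop_def Dop_cscale M(2) cscale_add_right)
    qed
    ultimately show "2 * pi * \<i> * of_int k * cinner (mult_op \<mu> (Lam (cscale c (phi j)))) (phi k)
       = cinner (Gop (cscale c (phi j))) (phi k) - (\<Sum>i\<in>I. cf i * (ev (cscale c (phi j)) (pt i) * cnj (phi_fun k (pt i))))"
      by (simp add: Lam_cscale M(2) cinner_cscale_left ev_cscale right_diff_distrib sum_distrib_left mult_ac)
  qed
  then show ?thesis using that[OF Gop I] by blast
qed

section \<open>Exponential sums with weight $(s - a)(b - s)$\<close>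

definition wt :: "real \<Rightarrow> real \<Rightarrow> real \<Rightarrow> real" where "wt a b s = (s - a) * (b - s)"

definition wthat :: "real \<Rightarrow> real \<Rightarrow> real \<Rightarrow> complex" where
  "wthat a b \<omega> = (LINT s|lebesgue_on {a<..<b}. of_real (wt a b s) * cis (\<omega> * s))"

lemma continuous_on_wt [continuous_intros]: "continuous_on S f \<Longrightarrow> continuous_on S (\<lambda>x. wt a b (f x))"
  unfolding wt_def by (intro continuous_intros)

lemma continuous_on_cis' [continuous_intros]: "continuous_on S f \<Longrightarrow> continuous_on S (\<lambda>x. cis (f x))"
  unfolding cis_conv_exp by (intro continuous_intros)

lemma wt_nonneg: "s \<in> {a<..<b} \<Longrightarrow> 0 \<le> wt a b s"
  by (simp add: wt_def)

text \<open>Since the weight vanishes at a and b, the boundary term of order 1/\<omega> is absent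
  and two powers of \<omega> are gained. The value at 0 is the diagonal of the Gram matrices, the
  decay controls the rest.\<close>

lemma wthat_bounds:
  assumes ab: "a < b"
  shows wthat_decay: "\<omega> \<noteq> 0 \<Longrightarrow> norm (wthat a b \<omega>) \<le> 4 * (b - a) / \<omega>\<^sup>2"
    and wthat_0: "wthat a b 0 = of_real ((b - a) ^ 3 / 6)"
    and wthat_le: "norm (wthat a b \<omega>) \<le> (b - a) ^ 3"
proof -
  show "wthat a b 0 = of_real ((b - a) ^ 3 / 6)"
  proof -
    have "(LINT s|lebesgue_on {a<..<b}. wt a b s)
        = ((a + b) * b\<^sup>2 / 2 - b ^ 3 / 3 - a * b * b) - ((a + b) * a\<^sup>2 / 2 - a ^ 3 / 3 - a * b * a)"
    proof (rule ftc_open)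
      show "((\<lambda>s. (a + b) * s\<^sup>2 / 2 - s ^ 3 / 3 - a * b * s) has_vector_derivative wt a b s) (at s)" for s
        unfolding has_real_derivative_iff_has_vector_derivative[symmetric] wt_def
        by (auto intro!: derivative_eq_intros simp: algebra_simps power2_eq_square)
    qed (use ab in \<open>auto intro!: continuous_intros\<close>)
    also have "\<dots> = (b - a) ^ 3 / 6"
      by (simp add: field_simps power2_eq_square power3_eq_cube)
    finally have "complex_of_real (LINT s|lebesgue_on {a<..<b}. wt a b s) = of_real ((b - a) ^ 3 / 6)" by (simp only:)
    then show ?thesis unfolding wthat_def by simp
  qed
  have I: "integrable (lebesgue_on {a<..<b}) (\<lambda>s. of_real (wt a b s) * cis (\<omega> * s))"
    by (intro continuous_integrable_open continuous_intros)
  have "norm (wthat a b \<omega>) \<le> (LINT s|lebesgue_on {a<..<b}. (b - a)\<^sup>2)"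
    unfolding wthat_def
  proof (rule Bochner_Integration.integral_norm_bound_integral[OF I])
    show "norm (of_real (wt a b s) * cis (\<omega> * s)) \<le> (b - a)\<^sup>2" if "s \<in> space (lebesgue_on {a<..<b})" for s
      using that unfolding norm_mult norm_cis norm_of_real wt_def abs_mult power2_eq_square mult_1_right
      by (intro mult_mono) auto
  qed (rule finite_measure.integrable_const[OF finite_measure_lebesgue_on])
  also have "\<dots> = (b - a) ^ 3"
    using ab by (simp add: measure_restrict_space power2_eq_square power3_eq_cube)
  finally show "norm (wthat a b \<omega>) \<le> (b - a) ^ 3" .
  assume \<omega>: "\<omega> \<noteq> 0"
  define c where "c = \<i> * complex_of_real \<omega>"
  have c: "c \<noteq> 0" "norm c = \<bar>\<omega>\<bar>" using \<omega> by (auto simp: c_def norm_mult)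
  define E where "E s = exp (c * of_real s)" for s :: real
  have E: "cis (\<omega> * s) = E s" for s by (simp add: E_def c_def cis_conv_exp mult_ac)
  \<comment> \<open>A primitive of the weighted exponential, found by integrating by parts until the
    quadratic weight is used up.\<close>
  let ?P = "\<lambda>s::real. (of_real (s - a) * of_real (b - s) / c - of_real (a + b - 2 * s) / c ^ 2 - 2 / c ^ 3) * E s"
  have "wthat a b \<omega> = ?P b - ?P a"
    unfolding wthat_def E
  proof (rule ftc_open)
    show "(?P has_vector_derivative of_real (wt a b s) * E s) (at s)" for s
    proof -
      have "((\<lambda>z. ((z - of_real a) * (of_real b - z) / c - (of_real a + of_real b - 2 * z) / c ^ 2 - 2 / c ^ 3) * exp (c * z))
          has_field_derivative (of_real (wt a b s) * E s)) (at (of_real s))"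
        unfolding E_def wt_def using c
        by (auto intro!: derivative_eq_intros simp: field_simps power2_eq_square power3_eq_cube)
      then show ?thesis unfolding E_def
        using has_vector_derivative_real_field[of "\<lambda>z. ((z - of_real a) * (of_real b - z) / c - (of_real a + of_real b - 2 * z) / c ^ 2 - 2 / c ^ 3) * exp (c * z)" _ s UNIV]
        by simp
    qed
    show "continuous_on UNIV (\<lambda>s. of_real (wt a b s) * E s)"
      unfolding E_def by (intro continuous_intros)
  qed (use ab in simp)
  also have "\<dots> = of_real (b - a) * (E b + E a) / c ^ 2 - 2 * (E b - E a) / c ^ 3"
    by (simp add: algebra_simps diff_divide_distrib add_divide_distrib)
  also have "norm \<dots> \<le> (b - a) * 2 / \<omega>\<^sup>2 + 2 * (\<bar>\<omega>\<bar> * (b - a)) / \<bar>\<omega>\<bar> ^ 3"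
  proof (rule order_trans[OF norm_triangle_ineq4 add_mono])
    have n1: "norm (E s) = 1" for s by (simp add: E[symmetric])
    have "norm (E b + E a) \<le> 2" using norm_triangle_ineq[of "E b" "E a"] by (simp add: n1)
    then show "norm (of_real (b - a) * (E b + E a) / c ^ 2) \<le> (b - a) * 2 / \<omega>\<^sup>2"
      using ab unfolding norm_divide norm_mult norm_power c(2) norm_of_real
      by (intro divide_mono mult_mono) (use \<omega> in auto)
    \<comment> \<open>Bounding the difference by |\<omega>| (b - a) brings the cubic term down to
      the order of the quadratic one; each contributes 2 to the constant 4.\<close>
    have "E b - E a = (LINT s|lebesgue_on {a<..<b}. c * E s)"
    proof (rule ftc_open[symmetric])
      show "(E has_vector_derivative c * E s) (at s)" for s
        unfolding E_def by (rule has_vector_derivative_real_field) (auto intro!: derivative_eq_intros)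
      show "continuous_on UNIV (\<lambda>s. c * E s)" unfolding E_def by (intro continuous_intros)
    qed (use ab in simp)
    also have "norm \<dots> \<le> (LINT s|lebesgue_on {a<..<b}. \<bar>\<omega>\<bar>)"
    proof (rule Bochner_Integration.integral_norm_bound_integral)
      show "integrable (lebesgue_on {a<..<b}) (\<lambda>s. c * E s)"
        unfolding E_def by (intro continuous_integrable_open continuous_intros)
    qed (auto simp: norm_mult n1 c finite_measure.integrable_const[OF finite_measure_lebesgue_on])
    also have "\<dots> = \<bar>\<omega>\<bar> * (b - a)" using ab by (simp add: measure_restrict_space)
    finally show "norm (2 * (E b - E a) / c ^ 3) \<le> 2 * (\<bar>\<omega>\<bar> * (b - a)) / \<bar>\<omega>\<bar> ^ 3"
      unfolding norm_divide norm_mult norm_power c(2)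
      by (intro divide_right_mono mult_mono) auto
  qed
  also have "\<dots> = 4 * (b - a) / \<omega>\<^sup>2"
    using \<omega> by (simp add: power3_eq_cube power2_eq_square abs_mult[symmetric] field_simps)
  finally show "norm (wthat a b \<omega>) \<le> 4 * (b - a) / \<omega>\<^sup>2" .
qed

lemma wthat_minus: "norm (wthat a b (- \<omega>)) = norm (wthat a b \<omega>)"
proof -
  have "wthat a b (- \<omega>) = cnj (wthat a b \<omega>)"
    unfolding wthat_def Bochner_Integration.integral_cnj[symmetric] by (simp add: cis_cnj)
  then show ?thesis by simp
qed

lemma integral_exp_sums:
  assumes F: "finite F" "finite G"
  shows "(LINT s|lebesgue_on {a<..<b}. of_real (wt a b s) * ((\<Sum>j\<in>F. c j * cis (\<nu> j * s)) * (\<Sum>k\<in>G. d k * cis (\<nu>' k * s))))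
    = (\<Sum>j\<in>F. \<Sum>k\<in>G. c j * d k * wthat a b (\<nu> j + \<nu>' k))"
proof -
  have I: "integrable (lebesgue_on {a<..<b}) (\<lambda>s. of_real (wt a b s) * cis (\<omega> * s))" for \<omega>
    by (intro continuous_integrable_open continuous_intros)
  have "of_real (wt a b s) * ((\<Sum>j\<in>F. c j * cis (\<nu> j * s)) * (\<Sum>k\<in>G. d k * cis (\<nu>' k * s)))
    = (\<Sum>j\<in>F. \<Sum>k\<in>G. (c j * d k) * (of_real (wt a b s) * cis ((\<nu> j + \<nu>' k) * s)))" for s
    unfolding sum_product unfolding sum_distrib_left
    by (intro sum.cong refl) (simp add: cis_mult distrib_right distrib_left mult_ac)
  then show ?thesis
    using I by (simp add: wthat_def)
qed

lemma integral_exp_sum_norm: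
  assumes F: "finite F"
  shows "complex_of_real (LINT s|lebesgue_on {a<..<b}. wt a b s * (norm (\<Sum>j\<in>F. c j * cis (\<nu> j * s)))\<^sup>2)
    = (\<Sum>j\<in>F. \<Sum>k\<in>F. c j * cnj (c k) * wthat a b (\<nu> j - \<nu> k))"
proof -
  have "complex_of_real (wt a b s * (norm (\<Sum>j\<in>F. c j * cis (\<nu> j * s)))\<^sup>2)
     = of_real (wt a b s) * ((\<Sum>j\<in>F. c j * cis (\<nu> j * s)) * (\<Sum>k\<in>F. cnj (c k) * cis ((- \<nu> k) * s)))" for s
    unfolding of_real_mult complex_norm_square by (simp add: cis_cnj)
  then have "complex_of_real (LINT s|lebesgue_on {a<..<b}. wt a b s * (norm (\<Sum>j\<in>F. c j * cis (\<nu> j * s)))\<^sup>2)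
     = (LINT s|lebesgue_on {a<..<b}. of_real (wt a b s) * ((\<Sum>j\<in>F. c j * cis (\<nu> j * s)) * (\<Sum>k\<in>F. cnj (c k) * cis ((- \<nu> k) * s))))"
    unfolding integral_complex_of_real[symmetric] by (rule Bochner_Integration.integral_cong[OF refl])
  also have "\<dots> = (\<Sum>j\<in>F. \<Sum>k\<in>F. c j * cnj (c k) * wthat a b (\<nu> j + (- \<nu> k)))"
    by (rule integral_exp_sums[OF F F])
  finally show ?thesis by simp
qed

text \<open>Schur's test for a symmetric nonnegative matrix: r_j r_k <= (r_j^2 + r_k^2) / 2 reduces
  the quadratic form to row sums.\<close>

lemma schur_test:
  fixes B :: "'i \<Rightarrow> 'i \<Rightarrow> real"
  assumes F: "finite F" and B: "\<And>j k. 0 \<le> B j k" "\<And>j k. B j k = B k j"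
    and S: "\<And>k. k \<in> F \<Longrightarrow> (\<Sum>j\<in>F. B j k) \<le> S"
  shows "(\<Sum>j\<in>F. \<Sum>k\<in>F. r j * r k * B j k) \<le> S * (\<Sum>k\<in>F. (r k)\<^sup>2)"
proof -
  have "(\<Sum>j\<in>F. \<Sum>k\<in>F. r j * r k * B j k)
      \<le> (\<Sum>j\<in>F. \<Sum>k\<in>F. ((r j)\<^sup>2 / 2) * B j k + ((r k)\<^sup>2 / 2) * B j k)"
  proof (intro sum_mono)
    fix j k
    have "r j * r k \<le> (r j)\<^sup>2 / 2 + (r k)\<^sup>2 / 2" using sum_squares_bound[of "r j" "r k"] by simp
    then have "r j * r k * B j k \<le> ((r j)\<^sup>2 / 2 + (r k)\<^sup>2 / 2) * B j k" by (rule mult_right_mono[OF _ B(1)])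
    then show "r j * r k * B j k \<le> ((r j)\<^sup>2 / 2) * B j k + ((r k)\<^sup>2 / 2) * B j k" by (simp only: distrib_right)
  qed
  also have "\<dots> = (\<Sum>j\<in>F. ((r j)\<^sup>2 / 2) * (\<Sum>k\<in>F. B j k)) + (\<Sum>k\<in>F. ((r k)\<^sup>2 / 2) * (\<Sum>j\<in>F. B j k))"
    unfolding sum.distrib sum_distrib_left by (rule arg_cong[OF sum.swap])
  also have "\<dots> \<le> (\<Sum>j\<in>F. ((r j)\<^sup>2 / 2) * S) + (\<Sum>k\<in>F. ((r k)\<^sup>2 / 2) * S)"
  proof (intro add_mono sum_mono mult_left_mono)
    show "(\<Sum>k\<in>F. B j k) \<le> S" if "j \<in> F" for j
      using S[OF that] by (subst B(2)) simp
  qed (use S in auto)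
  also have "\<dots> = S * (\<Sum>k\<in>F. (r k)\<^sup>2)"
    by (simp add: sum_distrib_left sum.distrib[symmetric] field_simps)
  finally show ?thesis .
qed

text \<open>Expanding the square gives a quadratic form whose matrix entries are values of
  \<open>wthat\<close> at the differences of frequencies, to which Schur's test applies.\<close>

lemma exp_sum_upper:
  assumes F: "finite F" and S: "\<And>k. k \<in> F \<Longrightarrow> (\<Sum>j\<in>F. norm (wthat a b (\<nu> j - \<nu> k))) \<le> S"
  shows "(LINT s|lebesgue_on {a<..<b}. wt a b s * (norm (\<Sum>j\<in>F. c j * cis (\<nu> j * s)))\<^sup>2) \<le> S * (\<Sum>k\<in>F. (norm (c k))\<^sup>2)"
proof -
  have "(LINT s|lebesgue_on {a<..<b}. wt a b s * (norm (\<Sum>j\<in>F. c j * cis (\<nu> j * s)))\<^sup>2)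
      \<le> norm (complex_of_real (LINT s|lebesgue_on {a<..<b}. wt a b s * (norm (\<Sum>j\<in>F. c j * cis (\<nu> j * s)))\<^sup>2))"
    unfolding norm_of_real by simp
  also have "\<dots> \<le> (\<Sum>j\<in>F. \<Sum>k\<in>F. norm (c j) * norm (c k) * norm (wthat a b (\<nu> j - \<nu> k)))"
    unfolding integral_exp_sum_norm[OF F]
    by (rule order_trans[OF norm_sum sum_mono], rule order_trans[OF norm_sum sum_mono]) (simp add: norm_mult)
  also have "\<dots> \<le> S * (\<Sum>k\<in>F. (norm (c k))\<^sup>2)"
    by (rule schur_test[OF F norm_ge_zero _ S]) (metis minus_diff_eq wthat_minus)
  finally show ?thesis .
qed

text \<open>Duality: with a_k the moments of \<open>g\<close> and \<open>H\<close> the exponential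
  sum with the conjugate coefficients, the sum of |a_k|^2 equals the integral of \<open>H\<close>
  times \<open>g\<close>, and the upper bound for exponential sums controls \<open>H\<close>. The
  weight is placed on (-T, 2 T) because the one of (0, T) would degenerate at 0 and T.\<close>

lemma exp_bessel:
  fixes g :: "real \<Rightarrow> complex"
  assumes T: "0 < T" and g: "g \<in> L2_fun 0 T" and F: "finite F"
    and S: "\<And>k. k \<in> F \<Longrightarrow> (\<Sum>j\<in>F. norm (wthat (- T) (2 * T) (\<nu> j - \<nu> k))) \<le> S" and S0: "0 < S"
  shows "(\<Sum>k\<in>F. (norm (LINT s|lebesgue_on {0<..<T}. cis (\<nu> k * s) * g s))\<^sup>2)
     \<le> S / (2 * T\<^sup>2) * (LINT s|lebesgue_on {0<..<T}. (norm (g s))\<^sup>2)"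
proof -
  let ?M = "lebesgue_on {0<..<T}" and ?M' = "lebesgue_on {- T<..<2 * T}"
  define a where "a k = (LINT s|lebesgue_on {0<..<T}. cis (\<nu> k * s) * g s)" for k
  define H where "H s = (\<Sum>k\<in>F. cnj (a k) * cis (\<nu> k * s))" for s
  \<comment> \<open>With this \<open>C\<close> Young's inequality leaves half of the left side on
    the right, where it is absorbed.\<close>
  define C where "C = S / (2 * T\<^sup>2)"
  have C: "C > 0" using S0 T by (simp add: C_def)
  have Hc: "continuous_on X H" for X unfolding H_def by (intro continuous_intros)
  have cL: "(\<lambda>s. h s * g s) \<in> L2_fun 0 T" if h: "continuous_on UNIV h" for h
  proof -
    obtain K where K: "\<And>x. x \<in> {0..T} \<Longrightarrow> norm (h x) \<le> K" using continuous_bounded_on[OF h] by metis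
    note [measurable] = L2_funD(1)[OF g] continuous_measurable_on[OF h]
    show ?thesis
      by (rule L2_fun_bound[OF g, where C = K]) (auto intro!: AE_I2 mult_right_mono K simp: norm_mult)
  qed
  have I: "integrable ?M (\<lambda>s. cis (\<nu> k * s) * g s)" for k
    by (intro L2_fun_integrable cL continuous_intros)
  have Hint: "integrable (lebesgue_on {p<..<q}) (\<lambda>s. (norm (H s))\<^sup>2)" for p q
    by (intro continuous_integrable_open continuous_intros Hc)
  have "complex_of_real (\<Sum>k\<in>F. (norm (a k))\<^sup>2) = (\<Sum>k\<in>F. cnj (a k) * a k)"
    unfolding of_real_sum complex_norm_square by (simp add: mult.commute)
  also have "\<dots> = (\<Sum>k\<in>F. (LINT s|lebesgue_on {0<..<T}. (cnj (a k)) * (cis (\<nu> k * s) * g s)))"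
    by (subst (2) a_def) simp
  also have "\<dots> = (LINT s|lebesgue_on {0<..<T}. (\<Sum>k\<in>F. cnj (a k) * (cis (\<nu> k * s) * g s)))"
    by (rule Bochner_Integration.integral_sum[symmetric]) (intro integrable_mult_right I)
  also have "\<dots> = (LINT s|lebesgue_on {0<..<T}. H s * g s)"
    by (simp add: H_def sum_distrib_right mult.assoc)
  finally have eq: "complex_of_real (\<Sum>k\<in>F. (norm (a k))\<^sup>2) = (LINT s|lebesgue_on {0<..<T}. H s * g s)" .
  have "(\<Sum>k\<in>F. (norm (a k))\<^sup>2) = norm (complex_of_real (\<Sum>k\<in>F. (norm (a k))\<^sup>2))"
    unfolding norm_of_real by (simp add: sum_nonneg)
  also have "\<dots> \<le> (LINT s|lebesgue_on {0<..<T}. (C / 2) * (norm (g s))\<^sup>2 + (1 / (2 * C)) * (norm (H s))\<^sup>2)"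
    unfolding eq
  proof (rule Bochner_Integration.integral_norm_bound_integral)
    show "integrable ?M (\<lambda>s. H s * g s)" by (intro L2_fun_integrable cL Hc)
    show "integrable ?M (\<lambda>s. (C / 2) * (norm (g s))\<^sup>2 + (1 / (2 * C)) * (norm (H s))\<^sup>2)"
      by (intro Bochner_Integration.integrable_add integrable_mult_right L2_funD(2)[OF g] Hint)
    fix s
    have "2 * (C * norm (g s)) * norm (H s) \<le> (C * norm (g s))\<^sup>2 + (norm (H s))\<^sup>2" by (rule sum_squares_bound)
    then show "norm (H s * g s) \<le> (C / 2) * (norm (g s))\<^sup>2 + (1 / (2 * C)) * (norm (H s))\<^sup>2"
      using C by (simp add: norm_mult field_simps power2_eq_square)
  qed
  also have "\<dots> = (C / 2) * (LINT s|lebesgue_on {0<..<T}. (norm (g s))\<^sup>2) + (1 / (2 * C)) * (LINT s|lebesgue_on {0<..<T}. (norm (H s))\<^sup>2)"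
    using L2_funD(2)[OF g] Hint by simp
  finally have le1: "(\<Sum>k\<in>F. (norm (a k))\<^sup>2)
      \<le> (C / 2) * (LINT s|lebesgue_on {0<..<T}. (norm (g s))\<^sup>2) + (1 / (2 * C)) * (LINT s|lebesgue_on {0<..<T}. (norm (H s))\<^sup>2)" .
  have "(LINT s|lebesgue_on {0<..<T}. (norm (H s))\<^sup>2) \<le> C * (\<Sum>k\<in>F. (norm (a k))\<^sup>2)"
  proof -
    have "(LINT s|lebesgue_on {0<..<T}. 2 * T\<^sup>2 * (norm (H s))\<^sup>2) \<le> (LINT s|?M'. wt (- T) (2 * T) s * (norm (H s))\<^sup>2)"
    proof -
      have i1: "integrable ?M (\<lambda>s. 2 * T\<^sup>2 * (norm (H s))\<^sup>2)" by (intro integrable_mult_right Hint)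
      have i2: "integrable ?M' (\<lambda>s. wt (- T) (2 * T) s * (norm (H s))\<^sup>2)"
        by (intro continuous_integrable_open continuous_intros Hc)
      have le: "indicator {0<..<T} s *\<^sub>R (2 * T\<^sup>2 * (norm (H s))\<^sup>2)
          \<le> indicator {- T<..<2 * T} s *\<^sub>R (wt (- T) (2 * T) s * (norm (H s))\<^sup>2)" for s
      proof (cases "s \<in> {0<..<T}")
        case True
        \<comment> \<open>The weight of the larger interval is (s + T) (2 T - s) = 2 T^2 + s (T -
          s).\<close>
        then have "0 \<le> s * (T - s)" by simp
        then have "2 * T\<^sup>2 \<le> wt (- T) (2 * T) s" by (simp add: wt_def algebra_simps power2_eq_square)
        then show ?thesis using True T by (simp add: mult_right_mono)
      next
        case False
        then show ?thesis using wt_nonneg[of s "- T" "2 * T"] by (auto simp: indicator_def)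
      qed
      have "integrable lebesgue (\<lambda>s. indicator {0<..<T} s *\<^sub>R (2 * T\<^sup>2 * (norm (H s))\<^sup>2))"
        "integrable lebesgue (\<lambda>s. indicator {- T<..<2 * T} s *\<^sub>R (wt (- T) (2 * T) s * (norm (H s))\<^sup>2))"
        by (rule integrable_restrict_space[THEN iffD1, OF _ i1] integrable_restrict_space[THEN iffD1, OF _ i2]; simp)+
      then show ?thesis
        by (subst (1 2) integral_restrict_space, simp, simp) (rule integral_mono[OF _ _ le])
    qed
    also have "\<dots> \<le> S * (\<Sum>k\<in>F. (norm (cnj (a k)))\<^sup>2)"
      unfolding H_def by (rule exp_sum_upper[OF F S])
    finally show ?thesis using T unfolding integral_mult_right_zero by (simp add: C_def field_simps)
  qed
  then have "(1 / (2 * C)) * (LINT s|lebesgue_on {0<..<T}. (norm (H s))\<^sup>2) \<le> (1 / (2 * C)) * (C * (\<Sum>k\<in>F. (norm (a k))\<^sup>2))"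
    using C by (intro mult_left_mono) auto
  also have "\<dots> = (\<Sum>k\<in>F. (norm (a k))\<^sup>2) / 2" using C by simp
  finally have "(\<Sum>k\<in>F. (norm (a k))\<^sup>2)
      \<le> (C / 2) * (LINT s|lebesgue_on {0<..<T}. (norm (g s))\<^sup>2) + (\<Sum>k\<in>F. (norm (a k))\<^sup>2) / 2"
    using le1 by linarith
  then have "(\<Sum>k\<in>F. (norm (a k))\<^sup>2) \<le> C * (LINT s|lebesgue_on {0<..<T}. (norm (g s))\<^sup>2)"
    by simp
  then show ?thesis by (simp add: C_def a_def)
qed

section \<open>Gaps of the spectrum\<close>

lemma eigval_diff: "eigval u0 j - eigval u0 k = 4 * pi\<^sup>2 * (of_int (j - k) * (of_int (j + k) - u0 / (2 * pi)))"
  by (simp add: eigval_def field_simps power2_eq_square)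

text \<open>Outside \<open>E\<close> the second factor of the gap is at least 1/2, so the gap is at
  least |j - k| and the decay of \<open>wthat\<close> is summable. \<open>E\<close> contains at most
  k and one further, nearly resonant, index with j + k close to u0 / (2 pi); these two are estimated
  by \<open>wthat_le\<close>.\<close>

lemma eigval_sum_bound:
  assumes ab: "a < b" and F: "finite F"
  shows "(\<Sum>j\<in>F. norm (wthat a b (eigval u0 j - eigval u0 k))) \<le> 4 * (b - a) * jb_const + 2 * (b - a) ^ 3"
proof -
  let ?W = "\<lambda>j. norm (wthat a b (eigval u0 j - eigval u0 k))"
  define E where "E = {j \<in> F. j = k \<or> \<bar>of_int (j + k) - u0 / (2 * pi)\<bar> < 1 / 2}"
  have E: "finite E" "E \<subseteq> F" using F by (auto simp: E_def)
  have "card E \<le> 2"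
  proof -
    have "j = j'" if "\<bar>of_int (j + k) - u0 / (2 * pi)\<bar> < 1 / 2" "\<bar>of_int (j' + k) - u0 / (2 * pi)\<bar> < 1 / 2" for j j'
    proof -
      have "\<bar>real_of_int (j - j')\<bar> < 1" using that unfolding of_int_add of_int_diff by linarith
      then show ?thesis by linarith
    qed
    then obtain m where "{j. \<bar>of_int (j + k) - u0 / (2 * pi)\<bar> < 1 / 2} \<subseteq> {m}" by blast
    then have "E \<subseteq> {k, m}" by (auto simp: E_def)
    then have "card E \<le> card {k, m}" by (intro card_mono) auto
    also have "\<dots> \<le> 2" by (simp add: card_insert_if)
    finally show ?thesis .
  qed
  have "(\<Sum>j\<in>F. ?W j) = (\<Sum>j\<in>F - E. ?W j) + (\<Sum>j\<in>E. ?W j)"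
    using E F by (metis sum.subset_diff)
  also have "(\<Sum>j\<in>E. ?W j) \<le> real (card E) * (b - a) ^ 3"
    by (rule sum_bounded_above) (rule wthat_le[OF ab])
  also have "\<dots> \<le> 2 * (b - a) ^ 3"
    using \<open>card E \<le> 2\<close> ab by (intro mult_right_mono) auto
  also have "(\<Sum>j\<in>F - E. ?W j) \<le> (\<Sum>j\<in>F - E. 4 * (b - a) * (1 / (jb (j - k))\<^sup>2))"
  proof (rule sum_mono)
    fix j assume "j \<in> F - E"
    then have j: "j \<noteq> k" "1 / 2 \<le> \<bar>of_int (j + k) - u0 / (2 * pi)\<bar>" by (auto simp: E_def)
    let ?\<omega> = "eigval u0 j - eigval u0 k"
    have jbe: "jb (j - k) = \<bar>real_of_int (j - k)\<bar>" using j(1) by (simp add: jb_def)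
    have pi2: "2 \<le> 4 * pi\<^sup>2"
    proof -
      have "1 \<le> pi\<^sup>2" using pi_ge_two by (simp add: one_le_power)
      then show ?thesis by simp
    qed
    have "jb (j - k) = 2 * (\<bar>real_of_int (j - k)\<bar> * (1 / 2))" by (simp add: jbe)
    also have "\<dots> \<le> 4 * pi\<^sup>2 * (\<bar>real_of_int (j - k)\<bar> * \<bar>of_int (j + k) - u0 / (2 * pi)\<bar>)"
      using j(2) pi2 by (intro mult_mono mult_left_mono) auto
    also have "\<dots> = \<bar>?\<omega>\<bar>" by (simp only: eigval_diff abs_mult) simp
    finally have le: "jb (j - k) \<le> \<bar>?\<omega>\<bar>" .
    then have nz: "?\<omega> \<noteq> 0" using jb_pos[of "j - k"] by linarith
    have "(jb (j - k))\<^sup>2 \<le> \<bar>?\<omega>\<bar>\<^sup>2" using le by (intro power_mono) (auto simp: less_imp_le)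
    then have "4 * (b - a) / ?\<omega>\<^sup>2 \<le> 4 * (b - a) / (jb (j - k))\<^sup>2"
      using ab nz by (intro divide_left_mono mult_pos_pos zero_less_power2[THEN iffD2]) auto
    then show "?W j \<le> 4 * (b - a) * (1 / (jb (j - k))\<^sup>2)"
      using wthat_decay[OF ab nz] by simp
  qed
  also have "\<dots> = 4 * (b - a) * (\<Sum>j\<in>(\<lambda>j. j - k) ` (F - E). 1 / (jb j)\<^sup>2)"
    unfolding sum_distrib_left[symmetric] by (subst sum.reindex) (auto simp: inj_on_def)
  also have "\<dots> \<le> 4 * (b - a) * jb_const"
    using ab F by (intro mult_left_mono sum_jb_le) auto
  finally show ?thesis by simp
qed

text \<open>The constant of \<open>exp_bessel\<close> for the enlarged interval, which has length 3
  T.\<close>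

definition bessel_const :: "real \<Rightarrow> real" where
  "bessel_const T = (4 * (3 * T) * jb_const + 2 * (3 * T) ^ 3) / (2 * T\<^sup>2)"

lemma jb_const_pos: "0 < jb_const"
  using sum_jb_le[of "{0}"] by (simp add: jb_def)

lemma bessel_const_pos: "0 < T \<Longrightarrow> 0 < bessel_const T"
  using jb_const_pos by (simp add: bessel_const_def add_pos_pos)

lemma eigval_bessel:
  fixes g :: "real \<Rightarrow> complex"
  assumes T: "0 < T" and g: "g \<in> L2_fun 0 T" and F: "finite F"
  shows "(\<Sum>k\<in>F. (norm (LINT s|lebesgue_on {0<..<T}. cis (eigval u0 k * s) * g s))\<^sup>2)
     \<le> bessel_const T * (LINT s|lebesgue_on {0<..<T}. (norm (g s))\<^sup>2)"
  unfolding bessel_const_def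
proof (rule exp_bessel[OF T g F])
  show "(\<Sum>j\<in>F. norm (wthat (- T) (2 * T) (eigval u0 j - eigval u0 k))) \<le> 4 * (3 * T) * jb_const + 2 * (3 * T) ^ 3" for k
    using eigval_sum_bound[OF _ F, of "- T" "2 * T" u0 k] T by simp
  show "0 < 4 * (3 * T) * jb_const + 2 * (3 * T) ^ 3" using T jb_const_pos by (simp add: add_pos_pos)
qed

section \<open>Square-integrable functions of time with values in $L^2(0,1)$\<close>

text \<open>The analogue of \<open>L2_fun\<close> for values in \<open>l2\<close>, which is not a
  Euclidean space.\<close>

definition L2V :: "real \<Rightarrow> (real \<Rightarrow> l2) set" where
  "L2V T = {q \<in> borel_measurable (lebesgue_on {0<..<T}). integrable (lebesgue_on {0<..<T}) (\<lambda>s. (norm (q s))\<^sup>2)}"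

lemma L2VD:
  assumes "q \<in> L2V T"
  shows "q \<in> borel_measurable (lebesgue_on {0<..<T})"
    and "integrable (lebesgue_on {0<..<T}) (\<lambda>s. (norm (q s))\<^sup>2)"
  using assms by (auto simp: L2V_def)

lemma continuous_measurable_l2:
  fixes f :: "real \<Rightarrow> 'a::{second_countable_topology, real_normed_vector}"
  assumes "continuous_on UNIV f"
  shows "f \<in> borel_measurable (lebesgue_on S)"
  using borel_measurable_continuous_onI[OF assms]
  by (intro measurable_restrict_space1 measurable_completion) simp

lemma bounded_linear_measurable:
  assumes "bounded_linear f" "q \<in> borel_measurable N"
  shows "(\<lambda>s. f (q s)) \<in> borel_measurable N"
  using borel_measurable_continuous_on[OF linear_continuous_on[OF assms(1)] assms(2)] .

lemma L2V_bound:
  assumes p: "integrable (lebesgue_on {0<..<T}) (\<lambda>s. (norm (p s))\<^sup>2)"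
    and q: "q \<in> borel_measurable (lebesgue_on {0<..<T})"
    and le: "\<And>s. s \<in> {0<..<T} \<Longrightarrow> norm (q s) \<le> C * norm (p s)"
  shows "q \<in> L2V T"
    and "(LINT s|lebesgue_on {0<..<T}. (norm (q s))\<^sup>2) \<le> C\<^sup>2 * (LINT s|lebesgue_on {0<..<T}. (norm (p s))\<^sup>2)"
proof -
  have le2: "(norm (q s))\<^sup>2 \<le> C\<^sup>2 * (norm (p s))\<^sup>2" if "s \<in> {0<..<T}" for s
    using power_mono[OF le[OF that] norm_ge_zero, of 2] by (simp add: power_mult_distrib)
  have i: "integrable (lebesgue_on {0<..<T}) (\<lambda>s. C\<^sup>2 * (norm (p s))\<^sup>2)" using p by simp
  have iq: "integrable (lebesgue_on {0<..<T}) (\<lambda>s. (norm (q s))\<^sup>2)"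
    by (rule Bochner_Integration.integrable_bound[OF i]) (use q le2 in auto)
  then show "q \<in> L2V T" using q by (simp add: L2V_def)
  have "(LINT s|lebesgue_on {0<..<T}. (norm (q s))\<^sup>2) \<le> (LINT s|lebesgue_on {0<..<T}. C\<^sup>2 * (norm (p s))\<^sup>2)"
    by (rule integral_mono[OF iq i]) (use le2 in auto)
  then show "(LINT s|lebesgue_on {0<..<T}. (norm (q s))\<^sup>2) \<le> C\<^sup>2 * (LINT s|lebesgue_on {0<..<T}. (norm (p s))\<^sup>2)"
    by simp
qed

lemma L2V_add:
  assumes "p \<in> L2V T" "q \<in> L2V T"
  shows "(\<lambda>s. p s + q s) \<in> L2V T"
proof -
  note [measurable] = L2VD(1)[OF assms(1)] L2VD(1)[OF assms(2)]
  have "integrable (lebesgue_on {0<..<T}) (\<lambda>s. (norm (p s + q s))\<^sup>2)"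
  proof (rule Bochner_Integration.integrable_bound)
    show "integrable (lebesgue_on {0<..<T}) (\<lambda>s. 2 * (norm (p s))\<^sup>2 + 2 * (norm (q s))\<^sup>2)"
      using L2VD(2)[OF assms(1)] L2VD(2)[OF assms(2)] by simp
    have "(norm (p s + q s))\<^sup>2 \<le> 2 * (norm (p s))\<^sup>2 + 2 * (norm (q s))\<^sup>2" for s
    proof -
      have "(norm (p s + q s))\<^sup>2 \<le> (norm (p s) + norm (q s))\<^sup>2"
        by (intro power_mono norm_triangle_ineq) auto
      also have "\<dots> \<le> 2 * (norm (p s))\<^sup>2 + 2 * (norm (q s))\<^sup>2"
        using sum_squares_bound[of "norm (p s)" "norm (q s)"] by (simp add: power2_sum)
      finally show ?thesis .
    qed
    then show "AE s in lebesgue_on {0<..<T}. norm ((norm (p s + q s))\<^sup>2)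
        \<le> norm (2 * (norm (p s))\<^sup>2 + 2 * (norm (q s))\<^sup>2)" by auto
  qed measurable
  then show ?thesis by (simp add: L2V_def)
qed

lemma L2V_scaleR:
  assumes q: "q \<in> L2V T" and h: "h \<in> borel_measurable (lebesgue_on {0<..<T})"
    and le: "\<And>s. s \<in> {0<..<T} \<Longrightarrow> \<bar>h s\<bar> \<le> C"
  shows "(\<lambda>s. h s *\<^sub>R q s) \<in> L2V T"
  by (rule L2V_bound(1)[OF L2VD(2)[OF q], where C = C])
    (use h L2VD(1)[OF q] le in \<open>auto intro!: mult_right_mono borel_measurable_scaleR\<close>)

lemma L2V_diff:
  assumes "p \<in> L2V T" "q \<in> L2V T"
  shows "(\<lambda>s. p s - q s) \<in> L2V T"
  using L2V_add[OF assms(1) L2V_scaleR[OF assms(2), of "\<lambda>_. - 1" 1]] by simp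

lemma L2V_control:
  assumes u: "u \<in> L2_fun 0 T" and f: "f \<in> borel_measurable (lebesgue_on {0<..<T})"
    and le: "\<And>s. s \<in> {0<..<T} \<Longrightarrow> norm (f s) \<le> B"
  shows "(\<lambda>s. u s *\<^sub>R f s) \<in> L2V T"
    and "(LINT s|lebesgue_on {0<..<T}. (norm (u s *\<^sub>R f s))\<^sup>2) \<le> B\<^sup>2 * (LINT s|lebesgue_on {0<..<T}. (u s)\<^sup>2)"
proof -
  note [measurable] = L2_funD(1)[OF u] f
  have "norm (u s *\<^sub>R f s) \<le> B * norm (u s)" if "s \<in> {0<..<T}" for s
    using mult_right_mono[OF le[OF that], of "\<bar>u s\<bar>"] by (simp add: mult.commute)
  note * = L2V_bound[where q = "\<lambda>s. u s *\<^sub>R f s", OF L2_funD(2)[OF u] _ this]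
  show "(\<lambda>s. u s *\<^sub>R f s) \<in> L2V T" by (rule *(1)) measurable
  show "(LINT s|lebesgue_on {0<..<T}. (norm (u s *\<^sub>R f s))\<^sup>2) \<le> B\<^sup>2 * (LINT s|lebesgue_on {0<..<T}. (u s)\<^sup>2)"
    using *(2) by simp
qed

lemma L2V_linear:
  assumes f: "bounded_linear f"
  shows "\<exists>K>0. \<forall>q\<in>L2V T. (\<lambda>s. f (q s)) \<in> L2V T \<and>
    (LINT s|lebesgue_on {0<..<T}. (norm (f (q s)))\<^sup>2) \<le> K * (LINT s|lebesgue_on {0<..<T}. (norm (q s))\<^sup>2)"
proof -
  obtain K where K: "0 < K" "\<And>x. norm (f x) \<le> norm x * K" using bounded_linear.pos_bounded[OF f] by blast
  show ?thesis
  proof (intro exI[of _ "K\<^sup>2"] conjI ballI)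
    fix q assume q: "q \<in> L2V T"
    note * = L2V_bound[OF L2VD(2)[OF q] bounded_linear_measurable[OF f L2VD(1)[OF q]], of K]
    show "(\<lambda>s. f (q s)) \<in> L2V T" by (rule *(1)) (use K in \<open>simp add: mult.commute\<close>)
    show "(LINT s|lebesgue_on {0<..<T}. (norm (f (q s)))\<^sup>2) \<le> K\<^sup>2 * (LINT s|lebesgue_on {0<..<T}. (norm (q s))\<^sup>2)"
      by (rule *(2)) (use K in \<open>simp add: mult.commute\<close>)
  qed (use K in simp)
qed

lemma L2V_functional:
  fixes f :: "l2 \<Rightarrow> complex"
  assumes q: "q \<in> L2V T" and f: "bounded_linear f" and K: "\<And>x. norm (f x) \<le> K * norm x"
  shows "(\<lambda>s. f (q s)) \<in> L2_fun 0 T"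
    and "(LINT s|lebesgue_on {0<..<T}. (norm (f (q s)))\<^sup>2) \<le> K\<^sup>2 * (LINT s|lebesgue_on {0<..<T}. (norm (q s))\<^sup>2)"
proof -
  have le2: "(norm (f (q s)))\<^sup>2 \<le> K\<^sup>2 * (norm (q s))\<^sup>2" for s
    using power_mono[OF K[of "q s"] norm_ge_zero, of 2] by (simp add: power_mult_distrib)
  note m = bounded_linear_measurable[OF f L2VD(1)[OF q]]
  have i: "integrable (lebesgue_on {0<..<T}) (\<lambda>s. K\<^sup>2 * (norm (q s))\<^sup>2)" using L2VD(2)[OF q] by simp
  have iq: "integrable (lebesgue_on {0<..<T}) (\<lambda>s. (norm (f (q s)))\<^sup>2)"
    by (rule Bochner_Integration.integrable_bound[OF i]) (use m le2 in auto)
  then show "(\<lambda>s. f (q s)) \<in> L2_fun 0 T" using m by (simp add: L2_fun_def)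
  have "(LINT s|lebesgue_on {0<..<T}. (norm (f (q s)))\<^sup>2) \<le> (LINT s|lebesgue_on {0<..<T}. K\<^sup>2 * (norm (q s))\<^sup>2)"
    by (rule integral_mono[OF iq i]) (use le2 in auto)
  then show "(LINT s|lebesgue_on {0<..<T}. (norm (f (q s)))\<^sup>2) \<le> K\<^sup>2 * (LINT s|lebesgue_on {0<..<T}. (norm (q s))\<^sup>2)"
    by simp
qed

lemma L2_fun_cis_mult:
  assumes g: "g \<in> L2_fun a b"
  shows "(\<lambda>s. cis (\<omega> * s) * g s) \<in> L2_fun a b"
proof -
  have [measurable]: "(\<lambda>s. cis (\<omega> * s)) \<in> borel_measurable (lebesgue_on {a<..<b})"
    by (intro continuous_measurable_on continuous_intros)
  note [measurable] = L2_funD(1)[OF g]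
  show ?thesis by (rule L2_fun_bound[OF g, where C = 1]) (auto simp: norm_mult)
qed

text \<open>Cauchy-Schwarz, read off from the nonnegative variance of \<open>norm (h s)\<close>
  about its mean m / T.\<close>

lemma norm_integral_sq_le:
  fixes h :: "real \<Rightarrow> complex"
  assumes T: "0 < T" and h: "h \<in> L2_fun 0 T"
  shows "(norm (LINT s|lebesgue_on {0<..<T}. h s))\<^sup>2 \<le> T * (LINT s|lebesgue_on {0<..<T}. (norm (h s))\<^sup>2)"
proof -
  define m where "m = (LINT s|lebesgue_on {0<..<T}. norm (h s))"
  have m0: "norm (LINT s|lebesgue_on {0<..<T}. h s) \<le> m" unfolding m_def by (rule integral_norm_bound)
  have i: "integrable (lebesgue_on {0<..<T}) (\<lambda>s. norm (h s))" by (intro integrable_norm L2_fun_integrable h)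
  have c: "integrable (lebesgue_on {0<..<T}) (\<lambda>s. (m / T)\<^sup>2)"
    by (rule finite_measure.integrable_const[OF finite_measure_lebesgue_on])
  have "0 \<le> (LINT s|lebesgue_on {0<..<T}. (norm (h s) - m / T)\<^sup>2)"
    by (rule Bochner_Integration.integral_nonneg) simp
  also have "\<dots> = (LINT s|lebesgue_on {0<..<T}. (norm (h s))\<^sup>2 + (m / T)\<^sup>2 - 2 * (m / T) * norm (h s))"
    by (simp add: power2_diff mult_ac)
  also have "\<dots> = (LINT s|lebesgue_on {0<..<T}. (norm (h s))\<^sup>2) + T * (m / T)\<^sup>2 - 2 * (m / T) * m"
    using i c L2_funD(2)[OF h] T by (simp add: m_def measure_restrict_space)
  also have "\<dots> = (LINT s|lebesgue_on {0<..<T}. (norm (h s))\<^sup>2) - m\<^sup>2 / T"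
    using T by (simp add: power2_eq_square field_simps)
  finally have "m\<^sup>2 \<le> T * (LINT s|lebesgue_on {0<..<T}. (norm (h s))\<^sup>2)" using T by (simp add: field_simps)
  then show ?thesis using power_mono[OF m0 norm_ge_zero, of 2] by linarith
qed

text \<open>Orthogonality in x does the work, so the frequencies are arbitrary: the scalar estimate
  is applied for each k and Bessel's inequality at each time. Its counterpart is
  \<open>eigval_bessel\<close>, where one scalar function of time meets all frequencies.\<close>

lemma bessel_vector:
  assumes T: "0 < T" and p: "p \<in> L2V T" and F: "finite F"
  shows "(\<Sum>k\<in>F. (norm (LINT s|lebesgue_on {0<..<T}. cis (\<omega> k * s) * cinner (p s) (phi k)))\<^sup>2)
     \<le> T * (LINT s|lebesgue_on {0<..<T}. (norm (p s))\<^sup>2)"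
proof -
  have L: "(\<lambda>s. cinner (p s) (phi k)) \<in> L2_fun 0 T" for k
    by (rule L2V_functional(1)[OF p bounded_linear_cinner_left, where K = 1])
      (use norm_cinner_le[of _ "phi k"] in simp)
  have "(\<Sum>k\<in>F. (norm (LINT s|lebesgue_on {0<..<T}. cis (\<omega> k * s) * cinner (p s) (phi k)))\<^sup>2)
      \<le> (\<Sum>k\<in>F. T * (LINT s|lebesgue_on {0<..<T}. (norm (cis (\<omega> k * s) * cinner (p s) (phi k)))\<^sup>2))"
    by (intro sum_mono norm_integral_sq_le T L2_fun_cis_mult L)
  also have "\<dots> = T * (LINT s|lebesgue_on {0<..<T}. (\<Sum>k\<in>F. (norm (cinner (p s) (phi k)))\<^sup>2))"
    using L2_funD(2)[OF L] by (simp add: norm_mult sum_distrib_left)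
  also have "\<dots> \<le> T * (LINT s|lebesgue_on {0<..<T}. (norm (p s))\<^sup>2)"
    using T L2_funD(2)[OF L] by (intro mult_left_mono integral_mono L2VD(2)[OF p] bessel F) auto
  finally show ?thesis .
qed


section \<open>The Duhamel operator\<close>

text \<open>\<open>M\<close> stands for multiplication by \<open>\<mu>\<close>, which enters through
  these properties alone; \<open>M_deriv\<close> is the integration by parts.\<close>

locale control =
  fixes M Gop :: "l2 \<Rightarrow> l2" and I :: "'i set" and cf :: "'i \<Rightarrow> complex" and pt :: "'i \<Rightarrow> real"
    and u0 T :: real
  assumes M: "bounded_linear M"
    and M_cscale: "M (cscale c x) = cscale c (M x)"
    and M_sym: "cinner (M x) y = cinner x (M y)"
    and Gop: "bounded_linear Gop" and I: "finite I"
    and M_deriv: "2 * pi * \<i> * of_int k * cinner (M (Lam \<eta>)) (phi k)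
       = cinner (Gop \<eta>) (phi k) - (\<Sum>i\<in>I. cf i * (ev \<eta> (pt i) * cnj (phi_fun k (pt i))))"
    and T: "0 < T"
begin

abbreviation "MT \<equiv> lebesgue_on {0<..<T}"
abbreviation "U \<equiv> evol (eigval u0)"

text \<open>The k-th coefficient of the Duhamel integral at time T in the interaction picture, with
  \<open>Lam\<close> removed; the factor \<open>jb k\<close> is the derivative that has to be
  gained.\<close>

definition gam :: "(real \<Rightarrow> l2) \<Rightarrow> int \<Rightarrow> complex" where
  "gam q k = - \<i> * of_real (jb k) * (LINT s|MT. cis (eigval u0 k * s) * cinner (M (Lam (q s))) (phi k))"

lemma MLam: "bounded_linear (\<lambda>x. M (Lam x))"
  by (rule bounded_linear_compose[OF M bounded_linear_Lam])

lemma coef_MLam: "bounded_linear (\<lambda>x. cinner (M (Lam x)) (phi k))"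
  by (rule bounded_linear_compose[OF bounded_linear_cinner_left MLam])

lemma gam_L2:
  assumes "q \<in> L2V T"
  shows "(\<lambda>s. cis (eigval u0 k * s) * cinner (M (Lam (q s))) (phi k)) \<in> L2_fun 0 T"
proof -
  obtain K where K: "\<And>x. norm (cinner (M (Lam x)) (phi k)) \<le> norm x * K"
    using bounded_linear.bounded[OF coef_MLam] by blast
  show ?thesis
    by (intro L2_fun_cis_mult L2V_functional(1)[OF assms coef_MLam, where K = K])
      (use K in \<open>simp add: mult.commute\<close>)
qed

text \<open>The hidden regularity. Apart from k = 0, \<open>jb k\<close> is dominated by the factor
  2 pi |k| of \<open>M_deriv\<close>. Orthogonality in x handles the term with \<open>Gop\<close>.
  The boundary terms have no decay in k, and for them it is the growth of the spectral gaps that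
  bounds the sum over k.\<close>

lemma gam_bound: "\<exists>C>0. \<forall>q\<in>L2V T. \<forall>F. finite F \<longrightarrow>
    (\<Sum>k\<in>F. (norm (gam q k))\<^sup>2) \<le> C * (LINT s|MT. (norm (q s))\<^sup>2)"
proof -
  obtain KM where KM: "0 < KM" "\<And>q. q \<in> L2V T \<Longrightarrow> (\<lambda>s. M (Lam (q s))) \<in> L2V T"
    "\<And>q. q \<in> L2V T \<Longrightarrow> (LINT s|MT. (norm (M (Lam (q s))))\<^sup>2) \<le> KM * (LINT s|MT. (norm (q s))\<^sup>2)"
    using L2V_linear[OF MLam, of T] by metis
  obtain KG where KG: "0 < KG" "\<And>q. q \<in> L2V T \<Longrightarrow> (\<lambda>s. Gop (q s)) \<in> L2V T"
    "\<And>q. q \<in> L2V T \<Longrightarrow> (LINT s|MT. (norm (Gop (q s)))\<^sup>2) \<le> KG * (LINT s|MT. (norm (q s))\<^sup>2)"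
    using L2V_linear[OF Gop, of T] by metis
  let ?S = "\<Sum>i\<in>I. (norm (cf i))\<^sup>2"
  let ?B = "real (card I) * (bessel_const T * (norm (rho 0))\<^sup>2)"
  \<comment> \<open>The 3 comes from the square of a sum of three terms; \<open>?S * ?B\<close> is
    Cauchy-Schwarz over the finitely many boundary values.\<close>
  define C where "C = 3 * (T * KM + T * KG + ?S * ?B)"
  have C: "C > 0"
    unfolding C_def using T KM(1) KG(1) bessel_const_pos[OF T]
    by (intro mult_pos_pos add_pos_nonneg mult_nonneg_nonneg sum_nonneg) auto
  have "(\<Sum>k\<in>F. (norm (gam q k))\<^sup>2) \<le> C * (LINT s|MT. (norm (q s))\<^sup>2)"
    if q: "q \<in> L2V T" and F: "finite F" for q F
  proof -
    let ?N = "LINT s|MT. (norm (q s))\<^sup>2"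
    have N0: "0 \<le> ?N" by simp
    define Z where "Z k = (LINT s|MT. cis (eigval u0 k * s) * cinner (M (Lam (q s))) (phi k))" for k
    define A where "A k = (LINT s|MT. cis (eigval u0 k * s) * cinner (Gop (q s)) (phi k))" for k
    \<comment> \<open>The factor \<open>cnj (phi_fun k (pt i))\<close> has modulus 1 and is left
      out. What remains depends on k only through the exponential, as \<open>eigval_bessel\<close>
      requires.\<close>
    define B where "B i k = (LINT s|MT. cis (eigval u0 k * s) * ev (q s) (pt i))" for i k
    have evL: "(\<lambda>s. ev (q s) p) \<in> L2_fun 0 T" "(LINT s|MT. (norm (ev (q s) p))\<^sup>2) \<le> (norm (rho 0))\<^sup>2 * ?N" for p
      by (rule L2V_functional[OF q bounded_linear_ev norm_ev_le])+
    have iB: "integrable MT (\<lambda>s. cis (eigval u0 k * s) * ev (q s) p)" for k p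
      by (intro L2_fun_integrable L2_fun_cis_mult evL)
    have iA: "integrable MT (\<lambda>s. cis (eigval u0 k * s) * cinner (Gop (q s)) (phi k))" for k
      by (intro L2_fun_integrable L2_fun_cis_mult
          L2V_functional(1)[OF KG(2)[OF q] bounded_linear_cinner_left, where K = 1])
        (use norm_cinner_le[of _ "phi k"] in simp)
    have rel: "2 * pi * \<i> * of_int k * Z k = A k - (\<Sum>i\<in>I. (cf i * cnj (phi_fun k (pt i))) * B i k)" for k
    proof -
      have "2 * pi * \<i> * of_int k * Z k
          = (LINT s|MT. cis (eigval u0 k * s) * (2 * pi * \<i> * of_int k * cinner (M (Lam (q s))) (phi k)))"
        unfolding Z_def integral_mult_right_zero[symmetric] by (simp add: mult_ac)
      also have "\<dots> = (LINT s|MT. cis (eigval u0 k * s) * cinner (Gop (q s)) (phi k)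
           - (\<Sum>i\<in>I. (cf i * cnj (phi_fun k (pt i))) * (cis (eigval u0 k * s) * ev (q s) (pt i))))"
        unfolding M_deriv by (simp add: right_diff_distrib sum_distrib_left mult_ac)
      also have "\<dots> = A k - (\<Sum>i\<in>I. (cf i * cnj (phi_fun k (pt i))) * B i k)"
        using iA iB by (simp add: A_def B_def)
      finally show ?thesis .
    qed
    \<comment> \<open>At k = 0 the identity \<open>rel\<close> says nothing about \<open>Z\<close>,
      so its plain norm is kept as an extra term; elsewhere 1 <= 2 pi.\<close>
    have g: "norm (gam q k) \<le> norm (Z k) + norm (A k) + (\<Sum>i\<in>I. norm (cf i) * norm (B i k))" for k
    proof (cases "k = 0")
      case True
      then have "norm (gam q k) = norm (Z k)" by (simp add: gam_def Z_def jb_def norm_mult)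
      then show ?thesis by (simp add: sum_nonneg add_increasing2)
    next
      case False
      then have "norm (gam q k) = \<bar>real_of_int k\<bar> * norm (Z k)"
        by (simp add: gam_def Z_def jb_def norm_mult)
      also have "\<dots> \<le> 2 * pi * (\<bar>real_of_int k\<bar> * norm (Z k))"
        using mult_right_mono[of 1 "2 * pi" "\<bar>real_of_int k\<bar> * norm (Z k)"] pi_ge_two by simp
      also have "\<dots> = norm (2 * pi * \<i> * of_int k * Z k)" by (simp add: norm_mult)
      also have "\<dots> \<le> norm (A k) + (\<Sum>i\<in>I. norm (cf i) * norm (B i k))"
        unfolding rel
        by (rule order_trans[OF norm_triangle_ineq4 add_left_mono], rule order_trans[OF norm_sum])
          (simp add: norm_mult)
      finally show ?thesis using norm_ge_zero[of "Z k"] by linarith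
    qed
    have g2: "(norm (gam q k))\<^sup>2 \<le> 3 * ((norm (Z k))\<^sup>2 + (norm (A k))\<^sup>2 + ?S * (\<Sum>i\<in>I. (norm (B i k))\<^sup>2))" for k
    proof -
      let ?w = "\<Sum>i\<in>I. norm (cf i) * norm (B i k)"
      have "(norm (gam q k))\<^sup>2 \<le> (norm (Z k) + norm (A k) + ?w)\<^sup>2" by (rule power_mono[OF g]) simp
      also have "\<dots> \<le> 3 * ((norm (Z k))\<^sup>2 + (norm (A k))\<^sup>2 + ?w\<^sup>2)"
        using sum_squares_bound[of "norm (Z k)" "norm (A k)"] sum_squares_bound[of "norm (Z k)" ?w]
          sum_squares_bound[of "norm (A k)" ?w]
        by (simp add: power2_sum distrib_left distrib_right)
      also have "?w\<^sup>2 \<le> ?S * (\<Sum>i\<in>I. (norm (B i k))\<^sup>2)" by (rule Cauchy_Schwarz_ineq_sum)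
      finally show ?thesis by simp
    qed
    have "(\<Sum>k\<in>F. (norm (gam q k))\<^sup>2)
        \<le> (\<Sum>k\<in>F. 3 * ((norm (Z k))\<^sup>2 + (norm (A k))\<^sup>2 + ?S * (\<Sum>i\<in>I. (norm (B i k))\<^sup>2)))"
      by (rule sum_mono[OF g2])
    also have "\<dots> = 3 * ((\<Sum>k\<in>F. (norm (Z k))\<^sup>2) + (\<Sum>k\<in>F. (norm (A k))\<^sup>2) + ?S * (\<Sum>i\<in>I. \<Sum>k\<in>F. (norm (B i k))\<^sup>2))"
      by (subst sum.swap) (simp only: sum_distrib_left[symmetric] sum.distrib)
    also have "\<dots> \<le> 3 * (T * (KM * ?N) + T * (KG * ?N) + ?S * (?B * ?N))"
    proof (intro mult_left_mono add_mono)
      show "(\<Sum>k\<in>F. (norm (Z k))\<^sup>2) \<le> T * (KM * ?N)"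
        unfolding Z_def using T by (intro order_trans[OF bessel_vector[OF T KM(2)[OF q] F] mult_left_mono] KM(3) q) simp
      show "(\<Sum>k\<in>F. (norm (A k))\<^sup>2) \<le> T * (KG * ?N)"
        unfolding A_def using T by (intro order_trans[OF bessel_vector[OF T KG(2)[OF q] F] mult_left_mono] KG(3) q) simp
      have "(\<Sum>k\<in>F. (norm (B i k))\<^sup>2) \<le> bessel_const T * (norm (rho 0))\<^sup>2 * ?N" for i
        unfolding B_def using bessel_const_pos[OF T] evL(2)[of "pt i"]
        by (intro order_trans[OF eigval_bessel[OF T evL(1) F]]) (simp add: mult.assoc mult_left_mono)
      then have "(\<Sum>i\<in>I. \<Sum>k\<in>F. (norm (B i k))\<^sup>2) \<le> (\<Sum>i\<in>I. bessel_const T * (norm (rho 0))\<^sup>2 * ?N)"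
        by (intro sum_mono)
      then show "(\<Sum>i\<in>I. \<Sum>k\<in>F. (norm (B i k))\<^sup>2) \<le> ?B * ?N" by simp
    qed (auto intro: sum_nonneg)
    also have "\<dots> = C * ?N" by (simp add: C_def algebra_simps)
    finally show ?thesis .
  qed
  then show ?thesis using C by blast
qed

text \<open>Squared in the estimate, so that \<open>Cg\<close> itself is the operator bound for
  \<open>Gam\<close>.\<close>

definition "Cg = (SOME C. 0 < C \<and> (\<forall>q\<in>L2V T. \<forall>F. finite F \<longrightarrow>
    (\<Sum>k\<in>F. (norm (gam q k))\<^sup>2) \<le> C\<^sup>2 * (LINT s|MT. (norm (q s))\<^sup>2)))"

lemma Cg: "0 < Cg" "\<And>q F. q \<in> L2V T \<Longrightarrow> finite F \<Longrightarrow> (\<Sum>k\<in>F. (norm (gam q k))\<^sup>2) \<le> Cg\<^sup>2 * (LINT s|MT. (norm (q s))\<^sup>2)"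
proof -
  obtain C where C: "C > 0" "\<forall>q\<in>L2V T. \<forall>F. finite F \<longrightarrow>
    (\<Sum>k\<in>F. (norm (gam q k))\<^sup>2) \<le> C * (LINT s|MT. (norm (q s))\<^sup>2)" using gam_bound by blast
  then have "\<exists>C. 0 < C \<and> (\<forall>q\<in>L2V T. \<forall>F. finite F \<longrightarrow>
    (\<Sum>k\<in>F. (norm (gam q k))\<^sup>2) \<le> C\<^sup>2 * (LINT s|MT. (norm (q s))\<^sup>2))"
    by (intro exI[of _ "sqrt C"]) simp
  from someI_ex[OF this] show "0 < Cg" "\<And>q F. q \<in> L2V T \<Longrightarrow> finite F \<Longrightarrow> (\<Sum>k\<in>F. (norm (gam q k))\<^sup>2) \<le> Cg\<^sup>2 * (LINT s|MT. (norm (q s))\<^sup>2)"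
    by (auto simp: Cg_def)
qed

definition Gam :: "(real \<Rightarrow> l2) \<Rightarrow> l2" where "Gam q = of_coef (gam q)"

lemma coef_Gam: "q \<in> L2V T \<Longrightarrow> cinner (Gam q) (phi k) = gam q k"
  unfolding Gam_def by (rule coef_of_coef) (rule Cg)

lemma norm_Gam: "q \<in> L2V T \<Longrightarrow> (norm (Gam q))\<^sup>2 \<le> Cg\<^sup>2 * (LINT s|MT. (norm (q s))\<^sup>2)"
  unfolding Gam_def by (rule norm_of_coef) (rule Cg)

lemma Gam_cong: "(\<And>s. s \<in> {0<..<T} \<Longrightarrow> p s = q s) \<Longrightarrow> Gam p = Gam q"
proof -
  assume eq: "\<And>s. s \<in> {0<..<T} \<Longrightarrow> p s = q s"
  have "gam p k = gam q k" for k
    unfolding gam_def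
    by (intro arg_cong[of _ _ "\<lambda>x. - \<i> * of_real (jb k) * x"] Bochner_Integration.integral_cong) (simp_all add: eq)
  then show ?thesis unfolding Gam_def by (metis ext)
qed

lemma Gam_add:
  assumes "p \<in> L2V T" "q \<in> L2V T"
  shows "Gam (\<lambda>s. p s + q s) = Gam p + Gam q"
proof (rule l2_coef_eqI)
  fix k
  have "gam (\<lambda>s. p s + q s) k = gam p k + gam q k"
    using L2_fun_integrable[OF gam_L2[OF assms(1)]] L2_fun_integrable[OF gam_L2[OF assms(2)]]
    by (simp add: gam_def bounded_linear.linear[OF coef_MLam, THEN linear_add] distrib_left)
  then show "cinner (Gam (\<lambda>s. p s + q s)) (phi k) = cinner (Gam p + Gam q) (phi k)"
    by (simp add: coef_Gam L2V_add assms cinner_add_left)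
qed

lemma Gam_diff:
  assumes "p \<in> L2V T" "q \<in> L2V T"
  shows "Gam (\<lambda>s. p s - q s) = Gam p - Gam q"
  using Gam_add[OF L2V_diff[OF assms] assms(2)] by simp

end

section \<open>Indefinite integrals\<close>

text \<open>The integral from 0 to t, but constant for t outside [0, T]. Functions of time are
  extended in this way, so that continuity and suprema can be taken over the whole line.\<close>

definition indef :: "real \<Rightarrow> (real \<Rightarrow> real) \<Rightarrow> real \<Rightarrow> real" where
  "indef T h t = (LINT s|lebesgue_on {0<..<T}. indicator {..<t} s * h s)"

context
  fixes T :: real and h :: "real \<Rightarrow> real"
  assumes h: "integrable (lebesgue_on {0<..<T}) h"
begin

lemma indef_integrable:
  assumes "S \<in> sets borel"
  shows "integrable (lebesgue_on {0<..<T}) (\<lambda>s. indicator S s * h s)"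
proof (rule Bochner_Integration.integrable_bound[OF h])
  have [measurable]: "(indicator S :: real \<Rightarrow> real) \<in> borel_measurable (lebesgue_on {0<..<T})"
    using assms by (intro measurable_restrict_space1 borel_measurable_indicator) auto
  note [measurable] = borel_measurable_integrable[OF h]
  show "(\<lambda>s. indicator S s * h s) \<in> borel_measurable (lebesgue_on {0<..<T})" by measurable
qed (auto simp: indicator_def)

lemma indef_diff:
  assumes "r \<le> t"
  shows "indef T h t - indef T h r = (LINT s|lebesgue_on {0<..<T}. indicator {r..<t} s * h s)"
proof -
  have "indef T h t - indef T h r = (LINT s|lebesgue_on {0<..<T}. indicator {..<t} s * h s - indicator {..<r} s * h s)"
    unfolding indef_def by (rule Bochner_Integration.integral_diff[symmetric]; rule indef_integrable; simp)
  also have "\<dots> = (LINT s|lebesgue_on {0<..<T}. indicator {r..<t} s * h s)"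
    using assms by (intro Bochner_Integration.integral_cong) (auto simp: indicator_def)
  finally show ?thesis .
qed

lemma indef_mono:
  assumes "\<And>s. 0 \<le> h s" "r \<le> t"
  shows "indef T h r \<le> indef T h t"
proof -
  have "0 \<le> (LINT s|lebesgue_on {0<..<T}. indicator {r..<t} s * h s)"
    using assms by (intro Bochner_Integration.integral_nonneg) auto
  then show ?thesis using indef_diff[OF assms(2)] by linarith
qed

lemma indef_le_total:
  assumes "\<And>s. 0 \<le> h s"
  shows "indef T h t \<le> (LINT s|lebesgue_on {0<..<T}. h s)"
  unfolding indef_def using assms
  by (intro integral_mono h indef_integrable) (auto simp: indicator_def)

lemma continuous_on_indef: "continuous_on UNIV (indef T h)"
  unfolding continuous_on_sequentially
proof (intro ballI allI impI, elim conjE)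
  fix x :: "nat \<Rightarrow> real" and a assume x: "x \<longlonglongrightarrow> a"
  have "(\<lambda>n. indef T h (x n)) \<longlonglongrightarrow> indef T h a"
    unfolding indef_def
  proof (rule integral_dominated_convergence[where w = "\<lambda>s. norm (h s)"])
    show "integrable (lebesgue_on {0<..<T}) (\<lambda>s. norm (h s))" by (rule integrable_norm[OF h])
    have "{a} \<in> null_sets lebesgue" by (simp add: null_sets_def)
    then have "AE s in lebesgue. s \<notin> {a}" by (rule AE_not_in)
    then have "AE s in lebesgue_on {0<..<T}. s \<noteq> a"
      by (subst AE_restrict_space_iff) (auto elim!: eventually_mono)
    then show "AE s in lebesgue_on {0<..<T}. (\<lambda>n. indicator {..<x n} s * h s) \<longlonglongrightarrow> indicator {..<a} s * h s"
    proof eventually_elim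
      case (elim s)
      have "\<forall>\<^sub>F n in sequentially. indicator {..<x n} s = (indicator {..<a} s :: real)"
      proof (cases "s < a")
        case True
        then show ?thesis using order_tendstoD(1)[OF x, of s] by (auto elim!: eventually_mono)
      next
        case False
        then show ?thesis using order_tendstoD(2)[OF x, of s] elim by (auto elim!: eventually_mono)
      qed
      then show ?case by (intro tendsto_eventually) (auto elim!: eventually_mono)
    qed
    show "AE s in lebesgue_on {0<..<T}. norm (indicator {..<x n} s * h s) \<le> norm (h s)" for n
      by (auto simp: indicator_def)
  qed (use borel_measurable_integrable[OF indef_integrable] in auto)
  then show "(indef T h \<circ> x) \<longlonglongrightarrow> indef T h a" by (simp add: o_def)
qed

end

text \<open>Subdividing \<open>[0, t]\<close> into \<open>n\<close> pieces on which \<open>m\<close> grows equally gives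
  $|h(t) - h(0)| \le C (m(t) - m(0))^2 / n$.\<close>

lemma const_of_quadratic_variation:
  fixes h m :: "real \<Rightarrow> real"
  assumes m: "continuous_on UNIV m" "\<And>r t. r \<le> t \<Longrightarrow> m r \<le> m t"
    and hq: "\<And>r t. 0 \<le> r \<Longrightarrow> r \<le> t \<Longrightarrow> t \<le> T \<Longrightarrow> \<bar>h t - h r\<bar> \<le> C * (m t - m r)\<^sup>2"
    and t: "0 \<le> t" "t \<le> T"
  shows "h t = h 0"
proof (rule ccontr)
  assume ne: "h t \<noteq> h 0"
  define \<Delta> where "\<Delta> = m t - m 0"
  have "\<bar>h t - h 0\<bar> \<le> C * \<Delta>\<^sup>2" using hq[of 0 t] t by (simp add: \<Delta>_def)
  then have \<Delta>: "\<Delta> > 0" using ne m(2)[of 0 t] t by (cases "\<Delta> = 0") (auto simp: \<Delta>_def)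
  have le: "\<bar>h t - h 0\<bar> \<le> C * \<Delta>\<^sup>2 / real n" if n: "n > 0" for n
  proof -
    have "\<exists>s\<ge>0. s \<le> t \<and> m s = m 0 + real j * (\<Delta> / n)" if "j \<le> n" for j
    proof (rule IVT')
      show "m 0 \<le> m 0 + real j * (\<Delta> / n)" using \<Delta> by simp
      have "real j * (\<Delta> / n) \<le> real n * (\<Delta> / n)" using that \<Delta> by (intro mult_right_mono) auto
      then show "m 0 + real j * (\<Delta> / n) \<le> m t" using n by (simp add: \<Delta>_def)
    qed (use t continuous_on_subset[OF m(1)] in auto)
    then obtain s where s: "\<And>j. j \<le> n \<Longrightarrow> 0 \<le> s j" "\<And>j. j \<le> n \<Longrightarrow> s j \<le> t"
      "\<And>j. j \<le> n \<Longrightarrow> m (s j) = m 0 + real j * (\<Delta> / n)" by metis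
    have step: "\<bar>h (s (Suc j)) - h (s j)\<bar> \<le> C * (\<Delta> / n)\<^sup>2" if "j < n" for j
    proof -
      have d: "m (s (Suc j)) - m (s j) = \<Delta> / n" using s(3)[of j] s(3)[of "Suc j"] that
        by (simp add: distrib_right add_divide_distrib)
      then have "m (s j) < m (s (Suc j))" using \<Delta> n by (smt (verit) divide_pos_pos of_nat_0_less_iff)
      then have "s j \<le> s (Suc j)" using m(2)[of "s (Suc j)" "s j"] by linarith
      then show ?thesis using hq[of "s j" "s (Suc j)"] s(1)[of j] s(2)[of "Suc j"] that t unfolding d by auto
    qed
    have "h (s n) - h (s 0) = (\<Sum>j<n. h (s (Suc j)) - h (s j))" by (rule sum_lessThan_telescope[symmetric])
    also have "\<bar>\<dots>\<bar> \<le> (\<Sum>j<n. C * (\<Delta> / n)\<^sup>2)"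
      by (rule order_trans[OF sum_abs sum_mono]) (use step in auto)
    also have "\<dots> = C * \<Delta>\<^sup>2 / n" using n by (simp add: power2_eq_square field_simps)
    finally have "\<bar>h (s n) - h (s 0)\<bar> \<le> C * \<Delta>\<^sup>2 / n" .
    \<comment> \<open>The level m 0 may be attained away from 0, but \<open>hq\<close> forces h to
      be constant on a level set of m; the same holds at the end t.\<close>
    moreover have "h (s 0) = h 0" using hq[of 0 "s 0"] s(1)[of 0] s(2)[of 0] s(3)[of 0] t by simp
    moreover have "h (s n) = h t"
      using hq[of "s n" t] s(1)[of n] s(2)[of n] s(3)[of n] t n by (simp add: \<Delta>_def)
    ultimately show ?thesis by simp
  qed
  have "\<bar>h t - h 0\<bar> > 0" using ne by simp
  then obtain n where "real n * \<bar>h t - h 0\<bar> > C * \<Delta>\<^sup>2" using reals_Archimedean3 by blast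
  moreover from this have "n > 0" using \<open>\<bar>h t - h 0\<bar> \<le> C * \<Delta>\<^sup>2\<close> by (cases n) auto
  ultimately show False using le[of n] by (simp add: field_simps)
qed

text \<open>With m the indefinite integral of \<open>h\<close>, the chain rule would give exp
  (\<kappa> m) - 1 for the left side on [0, T]. As m need not be differentiable everywhere, this is
  shown through the quadratic variation of the difference \<open>H\<close>.\<close>

lemma indef_exp_le:
  assumes h: "integrable (lebesgue_on {0<..<T}) h" and h0: "\<And>s. 0 \<le> h s" and \<kappa>: "0 < \<kappa>" and T: "0 < T"
  shows "\<kappa> * indef T (\<lambda>s. h s * exp (\<kappa> * indef T h s)) t \<le> exp (\<kappa> * indef T h t)"
proof -
  let ?m = "indef T h"
  let ?g = "\<lambda>s. h s * exp (\<kappa> * ?m s)"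
  have mono: "?m r \<le> ?m t" if "r \<le> t" for r t by (rule indef_mono[OF h h0 that])
  have tot: "?m t \<le> (LINT s|lebesgue_on {0<..<T}. h s)" for t by (rule indef_le_total[OF h h0])
  have c: "continuous_on UNIV ?m" by (rule continuous_on_indef[OF h])
  have g: "integrable (lebesgue_on {0<..<T}) ?g"
  proof (rule Bochner_Integration.integrable_bound)
    let ?B = "exp (\<kappa> * (LINT s|lebesgue_on {0<..<T}. h s))"
    show "integrable (lebesgue_on {0<..<T}) (\<lambda>s. ?B * h s)" using h by simp
    have [measurable]: "?m \<in> borel_measurable (lebesgue_on {0<..<T})" by (rule continuous_measurable_l2[OF c])
    note [measurable] = borel_measurable_integrable[OF h]
    show "?g \<in> borel_measurable (lebesgue_on {0<..<T})" by measurable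
    show "AE s in lebesgue_on {0<..<T}. norm (?g s) \<le> norm (?B * h s)"
    proof (rule AE_I2)
      fix s
      have "h s * exp (\<kappa> * ?m s) \<le> h s * ?B"
        using tot[of s] \<kappa> h0[of s] by (intro mult_left_mono) auto
      then show "norm (?g s) \<le> norm (?B * h s)" using h0[of s] by (simp add: abs_mult mult.commute)
    qed
  qed
  define H where "H t = exp (\<kappa> * ?m t) - \<kappa> * indef T ?g t" for t
  have main: "H t = H 0" if t: "0 \<le> t" "t \<le> T" for t
  proof (rule const_of_quadratic_variation[OF c mono _ t])
    fix r t assume rt: "0 \<le> r" "r \<le> t" "t \<le> T"
    let ?d = "?m t - ?m r" and ?E = "\<lambda>s. exp (\<kappa> * ?m s)"
    have hI: "integrable (lebesgue_on {0<..<T}) (\<lambda>s. indicator {r..<t} s * h s)" by (rule indef_integrable[OF h]) simp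
    have gI: "integrable (lebesgue_on {0<..<T}) (\<lambda>s. indicator {r..<t} s * ?g s)" by (rule indef_integrable[OF g]) simp
    have d0: "0 \<le> ?d" using mono[OF rt(2)] by simp
    have "(LINT s|lebesgue_on {0<..<T}. ?E r * (indicator {r..<t} s * h s)) \<le> (LINT s|lebesgue_on {0<..<T}. indicator {r..<t} s * ?g s)"
      using hI gI mono \<kappa> h0 by (intro integral_mono) (auto simp: indicator_def mult.commute[of "h _"] intro!: mult_right_mono)
    then have lo: "?E r * ?d \<le> indef T ?g t - indef T ?g r"
      unfolding indef_diff[OF h rt(2)] indef_diff[OF g rt(2)] by simp
    have "(LINT s|lebesgue_on {0<..<T}. indicator {r..<t} s * ?g s) \<le> (LINT s|lebesgue_on {0<..<T}. ?E t * (indicator {r..<t} s * h s))"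
      using hI gI mono \<kappa> h0 by (intro integral_mono) (auto simp: indicator_def mult.commute[of "h _"] intro!: mult_right_mono)
    then have hi: "indef T ?g t - indef T ?g r \<le> ?E t * ?d"
      unfolding indef_diff[OF h rt(2)] indef_diff[OF g rt(2)] by simp
    have e: "?E t = ?E r * exp (\<kappa> * ?d)" by (simp add: exp_add[symmetric] algebra_simps)
    have "1 + \<kappa> * ?d \<le> exp (\<kappa> * ?d)" by (rule exp_ge_add_one_self)
    then have elo: "?E r * (\<kappa> * ?d) \<le> ?E t - ?E r"
      unfolding e using mult_left_mono[of "1 + \<kappa> * ?d" "exp (\<kappa> * ?d)" "?E r"] by (simp add: algebra_simps)
    have "1 + - (\<kappa> * ?d) \<le> exp (- (\<kappa> * ?d))" by (rule exp_ge_add_one_self)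
    then have "?E t * (1 - \<kappa> * ?d) \<le> ?E t * exp (- (\<kappa> * ?d))" by simp
    also have "\<dots> = ?E r" by (simp add: exp_add[symmetric] algebra_simps)
    finally have ehi: "?E t - ?E r \<le> ?E t * (\<kappa> * ?d)" by (simp add: algebra_simps)
    \<comment> \<open>Both increments lie between \<open>?E r * (\<kappa> * ?d)\<close> and
      \<open>?E t * (\<kappa> * ?d)\<close>, an interval whose length is of second order in
      \<open>?d\<close>.\<close>
    have "\<bar>H t - H r\<bar> = \<bar>(?E t - ?E r) - \<kappa> * (indef T ?g t - indef T ?g r)\<bar>"
      by (simp add: H_def algebra_simps)
    also have "\<dots> \<le> ?E t * (\<kappa> * ?d) - ?E r * (\<kappa> * ?d)"
    proof -
      have "?E r * (\<kappa> * ?d) \<le> \<kappa> * (indef T ?g t - indef T ?g r)"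
        using mult_left_mono[OF lo, of \<kappa>] \<kappa> by (simp only: mult_ac)
      moreover have "\<kappa> * (indef T ?g t - indef T ?g r) \<le> ?E t * (\<kappa> * ?d)"
        using mult_left_mono[OF hi, of \<kappa>] \<kappa> by (simp only: mult_ac)
      ultimately show ?thesis using elo ehi by linarith
    qed
    also have "\<dots> = (\<kappa> * ?d) * (?E t - ?E r)" by (simp add: algebra_simps)
    also have "\<dots> \<le> (\<kappa> * ?d) * (?E t * (\<kappa> * ?d))" using \<kappa> d0 ehi by (intro mult_left_mono) auto
    also have "\<dots> \<le> (\<kappa> * ?d) * (?E T * (\<kappa> * ?d))"
      using \<kappa> d0 mono[OF rt(3)] by (intro mult_left_mono mult_right_mono) auto
    also have "\<dots> = (\<kappa>\<^sup>2 * ?E T) * ?d\<^sup>2" by (simp add: power2_eq_square mult_ac)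
    finally show "\<bar>H t - H r\<bar> \<le> (\<kappa>\<^sup>2 * ?E T) * ?d\<^sup>2" .
  qed
  have clamp: "indef T f t = indef T f (max 0 (min T t))" for f
    unfolding indef_def by (rule Bochner_Integration.integral_cong) (auto simp: indicator_def)
  have z: "indef T f 0 = 0" for f
  proof -
    have "indef T f 0 = (LINT s|lebesgue_on {0<..<T}. 0)"
      unfolding indef_def by (rule Bochner_Integration.integral_cong) auto
    then show ?thesis by simp
  qed
  have "H (max 0 (min T t)) = 1" using main[of "max 0 (min T t)"] T by (auto simp: H_def z)
  then show ?thesis unfolding clamp[of h] clamp[of ?g] by (simp add: H_def)
qed

section \<open>The equation in the interaction picture\<close>

context control
begin

text \<open>The Duhamel term up to time t. Cutting off the source rather than the interval keeps the
  same constant \<open>Cg\<close> for all t.\<close>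

definition Pt :: "(real \<Rightarrow> l2) \<Rightarrow> real \<Rightarrow> l2" where
  "Pt q t = Gam (\<lambda>s. indicator {..<t} s *\<^sub>R q s)"

lemma L2V_indicator:
  assumes "q \<in> L2V T" "S \<in> sets borel"
  shows "(\<lambda>s. indicator S s *\<^sub>R q s) \<in> L2V T"
proof (rule L2V_scaleR[OF assms(1), where C = 1])
  show "(indicator S :: real \<Rightarrow> real) \<in> borel_measurable MT"
    using assms(2) by (intro measurable_restrict_space1 borel_measurable_indicator) auto
qed (auto simp: indicator_def)

lemma Pt_diff:
  assumes q: "q \<in> L2V T" and rt: "r \<le> t"
  shows "Pt q t - Pt q r = Gam (\<lambda>s. indicator {r..<t} s *\<^sub>R q s)"
proof -
  have "Pt q t - Pt q r = Gam (\<lambda>s. indicator {..<t} s *\<^sub>R q s - indicator {..<r} s *\<^sub>R q s)"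
    unfolding Pt_def by (rule Gam_diff[symmetric]; rule L2V_indicator[OF q]; simp)
  also have "\<dots> = Gam (\<lambda>s. indicator {r..<t} s *\<^sub>R q s)"
    by (rule Gam_cong) (use rt in \<open>auto simp: indicator_def\<close>)
  finally show ?thesis .
qed

lemma norm_Pt_diff:
  assumes q: "q \<in> L2V T" and rt: "r \<le> t"
  shows "(norm (Pt q t - Pt q r))\<^sup>2 \<le> Cg\<^sup>2 * (indef T (\<lambda>s. (norm (q s))\<^sup>2) t - indef T (\<lambda>s. (norm (q s))\<^sup>2) r)"
proof -
  have "(norm (Pt q t - Pt q r))\<^sup>2 \<le> Cg\<^sup>2 * (LINT s|MT. (norm (indicator {r..<t} s *\<^sub>R q s))\<^sup>2)"
    unfolding Pt_diff[OF assms] by (rule norm_Gam) (rule L2V_indicator[OF q], simp)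
  also have "(LINT s|MT. (norm (indicator {r..<t} s *\<^sub>R q s))\<^sup>2) = (LINT s|MT. indicator {r..<t} s * (norm (q s))\<^sup>2)"
    by (intro Bochner_Integration.integral_cong) (auto simp: indicator_def)
  finally show ?thesis by (simp add: indef_diff[OF L2VD(2)[OF q] rt])
qed

lemma norm_Pt:
  assumes q: "q \<in> L2V T"
  shows "(norm (Pt q t))\<^sup>2 \<le> Cg\<^sup>2 * indef T (\<lambda>s. (norm (q s))\<^sup>2) t"
proof -
  have "(norm (Pt q t))\<^sup>2 \<le> Cg\<^sup>2 * (LINT s|MT. (norm (indicator {..<t} s *\<^sub>R q s))\<^sup>2)"
    unfolding Pt_def by (rule norm_Gam) (rule L2V_indicator[OF q], simp)
  also have "(LINT s|MT. (norm (indicator {..<t} s *\<^sub>R q s))\<^sup>2) = indef T (\<lambda>s. (norm (q s))\<^sup>2) t"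
    unfolding indef_def by (intro Bochner_Integration.integral_cong) (auto simp: indicator_def)
  finally show ?thesis .
qed

text \<open>Increments of \<open>Pt q\<close> are at most \<open>Cg\<close> times the square root of
  increments of the integral of the squared norm of \<open>q\<close>, and that integral is
  continuous in its upper limit.\<close>

lemma continuous_on_Pt:
  assumes q: "q \<in> L2V T"
  shows "continuous_on S (Pt q)"
proof -
  let ?n = "indef T (\<lambda>s. (norm (q s))\<^sup>2)"
  have n: "continuous_on UNIV ?n" by (rule continuous_on_indef[OF L2VD(2)[OF q]])
  have le: "norm (Pt q t - Pt q r) \<le> Cg * sqrt \<bar>?n t - ?n r\<bar>" for t r
  proof -
    have *: "norm (Pt q t - Pt q r) \<le> Cg * sqrt \<bar>?n t - ?n r\<bar>" if "r \<le> t" for t r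
    proof (rule power2_le_imp_le)
      show "(norm (Pt q t - Pt q r))\<^sup>2 \<le> (Cg * sqrt \<bar>?n t - ?n r\<bar>)\<^sup>2"
        using norm_Pt_diff[OF q that] indef_mono[OF L2VD(2)[OF q] _ that] by (simp add: power_mult_distrib)
      show "0 \<le> Cg * sqrt \<bar>?n t - ?n r\<bar>" using Cg(1) by simp
    qed
    show ?thesis using *[of r t] *[of t r] by (cases "r \<le> t") (auto simp: norm_minus_commute abs_minus_commute)
  qed
  have "isCont (Pt q) r" for r
    unfolding isCont_def
  proof (rule LIM_zero_cancel, rule Lim_null_comparison)
    show "\<forall>\<^sub>F t in at r. norm (Pt q t - Pt q r) \<le> Cg * sqrt \<bar>?n t - ?n r\<bar>" using le by simp
    have "(?n \<longlongrightarrow> ?n r) (at r)" using n by (simp add: continuous_on_eq_continuous_at isCont_def)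
    then have "((\<lambda>t. Cg * sqrt \<bar>?n t - ?n r\<bar>) \<longlongrightarrow> Cg * sqrt \<bar>?n r - ?n r\<bar>) (at r)" by (intro tendsto_intros)
    then show "((\<lambda>t. Cg * sqrt \<bar>?n t - ?n r\<bar>) \<longlongrightarrow> 0) (at r)" by simp
  qed
  then show ?thesis by (simp add: continuous_at_imp_continuous_on)
qed

lemma Pt_clamp: "Pt q t = Pt q (max 0 (min T t))"
  unfolding Pt_def by (rule Gam_cong) (auto simp: indicator_def)

lemma Gam_zero: "Gam (\<lambda>s. 0) = 0"
  using Gam_diff[of "\<lambda>s. 0" "\<lambda>s. 0"] by (simp add: L2V_def)

lemma Pt_0: "t \<le> 0 \<Longrightarrow> Pt q t = 0"
proof -
  assume "t \<le> 0"
  then have "Pt q t = Gam (\<lambda>s. 0)" unfolding Pt_def by (intro Gam_cong) (auto simp: indicator_def)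
  then show ?thesis by (simp add: Gam_zero)
qed

lemma Pt_T: "T \<le> t \<Longrightarrow> Pt q t = Gam q"
  unfolding Pt_def by (rule Gam_cong) (auto simp: indicator_def)

abbreviation drive :: "(real \<Rightarrow> real) \<Rightarrow> (real \<Rightarrow> l2) \<Rightarrow> real \<Rightarrow> l2" where
  "drive u z \<equiv> (\<lambda>s. u s *\<^sub>R U s (z s))"

lemma drive_L2V:
  assumes u: "u \<in> L2_fun 0 T" and z: "continuous_on UNIV z"
  shows "drive u z \<in> L2V T"
proof -
  have c: "continuous_on UNIV (\<lambda>s. U s (z s))" by (intro continuous_on_evol_compose continuous_intros z)
  have "compact (z ` {0..T})" by (intro compact_continuous_image continuous_on_subset[OF z]) auto
  then obtain B where B: "\<And>x. x \<in> z ` {0..T} \<Longrightarrow> norm x \<le> B" using compact_imp_bounded bounded_iff by metis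
  show ?thesis
    by (rule L2V_control(1)[OF u continuous_measurable_l2[OF c], where B = B]) (use B in auto)
qed

lemma norm_Pt_drive:
  assumes u: "u \<in> L2_fun 0 T" and z: "continuous_on UNIV z" and B: "\<And>s. norm (z s) \<le> B"
  shows "norm (Pt (drive u z) t) \<le> Cg * sqrt (LINT s|MT. (u s)\<^sup>2) * B"
proof (rule power2_le_imp_le)
  have c: "continuous_on UNIV (\<lambda>s. U s (z s))" by (intro continuous_on_evol_compose continuous_intros z)
  note d = drive_L2V[OF u z]
  have B0: "0 \<le> B" using order_trans[OF norm_ge_zero B] .
  have "(norm (Pt (drive u z) t))\<^sup>2 \<le> Cg\<^sup>2 * indef T (\<lambda>s. (norm (drive u z s))\<^sup>2) t" by (rule norm_Pt[OF d])
  also have "\<dots> \<le> Cg\<^sup>2 * (LINT s|MT. (norm (drive u z s))\<^sup>2)"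
    by (intro mult_left_mono indef_le_total L2VD(2)[OF d]) auto
  also have "\<dots> \<le> Cg\<^sup>2 * (B\<^sup>2 * (LINT s|MT. (u s)\<^sup>2))"
    by (intro mult_left_mono L2V_control(2)[OF u continuous_measurable_l2[OF c]]) (use B in auto)
  also have "\<dots> = (Cg * sqrt (LINT s|MT. (u s)\<^sup>2) * B)\<^sup>2"
    by (simp add: power_mult_distrib)
  finally show "(norm (Pt (drive u z) t))\<^sup>2 \<le> (Cg * sqrt (LINT s|MT. (u s)\<^sup>2) * B)\<^sup>2" .
  show "0 \<le> Cg * sqrt (LINT s|MT. (u s)\<^sup>2) * B" using Cg(1) B0 by simp
qed

text \<open>Asked on the whole line: a solution is then constant outside [0, T], hence bounded, and
  the fixed point lives among the bounded continuous functions.\<close>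

definition is_sol :: "(real \<Rightarrow> real) \<Rightarrow> l2 \<Rightarrow> (real \<Rightarrow> l2) \<Rightarrow> bool" where
  "is_sol u \<eta> z \<longleftrightarrow> continuous_on UNIV z \<and> (\<forall>t. z t = \<eta> + Pt (drive u z) t)"

text \<open>With $m(t) = \int_0^t u^2$ and $\kappa = 4 C^2$, the map is a contraction by $1/2$ for the
  norm $\sup_t e^{-\kappa m(t)/2} \|z(t)\|$.\<close>

lemma sol_ex1:
  assumes u: "u \<in> L2_fun 0 T"
  shows "\<exists>!z. is_sol u \<eta> z"
proof -
  let ?h = "\<lambda>s. (u s)\<^sup>2"
  have h: "integrable MT ?h" using L2_funD(2)[OF u] by simp
  define m where "m = indef T ?h"
  have mc [continuous_intros]: "continuous_on S (\<lambda>s. m (f s))" if "continuous_on S f" for S and f :: "real \<Rightarrow> real"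
    using continuous_on_compose2[OF continuous_on_indef[OF h] that] by (simp add: m_def)
  have m0: "0 \<le> m t" for t
    unfolding m_def indef_def by (rule Bochner_Integration.integral_nonneg) simp
  have mT: "m t \<le> (LINT s|MT. ?h s)" for t
    unfolding m_def by (rule indef_le_total[OF h]) simp
  define K where "K = 4 * Cg\<^sup>2"
  have K: "K > 0" using Cg(1) by (simp add: K_def)
  define w where "w s = exp (K / 2 * m s)" for s
  have wc [continuous_intros]: "continuous_on S w" for S unfolding w_def[abs_def] by (intro continuous_intros)
  have w1: "1 \<le> w s" for s using K m0 by (simp add: w_def)
  have wB: "w s \<le> exp (K / 2 * (LINT s|MT. ?h s))" for s using K mT by (simp add: w_def)
  have w2: "(w s)\<^sup>2 = exp (K * m s)" for s by (simp add: w_def exp_double[symmetric] power2_eq_square exp_add[symmetric])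
  \<comment> \<open>The unknown of this map is the solution divided by \<open>w\<close>, so that the
    plain supremum norm is the weighted norm.\<close>
  define G where "G z t = (1 / w t) *\<^sub>R (\<eta> + Pt (drive u (\<lambda>s. w s *\<^sub>R z s)) t)" for z t
  have wz: "continuous_on UNIV (\<lambda>s. w s *\<^sub>R z s)" if "continuous_on UNIV z" for z :: "real \<Rightarrow> l2"
    by (intro continuous_intros that)
  have Gb: "G z \<in> bcontfun" if z: "continuous_on UNIV z" "\<And>s. norm (z s) \<le> B" for z B
  proof (rule bcontfun_normI)
    have "w t \<noteq> 0" for t using w1[of t] by linarith
    then show "continuous_on UNIV (G z)"
      unfolding G_def[abs_def] by (intro continuous_intros continuous_on_Pt drive_L2V u wz z) auto
    let ?B = "exp (K / 2 * (LINT s|MT. ?h s)) * B"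
    have zB: "norm (w s *\<^sub>R z s) \<le> ?B" for s
      using w1[of s] wB[of s] z(2)[of s] by (auto intro!: mult_mono order_trans[OF norm_ge_zero z(2)])
    show "norm (G z t) \<le> norm \<eta> + Cg * sqrt (LINT s|MT. (u s)\<^sup>2) * ?B" for t
    proof -
      have "norm (G z t) = norm (\<eta> + Pt (drive u (\<lambda>s. w s *\<^sub>R z s)) t) / w t"
        using w1[of t] by (simp add: G_def)
      also have "\<dots> \<le> norm (\<eta> + Pt (drive u (\<lambda>s. w s *\<^sub>R z s)) t) / 1"
        using w1[of t] by (intro divide_left_mono) auto
      also have "\<dots> \<le> norm \<eta> + Cg * sqrt (LINT s|MT. (u s)\<^sup>2) * ?B"
        unfolding div_by_1
        by (rule order_trans[OF norm_triangle_ineq add_left_mono]) (rule norm_Pt_drive[OF u wz[OF z(1)] zB])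
      finally show ?thesis .
    qed
  qed
  define \<Phi> where "\<Phi> Z = Bcontfun (G (apply_bcontfun Z))" for Z :: "real \<Rightarrow>\<^sub>C l2"
  have \<Phi>: "apply_bcontfun (\<Phi> Z) = G (apply_bcontfun Z)" for Z
    unfolding \<Phi>_def by (rule Bcontfun_inverse, rule Gb[of _ "norm Z"]) (auto intro: norm_bounded)
  have contr: "dist (\<Phi> Z) (\<Phi> Z') \<le> (1 / 2) * dist Z Z'" for Z Z'
  proof (rule dist_bound)
    fix t
    let ?d = "\<lambda>s. Z s - Z' s"
    have dc: "continuous_on UNIV ?d" by (intro continuous_intros continuous_on_apply_bcontfun)
    have dd: "norm (?d s) \<le> dist Z Z'" for s using dist_bounded[of Z s Z'] by (simp add: dist_norm)
    have q: "drive u (\<lambda>s. w s *\<^sub>R z s) \<in> L2V T" if "continuous_on UNIV z" for z by (intro drive_L2V u wz that)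
    have "G Z t - G Z' t = (1 / w t) *\<^sub>R (Pt (drive u (\<lambda>s. w s *\<^sub>R Z s)) t - Pt (drive u (\<lambda>s. w s *\<^sub>R Z' s)) t)"
      by (simp add: G_def scaleR_diff_right scaleR_add_right)
    also have "Pt (drive u (\<lambda>s. w s *\<^sub>R Z s)) t - Pt (drive u (\<lambda>s. w s *\<^sub>R Z' s)) t = Pt (drive u (\<lambda>s. w s *\<^sub>R ?d s)) t"
      unfolding Pt_def
      by (subst Gam_diff[symmetric])
        (auto intro!: L2V_indicator q continuous_on_apply_bcontfun simp: scaleR_diff_right[symmetric] evol_diff[symmetric] simp del: scaleR_scaleR)
    finally have eq: "G Z t - G Z' t = (1 / w t) *\<^sub>R Pt (drive u (\<lambda>s. w s *\<^sub>R ?d s)) t" .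
    have "(norm (Pt (drive u (\<lambda>s. w s *\<^sub>R ?d s)) t))\<^sup>2 \<le> Cg\<^sup>2 * indef T (\<lambda>s. (norm (drive u (\<lambda>s. w s *\<^sub>R ?d s) s))\<^sup>2) t"
      by (rule norm_Pt[OF q[OF dc]])
    also have "indef T (\<lambda>s. (norm (drive u (\<lambda>s. w s *\<^sub>R ?d s) s))\<^sup>2) t
        \<le> (LINT s|MT. (dist Z Z')\<^sup>2 * (indicator {..<t} s * (?h s * exp (K * m s))))"
      unfolding indef_def
    proof (rule integral_mono)
      show "integrable MT (\<lambda>s. indicator {..<t} s * (norm (drive u (\<lambda>s. w s *\<^sub>R ?d s) s))\<^sup>2)"
        by (rule indef_integrable[OF L2VD(2)[OF q[OF dc]]]) simp
      have "integrable MT (\<lambda>s. ?h s * exp (K * m s))"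
      proof (rule Bochner_Integration.integrable_bound)
        let ?B = "exp (K * (LINT s|MT. ?h s))"
        show "integrable MT (\<lambda>s. ?B * ?h s)" using h by simp
        have [measurable]: "m \<in> borel_measurable MT" by (intro continuous_measurable_l2 mc continuous_on_id)
        note [measurable] = L2_funD(1)[OF u]
        show "(\<lambda>s. ?h s * exp (K * m s)) \<in> borel_measurable MT" by measurable
        show "AE s in MT. norm (?h s * exp (K * m s)) \<le> norm (?B * ?h s)"
        proof (rule AE_I2)
          fix s
          have "?h s * exp (K * m s) \<le> ?h s * ?B" using mT[of s] K by (intro mult_left_mono) auto
          then show "norm (?h s * exp (K * m s)) \<le> norm (?B * ?h s)" by (simp add: abs_mult mult.commute)
        qed
      qed
      then show "integrable MT (\<lambda>s. (dist Z Z')\<^sup>2 * (indicator {..<t} s * (?h s * exp (K * m s))))"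
        by (intro integrable_mult_right indef_integrable) auto
      fix s
      have "(norm (drive u (\<lambda>s. w s *\<^sub>R ?d s) s))\<^sup>2 = ?h s * (exp (K * m s) * (norm (?d s))\<^sup>2)"
        by (simp add: power_mult_distrib w2)
      also have "\<dots> \<le> ?h s * (exp (K * m s) * (dist Z Z')\<^sup>2)"
        by (intro mult_left_mono power_mono dd) auto
      finally show "indicator {..<t} s * (norm (drive u (\<lambda>s. w s *\<^sub>R ?d s) s))\<^sup>2
          \<le> (dist Z Z')\<^sup>2 * (indicator {..<t} s * (?h s * exp (K * m s)))"
        by (simp add: indicator_def mult_ac)
    qed
    also have "\<dots> = (dist Z Z')\<^sup>2 * indef T (\<lambda>s. ?h s * exp (K * m s)) t" by (simp add: indef_def)
    also have "Cg\<^sup>2 * \<dots> \<le> (dist Z Z')\<^sup>2 * ((w t)\<^sup>2 / 4)"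
    proof -
      \<comment> \<open>The integral of u^2 exp (K m) is at most exp (K m) / K; with K = 4 Cg^2 this
        leaves the factor 1/4, hence 1/2 for norms.\<close>
      have "K * indef T (\<lambda>s. ?h s * exp (K * m s)) t \<le> (w t)\<^sup>2"
        using indef_exp_le[OF h _ K T, of t] by (simp add: m_def w2)
      then have "Cg\<^sup>2 * indef T (\<lambda>s. ?h s * exp (K * m s)) t \<le> (w t)\<^sup>2 / 4" by (simp add: K_def)
      then have "(dist Z Z')\<^sup>2 * (Cg\<^sup>2 * indef T (\<lambda>s. ?h s * exp (K * m s)) t) \<le> (dist Z Z')\<^sup>2 * ((w t)\<^sup>2 / 4)"
        by (intro mult_left_mono) auto
      then show ?thesis by (simp add: mult_ac)
    qed
    finally have "(norm (Pt (drive u (\<lambda>s. w s *\<^sub>R ?d s)) t))\<^sup>2 \<le> (dist Z Z' * w t / 2)\<^sup>2"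
      using Cg(1) by (simp add: power_mult_distrib power_divide mult_left_mono)
    then have "norm (Pt (drive u (\<lambda>s. w s *\<^sub>R ?d s)) t) \<le> dist Z Z' * w t / 2"
      by (rule power2_le_imp_le) (use w1[of t] in simp)
    then show "dist (\<Phi> Z t) (\<Phi> Z' t) \<le> (1 / 2) * dist Z Z'"
      using w1[of t] unfolding \<Phi> dist_norm[of "G Z t"] eq by (simp add: field_simps)
  qed
  have "\<exists>!Z. \<Phi> Z = Z"
    by (rule banach_fix_type[where c = "1 / 2"]) (use contr in auto)
  then obtain Z where Z: "\<Phi> Z = Z" and uniq: "\<And>Z'. \<Phi> Z' = Z' \<Longrightarrow> Z' = Z" by metis
  have w0: "w t \<noteq> 0" for t using w1[of t] by linarith
  show ?thesis
  proof (rule ex1I[of _ "\<lambda>t. w t *\<^sub>R Z t"])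
    show "is_sol u \<eta> (\<lambda>t. w t *\<^sub>R Z t)"
      unfolding is_sol_def
    proof (intro conjI allI wz continuous_on_apply_bcontfun)
      fix t
      have "Z t = G Z t" using \<Phi>[of Z] Z by simp
      then have "w t *\<^sub>R Z t = w t *\<^sub>R G Z t" by simp
      then show "w t *\<^sub>R Z t = \<eta> + Pt (drive u (\<lambda>t. w t *\<^sub>R Z t)) t" using w0 by (simp add: G_def)
    qed
  next
    fix z assume z: "is_sol u \<eta> z"
    then have zc: "continuous_on UNIV z" and ze: "\<And>t. z t = \<eta> + Pt (drive u z) t"
      unfolding is_sol_def by blast+
    define y where "y t = (1 / w t) *\<^sub>R z t" for t
    have yc: "continuous_on UNIV y" unfolding y_def[abs_def] using w0 by (intro continuous_intros zc) auto
    have "compact (z ` {0..T})" by (intro compact_continuous_image continuous_on_subset[OF zc]) auto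
    then obtain B where B: "\<And>x. x \<in> z ` {0..T} \<Longrightarrow> norm x \<le> B" using compact_imp_bounded bounded_iff by metis
    \<comment> \<open>Clamping shows that an arbitrary solution is bounded, so it belongs to the
      space in which the fixed point is unique.\<close>
    have "z t = z (max 0 (min T t))" for t by (metis ze Pt_clamp)
    moreover have "max 0 (min T t) \<in> {0..T}" for t using T by auto
    ultimately have zB: "norm (z t) \<le> B" for t by (metis B imageI)
    have "y \<in> bcontfun"
    proof (rule bcontfun_normI[OF yc])
      show "norm (y t) \<le> B" for t
      proof -
        have "norm (y t) = norm (z t) / w t" using w1[of t] by (simp add: y_def)
        also have "\<dots> \<le> norm (z t) / 1" using w1[of t] by (intro divide_left_mono) auto
        finally show ?thesis using zB[of t] by simp
      qed
    qed
    then obtain Y where Y: "y = apply_bcontfun Y" by (rule bcontfunE)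
    have wy: "w s *\<^sub>R y s = z s" for s using w0 by (simp add: y_def)
    have "\<Phi> Y = Y"
    proof (rule bcontfun_eqI)
      show "\<Phi> Y t = Y t" for t
        unfolding \<Phi> Y[symmetric] G_def wy ze[symmetric] by (simp add: y_def)
    qed
    then have "Y = Z" by (rule uniq)
    then show "z = (\<lambda>t. w t *\<^sub>R Z t)" using wy Y by (simp add: fun_eq_iff)
  qed
qed

definition sol :: "(real \<Rightarrow> real) \<Rightarrow> l2 \<Rightarrow> real \<Rightarrow> l2" where
  "sol u \<eta> = (THE z. is_sol u \<eta> z)"

lemma sol:
  assumes u: "u \<in> L2_fun 0 T"
  shows is_sol_sol: "is_sol u \<eta> (sol u \<eta>)"
    and sol_eqI: "is_sol u \<eta> z \<Longrightarrow> z = sol u \<eta>"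
  using theI'[OF sol_ex1[OF u, of \<eta>]] the1_equality[OF sol_ex1[OF u, of \<eta>], of z, symmetric]
  unfolding sol_def by blast+

lemma sol_props:
  assumes u: "u \<in> L2_fun 0 T"
  shows continuous_on_sol: "continuous_on S (sol u \<eta>)"
    and sol_eq: "sol u \<eta> t = \<eta> + Pt (drive u (sol u \<eta>)) t"
    and sol_0: "sol u \<eta> 0 = \<eta>"
    and sol_clamp: "sol u \<eta> t = sol u \<eta> (max 0 (min T t))"
proof -
  have *: "sol u \<eta> t = \<eta> + Pt (drive u (sol u \<eta>)) t" for t
    using is_sol_sol[OF u, of \<eta>] unfolding is_sol_def by blast
  show "continuous_on S (sol u \<eta>)"
    using is_sol_sol[OF u, of \<eta>] continuous_on_subset unfolding is_sol_def by blast
  show "sol u \<eta> t = \<eta> + Pt (drive u (sol u \<eta>)) t" by (rule *)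
  show "sol u \<eta> 0 = \<eta>" by (subst *) (simp add: Pt_0)
  show "sol u \<eta> t = sol u \<eta> (max 0 (min T t))"
    by (metis * Pt_clamp)
qed

text \<open>The maximum over [0, T] is the maximum over the line. That it is attained lets later
  estimates absorb it.\<close>

lemma sol_bounded:
  assumes u: "u \<in> L2_fun 0 T"
  obtains B where "\<And>t. norm (sol u \<eta> t) \<le> B" "\<exists>t. norm (sol u \<eta> t) = B"
proof -
  have "\<exists>t\<in>{0..T}. \<forall>s\<in>{0..T}. norm (sol u \<eta> s) \<le> norm (sol u \<eta> t)"
    by (rule continuous_attains_sup) (use T in \<open>auto intro!: continuous_intros continuous_on_sol u\<close>)
  then obtain t where t: "t \<in> {0..T}" "\<And>s. s \<in> {0..T} \<Longrightarrow> norm (sol u \<eta> s) \<le> norm (sol u \<eta> t)" by blast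
  have "norm (sol u \<eta> s) \<le> norm (sol u \<eta> t)" for s
    using t(2)[of "max 0 (min T s)"] sol_clamp[OF u, of \<eta> s] T by simp
  then show ?thesis using that by blast
qed

end

section \<open>Mild solutions and conservation of the norm\<close>

lemma measurable_evol:
  assumes p: "p \<in> borel_measurable N" and f: "f \<in> borel_measurable N"
  shows "(\<lambda>s. evol \<theta> (f s) (p s)) \<in> borel_measurable N"
  by (rule borel_measurable_continuous_Pair[OF f p])
    (intro continuous_on_evol_compose continuous_intros)

lemma integral_l2_coef:
  assumes "integrable N f"
  shows "cinner (integral\<^sup>L N f) y = (LINT s|N. cinner (f s) y)"
  using integral_bounded_linear[OF bounded_linear_cinner_left assms, of y] by simp

lemma integral_restrict_time:
  fixes F :: "real \<Rightarrow> 'a::{banach, second_countable_topology}"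
  assumes "0 \<le> t" "t \<le> T"
  shows "(LINT s|lebesgue_on {0<..<t}. F s) = (LINT s|lebesgue_on {0<..<T}. indicator {..<t} s *\<^sub>R F s)"
proof -
  have *: "indicator {0<..<T} s * indicator {..<t} s = (indicator {0<..<t} s :: real)" for s
    using assms by (auto simp: indicator_def)
  show ?thesis by (subst (1 2) integral_restrict_space) (auto simp: *)
qed

context control
begin

lemma integrable_L2V: "q \<in> L2V T \<Longrightarrow> integrable MT q"
proof -
  assume q: "q \<in> L2V T"
  show ?thesis
  proof (rule Bochner_Integration.integrable_bound)
    show "integrable MT (\<lambda>s. 1 + (norm (q s))\<^sup>2)"
      by (intro Bochner_Integration.integrable_add L2VD(2)[OF q]
          finite_measure.integrable_const[OF finite_measure_lebesgue_on])
    have "norm y \<le> 1 + (norm y)\<^sup>2" for y :: l2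
      using sum_squares_bound[of 1 "norm y"] norm_ge_zero[of y]
      unfolding power_one mult_1_right by linarith
    then have "norm y \<le> norm (1 + (norm y)\<^sup>2)" for y :: l2 by simp
    then show "AE s in MT. norm (q s) \<le> norm (1 + (norm (q s))\<^sup>2)" by auto
  qed (rule L2VD(1)[OF q])
qed

lemma L2V_evol:
  assumes q: "q \<in> L2V T" and f: "continuous_on UNIV f"
  shows "(\<lambda>s. U (f s) (q s)) \<in> L2V T"
  by (rule L2V_bound(1)[OF L2VD(2)[OF q], where C = 1])
    (auto intro: measurable_evol L2VD(1)[OF q] continuous_measurable_l2[OF f])

lemma L2V_M: "q \<in> L2V T \<Longrightarrow> (\<lambda>s. M (q s)) \<in> L2V T"
  using L2V_linear[OF M, of T] by blast

lemma L2V_Lam: "q \<in> L2V T \<Longrightarrow> (\<lambda>s. Lam (q s)) \<in> L2V T"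
  using L2V_linear[OF bounded_linear_Lam, of T] by blast

text \<open>The definition of \<open>gam\<close> read backwards: \<open>Lam\<close> cancels
  \<open>jb k\<close>, and \<open>U (- s)\<close> multiplies mode k by the phase in
  \<open>gam\<close>.\<close>

lemma Lam_Gam:
  assumes q: "q \<in> L2V T"
  shows "Lam (Gam q) = - cscale \<i> (LINT s|MT. U (- s) (M (Lam (q s))))"
proof (rule l2_coef_eqI)
  fix k
  have L: "(\<lambda>s. U (- s) (M (Lam (q s)))) \<in> L2V T"
    by (intro L2V_evol L2V_M L2V_Lam q continuous_intros)
  have "cinner (- cscale \<i> (LINT s|MT. U (- s) (M (Lam (q s))))) (phi k)
      = - \<i> * (LINT s|MT. cinner (U (- s) (M (Lam (q s)))) (phi k))"
    by (simp add: cinner_minus_left cinner_cscale_left integral_l2_coef integrable_L2V[OF L])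
  also have "\<dots> = - \<i> * (LINT s|MT. cis (eigval u0 k * s) * cinner (M (Lam (q s))) (phi k))"
    by (simp add: coef_evol cis_conv_exp)
  finally show "cinner (Lam (Gam q)) (phi k) = cinner (- cscale \<i> (LINT s|MT. U (- s) (M (Lam (q s))))) (phi k)"
    by (simp add: coef_Lam coef_Gam[OF q] gam_def)
qed

lemma duhamel_integral:
  assumes q: "q \<in> L2V T" and t: "0 \<le> t" "t \<le> T"
  shows "Lam (U t (Pt q t)) = - cscale \<i> (LINT s|lebesgue_on {0<..<t}. U (t - s) (M (Lam (q s))))"
proof -
  let ?q = "\<lambda>s. indicator {..<t} s *\<^sub>R q s"
  have L: "?q \<in> L2V T" by (rule L2V_indicator[OF q]) simp
  have L': "(\<lambda>s. U (- s) (M (Lam (?q s)))) \<in> L2V T"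
    by (intro L2V_evol L2V_M L2V_Lam L continuous_intros)
  have "U t (Lam (Pt q t)) = U t (- cscale \<i> (LINT s|MT. U (- s) (M (Lam (?q s)))))"
    unfolding Pt_def Lam_Gam[OF L] ..
  also have "\<dots> = - cscale \<i> (U t (LINT s|MT. U (- s) (M (Lam (?q s)))))"
    by (simp add: linear_neg[OF bounded_linear.linear[OF bounded_linear_evol]] evol_cscale)
  also have "U t (LINT s|MT. U (- s) (M (Lam (?q s)))) = (LINT s|MT. U t (U (- s) (M (Lam (?q s)))))"
    by (rule integral_bounded_linear[OF bounded_linear_evol integrable_L2V[OF L'], symmetric])
  also have "\<dots> = (LINT s|MT. indicator {..<t} s *\<^sub>R U (t - s) (M (Lam (q s))))"
    by (simp add: evol_evol evol_scaleR linear_scale[OF bounded_linear.linear[OF bounded_linear_Lam]]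
        linear_scale[OF bounded_linear.linear[OF M]])
  also have "\<dots> = (LINT s|lebesgue_on {0<..<t}. U (t - s) (M (Lam (q s))))"
    by (rule integral_restrict_time[OF t, symmetric])
  finally show ?thesis by (simp add: Lam_evol)
qed

text \<open>The dictionary between mild solutions and \<open>is_sol\<close>, used in one direction
  for existence and in the other for uniqueness.\<close>

lemma duhamel_drive:
  assumes u: "u \<in> L2_fun 0 T" and z: "continuous_on UNIV z" and t: "t \<in> {0..T}"
    and \<psi>: "\<And>s. s \<in> {0..T} \<Longrightarrow> \<psi> s = Lam (U s (z s))"
  shows "free_evol u0 t (Lam \<eta>) - cscale \<i> (LINT s|lebesgue_on {0<..<t}. free_evol u0 (t - s) (u s *\<^sub>R M (\<psi> s)))
     = Lam (U t (\<eta> + Pt (drive u z) t))"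
proof -
  have "(LINT s|lebesgue_on {0<..<t}. free_evol u0 (t - s) (u s *\<^sub>R M (\<psi> s)))
      = (LINT s|lebesgue_on {0<..<t}. U (t - s) (M (Lam (drive u z s))))"
    using t \<psi> by (intro Bochner_Integration.integral_cong)
      (auto simp: free_evol_eq linear_scale[OF bounded_linear.linear[OF bounded_linear_Lam]]
        linear_scale[OF bounded_linear.linear[OF M]])
  then show ?thesis
    using duhamel_integral[OF drive_L2V[OF u z], of t] t
    by (simp add: evol_add_right linear_add[OF bounded_linear.linear[OF bounded_linear_Lam]] free_evol_eq Lam_evol)
qed

definition traj :: "(real \<Rightarrow> real) \<Rightarrow> l2 \<Rightarrow> real \<Rightarrow> l2" where
  "traj u \<eta> = restrict (\<lambda>t. Lam (U t (sol u \<eta> t))) {0..T}"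

lemma traj_mild:
  assumes u: "u \<in> L2_fun 0 T" and \<mu>: "mult_op \<mu> = M"
  shows "mild_solution T u0 u \<mu> (Lam \<eta>) (traj u \<eta>)"
proof -
  have zc: "continuous_on UNIV (\<lambda>t. U t (sol u \<eta> t))"
    by (intro continuous_on_evol_compose continuous_intros continuous_on_sol[OF u])
  have "traj u \<eta> \<in> C_H1p T"
    unfolding C_H1p_def
  proof (intro CollectI conjI ballI)
    show "traj u \<eta> \<in> extensional {0..T}" by (simp add: traj_def)
    fix t assume t: "t \<in> {0..T}"
    show "traj u \<eta> t \<in> H1p" using t by (simp add: traj_def H1p_eq)
    have "((\<lambda>s. norm (U s (sol u \<eta> s) - U t (sol u \<eta> t))) \<longlongrightarrow> 0) (at t within {0..T})"
      using zc continuous_on_subset[OF zc, of "{0..T}"] t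
      by (intro tendsto_norm_zero LIM_zero) (auto simp: continuous_on_def)
    moreover have "\<forall>\<^sub>F s in at t within {0..T}. norm (U s (sol u \<eta> s) - U t (sol u \<eta> t)) = H1p_norm (traj u \<eta> s - traj u \<eta> t)"
      unfolding eventually_at_filter
      by (rule always_eventually) (use t in \<open>auto simp: traj_def Lam_diff[symmetric] H1p_norm_Lam\<close>)
    ultimately show "((\<lambda>s. H1p_norm (traj u \<eta> s - traj u \<eta> t)) \<longlongrightarrow> 0) (at t within {0..T})"
      by (rule Lim_transform_eventually)
  qed
  moreover have "traj u \<eta> t = free_evol u0 t (Lam \<eta>)
        - cscale \<i> (LINT s|lebesgue_on {0<..<t}. free_evol u0 (t - s) (u s *\<^sub>R M (traj u \<eta> s)))"
    if t: "t \<in> {0..T}" for t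
  proof -
    have "traj u \<eta> t = Lam (U t (sol u \<eta> t))" using t by (simp add: traj_def)
    also have "\<dots> = Lam (U t (\<eta> + Pt (drive u (sol u \<eta>)) t))"
      by (rule arg_cong[OF sol_eq[OF u], of "\<lambda>x. Lam (U t x)"])
    also have "\<dots> = free_evol u0 t (Lam \<eta>)
        - cscale \<i> (LINT s|lebesgue_on {0<..<t}. free_evol u0 (t - s) (u s *\<^sub>R M (traj u \<eta> s)))"
      by (rule duhamel_drive[OF u continuous_on_sol[OF u] t, symmetric]) (simp add: traj_def)
    finally show ?thesis .
  qed
  ultimately show ?thesis unfolding mild_solution_def \<mu> by (intro conjI ballI)
qed

text \<open>Continuity in \<open>H1p_norm\<close> is norm continuity once \<open>Lam\<close> is
  removed. Pulling back by the free evolution and freezing time outside [0, T] turns any mild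
  solution into one in the sense of \<open>is_sol\<close>, which is unique.\<close>

lemma mild_unique:
  assumes u: "u \<in> L2_fun 0 T" and \<mu>: "mult_op \<mu> = M"
    and mild: "mild_solution T u0 u \<mu> (Lam \<eta>) \<psi>"
  shows "\<psi> = traj u \<eta>"
proof -
  have \<psi>: "\<psi> \<in> extensional {0..T}" "\<And>t. t \<in> {0..T} \<Longrightarrow> \<psi> t \<in> H1p"
    "\<And>t. t \<in> {0..T} \<Longrightarrow> ((\<lambda>s. H1p_norm (\<psi> s - \<psi> t)) \<longlongrightarrow> 0) (at t within {0..T})"
    using mild by (auto simp: mild_solution_def C_H1p_def)
  have "\<exists>g. \<forall>t\<in>{0..T}. \<psi> t = Lam (g t)" using \<psi>(2) unfolding H1p_eq by (intro bchoice) blast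
  then obtain g where g: "\<And>t. t \<in> {0..T} \<Longrightarrow> \<psi> t = Lam (g t)" by blast
  have gc: "continuous_on {0..T} g"
    unfolding continuous_on_def
  proof (intro ballI)
    fix t assume t: "t \<in> {0..T}"
    have "\<forall>\<^sub>F s in at t within {0..T}. H1p_norm (\<psi> s - \<psi> t) = norm (g s - g t)"
      unfolding eventually_at_filter
      by (rule always_eventually) (use t g in \<open>auto simp: Lam_diff[symmetric] H1p_norm_Lam\<close>)
    from Lim_transform_eventually[OF \<psi>(3)[OF t] this]
    show "(g \<longlongrightarrow> g t) (at t within {0..T})" by (rule LIM_zero_cancel[OF tendsto_norm_zero_cancel])
  qed
  let ?c = "\<lambda>t. max 0 (min T t)"
  define z where "z t = U (- ?c t) (g (?c t))" for t
  have zc: "continuous_on UNIV z"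
    unfolding z_def[abs_def]
    by (intro continuous_on_evol_compose continuous_intros continuous_on_compose2[OF gc])
      (use T in auto)
  have \<psi>z: "\<psi> s = Lam (U s (z s))" if "s \<in> {0..T}" for s
    using that g[OF that] by (simp add: z_def evol_evol)
  have eq: "z t = \<eta> + Pt (drive u z) t" if t: "t \<in> {0..T}" for t
  proof -
    have "\<psi> t = free_evol u0 t (Lam \<eta>) - cscale \<i> (LINT s|lebesgue_on {0<..<t}. free_evol u0 (t - s) (u s *\<^sub>R M (\<psi> s)))"
      using mild t unfolding mild_solution_def \<mu> by blast
    also have "\<dots> = Lam (U t (\<eta> + Pt (drive u z) t))"
      by (rule duhamel_drive[OF u zc t \<psi>z])
    finally have "U t (z t) = U t (\<eta> + Pt (drive u z) t)" using \<psi>z[OF t] by simp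
    then have "U (- t) (U t (z t)) = U (- t) (U t (\<eta> + Pt (drive u z) t))" by simp
    then show ?thesis by (simp add: evol_evol)
  qed
  have "is_sol u \<eta> z"
    unfolding is_sol_def
  proof (intro conjI allI zc)
    fix t
    have "z t = z (?c t)" using T by (simp add: z_def)
    also have "\<dots> = \<eta> + Pt (drive u z) (?c t)" using T by (intro eq) auto
    also have "Pt (drive u z) (?c t) = Pt (drive u z) t" by (rule Pt_clamp[symmetric])
    finally show "z t = \<eta> + Pt (drive u z) t" .
  qed
  then have "z = sol u \<eta>" by (rule sol_eqI[OF u])
  then show ?thesis
    using \<psi>(1) \<psi>z by (intro extensionalityI[of _ "{0..T}"]) (auto simp: traj_def)
qed

text \<open>The derivative of the conserved quantity vanishes since \<open>M\<close> is symmetric; increments are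
  therefore of second order in $\int |u|$.\<close>

lemma norm_sol:
  assumes u: "u \<in> L2_fun 0 T"
  shows "norm (Lam (sol u \<eta> t)) = norm (Lam \<eta>)"
proof -
  define \<xi> where "\<xi> s = Lam (sol u \<eta> s)" for s
  let ?q = "drive u (sol u \<eta>)"
  \<comment> \<open>Formally the derivative of \<open>\<xi>\<close> is \<open>u\<close> times
    \<open>?P\<close>.\<close>
  let ?P = "\<lambda>s. - cscale \<i> (U (- s) (M (U s (\<xi> s))))"
  have q: "?q \<in> L2V T" by (rule drive_L2V[OF u continuous_on_sol[OF u]])
  obtain B0 where "\<And>t. norm (sol u \<eta> t) \<le> B0" using sol_bounded[OF u] by metis
  then have \<xi>B: "norm (\<xi> s) \<le> B0" for s using norm_Lam_le[of "sol u \<eta> s"] order_trans unfolding \<xi>_def by blast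
  obtain KM where KM: "0 < KM" "\<And>x. norm (M x) \<le> norm x * KM" using bounded_linear.pos_bounded[OF M] by blast
  define B where "B = B0 * KM"
  have PB: "norm (?P s) \<le> B" for s
  proof -
    have "norm (?P s) = norm (M (U s (\<xi> s)))" by (simp add: norm_cscale)
    also have "\<dots> \<le> norm (\<xi> s) * KM" using KM(2)[of "U s (\<xi> s)"] by simp
    also have "\<dots> \<le> B" unfolding B_def using \<xi>B[of s] KM(1) by (intro mult_right_mono) auto
    finally show ?thesis .
  qed
  have B: "0 \<le> B" using order_trans[OF norm_ge_zero PB] .
  have absu: "integrable MT (\<lambda>s. \<bar>u s\<bar>)" using integrable_norm[OF L2_fun_integrable[OF u]] by simp
  let ?n = "indef T (\<lambda>s. \<bar>u s\<bar>)"
  have Pc: "continuous_on UNIV ?P"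
    unfolding \<xi>_def by (intro continuous_intros bounded_linear.continuous_on[OF bounded_linear_cscale]
        continuous_on_evol_compose bounded_linear.continuous_on[OF M] bounded_linear.continuous_on[OF bounded_linear_Lam]
        continuous_on_sol[OF u])
  have uP: "(\<lambda>s. u s *\<^sub>R ?P s) \<in> L2V T"
    by (rule L2V_control(1)[OF u continuous_measurable_l2[OF Pc]]) (rule PB)
  have diff: "\<xi> t - \<xi> r = (LINT s|MT. indicator {r..<t} s *\<^sub>R (u s *\<^sub>R ?P s))" if rt: "r \<le> t" for r t
  proof -
    have L: "(\<lambda>s. indicator {r..<t} s *\<^sub>R ?q s) \<in> L2V T" by (rule L2V_indicator[OF q]) simp
    have L1: "(\<lambda>s. U (- s) (M (Lam (indicator {r..<t} s *\<^sub>R ?q s)))) \<in> L2V T"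
      by (intro L2V_evol L2V_M L2V_Lam L continuous_intros)
    have "\<xi> t - \<xi> r = Lam (Pt ?q t - Pt ?q r)"
      unfolding \<xi>_def Lam_diff[symmetric]
      using sol_eq[OF u, of \<eta> t] sol_eq[OF u, of \<eta> r] by (metis add_diff_cancel_left)
    also have "\<dots> = - cscale \<i> (LINT s|MT. U (- s) (M (Lam (indicator {r..<t} s *\<^sub>R ?q s))))"
      unfolding Pt_diff[OF q rt] by (rule Lam_Gam[OF L])
    also have "\<dots> = (LINT s|MT. - cscale \<i> (U (- s) (M (Lam (indicator {r..<t} s *\<^sub>R ?q s)))))"
      using integral_bounded_linear[OF bounded_linear_cscale integrable_L2V[OF L1], of \<i>] by simp
    also have "\<dots> = (LINT s|MT. indicator {r..<t} s *\<^sub>R (u s *\<^sub>R ?P s))"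
      by (simp add: \<xi>_def evol_scaleR Lam_evol[symmetric] linear_scale[OF bounded_linear.linear[OF bounded_linear_Lam]]
        linear_scale[OF bounded_linear.linear[OF M]] linear_scale[OF bounded_linear.linear[OF bounded_linear_cscale]])
    finally show ?thesis .
  qed
  have iuP: "integrable MT (\<lambda>s. indicator {r..<t} s *\<^sub>R (u s *\<^sub>R ?P s))" for r t
    by (rule integrable_L2V, rule L2V_indicator[OF uP]) simp
  have lip: "norm (\<xi> t - \<xi> r) \<le> B * (?n t - ?n r)" if rt: "r \<le> t" for r t
  proof -
    have "norm (\<xi> t - \<xi> r) \<le> (LINT s|MT. B * (indicator {r..<t} s * \<bar>u s\<bar>))"
      unfolding diff[OF rt]
    proof (rule Bochner_Integration.integral_norm_bound_integral[OF iuP])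
      show "integrable MT (\<lambda>s. B * (indicator {r..<t} s * \<bar>u s\<bar>))"
        by (intro integrable_mult_right indef_integrable[OF absu]) simp
      show "norm (indicator {r..<t} s *\<^sub>R (u s *\<^sub>R ?P s)) \<le> B * (indicator {r..<t} s * \<bar>u s\<bar>)" for s
        using mult_left_mono[OF PB[of s], of "\<bar>u s\<bar>"] by (simp add: indicator_def mult.commute)
    qed
    then show ?thesis by (simp add: indef_diff[OF absu rt])
  qed
  have n_mono: "?n r \<le> ?n t" if "r \<le> t" for r t by (rule indef_mono[OF absu _ that]) simp
  define h where "h t = (norm (\<xi> t))\<^sup>2" for t
  have "h t = h 0" if "0 \<le> t" "t \<le> T" for t
  proof (rule const_of_quadratic_variation[OF continuous_on_indef[OF absu] n_mono _ that])
    fix r t assume rt: "0 \<le> r" "r \<le> t" "t \<le> T"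
    let ?d = "?n t - ?n r"
    have d0: "0 \<le> ?d" using n_mono[OF rt(2)] by simp
    \<comment> \<open>\<open>M\<close> is symmetric and \<open>U\<close> unitary, so the pairing of
      M U \<xi> with U \<xi> is real, and the factor -\<i> makes the real part vanish.\<close>
    have orth: "inner (?P s) (\<xi> s) = 0" for s
    proof -
      let ?y = "U s (\<xi> s)"
      have adj: "cinner (U (- s) x) y = cinner x (U s y)" for x y
      proof -
        have "cinner x (U s y) = cinner (U (- s) x) y"
        proof (rule bounded_linear_eqI[where f = "\<lambda>y. cinner x (U s y)" and g = "\<lambda>y. cinner (U (- s) x) y"])
          show "bounded_linear (\<lambda>y. cinner x (U s y))"
            by (rule bounded_linear_compose[OF bounded_linear_cinner_right bounded_linear_evol])
          show "cinner x (U s (cscale c (phi k))) = cinner (U (- s) x) (cscale c (phi k))" for c k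
            by (simp add: evol_cscale evol_phi cscale_cscale cinner_cscale_right coef_evol exp_cnj)
        qed (rule bounded_linear_cinner_right)
        then show ?thesis by simp
      qed
      have "cinner (M ?y) ?y = cnj (cinner (M ?y) ?y)"
        using M_sym[of ?y ?y] cinner_commute[of "M ?y" ?y] by simp
      then have "Im (cinner (M ?y) ?y) = 0" by (simp add: complex_eq_iff)
      then show ?thesis
        by (simp add: inner_l2_def cinner_minus_left cinner_cscale_left adj)
    qed
    have pt: "\<bar>inner (indicator {r..<t} s *\<^sub>R (u s *\<^sub>R ?P s)) (\<xi> t + \<xi> r)\<bar> \<le> (2 * B\<^sup>2 * ?d) * (indicator {r..<t} s * \<bar>u s\<bar>)" for s
    proof (cases "s \<in> {r..<t}")
      case True
      \<comment> \<open>Two copies of the vanishing pairing with \<open>\<xi> s\<close> are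
        subtracted; the remaining differences are themselves of first order in
        \<open>?d\<close>.\<close>
      have "inner (?P s) (\<xi> t + \<xi> r) = inner (?P s) ((\<xi> t - \<xi> s) + (\<xi> r - \<xi> s))"
        using orth[of s] by (simp add: inner_add_right inner_diff_right)
      also have "\<bar>\<dots>\<bar> \<le> norm (?P s) * norm ((\<xi> t - \<xi> s) + (\<xi> r - \<xi> s))" by (rule Cauchy_Schwarz_ineq2)
      also have "\<dots> \<le> B * (B * ?d + B * ?d)"
      proof (intro mult_mono PB B order_trans[OF norm_triangle_ineq add_mono])
        have "norm (\<xi> t - \<xi> s) \<le> B * (?n t - ?n s)" using True by (intro lip) simp
        also have "\<dots> \<le> B * ?d" using B n_mono[of r s] True by (intro mult_left_mono) auto
        finally show "norm (\<xi> t - \<xi> s) \<le> B * ?d" .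
        have "norm (\<xi> r - \<xi> s) \<le> B * (?n s - ?n r)" using True lip[of r s] by (simp add: norm_minus_commute)
        also have "\<dots> \<le> B * ?d" using B n_mono[of s t] True by (intro mult_left_mono) auto
        finally show "norm (\<xi> r - \<xi> s) \<le> B * ?d" .
      qed (use B d0 in auto)
      finally have "\<bar>inner (?P s) (\<xi> t + \<xi> r)\<bar> \<le> 2 * B\<^sup>2 * ?d" by (simp add: power2_eq_square algebra_simps)
      then have "\<bar>u s\<bar> * \<bar>inner (?P s) (\<xi> t + \<xi> r)\<bar> \<le> \<bar>u s\<bar> * (2 * B\<^sup>2 * ?d)" by (intro mult_left_mono) auto
      then show ?thesis using True by (simp only: indicator_simps scaleR_one inner_scaleR_left abs_mult mult_1 mult.commute)
    qed simp
    have "h t - h r = inner (\<xi> t - \<xi> r) (\<xi> t + \<xi> r)"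
      by (simp add: h_def power2_norm_eq_inner inner_diff_left inner_diff_right inner_add_left inner_add_right inner_commute)
    also have "\<dots> = (LINT s|MT. inner (indicator {r..<t} s *\<^sub>R (u s *\<^sub>R ?P s)) (\<xi> t + \<xi> r))"
      unfolding diff[OF rt(2)]
      by (rule integral_bounded_linear[OF bounded_linear_inner_left iuP, symmetric])
    finally have eq: "h t - h r = (LINT s|MT. inner (indicator {r..<t} s *\<^sub>R (u s *\<^sub>R ?P s)) (\<xi> t + \<xi> r))" .
    have "\<bar>h t - h r\<bar> \<le> (LINT s|MT. (2 * B\<^sup>2 * ?d) * (indicator {r..<t} s * \<bar>u s\<bar>))"
      unfolding eq
    proof (subst real_norm_def[symmetric], rule Bochner_Integration.integral_norm_bound_integral)
      show "integrable MT (\<lambda>s. inner (indicator {r..<t} s *\<^sub>R (u s *\<^sub>R ?P s)) (\<xi> t + \<xi> r))"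
        by (rule integrable_bounded_linear[OF bounded_linear_inner_left iuP])
      show "integrable MT (\<lambda>s. (2 * B\<^sup>2 * ?d) * (indicator {r..<t} s * \<bar>u s\<bar>))"
        by (intro integrable_mult_right indef_integrable[OF absu]) simp
    qed (use pt in simp)
    also have "\<dots> = (2 * B\<^sup>2 * ?d) * ?d" by (simp add: indef_diff[OF absu rt(2)])
    finally show "\<bar>h t - h r\<bar> \<le> 2 * B\<^sup>2 * ?d\<^sup>2" by (simp add: power2_eq_square mult.assoc)
  qed
  from this[of "max 0 (min T t)"] have "h t = h 0"
    using T sol_clamp[OF u, of \<eta> t] by (simp add: h_def \<xi>_def)
  then show ?thesis by (simp add: h_def \<xi>_def sol_0[OF u])
qed

end

section \<open>The moment problem\<close>

locale spectrum =
  fixes u0 :: real and l :: int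
  assumes irr: "u0 \<notin> {2 * pi * q |q. q \<in> \<rat>}"
begin

definition nu :: "int \<Rightarrow> real" where "nu k = eigval u0 l - eigval u0 k"

definition nu0 :: real where "nu0 = u0 / (2 * pi)"

lemma nu0_irr: "nu0 \<notin> \<rat>"
proof
  assume "nu0 \<in> \<rat>"
  moreover have "u0 = 2 * pi * nu0" by (simp add: nu0_def)
  ultimately show False using irr by blast
qed

lemma nu_diff: "nu j - nu k = - (4 * pi\<^sup>2 * (of_int (j - k) * (of_int (j + k) - nu0)))"
  using eigval_diff[of u0 j k] by (simp add: nu_def nu0_def)

lemma nu_add: "nu j + nu k = - (4 * pi\<^sup>2 * ((of_int (j\<^sup>2 + k\<^sup>2 - 2 * l\<^sup>2)) - nu0 * of_int (j + k - 2 * l)))"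
  by (simp add: nu_def eigval_def nu0_def field_simps power2_eq_square)

lemma nu_l [simp]: "nu l = 0" by (simp add: nu_def)

lemma nu_inj: "nu j = nu k \<Longrightarrow> j = k"
proof (rule ccontr)
  assume "nu j = nu k" "j \<noteq> k"
  then have "real_of_int (j + k) - nu0 = 0" using nu_diff[of j k] by simp
  then have "nu0 = of_int (j + k)" by simp
  then show False using nu0_irr Rats_of_int[of "j + k"] by metis
qed

text \<open>The integer that multiplies the irrational \<open>nu0\<close> must vanish. This leaves j
  + k = 2 l and j^2 + k^2 = 2 l^2, whence (j - l)^2 + (k - l)^2 = 0.\<close>

lemma nu_add_eq_0:
  assumes "nu j + nu k = 0"
  shows "j = l \<and> k = l"
proof -
  have e: "of_int (j\<^sup>2 + k\<^sup>2 - 2 * l\<^sup>2) = nu0 * of_int (j + k - 2 * l)"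
    using assms unfolding nu_add by simp
  have s: "j + k - 2 * l = 0"
  proof (rule ccontr)
    assume n: "j + k - 2 * l \<noteq> 0"
    then have "real_of_int (j + k - 2 * l) \<noteq> 0" by (simp only: of_int_eq_0_iff) simp
    then have "nu0 = of_int (j\<^sup>2 + k\<^sup>2 - 2 * l\<^sup>2) / of_int (j + k - 2 * l)"
      unfolding e by simp
    moreover have "of_int (j\<^sup>2 + k\<^sup>2 - 2 * l\<^sup>2) / real_of_int (j + k - 2 * l) \<in> \<rat>"
      by (intro Rats_divide Rats_of_int)
    ultimately show False using nu0_irr by metis
  qed
  then have "real_of_int (j\<^sup>2 + k\<^sup>2 - 2 * l\<^sup>2) = 0" unfolding e by simp
  then have q: "j\<^sup>2 + k\<^sup>2 - 2 * l\<^sup>2 = 0" by (simp only: of_int_eq_0_iff)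
  have "(j - l)\<^sup>2 + (k - l)\<^sup>2 = (j\<^sup>2 + k\<^sup>2 - 2 * l\<^sup>2) - 2 * l * (j + k - 2 * l)"
    by (simp add: power2_eq_square algebra_simps)
  also have "\<dots> = 0" unfolding s q by simp
  finally have "(j - l)\<^sup>2 + (k - l)\<^sup>2 = 0" .
  then show ?thesis by (simp add: sum_power2_eq_zero_iff)
qed

text \<open>\<open>\<delta>\<close> is the distance from \<open>nu0\<close> to the nearest integer,
  positive by irrationality. The shift by the floor centres the linear growth, so that sums over m
  of inverse squares are covered by \<open>jb_const\<close>.\<close>

lemma nu0_dist: "\<exists>\<delta>>0. \<forall>m. \<delta> * jb (m - \<lfloor>nu0\<rfloor>) \<le> \<bar>of_int m - nu0\<bar>"
proof -
  define f where "f = nu0 - of_int \<lfloor>nu0\<rfloor>"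
  have "nu0 \<noteq> of_int \<lfloor>nu0\<rfloor>" using nu0_irr Rats_of_int[of "\<lfloor>nu0\<rfloor>"] by metis
  then have f: "0 < f" "f < 1" unfolding f_def by linarith+
  define \<delta> where "\<delta> = min f (1 - f)"
  have \<delta>: "0 < \<delta>" "\<delta> \<le> f" "\<delta> \<le> 1 - f" "\<delta> < 1" using f by (auto simp: \<delta>_def)
  have "\<delta> * jb p \<le> \<bar>of_int p - f\<bar>" for p
  proof -
    consider "p = 0" | "p \<ge> 1" | "p \<le> -1" by linarith
    then show ?thesis
    proof cases
      case 1
      then show ?thesis using \<delta> f by (simp add: jb_def)
    next
      case 2
      have "\<delta> * of_int p \<le> (1 - f) * of_int p" using 2 \<delta> by (intro mult_right_mono) auto
      also have "\<dots> \<le> of_int p - f" using mult_left_mono[of 1 "real_of_int p" f] 2 f by (simp add: algebra_simps)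
      finally show ?thesis using 2 f by (simp add: jb_def max_def)
    next
      case 3
      have "\<delta> * - of_int p \<le> 1 * - of_int p" using 3 \<delta> by (intro mult_right_mono) auto
      moreover have a: "jb p = - of_int p" and b: "\<bar>of_int p - f\<bar> = f - of_int p" using 3 f by (auto simp: jb_def)
      ultimately show ?thesis unfolding a b using f by linarith
    qed
  qed
  from this[of "_ - \<lfloor>nu0\<rfloor>"] have "\<delta> * jb (m - \<lfloor>nu0\<rfloor>) \<le> \<bar>of_int m - nu0\<bar>" for m by (simp add: f_def)
  then show ?thesis using \<delta>(1) by blast
qed

text \<open>If |j| and |k| are at least K, then |j + k| or |j - k| is at least 2 K, so one factor of
  \<nu>_j - \<nu>_k is at least of size K while the inverse square of the other is summable. In
  \<nu>_j + \<nu>_k the quadratic part j^2 + k^2 dominates and yields |j| K. Both row sums are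
  therefore of order 1 / K^2.\<close>

lemma tail_offdiag:
  assumes \<tau>: "0 < \<tau>" and \<epsilon>: "0 < \<epsilon>"
  shows "\<exists>K>\<bar>l\<bar>. \<forall>F. finite F \<longrightarrow> F \<subseteq> {k. K \<le> \<bar>k\<bar>} \<longrightarrow> (\<forall>k\<in>F.
    (\<Sum>j\<in>F - {k}. norm (wthat 0 \<tau> (nu j - nu k))) \<le> \<epsilon> \<and> (\<Sum>j\<in>F. norm (wthat 0 \<tau> (nu j + nu k))) \<le> \<epsilon>)"
proof -
  obtain \<delta> where \<delta>: "0 < \<delta>" "\<And>m. \<delta> * jb (m - \<lfloor>nu0\<rfloor>) \<le> \<bar>of_int m - nu0\<bar>" using nu0_dist by blast
  define R where "R = 2 * (real_of_int l)\<^sup>2 + 2 * \<bar>nu0\<bar> * \<bar>real_of_int l\<bar>"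
  define D where "D = 4 * \<tau> * jb_const * (1 + 1 / \<delta>\<^sup>2)"
  have R0: "0 \<le> R" by (simp add: R_def)
  have D0: "0 \<le> D" using \<tau> jb_const_pos by (simp add: D_def)
  \<comment> \<open>Each summand serves one estimate: |l| < K and 1 <= K, the absorption of
    \<open>nu0\<close> into j + k and into j^2 and k^2, the absorption of the terms in l, and the
    final bound D / K^2 <= \<open>\<epsilon>\<close>.\<close>
  define K0 where "K0 = \<bar>real_of_int l\<bar> + 1 + 4 * \<bar>nu0\<bar> + 4 * R + D / \<epsilon>"
  define K where "K = \<lceil>K0\<rceil>"
  have K0: "K0 \<le> of_int K" by (simp add: K_def)
  have De: "0 \<le> D / \<epsilon>" using D0 \<epsilon> by simp
  have K1: "1 \<le> real_of_int K" and Kl: "\<bar>real_of_int l\<bar> < of_int K" and Kn: "4 * \<bar>nu0\<bar> \<le> of_int K"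
    and KR: "4 * R \<le> of_int K" and KD: "D / \<epsilon> \<le> of_int K"
    using K0 R0 De unfolding K0_def by linarith+
  have KK: "real_of_int K \<le> (of_int K)\<^sup>2" using mult_left_mono[OF K1, of "of_int K"] K1 by (simp add: power2_eq_square)
  have D2: "D / (of_int K)\<^sup>2 \<le> \<epsilon>"
  proof -
    have "D \<le> \<epsilon> * of_int K" using KD \<epsilon> by (simp add: field_simps)
    also have "\<dots> \<le> \<epsilon> * (of_int K)\<^sup>2" using KK \<epsilon> by (intro mult_left_mono) auto
    finally show ?thesis using K1 by (simp add: field_simps)
  qed
  have "1 \<le> pi\<^sup>2" using pi_ge_two by (intro one_le_power) simp
  then have pi1: "1 \<le> 4 * pi\<^sup>2" by simp
  have W: "norm (wthat 0 \<tau> \<omega>) \<le> 4 * \<tau> / x\<^sup>2" if "0 < x" "x \<le> \<bar>\<omega>\<bar>" for x \<omega>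
  proof -
    have "norm (wthat 0 \<tau> \<omega>) \<le> 4 * (\<tau> - 0) / \<omega>\<^sup>2" using that by (intro wthat_decay \<tau>) auto
    also have "\<dots> \<le> 4 * \<tau> / x\<^sup>2"
    proof -
      have "x\<^sup>2 \<le> \<bar>\<omega>\<bar>\<^sup>2" using that by (intro power_mono) auto
      then show ?thesis using that \<tau> by (simp add: frac_le)
    qed
    finally show ?thesis .
  qed
  have sum1: "(\<Sum>j\<in>F - {k}. norm (wthat 0 \<tau> (nu j - nu k))) \<le> \<epsilon>"
    if F: "finite F" "F \<subseteq> {k. K \<le> \<bar>k\<bar>}" and k: "k \<in> F" for F k
  proof -
    let ?n = "\<lfloor>nu0\<rfloor>"
    have "(\<Sum>j\<in>F - {k}. norm (wthat 0 \<tau> (nu j - nu k)))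
        \<le> (\<Sum>j\<in>F - {k}. (4 * \<tau> / (of_int K)\<^sup>2) * (1 / (jb (j - k))\<^sup>2 + (1 / \<delta>\<^sup>2) * (1 / (jb (j + k - ?n))\<^sup>2)))"
    proof (rule sum_mono)
      fix j assume j: "j \<in> F - {k}"
      then have jk: "K \<le> \<bar>j\<bar>" "K \<le> \<bar>k\<bar>" "j \<noteq> k" using F k by auto
      have a: "jb (j - k) = \<bar>real_of_int (j - k)\<bar>" using jk(3) by (simp add: jb_def)
      have ap: "0 < jb (j - k)" "0 < jb (j + k - ?n)" by simp_all
      have om: "\<bar>real_of_int (j - k)\<bar> * \<bar>of_int (j + k) - nu0\<bar> \<le> \<bar>nu j - nu k\<bar>"
        using mult_right_mono[OF pi1, of "\<bar>real_of_int (j - k)\<bar> * \<bar>of_int (j + k) - nu0\<bar>"]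
        by (simp only: nu_diff abs_minus_cancel abs_mult) simp
      have "2 * K \<le> \<bar>j + k\<bar> \<or> 2 * K \<le> \<bar>j - k\<bar>" using jk by linarith
      then show "norm (wthat 0 \<tau> (nu j - nu k))
          \<le> (4 * \<tau> / (of_int K)\<^sup>2) * (1 / (jb (j - k))\<^sup>2 + (1 / \<delta>\<^sup>2) * (1 / (jb (j + k - ?n))\<^sup>2))"
      proof
        assume "2 * K \<le> \<bar>j + k\<bar>"
        then have "2 * real_of_int K \<le> \<bar>real_of_int (j + k)\<bar>" by linarith
        then have "of_int K \<le> \<bar>of_int (j + k) - nu0\<bar>" using Kn K1 by linarith
        then have "jb (j - k) * of_int K \<le> \<bar>nu j - nu k\<bar>"
          unfolding a by (intro order_trans[OF mult_left_mono om]) auto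
        then have "norm (wthat 0 \<tau> (nu j - nu k)) \<le> 4 * \<tau> / (jb (j - k) * of_int K)\<^sup>2"
          using K1 by (intro W mult_pos_pos) auto
        also have "\<dots> = (4 * \<tau> / (of_int K)\<^sup>2) * (1 / (jb (j - k))\<^sup>2)" by (simp add: power_mult_distrib)
        also have "\<dots> \<le> (4 * \<tau> / (of_int K)\<^sup>2) * (1 / (jb (j - k))\<^sup>2 + (1 / \<delta>\<^sup>2) * (1 / (jb (j + k - ?n))\<^sup>2))"
          using \<tau> by (intro mult_left_mono) auto
        finally show ?thesis .
      next
        assume "2 * K \<le> \<bar>j - k\<bar>"
        then have "real_of_int K \<le> \<bar>real_of_int (j - k)\<bar>" using K1 by linarith
        then have "of_int K * (\<delta> * jb (j + k - ?n)) \<le> \<bar>real_of_int (j - k)\<bar> * \<bar>of_int (j + k) - nu0\<bar>"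
          using \<delta>(1) K1 by (intro mult_mono \<delta>(2)) (auto intro!: mult_nonneg_nonneg simp: less_imp_le)
        then have "of_int K * (\<delta> * jb (j + k - ?n)) \<le> \<bar>nu j - nu k\<bar>" using om by linarith
        then have "norm (wthat 0 \<tau> (nu j - nu k)) \<le> 4 * \<tau> / (of_int K * (\<delta> * jb (j + k - ?n)))\<^sup>2"
          using K1 \<delta>(1) by (intro W mult_pos_pos) auto
        also have "\<dots> = (4 * \<tau> / (of_int K)\<^sup>2) * ((1 / \<delta>\<^sup>2) * (1 / (jb (j + k - ?n))\<^sup>2))" by (simp add: power_mult_distrib)
        also have "\<dots> \<le> (4 * \<tau> / (of_int K)\<^sup>2) * (1 / (jb (j - k))\<^sup>2 + (1 / \<delta>\<^sup>2) * (1 / (jb (j + k - ?n))\<^sup>2))"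
          using \<tau> by (intro mult_left_mono) auto
        finally show ?thesis .
      qed
    qed
    also have "\<dots> = (4 * \<tau> / (of_int K)\<^sup>2) * ((\<Sum>j\<in>F - {k}. 1 / (jb (j - k))\<^sup>2)
        + (1 / \<delta>\<^sup>2) * (\<Sum>j\<in>F - {k}. 1 / (jb (j + k - ?n))\<^sup>2))"
      by (simp only: sum_distrib_left[symmetric] sum.distrib)
    also have "\<dots> \<le> (4 * \<tau> / (of_int K)\<^sup>2) * (jb_const + (1 / \<delta>\<^sup>2) * jb_const)"
    proof -
      have "(\<Sum>j\<in>F - {k}. 1 / (jb (j - k))\<^sup>2) = (\<Sum>j\<in>(\<lambda>j. j - k) ` (F - {k}). 1 / (jb j)\<^sup>2)"
        by (subst sum.reindex) (auto simp: inj_on_def)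
      moreover have "(\<Sum>j\<in>F - {k}. 1 / (jb (j + k - ?n))\<^sup>2) = (\<Sum>j\<in>(\<lambda>j. j + k - ?n) ` (F - {k}). 1 / (jb j)\<^sup>2)"
        by (subst sum.reindex) (auto simp: inj_on_def)
      ultimately show ?thesis using \<tau> F
        by (intro mult_left_mono add_mono) (simp_all add: sum_jb_le)
    qed
    also have "\<dots> = D / (of_int K)\<^sup>2" by (simp add: D_def algebra_simps)
    finally show ?thesis using D2 by simp
  qed
  have sum2: "(\<Sum>j\<in>F. norm (wthat 0 \<tau> (nu j + nu k))) \<le> \<epsilon>"
    if F: "finite F" "F \<subseteq> {k. K \<le> \<bar>k\<bar>}" and k: "k \<in> F" for F k
  proof -
    have "(\<Sum>j\<in>F. norm (wthat 0 \<tau> (nu j + nu k))) \<le> (\<Sum>j\<in>F. (4 * \<tau> / (of_int K)\<^sup>2) * (1 / (jb j)\<^sup>2))"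
    proof (rule sum_mono)
      fix j assume j: "j \<in> F"
      then have jk: "K \<le> \<bar>j\<bar>" "K \<le> \<bar>k\<bar>" using F k by auto
      have J: "real_of_int K \<le> \<bar>real_of_int j\<bar>" "real_of_int K \<le> \<bar>real_of_int k\<bar>" using jk by linarith+
      \<comment> \<open>\<open>nu0\<close> costs a quarter of each square and the terms in l another
        quarter of k^2, which leaves at least half of j^2 + k^2.\<close>
      have sq: "3 / 4 * x\<^sup>2 \<le> x\<^sup>2 - nu0 * x" if "real_of_int K \<le> \<bar>x\<bar>" for x
      proof -
        have "nu0 * x \<le> \<bar>nu0\<bar> * \<bar>x\<bar>" by (simp add: abs_mult[symmetric])
        also have "\<dots> \<le> (\<bar>x\<bar> / 4) * \<bar>x\<bar>" using Kn that by (intro mult_right_mono) auto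
        also have "\<dots> = x\<^sup>2 / 4" by (simp add: power2_eq_square abs_mult[symmetric])
        finally show ?thesis by simp
      qed
      have "2 * (real_of_int l)\<^sup>2 - 2 * nu0 * of_int l \<le> R"
      proof -
        have "- (nu0 * of_int l) \<le> \<bar>nu0\<bar> * \<bar>real_of_int l\<bar>" by (metis abs_ge_minus_self abs_mult)
        then show ?thesis unfolding R_def by linarith
      qed
      also have "R \<le> (of_int K)\<^sup>2 / 4" using KR KK by linarith
      also have "\<dots> \<le> (of_int k)\<^sup>2 / 4"
        using power_mono[OF J(2), of 2] K1 by simp
      finally have Rk: "2 * (real_of_int l)\<^sup>2 - 2 * nu0 * of_int l \<le> (of_int k)\<^sup>2 / 4" .
      have "\<bar>real_of_int j\<bar> * of_int K \<le> \<bar>real_of_int j\<bar> * \<bar>real_of_int k\<bar>" using J by (intro mult_left_mono) auto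
      also have "\<dots> \<le> ((of_int j)\<^sup>2 + (of_int k)\<^sup>2) / 2"
        using sum_squares_bound[of "\<bar>real_of_int j\<bar>" "\<bar>real_of_int k\<bar>"] by simp
      also have "\<dots> \<le> (of_int j)\<^sup>2 - nu0 * of_int j + ((of_int k)\<^sup>2 - nu0 * of_int k)
          - (2 * (real_of_int l)\<^sup>2 - 2 * nu0 * of_int l)"
        using sq[OF J(1)] sq[OF J(2)] Rk zero_le_power2[of "real_of_int j"] by argo
      also have "\<dots> = of_int (j\<^sup>2 + k\<^sup>2 - 2 * l\<^sup>2) - nu0 * of_int (j + k - 2 * l)" by (simp add: algebra_simps)
      finally have low: "\<bar>real_of_int j\<bar> * of_int K \<le> of_int (j\<^sup>2 + k\<^sup>2 - 2 * l\<^sup>2) - nu0 * of_int (j + k - 2 * l)" (is "_ \<le> ?X") .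
      have jbj: "jb j = \<bar>real_of_int j\<bar>" using J K1 by (simp add: jb_def)
      have X0: "0 \<le> ?X" using low K1 by (meson abs_ge_zero mult_nonneg_nonneg order_trans zero_le_one)
      have "?X \<le> 4 * pi\<^sup>2 * ?X" using mult_right_mono[OF pi1 X0] by simp
      also have "\<dots> = \<bar>nu j + nu k\<bar>" unfolding nu_add abs_minus_cancel using X0 by (simp only: abs_mult) simp
      finally have "jb j * of_int K \<le> \<bar>nu j + nu k\<bar>" using low unfolding jbj by linarith
      then have "norm (wthat 0 \<tau> (nu j + nu k)) \<le> 4 * \<tau> / (jb j * of_int K)\<^sup>2"
        using K1 by (intro W mult_pos_pos) auto
      also have "\<dots> = (4 * \<tau> / (of_int K)\<^sup>2) * (1 / (jb j)\<^sup>2)" by (simp add: power_mult_distrib)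
      finally show "norm (wthat 0 \<tau> (nu j + nu k)) \<le> (4 * \<tau> / (of_int K)\<^sup>2) * (1 / (jb j)\<^sup>2)" .
    qed
    also have "\<dots> \<le> (4 * \<tau> / (of_int K)\<^sup>2) * jb_const"
      unfolding sum_distrib_left[symmetric] using \<tau> F by (intro mult_left_mono sum_jb_le) auto
    also have "\<dots> \<le> (4 * \<tau> / (of_int K)\<^sup>2) * (jb_const * (1 + 1 / \<delta>\<^sup>2))"
      using \<tau> jb_const_pos by (intro mult_left_mono) (auto simp: distrib_left)
    also have "\<dots> = D / (of_int K)\<^sup>2" by (simp add: D_def)
    finally show ?thesis using D2 by simp
  qed
  have "K > \<bar>l\<bar>" using Kl by linarith
  then show ?thesis using sum1 sum2 by blast
qed

text \<open>The square of the real part is half of |H|^2 plus half of Re (H^2). With the weight, the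
  diagonal of |H|^2 gives \<tau>^3 / 6, while its off-diagonal part (frequencies \<nu>_j - \<nu>_k)
  and H^2 (frequencies \<nu>_j + \<nu>_k) are at most \<tau>^3 / 24 each. So (1/6 - 1/24 - 1/24) / 2
  = 1/24 remains, and the weight is at most \<tau>^2.\<close>

lemma tail_lower_finite:
  assumes \<tau>: "0 < \<tau>"
  shows "\<exists>K>\<bar>l\<bar>. \<forall>F c. finite F \<longrightarrow> F \<subseteq> {k. K \<le> \<bar>k\<bar>} \<longrightarrow>
    \<tau> / 24 * (\<Sum>k\<in>F. (norm (c k))\<^sup>2) \<le> (LINT s|lebesgue_on {0<..<\<tau>}. (Re (\<Sum>k\<in>F. c k * cis (nu k * s)))\<^sup>2)"
proof -
  obtain K where K: "K > \<bar>l\<bar>" "\<And>F k. finite F \<Longrightarrow> F \<subseteq> {k. K \<le> \<bar>k\<bar>} \<Longrightarrow> k \<in> F \<Longrightarrow>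
    (\<Sum>j\<in>F - {k}. norm (wthat 0 \<tau> (nu j - nu k))) \<le> \<tau> ^ 3 / 24 \<and> (\<Sum>j\<in>F. norm (wthat 0 \<tau> (nu j + nu k))) \<le> \<tau> ^ 3 / 24"
    using tail_offdiag[OF \<tau>, of "\<tau> ^ 3 / 24"] \<tau> by (auto simp: zero_less_power)
  have "\<tau> / 24 * (\<Sum>k\<in>F. (norm (c k))\<^sup>2) \<le> (LINT s|lebesgue_on {0<..<\<tau>}. (Re (\<Sum>k\<in>F. c k * cis (nu k * s)))\<^sup>2)"
    if F: "finite F" "F \<subseteq> {k. K \<le> \<bar>k\<bar>}" for F c
  proof -
    let ?N = "\<Sum>k\<in>F. (norm (c k))\<^sup>2"
    let ?H = "\<lambda>s. \<Sum>k\<in>F. c k * cis (nu k * s)"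
    let ?W = "wthat 0 \<tau>"
    have Hc: "continuous_on UNIV ?H" by (intro continuous_intros)
    define I1 where "I1 = (LINT s|lebesgue_on {0<..<\<tau>}. wt 0 \<tau> s * (norm (?H s))\<^sup>2)"
    define I2 where "I2 = (LINT s|lebesgue_on {0<..<\<tau>}. of_real (wt 0 \<tau> s) * (?H s * ?H s))"
    have i2: "integrable (lebesgue_on {0<..<\<tau>}) (\<lambda>s. of_real (wt 0 \<tau> s) * (?H s * ?H s))"
      by (intro continuous_integrable_open continuous_intros)
    have pt: "wt 0 \<tau> s * (Re (?H s))\<^sup>2 = wt 0 \<tau> s * (norm (?H s))\<^sup>2 / 2 + Re (of_real (wt 0 \<tau> s) * (?H s * ?H s)) / 2" for s
    proof -
      have "w * (Re z)\<^sup>2 = w * (norm z)\<^sup>2 / 2 + Re (of_real w * (z * z)) / 2" for w z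
        unfolding cmod_power2 by (simp add: power2_eq_square field_simps)
      then show ?thesis .
    qed
    have split: "(LINT s|lebesgue_on {0<..<\<tau>}. wt 0 \<tau> s * (Re (?H s))\<^sup>2) = I1 / 2 + Re I2 / 2"
    proof -
      have "integrable (lebesgue_on {0<..<\<tau>}) (\<lambda>s. wt 0 \<tau> s * (norm (?H s))\<^sup>2 / 2)"
        by (intro continuous_integrable_open continuous_intros) simp
      moreover have "integrable (lebesgue_on {0<..<\<tau>}) (\<lambda>s. Re (of_real (wt 0 \<tau> s) * (?H s * ?H s)) / 2)"
        by (intro continuous_integrable_open continuous_intros) simp
      moreover have "(LINT s|lebesgue_on {0<..<\<tau>}. Re (of_real (wt 0 \<tau> s) * (?H s * ?H s))) = Re I2"
        unfolding I2_def by (rule integral_bounded_linear[OF bounded_linear_Re i2])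
      ultimately show ?thesis unfolding pt by (simp only: Bochner_Integration.integral_add integral_divide_zero I1_def)
    qed
    define B1 where "B1 j k = (if j = k then 0 else norm (?W (nu j - nu k)))" for j k
    have sym: "norm (?W (nu j - nu k)) = norm (?W (nu k - nu j))" for j k
      by (metis minus_diff_eq wthat_minus)
    have diag: "of_real I1 = of_real (\<tau> ^ 3 / 6) * of_real ?N + (\<Sum>j\<in>F. \<Sum>k\<in>F. if j = k then 0 else c j * cnj (c k) * ?W (nu j - nu k))"
    proof -
      have "of_real I1 = (\<Sum>j\<in>F. \<Sum>k\<in>F. c j * cnj (c k) * ?W (nu j - nu k))"
        unfolding I1_def by (rule integral_exp_sum_norm[OF F(1)])
      also have "\<dots> = (\<Sum>j\<in>F. \<Sum>k\<in>F. (if j = k then of_real (\<tau> ^ 3 / 6) * of_real ((norm (c j))\<^sup>2) else 0)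
            + (if j = k then 0 else c j * cnj (c k) * ?W (nu j - nu k)))"
        unfolding complex_norm_square using wthat_0[OF \<tau>] by (intro sum.cong refl) (auto simp: mult_ac)
      also have "\<dots> = of_real (\<tau> ^ 3 / 6) * of_real ?N + (\<Sum>j\<in>F. \<Sum>k\<in>F. if j = k then 0 else c j * cnj (c k) * ?W (nu j - nu k))"
        using F by (simp add: sum.distrib sum.delta sum_distrib_left of_real_sum)
      finally show ?thesis .
    qed
    have off1: "norm (\<Sum>j\<in>F. \<Sum>k\<in>F. if j = k then 0 else c j * cnj (c k) * ?W (nu j - nu k)) \<le> (\<tau> ^ 3 / 24) * ?N"
    proof -
      have "norm (\<Sum>j\<in>F. \<Sum>k\<in>F. if j = k then 0 else c j * cnj (c k) * ?W (nu j - nu k))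
          \<le> (\<Sum>j\<in>F. \<Sum>k\<in>F. norm (c j) * norm (c k) * B1 j k)"
        by (rule order_trans[OF norm_sum sum_mono], rule order_trans[OF norm_sum sum_mono]) (simp add: B1_def norm_mult)
      also have "\<dots> \<le> (\<tau> ^ 3 / 24) * ?N"
      proof (rule schur_test[OF F(1)])
        show "0 \<le> B1 j k" "B1 j k = B1 k j" for j k by (auto simp: B1_def sym)
        show "(\<Sum>j\<in>F. B1 j k) \<le> \<tau> ^ 3 / 24" if k: "k \<in> F" for k
        proof -
          have "(\<Sum>j\<in>F. B1 j k) = (\<Sum>j\<in>F - {k}. norm (?W (nu j - nu k)))"
            using F(1) by (intro sum.mono_neutral_cong_right) (auto simp: B1_def)
          then show ?thesis using K(2)[OF F k] by simp
        qed
      qed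
      finally show ?thesis .
    qed
    have off2: "norm I2 \<le> (\<tau> ^ 3 / 24) * ?N"
    proof -
      have "I2 = (\<Sum>j\<in>F. \<Sum>k\<in>F. c j * c k * ?W (nu j + nu k))"
        unfolding I2_def by (rule integral_exp_sums[OF F(1) F(1)])
      then have "norm I2 \<le> (\<Sum>j\<in>F. \<Sum>k\<in>F. norm (c j) * norm (c k) * norm (?W (nu j + nu k)))"
        by (simp only:) (rule order_trans[OF norm_sum sum_mono], rule order_trans[OF norm_sum sum_mono], simp add: norm_mult)
      also have "\<dots> \<le> (\<tau> ^ 3 / 24) * ?N"
        by (rule schur_test[OF F(1) norm_ge_zero]) (use K(2)[OF F] in \<open>auto simp: add.commute\<close>)
      finally show ?thesis .
    qed
    have "I1 = Re (of_real I1)" by simp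
    also have "\<dots> \<ge> \<tau> ^ 3 / 6 * ?N - (\<tau> ^ 3 / 24) * ?N"
      unfolding diag using off1 complex_Re_le_cmod[of "- (\<Sum>j\<in>F. \<Sum>k\<in>F. if j = k then 0 else c j * cnj (c k) * ?W (nu j - nu k))"]
      by (simp only: plus_complex.sel of_real_mult[symmetric] Re_complex_of_real uminus_complex.sel norm_minus_cancel)
    finally have "\<tau> ^ 3 / 6 * ?N - (\<tau> ^ 3 / 24) * ?N \<le> I1" .
    moreover have "- ((\<tau> ^ 3 / 24) * ?N) \<le> Re I2"
      using off2 abs_Re_le_cmod[of I2] by linarith
    ultimately have "(\<tau> ^ 3 / 24) * ?N \<le> I1 / 2 + Re I2 / 2" by (simp add: field_simps)
    also have "\<dots> \<le> (LINT s|lebesgue_on {0<..<\<tau>}. \<tau>\<^sup>2 * (Re (?H s))\<^sup>2)"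
      unfolding split[symmetric]
    proof (rule integral_mono)
      show "integrable (lebesgue_on {0<..<\<tau>}) (\<lambda>s. wt 0 \<tau> s * (Re (?H s))\<^sup>2)"
        "integrable (lebesgue_on {0<..<\<tau>}) (\<lambda>s. \<tau>\<^sup>2 * (Re (?H s))\<^sup>2)"
        by (intro continuous_integrable_open continuous_intros)+
      fix s assume "s \<in> space (lebesgue_on {0<..<\<tau>})"
      then have "wt 0 \<tau> s \<le> \<tau>\<^sup>2" unfolding wt_def power2_eq_square by (intro mult_mono) auto
      then show "wt 0 \<tau> s * (Re (?H s))\<^sup>2 \<le> \<tau>\<^sup>2 * (Re (?H s))\<^sup>2" by (rule mult_right_mono) simp
    qed
    finally have "\<tau>\<^sup>2 * (\<tau> / 24 * ?N) \<le> \<tau>\<^sup>2 * (LINT s|lebesgue_on {0<..<\<tau>}. (Re (?H s))\<^sup>2)"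
      by (simp add: power3_eq_cube power2_eq_square mult_ac)
    then show ?thesis using \<tau> by (simp only: mult_le_cancel_left_pos zero_less_power)
  qed
  then show ?thesis using K(1) by blast
qed

end

text \<open>An orthogonal projection of \<open>l2\<close> for the real inner product; its range
  consists of the real controls acting on (0, \<open>\<tau>\<close>).\<close>

definition Xop :: "real \<Rightarrow> l2 \<Rightarrow> l2" where
  "Xop \<tau> v = l2_of (\<lambda>s. complex_of_real (indicator {0<..<\<tau>} s * Re (fun_of v s)))"

lemma indicator_measurable_M01: "S \<in> sets borel \<Longrightarrow> (indicator S :: real \<Rightarrow> real) \<in> borel_measurable M01"
  by (intro measurable_restrict_space1 borel_measurable_indicator) auto

lemma ind_times_measurable:
  fixes g :: "real \<Rightarrow> real"
  shows "S \<in> sets borel \<Longrightarrow> g \<in> borel_measurable M01 \<Longrightarrow> (\<lambda>s. indicator S s * g s) \<in> borel_measurable M01"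
  by (intro borel_measurable_times indicator_measurable_M01)

lemma Re_measurable: "f \<in> borel_measurable N \<Longrightarrow> (\<lambda>s. Re (f s)) \<in> borel_measurable N"
  by (rule measurable_compose[OF _ borel_measurable_Re])

lemma complex_of_real_measurable:
  "f \<in> borel_measurable N \<Longrightarrow> (\<lambda>s. complex_of_real (f s)) \<in> borel_measurable N"
  by (rule measurable_compose[OF _ borel_measurable_of_real])

lemma Xop_fun: "AE s in M01. fun_of (Xop \<tau> v) s = complex_of_real (indicator {0<..<\<tau>} s * Re (fun_of v s))"
  unfolding Xop_def
proof (rule fun_of_l2_of, rule L2_fun_bound[OF fun_of_L2[of v], where C = 1])
  show "(\<lambda>s. complex_of_real (indicator {0<..<\<tau>} s * Re (fun_of v s))) \<in> borel_measurable M01"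
    by (intro complex_of_real_measurable ind_times_measurable Re_measurable fun_of_borel) simp
  show "AE s in M01. norm (complex_of_real (indicator {0<..<\<tau>} s * Re (fun_of v s))) \<le> 1 * norm (fun_of v s)"
    by (rule AE_I2) (auto simp: indicator_def norm_mult abs_Re_le_cmod simp del: of_real_mult)
qed

lemma norm_Xop_le: "norm (Xop \<tau> v) \<le> norm v"
proof (rule power2_le_imp_le)
  show "(norm (Xop \<tau> v))\<^sup>2 \<le> (norm v)\<^sup>2"
    unfolding norm_l2_sq
  proof (rule integral_mono_AE)
    show "AE s in M01. (norm (fun_of (Xop \<tau> v) s))\<^sup>2 \<le> (norm (fun_of v s))\<^sup>2"
      using Xop_fun[of \<tau> v]
    proof eventually_elim
      case (elim s)
      show ?case unfolding elim
        by (intro power_mono) (auto simp: indicator_def abs_Re_le_cmod simp del: of_real_mult)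
    qed
  qed (auto intro: L2_funD(2)[OF fun_of_L2])
qed simp

lemma bounded_linear_Xop: "bounded_linear (Xop \<tau>)"
proof (rule bounded_linear_intro[where K = 1])
  show "Xop \<tau> (x + y) = Xop \<tau> x + Xop \<tau> y" for x y
    using Xop_fun[of \<tau> "x + y"] Xop_fun[of \<tau> x] Xop_fun[of \<tau> y] fun_of_add[of x y] fun_of_add[of "Xop \<tau> x" "Xop \<tau> y"]
    by (intro l2_eqI, eventually_elim) (simp add: algebra_simps)
  show "Xop \<tau> (r *\<^sub>R x) = r *\<^sub>R Xop \<tau> x" for r x
    using Xop_fun[of \<tau> "r *\<^sub>R x"] Xop_fun[of \<tau> x] fun_of_scaleR[of r x] fun_of_scaleR[of r "Xop \<tau> x"]
    by (intro l2_eqI, eventually_elim) (simp add: scaleR_conv_of_real)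
qed (simp add: norm_Xop_le)

lemma inner_l2_alt: "inner x y = (LINT s|M01. Re (fun_of x s * cnj (fun_of y s)))"
  unfolding inner_l2_def cinner_def
  by (rule integral_bounded_linear[OF bounded_linear_Re integrable_cinner, symmetric])

lemma inner_Xop: "inner (Xop \<tau> v) w = (LINT s|M01. indicator {0<..<\<tau>} s * (Re (fun_of v s) * Re (fun_of w s)))"
  unfolding inner_l2_alt
proof (rule integral_cong_AE)
  show "(\<lambda>s. Re (fun_of (Xop \<tau> v) s * cnj (fun_of w s))) \<in> borel_measurable M01"
    by (intro Re_measurable borel_measurable_times cnj_borel_measurable fun_of_borel)
  show "(\<lambda>s. indicator {0<..<\<tau>} s * (Re (fun_of v s) * Re (fun_of w s))) \<in> borel_measurable M01"
    by (intro ind_times_measurable borel_measurable_times Re_measurable fun_of_borel) simp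
  show "AE s in M01. Re (fun_of (Xop \<tau> v) s * cnj (fun_of w s)) = indicator {0<..<\<tau>} s * (Re (fun_of v s) * Re (fun_of w s))"
    using Xop_fun[of \<tau> v] by eventually_elim simp
qed

lemma Xop_symmetric: "inner (Xop \<tau> v) w = inner v (Xop \<tau> w)"
  by (simp add: inner_commute[of v] inner_Xop mult.commute)

lemma Xop_Xop: "\<tau> \<le> \<tau>' \<Longrightarrow> Xop \<tau> (Xop \<tau>' v) = Xop \<tau> v"
  using Xop_fun[of \<tau> "Xop \<tau>' v"] Xop_fun[of \<tau>' v] Xop_fun[of \<tau> v]
  by (intro l2_eqI, eventually_elim) (auto simp: indicator_def)

lemma norm_Xop_sq: "(norm (Xop \<tau> v))\<^sup>2 = inner (Xop \<tau> v) v"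
  using Xop_symmetric[of \<tau> "Xop \<tau> v" v] by (simp add: power2_norm_eq_inner Xop_symmetric Xop_Xop)

lemma norm_Xop_mono:
  assumes "\<tau> \<le> \<tau>'"
  shows "norm (Xop \<tau> v) \<le> norm (Xop \<tau>' v)"
  using norm_Xop_le[of \<tau> "Xop \<tau>' v"] by (simp add: Xop_Xop[OF assms])

text \<open>The image of \<open>E\<close> is complete, hence closed, so \<open>f v\<close> has a
  positive distance from it. This bounds the coefficient a by the norm of the image, and then x
  through the bound on \<open>E\<close>. Only real multiples are added, so a frequency with complex
  coefficient takes two such steps.\<close>

lemma complete_bounded_below:
  fixes f :: "l2 \<Rightarrow> l2"
  assumes f: "bounded_linear f" and E: "subspace E" "closed E"
    and c: "0 < c" "\<And>x. x \<in> E \<Longrightarrow> c * norm x \<le> norm (f x)" and v: "f v \<notin> f ` E"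
  shows "\<exists>c'>0. \<forall>x\<in>E. \<forall>a. c' * norm (x + a *\<^sub>R v) \<le> norm (f (x + a *\<^sub>R v))"
proof -
  interpret f: bounded_linear f by fact
  have "complete E" using E(2) by (simp add: complete_eq_closed)
  then have "complete (f ` E)"
    by (intro complete_isometric_image[OF c(1) E(1) f]) (use c in auto)
  then have cl: "closed (f ` E)" by (simp add: complete_eq_closed)
  have ne: "f ` E \<noteq> {}" using subspace_0[OF E(1)] by blast
  define \<delta> where "\<delta> = infdist (f v) (f ` E)"
  have \<delta>: "0 < \<delta>" unfolding \<delta>_def using infdist_pos_not_in_closed[OF cl ne v] .
  have low: "\<bar>a\<bar> * \<delta> \<le> norm (f (x + a *\<^sub>R v))" if x: "x \<in> E" for x a
  proof (cases "a = 0")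
    case False
    have "- (1 / a) *\<^sub>R x \<in> E" by (rule subspace_scale[OF E(1) x])
    then have "\<delta> \<le> dist (f v) (f (- (1 / a) *\<^sub>R x))" unfolding \<delta>_def by (intro infdist_le) auto
    also have "\<dots> = norm ((1 / a) *\<^sub>R f (x + a *\<^sub>R v))"
      using False by (simp add: dist_norm f.add f.scaleR f.neg scaleR_add_right add.commute)
    also have "\<dots> = norm (f (x + a *\<^sub>R v)) / \<bar>a\<bar>" by simp
    finally show ?thesis using False by (simp add: field_simps)
  qed simp
  define D where "D = (1 + norm (f v) / \<delta>) / c + norm v / \<delta>"
  have D: "0 < D" unfolding D_def using c(1) \<delta> by (intro add_pos_nonneg divide_pos_pos) auto
  have "norm (x + a *\<^sub>R v) \<le> D * norm (f (x + a *\<^sub>R v))" if x: "x \<in> E" for x a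
  proof -
    let ?n = "norm (f (x + a *\<^sub>R v))"
    have a: "\<bar>a\<bar> \<le> ?n / \<delta>" using low[OF x, of a] \<delta> by (simp add: field_simps)
    have "f x = f (x + a *\<^sub>R v) - a *\<^sub>R f v" by (simp add: f.add f.scaleR)
    then have "norm (f x) \<le> ?n + \<bar>a\<bar> * norm (f v)" by (metis norm_triangle_ineq4 norm_scaleR)
    also have "\<dots> \<le> ?n + (?n / \<delta>) * norm (f v)" by (intro add_left_mono mult_right_mono a) auto
    finally have "c * norm x \<le> (1 + norm (f v) / \<delta>) * ?n" using c(2)[OF x] by (simp add: algebra_simps)
    then have x1: "norm x \<le> (1 + norm (f v) / \<delta>) / c * ?n" using c(1) by (simp add: field_simps)
    have "norm (x + a *\<^sub>R v) \<le> norm x + \<bar>a\<bar> * norm v" using norm_triangle_ineq[of x "a *\<^sub>R v"] by simp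
    also have "\<dots> \<le> (1 + norm (f v) / \<delta>) / c * ?n + (?n / \<delta>) * norm v"
      by (intro add_mono x1 mult_right_mono a) auto
    also have "\<dots> = D * ?n" by (simp add: D_def algebra_simps)
    finally show ?thesis .
  qed
  then show ?thesis using D
    by (intro exI[of _ "1 / D"]) (auto simp: field_simps)
qed

text \<open>Pairing with \<open>Jq q\<close> gives the primitive at q. Vanishing and time shifts are
  phrased through these values, which avoids shifting representatives.\<close>

definition Jq :: "real \<Rightarrow> l2" where "Jq q = l2_of (\<lambda>s. of_real (indicator {..q} s))"

lemma indicator_L2: "(\<lambda>s. complex_of_real (indicator {..q} s)) \<in> L2_fun 0 1"
  by (rule L2_fun_bounded[where C = 1], rule complex_of_real_measurable, rule indicator_measurable_M01)
    (auto simp: indicator_def)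

lemma inner_Xop_indicator:
  assumes \<tau>: "0 < \<tau>"
  shows "inner (Xop \<tau> v) (l2_of (\<lambda>s. c * indicator {..q} s)) = Re c * inner v (Jq (max 0 (min \<tau> q)))"
proof -
  have cind: "(\<lambda>s. c * indicator {..q} s) \<in> L2_fun 0 1" for c :: complex and q :: real
    using L2_fun_cmult[OF indicator_L2, of c q] by (simp add: of_real_indicator)
    have "inner (Xop \<tau> v) (l2_of (\<lambda>s. c * indicator {..q} s))
        = (LINT s|M01. Re c * Re (fun_of v s * cnj (fun_of (Jq (max 0 (min \<tau> q))) s)))"
      unfolding inner_Xop
    proof (rule integral_cong_AE)
      show "(\<lambda>s. indicator {0<..<\<tau>} s * (Re (fun_of v s) * Re (fun_of (l2_of (\<lambda>s. c * indicator {..q} s)) s))) \<in> borel_measurable M01"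
        by (intro ind_times_measurable borel_measurable_times Re_measurable fun_of_borel) simp
      show "(\<lambda>s. Re c * Re (fun_of v s * cnj (fun_of (Jq (max 0 (min \<tau> q))) s))) \<in> borel_measurable M01"
        by (intro borel_measurable_times borel_measurable_const Re_measurable cnj_borel_measurable fun_of_borel)
      have "{\<tau>} \<in> null_sets lebesgue" by (simp add: null_sets_def)
      then have "AE s in lebesgue. s \<notin> {\<tau>}" by (rule AE_not_in)
      then have "AE s in M01. s \<noteq> \<tau>"
        by (subst AE_restrict_space_iff) (auto elim!: eventually_mono)
      with AE_space show "AE s in M01. indicator {0<..<\<tau>} s * (Re (fun_of v s) * Re (fun_of (l2_of (\<lambda>s. c * indicator {..q} s)) s))
          = Re c * Re (fun_of v s * cnj (fun_of (Jq (max 0 (min \<tau> q))) s))"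
        using fun_of_l2_of[OF cind[of c q]] fun_of_l2_of[OF indicator_L2[of "max 0 (min \<tau> q)"]]
        unfolding Jq_def
      proof eventually_elim
        case (elim s)
        show ?case unfolding elim(3,4) using elim(1,2) by (auto simp: indicator_def)
      qed
    qed
    then show ?thesis by (simp add: inner_l2_alt)
qed

lemma inner_Xop_Jq:
  assumes "0 < \<tau>" "0 \<le> p" "p \<le> \<tau>"
  shows "inner (Xop \<tau> v) (Jq p) = inner v (Jq p)"
  using inner_Xop_indicator[of \<tau> v 1 p] assms by (simp add: Jq_def of_real_indicator)

text \<open>The primitive of the real part vanishes on [0, \<open>\<tau>\<close>], so the truncated
  real part is orthogonal to all indicators of half lines, and these are total.\<close>

lemma Xop_eq_0I:
  assumes \<tau>: "0 < \<tau>" "\<tau> \<le> 1" and 0: "\<And>q. 0 \<le> q \<Longrightarrow> q \<le> \<tau> \<Longrightarrow> inner v (Jq q) = 0"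
  shows "Xop \<tau> v = 0"
proof -
  let ?V = "{w. inner (Xop \<tau> v) w = 0}"
  have "Xop \<tau> v \<in> ?V"
  proof (rule indicator_total)
    show "closed ?V" by (intro closed_Collect_eq continuous_intros)
    show "subspace ?V" by (auto simp: subspace_def inner_add_right)
    show "l2_of (\<lambda>s. c * indicator {..q} s) \<in> ?V" for c q
      using 0[of "max 0 (min \<tau> q)"] \<tau> by (simp add: inner_Xop_indicator)
  qed
  then show ?thesis by simp
qed

section \<open>Analysis and synthesis operators of the exponential family\<close>

context spectrum
begin

definition ex :: "int \<Rightarrow> l2" where "ex k = l2_of (\<lambda>s. cis (nu k * s))"

lemma cis_L2: "(\<lambda>s. cis (\<omega> * s)) \<in> L2_fun 0 1"
  by (rule L2_fun_bounded[where C = 1]) (auto intro!: continuous_measurable_on continuous_intros)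

text \<open>The conjugate of cis (\<nu>_k s) is cis (\<lambda>_k s) times a phase common to all k,
  which is absorbed into \<open>w\<close>.\<close>

lemma ex_bessel:
  assumes F: "finite F"
  shows "(\<Sum>k\<in>F. (norm (cinner w (ex k)))\<^sup>2) \<le> bessel_const 1 * (norm w)\<^sup>2"
proof -
  let ?g = "\<lambda>s. cis (- eigval u0 l * s) * fun_of w s"
  have g: "?g \<in> L2_fun 0 1" by (rule L2_fun_cis_mult[OF fun_of_L2])
  have "cinner w (ex k) = (LINT s|M01. cis (eigval u0 k * s) * ?g s)" for k
  proof -
    have "cinner w (ex k) = (LINT s|M01. fun_of w s * cnj (cis (nu k * s)))"
      unfolding ex_def using cinner_l2_of[OF fun_of_L2[of w] cis_L2] by simp
    also have "\<dots> = (LINT s|M01. cis (eigval u0 k * s) * ?g s)"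
    proof (rule Bochner_Integration.integral_cong[OF refl])
      fix s
      have "cnj (cis (nu k * s)) = cis (eigval u0 k * s) * cis (- eigval u0 l * s)"
        unfolding cis_cnj cis_mult nu_def by (simp add: algebra_simps)
      then show "fun_of w s * cnj (cis (nu k * s)) = cis (eigval u0 k * s) * ?g s"
        by (simp only: mult_ac)
    qed
    finally show ?thesis .
  qed
  then have "(\<Sum>k\<in>F. (norm (cinner w (ex k)))\<^sup>2) \<le> bessel_const 1 * (LINT s|M01. (norm (?g s))\<^sup>2)"
    using eigval_bessel[OF _ g F, of u0] by simp
  also have "(LINT s|M01. (norm (?g s))\<^sup>2) = (norm w)\<^sup>2"
    by (simp add: norm_l2_sq norm_mult)
  finally show ?thesis .
qed

text \<open>The analysis operator: the moments of a function of time, stored as the coefficients of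
  an element of \<open>l2\<close>.\<close>

definition An :: "l2 \<Rightarrow> l2" where "An w = of_coef (\<lambda>k. cinner w (ex k))"

lemma coef_An: "cinner (An w) (phi k) = cinner w (ex k)"
  unfolding An_def by (rule coef_of_coef) (rule ex_bessel)

lemma norm_An: "(norm (An w))\<^sup>2 \<le> bessel_const 1 * (norm w)\<^sup>2"
  unfolding An_def by (rule norm_of_coef) (rule ex_bessel)

lemma bounded_linear_An: "bounded_linear An"
proof (rule bounded_linear_intro[where K = "sqrt (bessel_const 1)"])
  show "An (x + y) = An x + An y" for x y
    by (rule l2_coef_eqI) (simp add: coef_An cinner_add_left)
  show "An (r *\<^sub>R x) = r *\<^sub>R An x" for r x
    by (rule l2_coef_eqI) (simp add: coef_An scaleR_eq_cscale cinner_cscale_left)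
  show "norm (An x) \<le> norm x * sqrt (bessel_const 1)" for x
    using real_sqrt_le_mono[OF norm_An[of x]] by (simp add: real_sqrt_mult mult.commute)
qed

text \<open>The dual form of \<open>ex_bessel\<close>: pair the sum with itself, apply
  Cauchy-Schwarz over the coefficients, and cancel one factor of its squared norm.\<close>

lemma ex_upper:
  assumes F: "finite F"
  shows "(norm (\<Sum>k\<in>F. cscale (c k) (ex k)))\<^sup>2 \<le> bessel_const 1 * (\<Sum>k\<in>F. (norm (c k))\<^sup>2)"
proof -
  define x where "x = (\<Sum>k\<in>F. cscale (c k) (ex k))"
  let ?N = "\<Sum>k\<in>F. (norm (c k))\<^sup>2"
  have "(norm x)\<^sup>2 = norm (cinner x x)" by (simp add: cinner_self norm_power)
  also have "cinner x x = (\<Sum>k\<in>F. c k * cinner (ex k) x)"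
    by (subst (1) x_def) (simp add: cinner_sum_left cinner_cscale_left)
  also have "norm \<dots> \<le> (\<Sum>k\<in>F. norm (c k) * norm (cinner x (ex k)))"
    by (rule order_trans[OF norm_sum sum_mono]) (subst cinner_commute, simp add: norm_mult)
  finally have "((norm x)\<^sup>2)\<^sup>2 \<le> (\<Sum>k\<in>F. norm (c k) * norm (cinner x (ex k)))\<^sup>2" by (rule power_mono) simp
  also have "\<dots> \<le> ?N * (\<Sum>k\<in>F. (norm (cinner x (ex k)))\<^sup>2)" by (rule Cauchy_Schwarz_ineq_sum)
  also have "\<dots> \<le> ?N * (bessel_const 1 * (norm x)\<^sup>2)" by (intro mult_left_mono ex_bessel F sum_nonneg) auto
  finally have le: "(norm x)\<^sup>2 * (norm x)\<^sup>2 \<le> (bessel_const 1 * ?N) * (norm x)\<^sup>2" by (simp add: power2_eq_square mult_ac)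
  show ?thesis
  proof (cases "x = 0")
    case True
    then show ?thesis using bessel_const_pos[of 1] by (simp add: x_def[symmetric] sum_nonneg)
  next
    case False
    have "(norm x)\<^sup>2 \<le> bessel_const 1 * ?N"
      by (rule mult_right_le_imp_le[OF le]) (use False in simp)
    then show ?thesis by (simp add: x_def)
  qed
qed

definition Bsum :: "l2 \<Rightarrow> nat \<Rightarrow> l2" where
  "Bsum d n = (\<Sum>k\<in>{- int n..int n}. cscale (cinner d (phi k)) (ex k))"

text \<open>The synthesis operator, which sends d to the series of d_k cis (\<nu>_k s); it is the
  adjoint of \<open>An\<close>.\<close>

definition Bop :: "l2 \<Rightarrow> l2" where "Bop d = lim (Bsum d)"

lemma Bsum_tendsto: "Bsum d \<longlonglongrightarrow> Bop d"
proof -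
  let ?X = "\<lambda>n. \<Sum>k\<in>{- int n..int n}. cscale (cinner d (phi k)) (phi k)"
  let ?C = "sqrt (bessel_const 1)"
  have C: "0 < ?C" using bessel_const_pos[of 1] by simp
  have le: "norm (Bsum d m - Bsum d n) \<le> ?C * norm (?X m - ?X n)" if "n \<le> m" for m n
  proof (rule power2_le_imp_le)
    let ?D = "{- int m..int m} - {- int n..int n}"
    have "Bsum d m - Bsum d n = (\<Sum>k\<in>?D. cscale (cinner d (phi k)) (ex k))"
      unfolding Bsum_def using that by (subst sum_diff) auto
    moreover have "?X m - ?X n = (\<Sum>k\<in>?D. cscale (cinner d (phi k)) (phi k))"
      using that by (subst sum_diff) auto
    ultimately show "(norm (Bsum d m - Bsum d n))\<^sup>2 \<le> (?C * norm (?X m - ?X n))\<^sup>2"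
      using ex_upper[of ?D "\<lambda>k. cinner d (phi k)"] bessel_const_pos[of 1]
      by (simp add: power_mult_distrib norm_sum_phi)
  qed (use C in simp)
  have "Cauchy ?X" by (rule LIMSEQ_imp_Cauchy[OF fourier_partial_sums])
  have "Cauchy (Bsum d)"
  proof (rule metric_CauchyI)
    fix e :: real assume "e > 0"
    then obtain N where N: "\<And>m n. m \<ge> N \<Longrightarrow> n \<ge> N \<Longrightarrow> dist (?X m) (?X n) < e / ?C"
      using metric_CauchyD[OF \<open>Cauchy ?X\<close>, of "e / ?C"] C by auto
    have *: "dist (Bsum d m) (Bsum d n) < e" if "m \<ge> N" "n \<ge> N" "n \<le> m" for m n
    proof -
      have "dist (Bsum d m) (Bsum d n) \<le> ?C * dist (?X m) (?X n)" unfolding dist_norm by (rule le[OF that(3)])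
      also have "\<dots> < ?C * (e / ?C)" using N[OF that(1,2)] C by (intro mult_strict_left_mono)
      also have "\<dots> = e" using C by simp
      finally show ?thesis .
    qed
    show "\<exists>M. \<forall>m\<ge>M. \<forall>n\<ge>M. dist (Bsum d m) (Bsum d n) < e"
    proof (intro exI allI impI)
      fix m n assume "m \<ge> N" "n \<ge> N"
      then show "dist (Bsum d m) (Bsum d n) < e"
        using *[of m n] *[of n m] by (cases "n \<le> m") (auto simp: dist_commute)
    qed
  qed
  then have "convergent (Bsum d)" by (rule Cauchy_convergent)
  then show ?thesis unfolding Bop_def by (simp add: convergent_LIMSEQ_iff)
qed

lemma bounded_linear_Bop: "bounded_linear Bop"
proof (rule bounded_linear_intro[where K = "sqrt (bessel_const 1)"])
  show "Bop (x + y) = Bop x + Bop y" for x y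
  proof (rule LIMSEQ_unique[OF Bsum_tendsto])
    have "Bsum (x + y) = (\<lambda>n. Bsum x n + Bsum y n)"
      by (simp add: fun_eq_iff Bsum_def cinner_add_left cscale_add_left sum.distrib)
    then show "Bsum (x + y) \<longlonglongrightarrow> Bop x + Bop y" using tendsto_add[OF Bsum_tendsto Bsum_tendsto] by simp
  qed
  show "Bop (r *\<^sub>R x) = r *\<^sub>R Bop x" for r x
  proof (rule LIMSEQ_unique[OF Bsum_tendsto])
    have "Bsum (r *\<^sub>R x) = (\<lambda>n. r *\<^sub>R Bsum x n)"
      by (simp add: fun_eq_iff Bsum_def scaleR_eq_cscale cinner_cscale_left cscale_cscale cscale_sum_right)
    then show "Bsum (r *\<^sub>R x) \<longlonglongrightarrow> r *\<^sub>R Bop x"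
      using tendsto_scaleR[OF tendsto_const Bsum_tendsto, of r] by simp
  qed
  show "norm (Bop x) \<le> norm x * sqrt (bessel_const 1)" for x
  proof (rule LIMSEQ_le_const2[OF tendsto_norm[OF Bsum_tendsto]], intro exI allI impI)
    fix n
    show "norm (Bsum x n) \<le> norm x * sqrt (bessel_const 1)"
    proof (rule power2_le_imp_le)
      have "(norm (Bsum x n))\<^sup>2 \<le> bessel_const 1 * (\<Sum>k\<in>{- int n..int n}. (norm (cinner x (phi k)))\<^sup>2)"
        unfolding Bsum_def by (rule ex_upper) simp
      also have "\<dots> \<le> bessel_const 1 * (norm x)\<^sup>2"
        using bessel_const_pos[of 1] by (intro mult_left_mono bessel) auto
      finally show "(norm (Bsum x n))\<^sup>2 \<le> (norm x * sqrt (bessel_const 1))\<^sup>2"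
        using bessel_const_pos[of 1] by (simp add: power_mult_distrib mult.commute)
    qed (use bessel_const_pos[of 1] in simp)
  qed
qed

lemma Bop_phi: "Bop (cscale c (phi k)) = cscale c (ex k)"
proof (rule LIMSEQ_unique[OF Bsum_tendsto])
  have "Bsum (cscale c (phi k)) n = cscale c (ex k)" if "n \<ge> nat \<bar>k\<bar>" for n
  proof -
    have "Bsum (cscale c (phi k)) n = (\<Sum>j\<in>{- int n..int n}. if j = k then cscale c (ex k) else 0)"
      unfolding Bsum_def by (rule sum.cong) (auto simp: cinner_cscale_left cinner_phi)
    moreover have "k \<in> {- int n..int n}" using that by auto
    ultimately show ?thesis by simp
  qed
  then have "\<forall>\<^sub>F n in sequentially. Bsum (cscale c (phi k)) n = cscale c (ex k)"
    by (auto simp: eventually_sequentially)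
  then show "Bsum (cscale c (phi k)) \<longlonglongrightarrow> cscale c (ex k)" by (rule tendsto_eventually)
qed

lemma Bop_adjoint: "cinner (Bop d) w = cinner d (An w)"
proof (rule bounded_linear_eqI[where f = "\<lambda>d. cinner (Bop d) w" and g = "\<lambda>d. cinner d (An w)"])
  show "bounded_linear (\<lambda>d. cinner (Bop d) w)"
    by (rule bounded_linear_compose[OF bounded_linear_cinner_left bounded_linear_Bop])
  show "cinner (Bop (cscale c (phi k))) w = cinner (cscale c (phi k)) (An w)" for c k
    unfolding Bop_phi cinner_cscale_left using coef_An[of w k] cinner_commute[of "phi k" "An w"] cinner_commute[of "ex k" w]
    by simp
qed (rule bounded_linear_cinner_left)

text \<open>The coefficient at l is kept real: \<nu>_l = 0, so an imaginary constant would be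
  invisible in the real part and would spoil any lower bound.\<close>

definition Es :: "int set \<Rightarrow> l2 set" where
  "Es S = {d. (\<forall>k. k \<notin> S \<longrightarrow> cinner d (phi k) = 0) \<and> Im (cinner d (phi l)) = 0}"

lemma subspace_Es: "subspace (Es S)"
  by (auto simp: Es_def subspace_def cinner_add_left scaleR_eq_cscale cinner_cscale_left)

lemma closed_Es: "closed (Es S)"
proof -
  have c: "continuous_on UNIV (\<lambda>d. cinner d (phi k))" for k
    by (intro linear_continuous_on bounded_linear_cinner_left)
  have "Es S = (\<Inter>k\<in>- S. {d. cinner d (phi k) = 0}) \<inter> {d. Im (cinner d (phi l)) = 0}"
    by (auto simp: Es_def)
  then show ?thesis
    by (auto intro!: closed_Int closed_INT closed_Collect_eq continuous_intros c)
qed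

text \<open>An Ingham inequality for the frequencies in \<open>S\<close>, observed through the real
  part on (0, \<open>\<tau>\<close>).\<close>

definition LB :: "real \<Rightarrow> int set \<Rightarrow> bool" where
  "LB \<tau> S \<longleftrightarrow> (\<exists>c>0. \<forall>d\<in>Es S. c * norm d \<le> norm (Xop \<tau> (Bop d)))"

lemma bounded_linear_XB: "bounded_linear (\<lambda>d. Xop \<tau> (Bop d))"
  by (rule bounded_linear_compose[OF bounded_linear_Xop bounded_linear_Bop])

text \<open>The bound for finite sums is uniform, so it passes to the limit along the symmetric
  partial sums.\<close>

lemma LB_tail:
  assumes \<tau>: "0 < \<tau>" "\<tau> \<le> 1"
  shows "\<exists>K>\<bar>l\<bar>. LB \<tau> {k. K \<le> \<bar>k\<bar>}"
proof -
  obtain K where K: "K > \<bar>l\<bar>" "\<And>F c. finite F \<Longrightarrow> F \<subseteq> {k. K \<le> \<bar>k\<bar>} \<Longrightarrow>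
    \<tau> / 24 * (\<Sum>k\<in>F. (norm (c k))\<^sup>2) \<le> (LINT s|lebesgue_on {0<..<\<tau>}. (Re (\<Sum>k\<in>F. c k * cis (nu k * s)))\<^sup>2)"
    using tail_lower_finite[OF \<tau>(1)] by blast
  have fin: "\<tau> / 24 * (\<Sum>k\<in>F. (norm (c k))\<^sup>2) \<le> (norm (Xop \<tau> (\<Sum>k\<in>F. cscale (c k) (ex k))))\<^sup>2"
    if F: "finite F" "F \<subseteq> {k. K \<le> \<bar>k\<bar>}" for F c
  proof -
    let ?H = "\<lambda>s. \<Sum>k\<in>F. c k * cis (nu k * s)"
    have HL: "?H \<in> L2_fun 0 1"
      by (rule L2_fun_bounded[where C = "\<Sum>k\<in>F. norm (c k)"])
        (auto intro!: continuous_measurable_on continuous_intros AE_I2 order_trans[OF norm_sum] simp: norm_mult)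
    have sum: "(\<Sum>k\<in>F. cscale (c k) (ex k)) = l2_of ?H"
      using F(1)
    proof induction
      case (insert j F)
      have L: "(\<lambda>s. \<Sum>k\<in>F. c k * cis (nu k * s)) \<in> L2_fun 0 1"
        by (rule L2_fun_bounded[where C = "\<Sum>k\<in>F. norm (c k)"])
          (auto intro!: continuous_measurable_on continuous_intros AE_I2 order_trans[OF norm_sum] simp: norm_mult)
      have "l2_of (\<lambda>s. \<Sum>k\<in>insert j F. c k * cis (nu k * s)) = l2_of (\<lambda>s. c j * cis (nu j * s) + (\<Sum>k\<in>F. c k * cis (nu k * s)))"
        using insert by simp
      also have "\<dots> = cscale (c j) (ex j) + l2_of (\<lambda>s. \<Sum>k\<in>F. c k * cis (nu k * s))"
        unfolding l2_of_add[OF L2_fun_cmult[OF cis_L2] L] l2_of_cmult[OF cis_L2] ex_def ..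
      finally show ?case using insert by simp
    qed (simp add: zero_l2_def)
    have "(norm (Xop \<tau> (l2_of ?H)))\<^sup>2 = (LINT s|M01. indicator {0<..<\<tau>} s *\<^sub>R (Re (?H s))\<^sup>2)"
      unfolding norm_Xop_sq inner_Xop
    proof (rule integral_cong_AE)
      show "(\<lambda>s. indicator {0<..<\<tau>} s * (Re (fun_of (l2_of ?H) s) * Re (fun_of (l2_of ?H) s))) \<in> borel_measurable M01"
        by (intro ind_times_measurable borel_measurable_times Re_measurable fun_of_borel) simp
      show "(\<lambda>s. indicator {0<..<\<tau>} s *\<^sub>R (Re (?H s))\<^sup>2) \<in> borel_measurable M01"
        unfolding real_scaleR_def
        by (intro ind_times_measurable borel_measurable_power Re_measurable L2_funD(1)[OF HL]) simp
      show "AE s in M01. indicator {0<..<\<tau>} s * (Re (fun_of (l2_of ?H) s) * Re (fun_of (l2_of ?H) s)) = indicator {0<..<\<tau>} s *\<^sub>R (Re (?H s))\<^sup>2"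
        using fun_of_l2_of[OF HL]
      proof eventually_elim
        case (elim s)
        show ?case unfolding elim by (simp add: power2_eq_square)
      qed
    qed
    also have "\<dots> = (LINT s|lebesgue_on {0<..<\<tau>}. (Re (?H s))\<^sup>2)"
      by (rule integral_restrict_M01[symmetric]) (use \<tau> in auto)
    finally show ?thesis using K(2)[OF F, of c] by (simp add: sum)
  qed
  have "sqrt (\<tau> / 24) * norm d \<le> norm (Xop \<tau> (Bop d))" if d: "d \<in> Es {k. K \<le> \<bar>k\<bar>}" for d
  proof -
    let ?X = "\<lambda>n. \<Sum>k\<in>{- int n..int n}. cscale (cinner d (phi k)) (phi k)"
    have le: "sqrt (\<tau> / 24) * norm (?X n) \<le> norm (Xop \<tau> (Bsum d n))" for n
    proof -
      let ?F = "{- int n..int n} \<inter> {k. K \<le> \<bar>k\<bar>}"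
      have 1: "?X n = (\<Sum>k\<in>?F. cscale (cinner d (phi k)) (phi k))"
        by (rule sum.mono_neutral_right) (use d in \<open>auto simp: Es_def\<close>)
      have 2: "Bsum d n = (\<Sum>k\<in>?F. cscale (cinner d (phi k)) (ex k))"
        unfolding Bsum_def by (rule sum.mono_neutral_right) (use d in \<open>auto simp: Es_def\<close>)
      have "\<tau> / 24 * (norm (?X n))\<^sup>2 \<le> (norm (Xop \<tau> (Bsum d n)))\<^sup>2"
        unfolding 1 2 by (subst norm_sum_phi, simp, rule fin) auto
      then have "(sqrt (\<tau> / 24) * norm (?X n))\<^sup>2 \<le> (norm (Xop \<tau> (Bsum d n)))\<^sup>2"
        using \<tau> by (simp add: power_mult_distrib)
      then show ?thesis by (rule power2_le_imp_le) simp
    qed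
    have "(\<lambda>n. sqrt (\<tau> / 24) * norm (?X n)) \<longlonglongrightarrow> sqrt (\<tau> / 24) * norm d"
      by (intro tendsto_intros fourier_partial_sums)
    moreover have "(\<lambda>n. norm (Xop \<tau> (Bsum d n))) \<longlonglongrightarrow> norm (Xop \<tau> (Bop d))"
      by (intro tendsto_norm bounded_linear.tendsto[OF bounded_linear_Xop] Bsum_tendsto)
    ultimately show ?thesis using le by (meson LIMSEQ_le)
  qed
  then show ?thesis using K(1) \<tau> unfolding LB_def by (intro exI[of _ K] conjI exI[of _ "sqrt (\<tau> / 24)"]) auto
qed

lemma LB_mono: "LB \<tau> S \<Longrightarrow> \<tau> \<le> \<tau>' \<Longrightarrow> LB \<tau>' S"
  unfolding LB_def using norm_Xop_mono order_trans by blast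

end

section \<open>Adding the finitely many low frequencies\<close>

context spectrum
begin

definition prim :: "real \<Rightarrow> real \<Rightarrow> complex" where
  "prim \<omega> s = (if \<omega> = 0 then of_real s else cis (\<omega> * s) / (\<i> * of_real \<omega>))"

lemma prim_shift: "cis (\<omega> * h) * (prim \<omega> q - prim \<omega> 0) = prim \<omega> (q + h) - prim \<omega> h"
  by (simp add: prim_def cis_mult right_diff_distrib distrib_left add.commute)

lemma cinner_ex_Jq:
  assumes q: "0 \<le> q" "q \<le> 1"
  shows "cinner (ex k) (Jq q) = prim (nu k) q - prim (nu k) 0"
proof -
  let ?\<omega> = "nu k"
  have "cinner (ex k) (Jq q) = (LINT s|M01. cis (?\<omega> * s) * cnj (of_real (indicator {..q} s)))"
    unfolding ex_def Jq_def by (rule cinner_l2_of[OF cis_L2 indicator_L2])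
  also have "\<dots> = (LINT s|M01. indicator {0<..<q} s *\<^sub>R cis (?\<omega> * s))"
  proof (rule integral_cong_AE)
    show "(\<lambda>s. cis (?\<omega> * s) * cnj (of_real (indicator {..q} s))) \<in> borel_measurable M01"
      by (intro borel_measurable_times cnj_borel_measurable L2_funD(1)[OF indicator_L2] L2_funD(1)[OF cis_L2])
    show "(\<lambda>s. indicator {0<..<q} s *\<^sub>R cis (?\<omega> * s)) \<in> borel_measurable M01"
      by (intro borel_measurable_scaleR indicator_measurable_M01 L2_funD(1)[OF cis_L2]) simp
    have "{q} \<in> null_sets lebesgue" by (simp add: null_sets_def)
    then have "AE s in lebesgue. s \<notin> {q}" by (rule AE_not_in)
    then have "AE s in M01. s \<noteq> q"
      by (subst AE_restrict_space_iff) (auto elim!: eventually_mono)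
    with AE_space show "AE s in M01. cis (?\<omega> * s) * cnj (of_real (indicator {..q} s)) = indicator {0<..<q} s *\<^sub>R cis (?\<omega> * s)"
      by eventually_elim (auto simp: indicator_def)
  qed
  also have "\<dots> = (LINT s|lebesgue_on {0<..<q}. cis (?\<omega> * s))"
    by (rule integral_restrict_M01[symmetric]) (use q in auto)
  also have "\<dots> = prim ?\<omega> q - prim ?\<omega> 0"
  proof (rule ftc_open[OF q(1)])
    show "(prim ?\<omega> has_vector_derivative cis (?\<omega> * s)) (at s)" for s
    proof (cases "?\<omega> = 0")
      case True
      then have p: "prim ?\<omega> = of_real" by (simp add: prim_def fun_eq_iff)
      show ?thesis using has_vector_derivative_of_real[OF DERIV_ident[of "at s"]] True unfolding p by simp
    next
      case False
      let ?c = "\<i> * complex_of_real ?\<omega>"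
      have p: "prim ?\<omega> = (\<lambda>s. exp (?c * of_real s) / ?c)"
        using False by (simp add: prim_def fun_eq_iff cis_conv_exp mult_ac)
      have "((\<lambda>s. exp (?c * of_real s) / ?c) has_vector_derivative exp (?c * of_real s)) (at s)"
        using False by (intro has_vector_derivative_real_field) (auto intro!: derivative_eq_intros)
      then show ?thesis unfolding p by (simp add: cis_conv_exp mult_ac)
    qed
    show "continuous_on UNIV (\<lambda>s. cis (?\<omega> * s))" by (intro continuous_intros)
  qed
  finally show ?thesis .
qed

abbreviation shiftop :: "real \<Rightarrow> l2 \<Rightarrow> l2" where "shiftop h \<equiv> dmult (\<lambda>k. cis (nu k * h))"

text \<open>Multiplying the coefficients by cis (\<nu>_k h) translates the exponential sum by h in
  time. In terms of primitives, the integral of the translate from 0 to q is the integral of the sum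
  from h to q + h.\<close>

lemma shiftop_Jq:
  assumes q: "0 \<le> q" "0 \<le> h" "q + h \<le> 1"
  shows "cinner (Bop (shiftop h d)) (Jq q) = cinner (Bop d) (Jq (q + h) - Jq h)"
proof (rule bounded_linear_eqI[where f = "\<lambda>d. cinner (Bop (shiftop h d)) (Jq q)" and g = "\<lambda>d. cinner (Bop d) (Jq (q + h) - Jq h)"])
  have m: "norm (cis (nu k * h)) \<le> 1" for k by simp
  show "bounded_linear (\<lambda>d. cinner (Bop (shiftop h d)) (Jq q))"
    by (intro bounded_linear_compose[OF bounded_linear_cinner_left] bounded_linear_compose[OF bounded_linear_Bop] bounded_linear_dmult[OF m])
  show "bounded_linear (\<lambda>d. cinner (Bop d) (Jq (q + h) - Jq h))"
    by (rule bounded_linear_compose[OF bounded_linear_cinner_left bounded_linear_Bop])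
  show "cinner (Bop (shiftop h (cscale c (phi k)))) (Jq q) = cinner (Bop (cscale c (phi k))) (Jq (q + h) - Jq h)" for c k
    using q arg_cong[OF prim_shift[of "nu k" h q], of "\<lambda>z. c * z"]
    by (simp add: dmult_cscale[OF m] dmult_phi[OF m] cscale_cscale Bop_phi cinner_cscale_left cinner_diff_right cinner_ex_Jq mult.assoc right_diff_distrib)
qed

text \<open>Haraux's device: if $f = \mathrm{Re} \sum_k d_k e^{i\nu_k s}$ vanishes on $(0, \tau)$, the second
  difference $f(s + 2h) - 2 \cos(\nu_j h) f(s + h) + f(s)$ vanishes on a shorter interval and does not
  contain the frequency $\nu_j$.\<close>

lemma second_difference:
  assumes d: "d \<in> Es (insert j S)" and z: "Xop \<tau> (Bop d) = 0" and LB: "LB \<tau>' S"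
    and \<tau>: "0 < \<tau>'" "0 < h" "\<tau>' + 2 * h \<le> \<tau>" "\<tau> \<le> 1"
  shows "(cos (nu k * h) - cos (nu j * h)) * cinner d (phi k) = 0"
proof -
  let ?r = "2 * cos (nu j * h)"
  define m where "m k = cis (nu k * (2 * h)) - of_real ?r * cis (nu k * h) + 1" for k
  \<comment> \<open>From 1 + cis (2 x) = 2 cos x cis x: the multiplier is a real factor, zero at k =
    j, times a phase.\<close>
  have mf: "m k = of_real (2 * (cos (nu k * h) - cos (nu j * h))) * cis (nu k * h)" for k
  proof -
    have "cis (2 * x) + 1 = of_real (2 * cos x) * cis x" for x
      by (simp add: complex_eq_iff cos_double_cos sin_double power2_eq_square)
    from this[of "nu k * h"] have "cis (nu k * (2 * h)) + 1 = of_real (2 * cos (nu k * h)) * cis (nu k * h)"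
      by (simp add: mult.left_commute)
    then show ?thesis unfolding m_def by (simp add: algebra_simps)
  qed
  have mb: "norm (m k) \<le> 4" for k
  proof -
    have "\<bar>2 * (x - y)\<bar> \<le> 4" if "\<bar>x\<bar> \<le> 1" "\<bar>y\<bar> \<le> 1" for x y :: real
      using mult_left_mono[OF order_trans[OF abs_triangle_ineq4 add_mono[OF that]], of 2] by (simp add: abs_mult)
    from this[OF abs_cos_le_one abs_cos_le_one] have "\<bar>2 * (cos (nu k * h) - cos (nu j * h))\<bar> \<le> 4" .
    then show ?thesis unfolding mf norm_mult norm_of_real norm_cis by simp
  qed
  have sb: "norm (cis (nu k * x)) \<le> 1" for k x by simp
  define d' where "d' = dmult m d"
  have cd: "cinner d' (phi k) = m k * cinner d (phi k)" for k unfolding d'_def by (rule coef_dmult[OF mb])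
  have d'E: "d' \<in> Es S"
    unfolding Es_def
  proof (intro CollectI conjI allI impI)
    fix k assume "k \<notin> S"
    then have "k = j \<or> cinner d (phi k) = 0" using d by (auto simp: Es_def)
    then show "cinner d' (phi k) = 0" by (auto simp: cd mf)
  next
    \<comment> \<open>At l the phase is 1 because \<nu>_l = 0, so the multiplier is real and the
      reality condition of \<open>Es\<close> survives.\<close>
    show "Im (cinner d' (phi l)) = 0" using d by (simp add: cd mf Es_def)
  qed
  have dec: "d' = shiftop (2 * h) d - ?r *\<^sub>R shiftop h d + d"
    by (rule l2_coef_eqI)
      (simp only: cd m_def cinner_add_left cinner_diff_left scaleR_eq_cscale cinner_cscale_left coef_dmult[OF sb] ring_distribs mult.assoc mult_1_left)
  interpret B: bounded_linear Bop by (rule bounded_linear_Bop)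
  have J0: "inner (Bop d) (Jq p) = 0" if "0 \<le> p" "p \<le> \<tau>" for p
    using inner_Xop_Jq[of \<tau> p "Bop d"] that \<tau> z by simp
  have "Xop \<tau>' (Bop d') = 0"
  proof (rule Xop_eq_0I)
    fix q assume q: "0 \<le> q" "q \<le> \<tau>'"
    have s: "inner (Bop (shiftop x d)) (Jq q) = 0" if "0 \<le> x" "x \<le> 2 * h" for x
    proof -
      have "inner (Bop (shiftop x d)) (Jq q) = inner (Bop d) (Jq (q + x) - Jq x)"
        unfolding inner_l2_def by (subst shiftop_Jq) (use that q \<tau> in auto)
      also have "\<dots> = 0" using that q \<tau> by (simp add: inner_diff_right J0)
      finally show ?thesis .
    qed
    show "inner (Bop d') (Jq q) = 0"
      using s[of h] s[of "2 * h"] J0[of q] q \<tau>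
      by (simp add: dec B.add B.diff B.scaleR inner_add_left inner_diff_left)
  qed (use \<tau> in auto)
  moreover obtain c where "0 < c" "c * norm d' \<le> norm (Xop \<tau>' (Bop d'))" using LB d'E unfolding LB_def by blast
  ultimately have "d' = 0" by (simp add: mult_le_0_iff)
  then have "m k * cinner d (phi k) = 0" using cd[of k] by simp
  then show ?thesis by (auto simp: mf)
qed

text \<open>For j different from l, the vanishing primitive contains the factor sin (\<nu>_j q / 2);
  its other factor, taken at q and at 2 q, gives two linear equations for Re a and Im a with
  determinant of modulus |sin y|. For j = l the observed function is the constant Re a, and Im a = 0
  is assumed.\<close>

lemma single_frequency:
  assumes \<tau>: "0 < \<tau>" "\<tau> \<le> 1" and z: "Xop \<tau> (Bop (cscale a (phi j))) = 0" and a: "j = l \<Longrightarrow> Im a = 0"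
  shows "a = 0"
proof -
  have J: "Re (a * (prim (nu j) q - prim (nu j) 0)) = 0" if q: "0 \<le> q" "q \<le> \<tau>" for q
  proof -
    have "inner (Bop (cscale a (phi j))) (Jq q) = 0" using inner_Xop_Jq[of \<tau> q "Bop (cscale a (phi j))"] q \<tau> z by simp
    then show ?thesis using q \<tau> by (simp add: inner_l2_def Bop_phi cinner_cscale_left cinner_ex_Jq)
  qed
  show ?thesis
  proof (cases "j = l")
    case True
    then have "Re a * \<tau> = 0" using J[of \<tau>] \<tau> by (simp add: prim_def)
    then show ?thesis using a[OF True] \<tau> by (simp add: complex_eq_iff)
  next
    case False
    then have \<omega>: "nu j \<noteq> 0" using nu_inj[of j l] by auto
    have e: "sin (nu j * q / 2) * (Re a * cos (nu j * q / 2) - Im a * sin (nu j * q / 2)) = 0" if q: "0 \<le> q" "q \<le> \<tau>" for q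
    proof -
      let ?x = "nu j * q / 2"
      have "a * (prim (nu j) q - prim (nu j) 0) = a * (cis (2 * ?x) - 1) / (\<i> * of_real (nu j))"
        using \<omega> by (simp add: prim_def diff_divide_distrib right_diff_distrib)
      then have "Im (a * (cis (2 * ?x) - 1)) = 0"
        using J[OF q] \<omega> by (simp add: Re_divide power2_eq_square)
      then have "Re a * sin (2 * ?x) + Im a * (cos (2 * ?x) - 1) = 0" by simp
      then have "2 * (sin ?x * (Re a * cos ?x - Im a * sin ?x)) = 0"
        unfolding sin_double cos_double_sin by (simp add: algebra_simps power2_eq_square)
      then show ?thesis by simp
    qed
    \<comment> \<open>Small enough that 2 q stays in [0, \<open>\<tau>\<close>] and that 2 y =
      \<nu>_j q lies in (-pi, pi), where neither sine vanishes.\<close>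
    define q where "q = min (\<tau> / 2) (pi / (2 * (\<bar>nu j\<bar> + 1)))"
    define y where "y = nu j * q / 2"
    have q: "0 < q" "2 * q \<le> \<tau>" using \<tau> by (auto simp: q_def add_pos_nonneg)
    have y0: "y \<noteq> 0" using \<omega> q by (simp add: y_def)
    have "\<bar>nu j\<bar> * q \<le> \<bar>nu j\<bar> * (pi / (2 * (\<bar>nu j\<bar> + 1)))" by (intro mult_left_mono) (auto simp: q_def)
    also have "\<dots> < pi" using pi_gt_zero by (simp add: field_simps add_pos_nonneg)
    finally have y: "\<bar>2 * y\<bar> < pi" using q(1) by (simp add: y_def abs_mult)
    have sin_nz: "sin x \<noteq> 0" if "x \<noteq> 0" "\<bar>x\<bar> < pi" for x
      using sin_gt_zero[of x] sin_gt_zero[of "- x"] that by (cases "x > 0") auto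
    have s1: "sin y \<noteq> 0" "sin (2 * y) \<noteq> 0" using sin_nz[of y] sin_nz[of "2 * y"] y0 y by simp_all
    have e1: "Re a * cos y - Im a * sin y = 0" using e[of q] q s1 by (simp add: y_def)
    have e2: "Re a * cos (2 * y) - Im a * sin (2 * y) = 0" using e[of "2 * q"] q s1 by (simp add: y_def)
    have "Re a * sin (2 * y - y) = (Re a * cos y - Im a * sin y) * sin (2 * y) - (Re a * cos (2 * y) - Im a * sin (2 * y)) * sin y"
      unfolding sin_diff by (simp add: algebra_simps)
    then have "Re a * sin y = 0" unfolding e1 e2 by simp
    then have r: "Re a = 0" using s1 by simp
    then have "Im a = 0" using e1 s1 by simp
    with r show ?thesis by (simp add: complex_eq_iff)
  qed
qed

text \<open>For k different from j, the second difference with step h kills the coefficient at k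
  unless cos (\<nu>_k h) = cos (\<nu>_j h). For small h the cosine is injective on the angles
  involved, so equality would mean \<nu>_k = \<nu>_j or \<nu>_k = -\<nu>_j, which irrationality
  excludes. The device costs time 2 h with h as small as desired, hence the hypothesis for all times
  beyond \<open>\<tau>0\<close>.\<close>

lemma LB_injective:
  assumes LB: "\<And>\<tau>'. \<tau>0 < \<tau>' \<Longrightarrow> \<tau>' \<le> 1 \<Longrightarrow> LB \<tau>' S" and \<tau>: "0 \<le> \<tau>0" "\<tau>0 < \<tau>" "\<tau> \<le> 1"
    and d: "d \<in> Es (insert j S)" and z: "Xop \<tau> (Bop d) = 0"
  shows "d = 0"
proof -
  define \<tau>' where "\<tau>' = (\<tau>0 + \<tau>) / 2"
  have \<tau>': "\<tau>0 < \<tau>'" "\<tau>' < \<tau>" "0 < \<tau>'" using \<tau> by (auto simp: \<tau>'_def)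
  have other: "cinner d (phi k) = 0" if k: "k \<noteq> j" for k
  proof (rule ccontr)
    assume nz: "cinner d (phi k) \<noteq> 0"
    \<comment> \<open>The first entry fits the loss 2 h between \<open>\<tau>'\<close> and
      \<open>\<tau>\<close>; the second keeps both angles in [0, pi].\<close>
    define h where "h = min ((\<tau> - \<tau>') / 2) (pi / (1 + \<bar>nu k\<bar> + \<bar>nu j\<bar>))"
    have h: "0 < h" "\<tau>' + 2 * h \<le> \<tau>" using \<tau>' by (auto simp: h_def add_pos_nonneg min_def field_simps)
    have hp: "h * (1 + \<bar>nu k\<bar> + \<bar>nu j\<bar>) \<le> pi"
      using min.cobounded2[of "(\<tau> - \<tau>') / 2" "pi / (1 + \<bar>nu k\<bar> + \<bar>nu j\<bar>)"]
      by (simp add: h_def[symmetric] pos_le_divide_eq add_pos_nonneg)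
    have "cos (nu k * h) - cos (nu j * h) = 0"
      using second_difference[OF d z LB[of \<tau>'], of h k] \<tau> \<tau>' h nz by simp
    then have ce: "cos \<bar>nu k * h\<bar> = cos \<bar>nu j * h\<bar>" by simp
    have le: "\<bar>nu k * h\<bar> \<le> pi" "\<bar>nu j * h\<bar> \<le> pi"
    proof -
      have "\<bar>nu k\<bar> * h \<le> h * (1 + \<bar>nu k\<bar> + \<bar>nu j\<bar>)" "\<bar>nu j\<bar> * h \<le> h * (1 + \<bar>nu k\<bar> + \<bar>nu j\<bar>)"
        using mult_left_mono[of "\<bar>nu k\<bar>" "1 + \<bar>nu k\<bar> + \<bar>nu j\<bar>" h] mult_left_mono[of "\<bar>nu j\<bar>" "1 + \<bar>nu k\<bar> + \<bar>nu j\<bar>" h] h(1)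
        by (simp_all add: mult.commute[of _ h])
      then have "\<bar>nu k\<bar> * h \<le> pi" "\<bar>nu j\<bar> * h \<le> pi" using hp by linarith+
      then show "\<bar>nu k * h\<bar> \<le> pi" "\<bar>nu j * h\<bar> \<le> pi" using h(1) by (simp_all only: abs_mult abs_of_pos)
    qed
    have "\<bar>nu k * h\<bar> = \<bar>nu j * h\<bar>" by (rule cos_inj_pi[OF abs_ge_zero le(1) abs_ge_zero le(2) ce])
    then have "\<bar>nu k\<bar> = \<bar>nu j\<bar>" using h(1) by (simp add: abs_mult)
    then have "nu k = nu j \<or> nu k + nu j = 0" by linarith
    then show False using nu_inj[of k j] nu_add_eq_0[of k j] k by auto
  qed
  have "d = cscale (cinner d (phi j)) (phi j)"
    by (rule l2_coef_eqI) (use other in \<open>auto simp: cinner_cscale_left cinner_phi\<close>)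
  moreover have "cinner d (phi j) = 0"
    by (rule single_frequency[of \<tau>]) (use calculation z \<tau> d in \<open>auto simp: Es_def\<close>)
  ultimately show ?thesis by simp
qed

text \<open>Injectivity keeps the new directions out of the image of the old space, and closedness
  of that image turns this into a lower bound. \<open>phi j\<close> and \<i> times
  \<open>phi j\<close> are added one after the other; for j = l only the first belongs to
  \<open>Es\<close>.\<close>

lemma LB_insert:
  assumes LB: "\<And>\<tau>'. \<tau>0 < \<tau>' \<Longrightarrow> \<tau>' \<le> 1 \<Longrightarrow> LB \<tau>' S" and \<tau>: "0 \<le> \<tau>0" "\<tau>0 < \<tau>" "\<tau> \<le> 1"
    and j: "j \<notin> S"
  shows "LB \<tau> (insert j S)"
proof -
  let ?f = "\<lambda>d. Xop \<tau> (Bop d)"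
  interpret f: bounded_linear ?f by (rule bounded_linear_XB)
  note inj = LB_injective[OF LB \<tau>, of _ j]
  obtain c where c: "0 < c" "\<And>d. d \<in> Es S \<Longrightarrow> c * norm d \<le> norm (?f d)"
    using LB[of \<tau>] \<tau> unfolding LB_def by blast
  have sub: "Es S \<subseteq> Es (insert j S)" by (auto simp: Es_def)
  have pj: "phi j \<in> Es (insert j S)" by (auto simp: Es_def cinner_phi)
  have v1: "?f (phi j) \<notin> ?f ` Es S"
  proof
    assume "?f (phi j) \<in> ?f ` Es S"
    then obtain x where x: "x \<in> Es S" "?f (phi j) = ?f x" by blast
    have "phi j - x = 0"
      by (rule inj) (use x sub pj subspace_diff[OF subspace_Es] f.diff[of "phi j" x] in auto)
    then have "x = phi j" by simp
    then have "cinner x (phi j) = cinner (phi j) (phi j)" by (rule arg_cong)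
    then have "cinner x (phi j) = 1" unfolding cinner_phi by simp
    then show False using x(1) j by (simp add: Es_def)
  qed
  obtain c1 where c1: "0 < c1" "\<And>x a. x \<in> Es S \<Longrightarrow> c1 * norm (x + a *\<^sub>R phi j) \<le> norm (?f (x + a *\<^sub>R phi j))"
    using complete_bounded_below[OF bounded_linear_XB subspace_Es closed_Es c v1] by blast
  define E1 where "E1 = {d \<in> Es (insert j S). Im (cinner d (phi j)) = 0}"
  have E1b: "c1 * norm d \<le> norm (?f d)" if d: "d \<in> E1" for d
  proof -
    let ?a = "Re (cinner d (phi j))"
    let ?x = "d - ?a *\<^sub>R phi j"
    have cx: "cinner ?x (phi k) = (if k = j then 0 else cinner d (phi k))" for k
      using d by (simp add: cinner_diff_left scaleR_eq_cscale cinner_cscale_left cinner_phi E1_def complex_eq_iff)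
    have "?x \<in> Es S" using d by (auto simp: Es_def E1_def cx)
    from c1(2)[OF this, of ?a] show ?thesis by simp
  qed
  show ?thesis
  proof (cases "j = l")
    case True
    then have "Es (insert j S) = E1" by (auto simp: E1_def Es_def)
    then show ?thesis using E1b c1(1) unfolding LB_def by blast
  next
    case False
    have E1s: "subspace E1"
      using subspace_Es[of "insert j S"] unfolding E1_def subspace_def
      by (auto simp: cinner_add_left scaleR_eq_cscale cinner_cscale_left)
    have "E1 = Es (insert j S) \<inter> {d. Im (cinner d (phi j)) = 0}" by (auto simp: E1_def)
    then have E1c: "closed E1"
      by (auto intro!: closed_Int closed_Es closed_Collect_eq continuous_intros linear_continuous_on bounded_linear_compose[OF bounded_linear_Im bounded_linear_cinner_left])
    let ?v = "cscale \<i> (phi j)"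
    have vE: "?v \<in> Es (insert j S)" using False by (auto simp: Es_def cinner_cscale_left cinner_phi)
    have v2: "?f ?v \<notin> ?f ` E1"
    proof
      assume "?f ?v \<in> ?f ` E1"
      then obtain x where x: "x \<in> E1" "?f ?v = ?f x" by blast
      have "?v - x = 0"
        by (rule inj) (use x vE subspace_diff[OF subspace_Es] f.diff[of ?v x] in \<open>auto simp: E1_def\<close>)
      then have "x = ?v" by simp
      then have "cinner x (phi j) = cinner ?v (phi j)" by (rule arg_cong)
      then have "cinner x (phi j) = \<i>" unfolding cinner_cscale_left cinner_phi by simp
      then show False using x(1) by (simp add: E1_def)
    qed
    obtain c2 where c2: "0 < c2" "\<And>x a. x \<in> E1 \<Longrightarrow> c2 * norm (x + a *\<^sub>R ?v) \<le> norm (?f (x + a *\<^sub>R ?v))"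
      using complete_bounded_below[OF bounded_linear_XB E1s E1c c1(1) E1b v2] by blast
    have "c2 * norm d \<le> norm (?f d)" if d: "d \<in> Es (insert j S)" for d
    proof -
      let ?a = "Im (cinner d (phi j))"
      let ?x = "d - ?a *\<^sub>R ?v"
      have "?x \<in> Es (insert j S)" by (intro subspace_diff subspace_scale subspace_Es d vE)
      moreover have "Im (cinner ?x (phi j)) = 0"
        by (simp add: cinner_diff_left scaleR_eq_cscale cinner_cscale_left cinner_phi)
      ultimately have "?x \<in> E1" by (simp add: E1_def)
      from c2(2)[OF this, of ?a] show ?thesis by simp
    qed
    then show ?thesis using c2(1) unfolding LB_def by blast
  qed
qed

text \<open>The tail already works at time \<open>\<tau>\<close> / 2. Each of the finitely many
  other frequencies uses up arbitrarily little time, so every time beyond \<open>\<tau>\<close> / 2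
  remains good throughout the induction.\<close>

lemma LB_UNIV:
  assumes \<tau>: "0 < \<tau>" "\<tau> \<le> 1"
  shows "LB \<tau> UNIV"
proof -
  obtain K where K: "LB (\<tau> / 2) {k. K \<le> \<bar>k\<bar>}" using LB_tail[of "\<tau> / 2"] \<tau> by auto
  have "\<forall>\<tau>'. \<tau> / 2 < \<tau>' \<longrightarrow> \<tau>' \<le> 1 \<longrightarrow> LB \<tau>' ({k. K \<le> \<bar>k\<bar>} \<union> F)" if "finite F" for F
    using that
  proof induction
    case empty
    then show ?case using LB_mono[OF K] by auto
  next
    case (insert j F)
    show ?case
    proof (cases "j \<in> {k. K \<le> \<bar>k\<bar>}")
      case True
      then have "{k. K \<le> \<bar>k\<bar>} \<union> insert j F = {k. K \<le> \<bar>k\<bar>} \<union> F" by auto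
      then show ?thesis using insert.IH by simp
    next
      case False
      show ?thesis
        using LB_insert[of "\<tau> / 2" "{k. K \<le> \<bar>k\<bar>} \<union> F" _ j] insert False \<tau> by auto
    qed
  qed
  from this[of "{- K..K}"] have "LB \<tau> ({k. K \<le> \<bar>k\<bar>} \<union> {- K..K})" using \<tau> by simp
  moreover have "{k. K \<le> \<bar>k\<bar>} \<union> {- K..K} = UNIV" by auto
  ultimately show ?thesis by simp
qed

text \<open>The Gram operator \<open>An \<circ> Xop \<tau> \<circ> Bop\<close> is coercive, so that
  $d \mapsto d - \varepsilon (G d - y)$ is a contraction for small $\varepsilon$.\<close>

lemma moment_problem:
  assumes \<tau>: "0 < \<tau>" "\<tau> \<le> 1"
  shows "\<exists>L C. 0 < C \<and> (\<forall>y\<in>Es UNIV. Xop \<tau> (L y) = L y \<and> (\<forall>k. cinner (L y) (ex k) = cinner y (phi k)) \<and> norm (L y) \<le> C * norm y)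
     \<and> (\<forall>y\<in>Es UNIV. \<forall>y'\<in>Es UNIV. norm (L y - L y') \<le> C * norm (y - y'))"
proof -
  let ?E = "Es UNIV"
  define G where "G d = An (Xop \<tau> (Bop d))" for d
  have Gbl: "bounded_linear G"
    unfolding G_def by (rule bounded_linear_compose[OF bounded_linear_An bounded_linear_XB])
  interpret G: bounded_linear G by (rule Gbl)
  obtain c where c: "0 < c" "\<And>d. d \<in> ?E \<Longrightarrow> c * norm d \<le> norm (Xop \<tau> (Bop d))"
    using LB_UNIV[OF \<tau>] unfolding LB_def by blast
  obtain K where K: "0 < K" "\<And>d. norm (G d) \<le> norm d * K" using G.pos_bounded by blast
  obtain KX where KX: "0 < KX" "\<And>d. norm (Xop \<tau> (Bop d)) \<le> norm d * KX"
    using bounded_linear.pos_bounded[OF bounded_linear_XB] by blast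
  have coercive: "c\<^sup>2 * (norm d)\<^sup>2 \<le> inner (G d) d" if d: "d \<in> ?E" for d
  proof -
    have "(c * norm d)\<^sup>2 \<le> (norm (Xop \<tau> (Bop d)))\<^sup>2" using c by (intro power_mono c(2) d) auto
    also have "\<dots> = inner (Bop d) (Xop \<tau> (Bop d))" by (simp add: norm_Xop_sq inner_commute)
    also have "\<dots> = inner d (G d)" unfolding inner_l2_def G_def Bop_adjoint ..
    finally show ?thesis by (simp add: power_mult_distrib inner_commute)
  qed
  \<comment> \<open>The exponential at l is the constant 1 and \<open>Xop\<close> has real values,
    so the l-th moment is real.\<close>
  have GE: "G d \<in> ?E" for d
  proof -
    have "cinner (G d) (phi l) = (LINT s|M01. fun_of (Xop \<tau> (Bop d)) s * cnj (cis (nu l * s)))"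
      unfolding G_def coef_An using cinner_l2_of[OF fun_of_L2[of "Xop \<tau> (Bop d)"] cis_L2[of "nu l"]] by (simp add: ex_def)
    also have "\<dots> = (LINT s|M01. complex_of_real (indicator {0<..<\<tau>} s * Re (fun_of (Bop d) s)))"
    proof (rule integral_cong_AE)
      show "(\<lambda>s. fun_of (Xop \<tau> (Bop d)) s * cnj (cis (nu l * s))) \<in> borel_measurable M01"
        by (intro borel_measurable_times fun_of_borel cnj_borel_measurable L2_funD(1)[OF cis_L2])
      show "(\<lambda>s. complex_of_real (indicator {0<..<\<tau>} s * Re (fun_of (Bop d) s))) \<in> borel_measurable M01"
        by (intro complex_of_real_measurable ind_times_measurable Re_measurable fun_of_borel) simp
      show "AE s in M01. fun_of (Xop \<tau> (Bop d)) s * cnj (cis (nu l * s)) = complex_of_real (indicator {0<..<\<tau>} s * Re (fun_of (Bop d) s))"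
        using Xop_fun[of \<tau> "Bop d"] by eventually_elim simp
    qed
    finally have "Im (cinner (G d) (phi l)) = 0" by (simp only: integral_complex_of_real Im_complex_of_real)
    then show ?thesis by (simp add: Es_def)
  qed
  \<comment> \<open>The minimiser of 1 - 2 \<open>\<epsilon>\<close> c^2 +
    \<open>\<epsilon>\<close>^2 K^2, at which the last term equals \<open>\<epsilon>\<close>
    c^2.\<close>
  define \<epsilon> where "\<epsilon> = c\<^sup>2 / K\<^sup>2"
  have \<epsilon>: "0 < \<epsilon>" using c K by (simp add: \<epsilon>_def)
  define Q where "Q = sqrt (max 0 (1 - \<epsilon> * c\<^sup>2))"
  have Q: "0 \<le> Q" "Q < 1" using \<epsilon> c by (auto simp: Q_def)
  have contr: "norm (z - \<epsilon> *\<^sub>R G z) \<le> Q * norm z" if z: "z \<in> ?E" for z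
  proof (rule power2_le_imp_le)
    have "(norm (z - \<epsilon> *\<^sub>R G z))\<^sup>2 = (norm z)\<^sup>2 - 2 * \<epsilon> * inner (G z) z + \<epsilon>\<^sup>2 * (norm (G z))\<^sup>2"
      unfolding power2_norm_eq_inner inner_diff_left inner_diff_right inner_scaleR_left inner_scaleR_right
        inner_commute[of z "G z"]
      by (simp add: power2_eq_square algebra_simps)
    also have "\<dots> \<le> (norm z)\<^sup>2 - 2 * \<epsilon> * (c\<^sup>2 * (norm z)\<^sup>2) + \<epsilon>\<^sup>2 * (norm z * K)\<^sup>2"
      using \<epsilon> coercive[OF z] power_mono[OF K(2)[of z] norm_ge_zero, of 2]
      by (intro add_mono diff_mono mult_left_mono) auto
    also have "\<epsilon>\<^sup>2 * (norm z * K)\<^sup>2 = \<epsilon> * (c\<^sup>2 * (norm z)\<^sup>2)"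
      using K(1) by (simp add: \<epsilon>_def power2_eq_square)
    also have "(norm z)\<^sup>2 - 2 * \<epsilon> * (c\<^sup>2 * (norm z)\<^sup>2) + \<epsilon> * (c\<^sup>2 * (norm z)\<^sup>2) = (1 - \<epsilon> * c\<^sup>2) * (norm z)\<^sup>2"
      by (simp add: algebra_simps)
    also have "\<dots> \<le> max 0 (1 - \<epsilon> * c\<^sup>2) * (norm z)\<^sup>2" by (intro mult_right_mono) auto
    also have "\<dots> = (Q * norm z)\<^sup>2" by (simp add: Q_def power_mult_distrib)
    finally show "(norm (z - \<epsilon> *\<^sub>R G z))\<^sup>2 \<le> (Q * norm z)\<^sup>2" .
  qed (use Q in simp)
  have "\<exists>d\<in>?E. G d = y" if y: "y \<in> ?E" for y
  proof -
    let ?\<Phi> = "\<lambda>d. d - \<epsilon> *\<^sub>R (G d - y)"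
    have "\<exists>!d\<in>?E. ?\<Phi> d = d"
    proof (rule Banach_fix[OF _ _ Q])
      show "complete ?E" by (simp add: complete_eq_closed closed_Es)
      show "?E \<noteq> {}" using y by blast
      show "?\<Phi> ` ?E \<subseteq> ?E" using y GE by (auto intro!: subspace_diff subspace_scale subspace_Es)
      show "dist (?\<Phi> x) (?\<Phi> x') \<le> Q * dist x x'" if "x \<in> ?E" "x' \<in> ?E" for x x'
      proof -
        have eq: "?\<Phi> x - ?\<Phi> x' = (x - x') - \<epsilon> *\<^sub>R G (x - x')" by (simp add: G.diff algebra_simps)
        show ?thesis unfolding dist_norm eq by (rule contr[OF subspace_diff[OF subspace_Es that]])
      qed
    qed
    then show ?thesis using \<epsilon> by auto
  qed
  then obtain dd where dd: "\<And>y. y \<in> ?E \<Longrightarrow> dd y \<in> ?E" "\<And>y. y \<in> ?E \<Longrightarrow> G (dd y) = y" by metis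
  have inv: "norm z \<le> norm (G z) / c\<^sup>2" if z: "z \<in> ?E" for z
  proof (cases "z = 0")
    case False
    have "c\<^sup>2 * (norm z)\<^sup>2 \<le> norm (G z) * norm z"
      using coercive[OF z] norm_cauchy_schwarz[of "G z" z] by linarith
    then have "(c\<^sup>2 * norm z) * norm z \<le> norm (G z) * norm z" by (simp add: power2_eq_square mult_ac)
    then have "c\<^sup>2 * norm z \<le> norm (G z)" by (rule mult_right_le_imp_le) (use False in simp)
    then show ?thesis using c(1) by (simp add: field_simps)
  qed simp
  \<comment> \<open>By coercivity the preimages \<open>dd\<close> are unique and depend on the data
    in a Lipschitz way, so \<open>L\<close> and its differences are estimated through
    \<open>G\<close>.\<close>
  define L where "L y = Xop \<tau> (Bop (dd y))" for y
  define C where "C = KX / c\<^sup>2"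
  have C: "0 < C" using KX c by (simp add: C_def)
  have dif: "norm (Xop \<tau> (Bop z)) \<le> C * norm (G z)" if z: "z \<in> ?E" for z
  proof -
    have "norm (Xop \<tau> (Bop z)) \<le> norm z * KX" by (rule KX(2))
    also have "\<dots> \<le> norm (G z) / c\<^sup>2 * KX" using KX(1) by (intro mult_right_mono inv z) auto
    finally show ?thesis by (simp add: C_def mult.commute)
  qed
  have "norm (L y - L y') \<le> C * norm (y - y')" if "y \<in> ?E" "y' \<in> ?E" for y y'
  proof -
    interpret f: bounded_linear "\<lambda>d. Xop \<tau> (Bop d)" by (rule bounded_linear_XB)
    have "L y - L y' = Xop \<tau> (Bop (dd y - dd y'))" by (simp add: L_def f.diff)
    then show ?thesis
      using dif[OF subspace_diff[OF subspace_Es dd(1)[OF that(1)] dd(1)[OF that(2)]]] dd(2) that by (simp add: G.diff)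
  qed
  moreover have "norm (L y) \<le> C * norm y" if "y \<in> ?E" for y
    using dif[OF dd(1)[OF that]] dd(2)[OF that] by (simp add: L_def)
  moreover have "cinner (L y) (ex k) = cinner y (phi k)" if "y \<in> ?E" for y k
    using arg_cong[OF dd(2)[OF that], of "\<lambda>x. cinner x (phi k)"] by (simp add: L_def G_def coef_An)
  moreover have "Xop \<tau> (L y) = L y" for y by (simp add: L_def Xop_Xop)
  ultimately show ?thesis using C by blast
qed

end

section \<open>The nonlinear problem\<close>

context control
begin

abbreviation nrm :: "(real \<Rightarrow> real) \<Rightarrow> real" where "nrm u \<equiv> sqrt (LINT s|MT. (u s)\<^sup>2)"

lemma L2_fun_real_diff:
  fixes u v :: "real \<Rightarrow> real"
  shows "u \<in> L2_fun a b \<Longrightarrow> v \<in> L2_fun a b \<Longrightarrow> (\<lambda>s. u s - v s) \<in> L2_fun a b"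
  using L2_fun_add[OF _ L2_fun_uminus, of u a b v] by simp

lemma Pt_minus:
  assumes "p \<in> L2V T" "q \<in> L2V T"
  shows "Pt (\<lambda>s. p s - q s) t = Pt p t - Pt q t"
  unfolding Pt_def scaleR_diff_right by (rule Gam_diff; rule L2V_indicator[OF assms(1)] L2V_indicator[OF assms(2)]; simp)

lemma Pt_drive_diff:
  assumes u: "u \<in> L2_fun 0 T" and v: "v \<in> L2_fun 0 T" and z: "continuous_on UNIV z" and w: "continuous_on UNIV w"
  shows Pt_drive_diff_left: "Pt (drive (\<lambda>s. u s - v s) z) t = Pt (drive u z) t - Pt (drive v z) t"
    and Pt_drive_diff_right: "Pt (drive u (\<lambda>s. z s - w s)) t = Pt (drive u z) t - Pt (drive u w) t"
  unfolding scaleR_diff_left evol_diff scaleR_diff_right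
  by (rule Pt_minus; rule drive_L2V; fact)+

text \<open>At a time where the norm is largest, the Duhamel term is at most half of the maximum and
  can be absorbed.\<close>

lemma norm_sol_le:
  assumes u: "u \<in> L2_fun 0 T" and small: "Cg * nrm u \<le> 1 / 2"
  shows "norm (sol u \<eta> t) \<le> 2 * norm \<eta>"
proof -
  obtain B where B: "\<And>t. norm (sol u \<eta> t) \<le> B" "\<exists>t. norm (sol u \<eta> t) = B" using sol_bounded[OF u, of \<eta>] by metis
  then obtain t0 where t0: "norm (sol u \<eta> t0) = B" by blast
  have B0: "0 \<le> B" using t0 norm_ge_zero[of "sol u \<eta> t0"] by linarith
  have "norm (sol u \<eta> t0) = norm (\<eta> + Pt (drive u (sol u \<eta>)) t0)" by (rule arg_cong[OF sol_eq[OF u]])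
  also have "\<dots> \<le> norm \<eta> + norm (Pt (drive u (sol u \<eta>)) t0)" by (rule norm_triangle_ineq)
  also have "\<dots> \<le> norm \<eta> + Cg * nrm u * B"
    by (intro add_left_mono norm_Pt_drive u continuous_on_sol B(1))
  also have "\<dots> \<le> norm \<eta> + 1 / 2 * B" by (intro add_left_mono mult_right_mono small B0)
  finally have "B \<le> 2 * norm \<eta>" unfolding t0 by simp
  with B(1)[of t] show ?thesis by simp
qed

lemma norm_sol_near:
  assumes u: "u \<in> L2_fun 0 T" and small: "Cg * nrm u \<le> 1 / 2"
  shows "norm (sol u \<eta> t - e) \<le> norm (\<eta> - e) + 2 * (Cg * nrm u * norm \<eta>)"
proof -
  have "sol u \<eta> t - e = (\<eta> - e) + Pt (drive u (sol u \<eta>)) t" by (subst sol_eq[OF u]) simp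
  then have "norm (sol u \<eta> t - e) \<le> norm (\<eta> - e) + norm (Pt (drive u (sol u \<eta>)) t)"
    by (simp only: norm_triangle_ineq)
  also have "\<dots> \<le> norm (\<eta> - e) + Cg * nrm u * (2 * norm \<eta>)"
    by (intro add_left_mono norm_Pt_drive u continuous_on_sol norm_sol_le small)
  finally show ?thesis by (simp add: mult_ac)
qed

lemma norm_sol_lipschitz:
  assumes u: "u \<in> L2_fun 0 T" "Cg * nrm u \<le> 1 / 2" and v: "v \<in> L2_fun 0 T" "Cg * nrm v \<le> 1 / 2"
  shows "norm (sol u \<eta> t - sol v \<eta> t) \<le> 4 * (Cg * nrm (\<lambda>s. u s - v s) * norm \<eta>)"
proof -
  let ?d = "\<lambda>s. sol u \<eta> s - sol v \<eta> s"
  have c: "continuous_on S ?d" for S by (intro continuous_intros continuous_on_sol u v)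
  have "\<exists>t\<in>{0..T}. \<forall>s\<in>{0..T}. norm (?d s) \<le> norm (?d t)"
    by (rule continuous_attains_sup) (use T in \<open>auto intro!: continuous_on_norm c\<close>)
  then obtain t0 where t0: "\<And>s. s \<in> {0..T} \<Longrightarrow> norm (?d s) \<le> norm (?d t0)" by blast
  define D where "D = norm (?d t0)"
  have D: "norm (?d s) \<le> D" for s
  proof -
    have "?d s = ?d (max 0 (min T s))" using sol_clamp[OF u(1), of \<eta> s] sol_clamp[OF v(1), of \<eta> s] by (simp only:)
    moreover have "max 0 (min T s) \<in> {0..T}" using T by auto
    ultimately show ?thesis unfolding D_def using t0 by metis
  qed
  have "?d t0 = Pt (drive u (sol u \<eta>)) t0 - Pt (drive v (sol v \<eta>)) t0"
    using sol_eq[OF u(1), of \<eta> t0] sol_eq[OF v(1), of \<eta> t0] by (metis add_diff_cancel_left)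
  also have "\<dots> = Pt (drive (\<lambda>s. u s - v s) (sol u \<eta>)) t0 + Pt (drive v ?d) t0"
    unfolding Pt_drive_diff_left[OF u(1) v(1) continuous_on_sol[OF u(1)] continuous_on_sol[OF v(1)]]
      Pt_drive_diff_right[OF v(1) v(1) continuous_on_sol[OF u(1)] continuous_on_sol[OF v(1)]] by simp
  finally have "D \<le> norm (Pt (drive (\<lambda>s. u s - v s) (sol u \<eta>)) t0) + norm (Pt (drive v ?d) t0)"
    unfolding D_def by (simp only: norm_triangle_ineq)
  also have "\<dots> \<le> Cg * nrm (\<lambda>s. u s - v s) * (2 * norm \<eta>) + Cg * nrm v * D"
    by (intro add_mono norm_Pt_drive L2_fun_real_diff u v continuous_on_sol norm_sol_le D c)
  also have "\<dots> \<le> Cg * nrm (\<lambda>s. u s - v s) * (2 * norm \<eta>) + 1 / 2 * D"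
    by (intro add_left_mono mult_right_mono v) (simp add: D_def)
  finally have "D \<le> 4 * (Cg * nrm (\<lambda>s. u s - v s) * norm \<eta>)" by (simp add: mult_ac)
  with D[of t] show ?thesis by simp
qed

text \<open>The difference of the two linearisation errors splits into u - v driving the distance of
  the solution from \<open>e\<close>, and v driving the difference of the solutions. Each part is
  Lipschitz in u - v with a small factor, as a contraction requires.\<close>

lemma sol_linearised:
  assumes u: "u \<in> L2_fun 0 T" "Cg * nrm u \<le> 1 / 2" and v: "v \<in> L2_fun 0 T" "Cg * nrm v \<le> 1 / 2"
  shows "norm (sol u \<eta> T - sol v \<eta> T - (Gam (drive u (\<lambda>_. e)) - Gam (drive v (\<lambda>_. e))))
    \<le> Cg * nrm (\<lambda>s. u s - v s) * (norm (\<eta> - e) + 2 * (Cg * nrm u * norm \<eta>))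
      + Cg * nrm v * (4 * (Cg * nrm (\<lambda>s. u s - v s) * norm \<eta>))"
proof -
  note cu = continuous_on_sol[OF u(1), of UNIV \<eta>] and cv = continuous_on_sol[OF v(1), of UNIV \<eta>]
  have ce: "continuous_on UNIV (\<lambda>_. e)" by simp
  note w = L2_fun_real_diff[OF u(1) v(1)]
  have G: "Gam q = Pt q T" for q using Pt_T by simp
  have s: "sol u \<eta> T - sol v \<eta> T = Pt (drive u (sol u \<eta>)) T - Pt (drive v (sol v \<eta>)) T"
    using sol_eq[OF u(1), of \<eta> T] sol_eq[OF v(1), of \<eta> T] by (metis add_diff_cancel_left)
  have "sol u \<eta> T - sol v \<eta> T - (Gam (drive u (\<lambda>_. e)) - Gam (drive v (\<lambda>_. e)))
      = Pt (drive (\<lambda>s. u s - v s) (\<lambda>s. sol u \<eta> s - e)) T + Pt (drive v (\<lambda>s. sol u \<eta> s - sol v \<eta> s)) T"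
    unfolding s G Pt_drive_diff_right[OF w w cu ce] Pt_drive_diff_right[OF v(1) v(1) cu cv]
      Pt_drive_diff_left[OF u(1) v(1) cu cu] Pt_drive_diff_left[OF u(1) v(1) ce ce] by simp
  then have "norm (sol u \<eta> T - sol v \<eta> T - (Gam (drive u (\<lambda>_. e)) - Gam (drive v (\<lambda>_. e))))
     \<le> norm (Pt (drive (\<lambda>s. u s - v s) (\<lambda>s. sol u \<eta> s - e)) T) + norm (Pt (drive v (\<lambda>s. sol u \<eta> s - sol v \<eta> s)) T)"
    by (simp only: norm_triangle_ineq)
  also have "\<dots> \<le> Cg * nrm (\<lambda>s. u s - v s) * (norm (\<eta> - e) + 2 * (Cg * nrm u * norm \<eta>))
      + Cg * nrm v * (4 * (Cg * nrm (\<lambda>s. u s - v s) * norm \<eta>))"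
    by (intro add_mono norm_Pt_drive continuous_on_diff w v cu cv ce norm_sol_near norm_sol_lipschitz u)
  finally show ?thesis .
qed

end

text \<open>The control as a real function on the whole line, representing
  \<open>Xop \<tau> v\<close> on (0, 1). It vanishes outside (0, \<open>\<tau>\<close>), so
  integrals over (0, T) and (0, 1) agree once both contain that interval.\<close>

definition ctl :: "real \<Rightarrow> l2 \<Rightarrow> real \<Rightarrow> real" where
  "ctl \<tau> v s = indicator {0<..<\<tau>} s * Re (fun_of v s)"

lemma supported_restrict:
  fixes f :: "real \<Rightarrow> 'a::euclidean_space"
  assumes f: "\<And>s. s \<notin> {0<..<\<tau>} \<Longrightarrow> f s = 0" and \<tau>: "\<tau> \<le> a" "\<tau> \<le> b"
  shows "(LINT s|lebesgue_on {0<..<a}. f s) = (LINT s|lebesgue_on {0<..<b}. f s)"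
    and "integrable (lebesgue_on {0<..<a}) f \<longleftrightarrow> integrable (lebesgue_on {0<..<b}) f"
    and "f \<in> borel_measurable (lebesgue_on {0<..<a}) \<longleftrightarrow> f \<in> borel_measurable (lebesgue_on {0<..<b})"
proof -
  have *: "(\<lambda>s. indicator {0<..<c} s *\<^sub>R f s) = f" if "\<tau> \<le> c" for c
  proof
    fix s show "indicator {0<..<c} s *\<^sub>R f s = f s"
      using f[of s] that by (cases "s \<in> {0<..<\<tau>}") (auto simp: indicator_def)
  qed
  show "(LINT s|lebesgue_on {0<..<a}. f s) = (LINT s|lebesgue_on {0<..<b}. f s)"
    by (subst (1 2) integral_restrict_space) (simp_all add: * \<tau>)
  show "integrable (lebesgue_on {0<..<a}) f \<longleftrightarrow> integrable (lebesgue_on {0<..<b}) f"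
    by (subst (1 2) integrable_restrict_space) (simp_all add: * \<tau>)
  show "f \<in> borel_measurable (lebesgue_on {0<..<a}) \<longleftrightarrow> f \<in> borel_measurable (lebesgue_on {0<..<b})"
    by (subst (1 2) borel_measurable_restrict_space_iff) (simp_all add: * \<tau>)
qed

lemma truncated_real_part:
  assumes \<tau>: "\<tau> \<le> T" "\<tau> \<le> 1" and g: "g \<in> L2_fun 0 1" and x: "AE s in M01. fun_of x s = g s"
  shows "(\<lambda>s. indicator {0<..<\<tau>} s * Re (g s)) \<in> L2_fun 0 T"
    and "(LINT s|lebesgue_on {0<..<T}. (indicator {0<..<\<tau>} s * Re (g s))\<^sup>2) \<le> (norm x)\<^sup>2"
proof -
  let ?u = "\<lambda>s. indicator {0<..<\<tau>} s * Re (g s)"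
  have m: "?u \<in> borel_measurable M01" by (intro ind_times_measurable Re_measurable L2_funD(1)[OF g]) simp
  have le: "\<bar>?u s\<bar> \<le> norm (g s)" for s using abs_Re_le_cmod[of "g s"] by (auto simp: indicator_def)
  have u1: "?u \<in> L2_fun 0 1" by (rule L2_fun_bound[OF g m, where C = 1]) (use le in simp)
  have "?u \<in> borel_measurable (lebesgue_on {0<..<T}) \<longleftrightarrow> ?u \<in> borel_measurable M01"
    by (rule supported_restrict(3)[OF _ \<tau>]) simp
  moreover have "integrable (lebesgue_on {0<..<T}) (\<lambda>s. (norm (?u s))\<^sup>2) \<longleftrightarrow> integrable M01 (\<lambda>s. (norm (?u s))\<^sup>2)"
    by (rule supported_restrict(2)[OF _ \<tau>]) simp
  ultimately show "?u \<in> L2_fun 0 T" using u1 by (simp only: L2_fun_def mem_Collect_eq)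
  have "(LINT s|lebesgue_on {0<..<T}. (norm (?u s))\<^sup>2) = (LINT s|M01. (norm (?u s))\<^sup>2)"
    by (rule supported_restrict(1)[OF _ \<tau>]) simp
  also have "\<dots> \<le> (LINT s|M01. (norm (fun_of x s))\<^sup>2)"
  proof (rule integral_mono_AE[OF L2_funD(2)[OF u1] L2_funD(2)[OF fun_of_L2]])
    show "AE s in M01. (norm (?u s))\<^sup>2 \<le> (norm (fun_of x s))\<^sup>2"
      using x
    proof eventually_elim
      case (elim s)
      show ?case unfolding elim by (rule power_mono) (use le in auto)
    qed
  qed
  finally show "(LINT s|lebesgue_on {0<..<T}. (?u s)\<^sup>2) \<le> (norm x)\<^sup>2"
    by (simp only: norm_l2_sq real_norm_def power2_abs)
qed

lemma ctl_props:
  assumes \<tau>: "\<tau> \<le> T" "\<tau> \<le> 1"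
  shows ctl_L2: "ctl \<tau> v \<in> L2_fun 0 T"
    and ctl_norm: "sqrt (LINT s|lebesgue_on {0<..<T}. (ctl \<tau> v s)\<^sup>2) \<le> norm v"
    and ctl_norm_diff: "sqrt (LINT s|lebesgue_on {0<..<T}. (ctl \<tau> v s - ctl \<tau> w s)\<^sup>2) \<le> norm (v - w)"
proof -
  have c: "ctl \<tau> v = (\<lambda>s. indicator {0<..<\<tau>} s * Re (fun_of v s))" for v by (simp add: ctl_def fun_eq_iff)
  have d: "(\<lambda>s. fun_of v s - fun_of w s) \<in> L2_fun 0 1"
    using L2_fun_add[OF fun_of_L2[of v] L2_fun_uminus[OF fun_of_L2[of w]]] by simp
  show "ctl \<tau> v \<in> L2_fun 0 T" unfolding c by (rule truncated_real_part(1)[OF \<tau> fun_of_L2 AE_I2]) simp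
  show "sqrt (LINT s|lebesgue_on {0<..<T}. (ctl \<tau> v s)\<^sup>2) \<le> norm v"
    unfolding c by (rule real_le_lsqrt, rule norm_ge_zero, rule truncated_real_part(2)[OF \<tau> fun_of_L2 AE_I2]) simp
  have "(LINT s|lebesgue_on {0<..<T}. (ctl \<tau> v s - ctl \<tau> w s)\<^sup>2) \<le> (norm (v - w))\<^sup>2"
    using truncated_real_part(2)[OF \<tau> d fun_of_diff] by (simp add: ctl_def right_diff_distrib)
  then show "sqrt (LINT s|lebesgue_on {0<..<T}. (ctl \<tau> v s - ctl \<tau> w s)\<^sup>2) \<le> norm (v - w)"
    by (intro real_le_lsqrt) auto
qed

context spectrum
begin

lemma ctl_moment:
  assumes \<tau>: "\<tau> \<le> T" "\<tau> \<le> 1"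
  shows "(LINT s|lebesgue_on {0<..<T}. complex_of_real (ctl \<tau> v s) * cis ((eigval u0 k - eigval u0 l) * s)) = cinner (Xop \<tau> v) (ex k)"
proof -
  have n: "cis ((eigval u0 k - eigval u0 l) * s) = cnj (cis (nu k * s))" for s
    by (simp add: cis_cnj nu_def left_diff_distrib)
  have "cinner (Xop \<tau> v) (ex k) = (LINT s|M01. fun_of (Xop \<tau> v) s * cnj (cis (nu k * s)))"
    using cinner_l2_of[OF fun_of_L2[of "Xop \<tau> v"] cis_L2[of "nu k"]] by (simp add: ex_def)
  also have "\<dots> = (LINT s|M01. complex_of_real (ctl \<tau> v s) * cnj (cis (nu k * s)))"
  proof (rule integral_cong_AE)
    show "(\<lambda>s. fun_of (Xop \<tau> v) s * cnj (cis (nu k * s))) \<in> borel_measurable M01"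
      by (intro borel_measurable_times fun_of_borel cnj_borel_measurable L2_funD(1)[OF cis_L2])
    show "(\<lambda>s. complex_of_real (ctl \<tau> v s) * cnj (cis (nu k * s))) \<in> borel_measurable M01"
      unfolding ctl_def
      by (intro borel_measurable_times complex_of_real_measurable Re_measurable fun_of_borel
          ind_times_measurable cnj_borel_measurable L2_funD(1)[OF cis_L2]) simp
    show "AE s in M01. fun_of (Xop \<tau> v) s * cnj (cis (nu k * s)) = complex_of_real (ctl \<tau> v s) * cnj (cis (nu k * s))"
      using Xop_fun[of \<tau> v] by eventually_elim (simp add: ctl_def)
  qed
  also have "\<dots> = (LINT s|lebesgue_on {0<..<T}. complex_of_real (ctl \<tau> v s) * cnj (cis (nu k * s)))"
    by (rule supported_restrict(1)[OF _ \<tau>(2) \<tau>(1)]) (simp add: ctl_def)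
  finally show ?thesis by (simp only: n)
qed

end

section \<open>Steering near the eigensolution\<close>

locale steering = control M Gop I cf pt u0 T + spectrum u0 l
  for M Gop :: "l2 \<Rightarrow> l2" and I :: "'i set" and cf :: "'i \<Rightarrow> complex" and pt :: "'i \<Rightarrow> real" and u0 T :: real and l :: int +
  fixes C :: real
  assumes C: "0 < C" and lower: "C / (\<bar>real_of_int k\<bar> + 1) \<le> norm (cinner (M (phi l)) (phi k))"
begin

definition e0 :: l2 where "e0 = cscale (of_real (jb l)) (phi l)"

text \<open>The factor by which the linearised end point map multiplies the k-th moment of the
  control, as \<open>Gam_drive_e0\<close> shows.\<close>

definition bc :: "int \<Rightarrow> complex" where "bc k = - \<i> * of_real (jb k) * cinner (M (phi l)) (phi k)"

lemma Lam_e0: "Lam e0 = phi l"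
  by (simp add: e0_def Lam_cscale Lam_phi cscale_cscale)

text \<open>The assumed decay 1 / (|k| + 1) is exactly what the weight compensates, as jb k >= (|k|
  + 1) / 2.\<close>

lemma norm_bc: "C / 2 \<le> norm (bc k)"
proof -
  have j: "(\<bar>real_of_int k\<bar> + 1) / 2 \<le> jb k" by (auto simp: jb_def)
  have "C / 2 = (\<bar>real_of_int k\<bar> + 1) / 2 * (C / (\<bar>real_of_int k\<bar> + 1))" by (simp add: field_simps)
  also have "\<dots> \<le> jb k * norm (cinner (M (phi l)) (phi k))"
    using C by (intro mult_mono j lower) (auto intro: less_imp_le[OF jb_pos])
  also have "\<dots> = norm (bc k)" by (simp add: bc_def norm_mult less_imp_le[OF jb_pos])
  finally show ?thesis .
qed

text \<open>The moment at l of a real control is real, so with an imaginary factor the l-th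
  coefficient of the linearised end point is imaginary. This is the missing real direction.\<close>

lemma Re_bc_l: "Re (bc l) = 0"
proof -
  have "cinner (M (phi l)) (phi l) = cnj (cinner (M (phi l)) (phi l))"
    using cinner_commute[of "phi l" "M (phi l)"] by (simp add: M_sym)
  then have "Im (cinner (M (phi l)) (phi l)) = 0" by (simp add: complex_eq_iff)
  then show ?thesis by (simp add: bc_def)
qed

text \<open>Along \<open>e0\<close> the source is a scalar function of time times
  \<open>M (phi l)\<close>, so the linearised end point map is diagonal in the modes.\<close>

lemma Gam_drive_e0:
  assumes u: "u \<in> L2_fun 0 T"
  shows "cinner (Gam (drive u (\<lambda>_. e0))) (phi k) = bc k * (LINT s|MT. complex_of_real (u s) * cis ((eigval u0 k - eigval u0 l) * s))"
proof -
  have "M (Lam (drive u (\<lambda>_. e0) s)) = cscale (of_real (u s) * exp (- (\<i> * of_real (eigval u0 l * s)))) (M (phi l))" for s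
    unfolding e0_def evol_cscale evol_phi scaleR_eq_cscale Lam_cscale Lam_phi M_cscale cscale_cscale by simp
  then have "cis (eigval u0 k * s) * cinner (M (Lam (drive u (\<lambda>_. e0) s))) (phi k)
     = (complex_of_real (u s) * cis ((eigval u0 k - eigval u0 l) * s)) * cinner (M (phi l)) (phi k)" for s
    by (simp add: cinner_cscale_left cis_conv_exp exp_diff exp_minus left_diff_distrib right_diff_distrib field_simps)
  then have "(LINT s|MT. cis (eigval u0 k * s) * cinner (M (Lam (drive u (\<lambda>_. e0) s))) (phi k))
     = (LINT s|MT. complex_of_real (u s) * cis ((eigval u0 k - eigval u0 l) * s)) * cinner (M (phi l)) (phi k)"
    by (simp only: integral_mult_left_zero)
  then show ?thesis
    unfolding coef_Gam[OF drive_L2V[OF u continuous_on_const]] gam_def bc_def by (simp only: mult_ac)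
qed

text \<open>The direction \<open>phi l\<close> (over the reals) is invisible for the linearised system; it is recovered
  from the conservation of the norm.\<close>

definition Pl :: "l2 \<Rightarrow> l2" where "Pl z = z - Re (cinner z (phi l)) *\<^sub>R phi l"

lemma Re_Pl: "Re (cinner (Pl z) (phi l)) = 0"
  by (simp add: Pl_def cinner_diff_left scaleR_eq_cscale cinner_cscale_left cinner_phi)

lemma Pl_Pl: "Pl (Pl z) = Pl z" using Re_Pl[of z] by (simp add: Pl_def[of "Pl z"])

lemma Pl_add: "Pl (x + y) = Pl x + Pl y" and Pl_diff: "Pl (x - y) = Pl x - Pl y"
  by (simp_all add: Pl_def cinner_add_left cinner_diff_left algebra_simps)

lemma norm_Pl: "norm (Pl z) \<le> 2 * norm z"
proof -
  have "norm (Pl z) \<le> norm z + \<bar>Re (cinner z (phi l))\<bar>" unfolding Pl_def by (rule order_trans[OF norm_triangle_ineq4]) simp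
  also have "\<bar>Re (cinner z (phi l))\<bar> \<le> norm z" using abs_Re_le_cmod[of "cinner z (phi l)"] norm_cinner_le[of z "phi l"] by simp
  finally show ?thesis by simp
qed

text \<open>Dividing by \<open>bc k\<close>, which is bounded below, reduces the target to a moment
  problem. \<open>Pl\<close> leaves an imaginary l-th coefficient, and the imaginary
  \<open>bc l\<close> turns it into the real one that \<open>Es\<close> requires.\<close>

lemma linearised_control:
  "\<exists>A w. 0 < A \<and> (\<forall>z. w z \<in> L2_fun 0 T \<and> Gam (drive (w z) (\<lambda>_. e0)) = Pl z \<and> nrm (w z) \<le> A * norm z)
    \<and> (\<forall>z z'. nrm (\<lambda>s. w z s - w z' s) \<le> A * norm (z - z'))"
proof -
  define \<tau> where "\<tau> = min T 1"
  have \<tau>: "0 < \<tau>" "\<tau> \<le> T" "\<tau> \<le> 1" using T by (auto simp: \<tau>_def)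
  obtain L C' where C': "0 < C'"
    and L: "\<And>y. y \<in> Es UNIV \<Longrightarrow> Xop \<tau> (L y) = L y" "\<And>y k. y \<in> Es UNIV \<Longrightarrow> cinner (L y) (ex k) = cinner y (phi k)"
      "\<And>y. y \<in> Es UNIV \<Longrightarrow> norm (L y) \<le> C' * norm y"
      "\<And>y y'. y \<in> Es UNIV \<Longrightarrow> y' \<in> Es UNIV \<Longrightarrow> norm (L y - L y') \<le> C' * norm (y - y')"
    using moment_problem[OF \<tau>(1,3)] by metis
  have bnz: "bc k \<noteq> 0" for k using norm_bc[of k] C by auto
  have m: "norm (1 / bc k) \<le> 2 / C" for k
    using frac_le[of 1 1 "C / 2" "norm (bc k)"] norm_bc[of k] C by (simp add: norm_divide)
  define Y where "Y z = dmult (\<lambda>k. 1 / bc k) (Pl z)" for z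
  have cY: "cinner (Y z) (phi k) = cinner (Pl z) (phi k) / bc k" for z k
    unfolding Y_def coef_dmult[OF m] by simp
  have YE: "Y z \<in> Es UNIV" for z
    using Re_Pl[of z] Re_bc_l by (simp add: Es_def cY Im_divide)
  have Ydiff: "Y z - Y z' = Y (z - z')" for z z'
    by (rule l2_coef_eqI) (simp add: cY cinner_diff_left Pl_diff diff_divide_distrib)
  have normY: "norm (Y z) \<le> 4 / C * norm z" for z
  proof -
    have "norm (Y z) \<le> 2 / C * norm (Pl z)" unfolding Y_def by (rule norm_dmult[OF m])
    also have "\<dots> \<le> 2 / C * (2 * norm z)" using C by (intro mult_left_mono norm_Pl) auto
    finally show ?thesis by simp
  qed
  define A where "A = C' * (4 / C)"
  define w where "w z = ctl \<tau> (L (Y z))" for z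
  have A: "0 < A" using C' C by (simp add: A_def)
  have wL: "w z \<in> L2_fun 0 T" for z unfolding w_def by (rule ctl_L2[OF \<tau>(2,3)])
  have "Gam (drive (w z) (\<lambda>_. e0)) = Pl z" for z
  proof (rule l2_coef_eqI)
    fix k
    have "cinner (Gam (drive (w z) (\<lambda>_. e0))) (phi k) = bc k * cinner (Xop \<tau> (L (Y z))) (ex k)"
      unfolding Gam_drive_e0[OF wL] unfolding w_def ctl_moment[OF \<tau>(2,3)] ..
    also have "\<dots> = cinner (Pl z) (phi k)" using bnz[of k] by (simp add: L(1,2) YE cY)
    finally show "cinner (Gam (drive (w z) (\<lambda>_. e0))) (phi k) = cinner (Pl z) (phi k)" .
  qed
  moreover have "nrm (w z) \<le> A * norm z" for z
  proof -
    have "nrm (w z) \<le> norm (L (Y z))" unfolding w_def by (rule ctl_norm[OF \<tau>(2,3)])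
    also have "\<dots> \<le> C' * norm (Y z)" by (rule L(3)[OF YE])
    also have "\<dots> \<le> C' * (4 / C * norm z)" using C' by (intro mult_left_mono normY) auto
    finally show ?thesis by (simp add: A_def)
  qed
  moreover have "nrm (\<lambda>s. w z s - w z' s) \<le> A * norm (z - z')" for z z'
  proof -
    have "nrm (\<lambda>s. w z s - w z' s) \<le> norm (L (Y z) - L (Y z'))" unfolding w_def by (rule ctl_norm_diff[OF \<tau>(2,3)])
    also have "\<dots> \<le> C' * norm (Y (z - z'))" unfolding Ydiff[symmetric] by (rule L(4)[OF YE YE])
    also have "\<dots> \<le> C' * (4 / C * norm (z - z'))" using C' by (intro mult_left_mono normY) auto
    finally show ?thesis by (simp add: A_def)
  qed
  ultimately show ?thesis using A wL by blast
qed

lemma small_radius: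
  fixes a b c :: real
  assumes "0 < a" "0 < b" "0 < c"
  shows "\<exists>r>0. a * r \<le> 1 / 2 \<and> b * r \<le> 1 / 8 \<and> c * r \<le> 1 / 2"
proof -
  define r where "r = min (1 / (2 * a)) (min (1 / (8 * b)) (1 / (2 * c)))"
  have "0 < r" using assms by (simp add: r_def)
  moreover have "a * r \<le> a * (1 / (2 * a))" "b * r \<le> b * (1 / (8 * b))" "c * r \<le> c * (1 / (2 * c))"
    using assms by (intro mult_left_mono; simp add: r_def)+
  ultimately show ?thesis using assms by (intro exI[of _ r]) simp
qed

text \<open>The squared norms of the two points differ by c times the sum of their real inner
  products with \<open>phi l\<close>, and both products are positive near
  \<open>phi l\<close>.\<close>

lemma norm_rigidity:
  assumes x: "norm x = 1" and y: "norm (x + c *\<^sub>R phi l) = 1"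
    and near: "norm (x - phi l) < 1" "norm (x + c *\<^sub>R phi l - phi l) < 1"
  shows "c = 0"
proof (rule ccontr)
  assume c: "c \<noteq> 0"
  have pp: "inner (phi l) (phi l) = 1" by (simp add: inner_l2_def cinner_phi)
  have pos: "0 < inner y (phi l)" if "norm (y - phi l) < 1" for y
  proof -
    have "inner y (phi l) = 1 + inner (y - phi l) (phi l)" by (simp add: inner_diff_left pp)
    then show ?thesis using Cauchy_Schwarz_ineq2[of "y - phi l" "phi l"] that by simp
  qed
  have "(norm (x + c *\<^sub>R phi l))\<^sup>2 = (norm x)\<^sup>2 + c * (inner x (phi l) + inner (x + c *\<^sub>R phi l) (phi l))"
    unfolding power2_norm_eq_inner inner_add_left inner_add_right inner_scaleR_left inner_scaleR_right
      inner_commute[of "phi l" x] pp by (simp add: algebra_simps)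
  then have "inner x (phi l) + inner (x + c *\<^sub>R phi l) (phi l) = 0" using c x y by simp
  with pos[OF near(1)] pos[OF near(2)] show False by linarith
qed

text \<open>The unknown is the target z given to the linearised problem, and
  \<open>\<Theta> z\<close> is the end point that its control really reaches. At a fixed point of z
  -> Pl (Pl z + \<open>\<zeta>\<close> - \<open>\<Theta> z\<close>) the error is a real multiple of
  \<open>phi l\<close>, which equality of the L^2 norms excludes.\<close>

lemma local_exact_control:
  "\<exists>\<delta>>0. \<forall>\<eta> \<zeta>. norm (Lam \<eta>) = 1 \<and> norm (Lam \<zeta>) = 1 \<and> norm (\<eta> - e0) < \<delta> \<and> norm (\<zeta> - e0) < \<delta> \<longrightarrow>
     (\<exists>u\<in>L2_fun 0 T. sol u \<eta> T = \<zeta>)"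
proof -
  obtain A w where A: "0 < A"
    and w1: "\<forall>z. w z \<in> L2_fun 0 T \<and> Gam (drive (w z) (\<lambda>_. e0)) = Pl z \<and> nrm (w z) \<le> A * norm z"
    and w2: "\<forall>z z'. nrm (\<lambda>s. w z s - w z' s) \<le> A * norm (z - z')"
    using linearised_control by (elim exE conjE) (rule that)
  have w: "w z \<in> L2_fun 0 T" "Gam (drive (w z) (\<lambda>_. e0)) = Pl z" "nrm (w z) \<le> A * norm z"
    "nrm (\<lambda>s. w z s - w z' s) \<le> A * norm (z - z')" for z z'
    using w1[THEN spec, of z] w2[THEN spec, THEN spec, of z z'] by (simp_all only: simp_thms)
  define K where "K = Cg * A"
  define H where "H = norm e0 + 1"
  have K: "0 < K" using A Cg(1) by (simp add: K_def)
  have H: "1 \<le> H" by (simp add: H_def)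
  \<comment> \<open>In this order the bounds serve the a priori estimates of the solutions, the
    contraction, and the closeness to \<open>phi l\<close> that \<open>norm_rigidity\<close>
    needs.\<close>
  obtain r where r: "0 < r" "K * r \<le> 1 / 2" "(6 * K * K * H) * r \<le> 1 / 8" "(2 * K * H) * r \<le> 1 / 2"
    using small_radius[of K "6 * K * K * H" "2 * K * H"] K H by auto
  \<comment> \<open>r / 8 gives norm (\<open>\<Phi> 0\<close>) <= 2 (\<open>\<delta>\<close> +
    \<open>\<delta>\<close>) <= r / 2; 1 / (8 K) supplies the second eighth of the contraction
    factor 2 (1/8 + 1/8); 1 / 4 adds to the 1 / 2 of the closeness estimate.\<close>
  define \<delta> where "\<delta> = min (r / 8) (min (1 / (8 * K)) (1 / 4))"
  have \<delta>: "0 < \<delta>" "\<delta> \<le> r / 8" "\<delta> \<le> 1 / 4" using r(1) K by (auto simp: \<delta>_def)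
  have "K * \<delta> \<le> K * (1 / (8 * K))" using K by (intro mult_left_mono) (auto simp: \<delta>_def)
  then have \<delta>4: "K * \<delta> \<le> 1 / 8" using K by simp
  have Kw: "Cg * nrm (w z) \<le> K * norm z" for z
    using mult_left_mono[OF w(3)[of z] less_imp_le[OF Cg(1)]] by (simp add: K_def mult.assoc)
  have Kwd: "Cg * nrm (\<lambda>s. w z s - w z' s) \<le> K * norm (z - z')" for z z'
    using mult_left_mono[OF w(4)[of z z'] less_imp_le[OF Cg(1)]] by (simp add: K_def mult.assoc)
  have Kr: "Cg * nrm (w z) \<le> K * r" if "norm z \<le> r" for z
    by (rule order_trans[OF Kw mult_left_mono[OF that less_imp_le[OF K]]])
  have small: "Cg * nrm (w z) \<le> 1 / 2" if "norm z \<le> r" for z by (rule order_trans[OF Kr[OF that] r(2)])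
  have nn: "0 \<le> Cg * nrm v" for v using Cg(1) by (intro mult_nonneg_nonneg) auto
  have "\<exists>u\<in>L2_fun 0 T. sol u \<eta> T = \<zeta>"
    if n\<eta>: "norm (Lam \<eta>) = 1" and n\<zeta>: "norm (Lam \<zeta>) = 1" and d\<eta>: "norm (\<eta> - e0) < \<delta>" and d\<zeta>: "norm (\<zeta> - e0) < \<delta>" for \<eta> \<zeta>
  proof -
    have \<eta>H: "norm \<eta> \<le> H" using norm_triangle_sub[of \<eta> e0] d\<eta> \<delta> by (simp add: H_def)
    define \<Theta> where "\<Theta> z = sol (w z) \<eta> T" for z
    define \<Phi> where "\<Phi> z = Pl (Pl z + \<zeta> - \<Theta> z)" for z
    have near: "norm (\<Theta> z - e0) \<le> norm (\<eta> - e0) + 2 * (K * norm z * H)" if z: "norm z \<le> r" for z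
    proof -
      have "norm (\<Theta> z - e0) \<le> norm (\<eta> - e0) + 2 * (Cg * nrm (w z) * norm \<eta>)"
        unfolding \<Theta>_def by (rule norm_sol_near[OF w(1) small[OF z]])
      also have "\<dots> \<le> norm (\<eta> - e0) + 2 * (K * norm z * H)"
        by (intro add_left_mono mult_left_mono mult_mono Kw \<eta>H) (use K in auto)
      finally show ?thesis .
    qed
    have contr: "norm (\<Phi> z - \<Phi> z') \<le> 1 / 2 * norm (z - z')" if z: "norm z \<le> r" "norm z' \<le> r" for z z'
    proof -
      let ?D = "norm (z - z')"
      have "\<Phi> z - \<Phi> z' = Pl ((Pl z + \<zeta> - \<Theta> z) - (Pl z' + \<zeta> - \<Theta> z'))"
        unfolding \<Phi>_def by (rule Pl_diff[symmetric])
      also have "(Pl z + \<zeta> - \<Theta> z) - (Pl z' + \<zeta> - \<Theta> z') = - (\<Theta> z - \<Theta> z' - (Pl z - Pl z'))" by simp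
      finally have "norm (\<Phi> z - \<Phi> z') \<le> 2 * norm (\<Theta> z - \<Theta> z' - (Pl z - Pl z'))"
        using norm_Pl[of "- (\<Theta> z - \<Theta> z' - (Pl z - Pl z'))"] by (simp only: norm_minus_cancel)
      also have "norm (\<Theta> z - \<Theta> z' - (Pl z - Pl z')) \<le> Cg * nrm (\<lambda>s. w z s - w z' s) * (norm (\<eta> - e0) + 2 * (Cg * nrm (w z) * norm \<eta>))
         + Cg * nrm (w z') * (4 * (Cg * nrm (\<lambda>s. w z s - w z' s) * norm \<eta>))"
        using sol_linearised[OF w(1) small[OF z(1)] w(1) small[OF z(2)], of \<eta> e0] by (simp only: w(2) \<Theta>_def)
      also have "\<dots> \<le> K * ?D * (\<delta> + 2 * (K * r * H)) + K * r * (4 * (K * ?D * H))"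
        by (intro add_mono mult_mono Kwd Kr z \<eta>H less_imp_le[OF d\<eta>] order_refl nn mult_nonneg_nonneg add_nonneg_nonneg)
          (use K H r(1) \<delta>(1) in auto)
      also have "\<dots> = (K * \<delta> + (6 * K * K * H) * r) * ?D" by (simp add: algebra_simps)
      also have "\<dots> \<le> (1 / 8 + 1 / 8) * ?D" by (intro mult_right_mono add_mono \<delta>4 r(3)) auto
      finally show ?thesis by simp
    qed
    have "Pl 0 = 0" by (simp add: Pl_def)
    moreover have "norm (\<zeta> - \<Theta> 0) \<le> norm (\<zeta> - e0) + norm (\<Theta> 0 - e0)"
      using norm_triangle_ineq4[of "\<zeta> - e0" "\<Theta> 0 - e0"] by simp
    ultimately have \<Phi>0: "norm (\<Phi> 0) \<le> r / 2"
      using near[of 0] r(1) d\<eta> d\<zeta> \<delta>(2) norm_Pl[of "\<zeta> - \<Theta> 0"] by (simp add: \<Phi>_def)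
    have "\<exists>!z\<in>cball 0 r. \<Phi> z = z"
    proof (rule Banach_fix[where c = "1 / 2"])
      show "complete (cball (0::l2) r)" by (simp add: complete_eq_closed)
      show "\<Phi> ` cball 0 r \<subseteq> cball 0 r"
      proof
        fix y assume "y \<in> \<Phi> ` cball 0 r"
        then obtain z where z: "norm z \<le> r" "y = \<Phi> z" by auto
        have "norm (\<Phi> z) \<le> norm (\<Phi> z - \<Phi> 0) + norm (\<Phi> 0)" using norm_triangle_sub[of "\<Phi> z" "\<Phi> 0"] by simp
        also have "\<dots> \<le> 1 / 2 * norm z + r / 2" using contr[OF z(1), of 0] r(1) \<Phi>0 by simp
        also have "\<dots> \<le> r" using z(1) by simp
        finally show "y \<in> cball 0 r" by (simp add: z(2))
      qed
      show "dist (\<Phi> x) (\<Phi> y) \<le> 1 / 2 * dist x y" if "x \<in> cball 0 r" "y \<in> cball 0 r" for x y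
        unfolding dist_norm by (rule contr) (use that in auto)
    qed (use r(1) in auto)
    then obtain z where z: "norm z \<le> r" "\<Phi> z = z" by auto
    then have "Pl z = z" using Pl_Pl[of "Pl z + \<zeta> - \<Theta> z"] unfolding \<Phi>_def by simp
    then have "Pl (\<zeta> - \<Theta> z) = 0" using z(2) unfolding \<Phi>_def by (simp add: Pl_add Pl_diff)
    then obtain a where a: "\<zeta> - \<Theta> z = a *\<^sub>R phi l" unfolding Pl_def by auto
    have "\<zeta> = \<Theta> z + cscale (of_real a) (phi l)" using a by (simp add: scaleR_eq_cscale algebra_simps)
    \<comment> \<open>\<open>Lam\<close> divides \<open>phi l\<close> by \<open>jb l\<close>, which
      rescales the coefficient of the error.\<close>
    then have L: "Lam \<zeta> = Lam (\<Theta> z) + (a / jb l) *\<^sub>R phi l"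
      using bounded_linear.linear[OF bounded_linear_Lam, THEN linear_add, of "\<Theta> z" "cscale (of_real a) (phi l)"]
      by (simp add: Lam_cscale Lam_phi cscale_cscale scaleR_eq_cscale)
    have Ln: "norm (Lam x - phi l) \<le> norm (x - e0)" for x
      using norm_Lam_le[of "x - e0"] by (simp add: Lam_diff Lam_e0)
    have "(2 * (K * norm z * H)) \<le> (2 * K * H) * r" using z(1) K H by (simp add: mult.assoc mult.left_commute)
    then have "norm (\<Theta> z - e0) < 1" using near[OF z(1)] r(4) d\<eta> \<delta>(3) by linarith
    then have "norm (Lam (\<Theta> z) - phi l) < 1" by (rule order_le_less_trans[OF Ln])
    moreover have "norm (Lam \<zeta> - phi l) < 1" by (rule order_le_less_trans[OF Ln]) (use d\<zeta> \<delta>(3) in simp)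
    moreover have "norm (Lam (\<Theta> z)) = 1" unfolding \<Theta>_def norm_sol[OF w(1)] by (rule n\<eta>)
    ultimately have "a / jb l = 0" using norm_rigidity[of "Lam (\<Theta> z)" "a / jb l"] n\<zeta> unfolding L by blast
    then have "\<zeta> = \<Theta> z" using a by simp
    then show ?thesis unfolding \<Theta>_def using w(1)[of z] by blast
  qed
  then show ?thesis using \<delta>(1) by blast
qed

text \<open>The end condition is pulled back by \<open>U (- T)\<close>: the eigensolution at T
  becomes \<open>e0\<close>, and all norms are kept because \<open>evol\<close> is isometric and
  commutes with \<open>Lam\<close>.\<close>

lemma local_control:
  assumes \<mu>: "mult_op \<mu> = M"
  shows "\<exists>\<delta>>0. \<forall>\<psi>0 \<in> H1p. \<forall>\<psi>1 \<in> H1p. norm \<psi>0 = 1 \<and> norm \<psi>1 = 1 \<and>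
       H1p_norm (\<psi>0 - phi l) < \<delta> \<and> H1p_norm (\<psi>1 - eigensol u0 l T) < \<delta> \<longrightarrow>
       (\<exists>u1 \<in> L2_fun 0 T. \<exists>\<psi>. mild_solution T u0 u1 \<mu> \<psi>0 \<psi> \<and> \<psi> 0 = \<psi>0 \<and> \<psi> T = \<psi>1)"
proof -
  obtain \<delta> where \<delta>: "0 < \<delta>" "\<And>\<eta> \<zeta>. norm (Lam \<eta>) = 1 \<Longrightarrow> norm (Lam \<zeta>) = 1 \<Longrightarrow> norm (\<eta> - e0) < \<delta> \<Longrightarrow>
      norm (\<zeta> - e0) < \<delta> \<Longrightarrow> \<exists>u\<in>L2_fun 0 T. sol u \<eta> T = \<zeta>"
    using local_exact_control by blast
  have eig: "eigensol u0 l T = Lam (U T e0)"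
    by (simp add: eigensol_def e0_def evol_cscale evol_phi Lam_cscale Lam_phi cscale_cscale mult.commute)
  have "\<exists>u1\<in>L2_fun 0 T. \<exists>\<psi>. mild_solution T u0 u1 \<mu> \<psi>0 \<psi> \<and> \<psi> 0 = \<psi>0 \<and> \<psi> T = \<psi>1"
    if \<psi>: "\<psi>0 \<in> H1p" "\<psi>1 \<in> H1p" "norm \<psi>0 = 1" "norm \<psi>1 = 1" "H1p_norm (\<psi>0 - phi l) < \<delta>" "H1p_norm (\<psi>1 - eigensol u0 l T) < \<delta>"
    for \<psi>0 \<psi>1
  proof -
    obtain \<eta> \<eta>1 where \<eta>: "\<psi>0 = Lam \<eta>" "\<psi>1 = Lam \<eta>1" using \<psi>(1,2) unfolding H1p_eq by blast
    let ?\<zeta> = "U (- T) \<eta>1"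
    have ret: "U T ?\<zeta> = \<eta>1" by (simp add: evol_evol)
    have "H1p_norm (\<psi>0 - phi l) = norm (\<eta> - e0)" unfolding \<eta>(1) Lam_e0[symmetric] Lam_diff[symmetric] by (rule H1p_norm_Lam)
    then have d0: "norm (\<eta> - e0) < \<delta>" using \<psi>(5) by simp
    have "H1p_norm (\<psi>1 - eigensol u0 l T) = norm (\<eta>1 - U T e0)" unfolding \<eta>(2) eig Lam_diff[symmetric] by (rule H1p_norm_Lam)
    also have "\<dots> = norm (U (- T) (\<eta>1 - U T e0))" by simp
    also have "\<dots> = norm (?\<zeta> - e0)" unfolding evol_diff evol_evol by simp
    finally have d1: "norm (?\<zeta> - e0) < \<delta>" using \<psi>(6) by simp
    have n1: "norm (Lam ?\<zeta>) = 1" using \<psi>(4) by (simp add: Lam_evol \<eta>(2))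
    obtain u where u: "u \<in> L2_fun 0 T" "sol u \<eta> T = ?\<zeta>" using \<delta>(2)[OF _ n1 d0 d1] \<psi>(3) \<eta>(1) by blast
    have "traj u \<eta> 0 = \<psi>0" using T by (simp add: traj_def sol_0[OF u(1)] \<eta>(1))
    moreover have "traj u \<eta> T = \<psi>1" using T by (simp add: traj_def u(2) ret \<eta>(2))
    moreover have "mild_solution T u0 u \<mu> \<psi>0 (traj u \<eta>)" unfolding \<eta>(1) by (rule traj_mild[OF u(1) \<mu>])
    ultimately show ?thesis using u(1) by blast
  qed
  then show ?thesis using \<delta>(1) by blast
qed

end

theorem theorem1p2:
  fixes N :: nat and A :: "real set" and \<mu> :: "real \<Rightarrow> real"
  assumes "N \<ge> 1" and "finite A" and "card A = N" and "A \<subseteq> {0<..<1}"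
    and "\<mu> \<in> H1_pw A"
  shows
    "(\<forall>(T::real) > 0. \<forall>\<psi>0 \<in> H1p. \<forall>u0::real. \<forall>u1 \<in> L2_fun 0 T.
        \<exists>!\<psi>. mild_solution T u0 u1 \<mu> \<psi>0 \<psi>) \<and>
     (\<forall>(u0::real) (l::int).
        u0 \<notin> {2 * pi * q |q. q \<in> \<rat>} \<and>
        (\<exists>C>0. \<forall>k::int. norm (cinner (mult_op \<mu> (phi l)) (phi k)) \<ge> C / (\<bar>real_of_int k\<bar> + 1)) \<longrightarrow>
        (\<forall>(T::real) > 0. \<exists>\<delta>>0. \<forall>\<psi>0 \<in> H1p. \<forall>\<psi>1 \<in> H1p.
           norm \<psi>0 = 1 \<and> norm \<psi>1 = 1 \<and>
           H1p_norm (\<psi>0 - phi l) < \<delta> \<and> H1p_norm (\<psi>1 - eigensol u0 l T) < \<delta> \<longrightarrow>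
           (\<exists>u1 \<in> L2_fun 0 T. \<exists>\<psi>. mild_solution T u0 u1 \<mu> \<psi>0 \<psi> \<and> \<psi> 0 = \<psi>0 \<and> \<psi> T = \<psi>1)))"
proof -
  obtain Gop and I :: "((real \<times> real) \<times> bool) set" and cf pt where G: "bounded_linear Gop" "finite I"
    "\<forall>\<eta> k. 2 * pi * \<i> * of_int k * cinner (mult_op \<mu> (Lam \<eta>)) (phi k)
       = cinner (Gop \<eta>) (phi k) - (\<Sum>i\<in>I. cf i * (ev \<eta> (pt i) * cnj (phi_fun k (pt i))))"
    by (rule mult_op_phi_deriv[OF assms(2,4,5)])
  obtain C where bd: "AE x in M01. \<bar>\<mu> x\<bar> \<le> C" by (rule H1_pw_traces[OF assms(2,4,5)]) (rule that)
  have m: "\<mu> \<in> borel_measurable M01" using assms(5) by (auto simp: H1_pw_def L2_fun_def)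
  have ctrl: "control (mult_op \<mu>) Gop I cf pt T" if "0 < T" for T
    by (rule control.intro[OF bounded_linear_mult_op[OF m bd] mult_op_cscale[OF m bd] mult_op_symmetric[OF m bd]
          G(1,2) G(3)[rule_format] that])
  show ?thesis
  proof (intro conjI allI impI ballI)
    fix T u0 :: real and \<psi>0 and u1 :: "real \<Rightarrow> real"
    assume T: "0 < T" and \<psi>0: "\<psi>0 \<in> H1p" and u: "u1 \<in> L2_fun 0 T"
    interpret control "mult_op \<mu>" Gop I cf pt u0 T by (rule ctrl[OF T])
    obtain \<eta> where \<eta>: "\<psi>0 = Lam \<eta>" using \<psi>0 unfolding H1p_eq by blast
    show "\<exists>!\<psi>. mild_solution T u0 u1 \<mu> \<psi>0 \<psi>"
      unfolding \<eta> using traj_mild[OF u refl] mild_unique[OF u refl] by blast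
  next
    fix u0 T :: real and l :: int
    assume h: "u0 \<notin> {2 * pi * q |q. q \<in> \<rat>} \<and>
        (\<exists>C>0. \<forall>k::int. norm (cinner (mult_op \<mu> (phi l)) (phi k)) \<ge> C / (\<bar>real_of_int k\<bar> + 1))" and T: "0 < T"
    then obtain c where c: "0 < c" "\<And>k. c / (\<bar>real_of_int k\<bar> + 1) \<le> norm (cinner (mult_op \<mu> (phi l)) (phi k))" by blast
    interpret control "mult_op \<mu>" Gop I cf pt u0 T by (rule ctrl[OF T])
    interpret steering "mult_op \<mu>" Gop I cf pt u0 T l c by unfold_locales (use h c in auto)
    show "\<exists>\<delta>>0. \<forall>\<psi>0 \<in> H1p. \<forall>\<psi>1 \<in> H1p.
           norm \<psi>0 = 1 \<and> norm \<psi>1 = 1 \<and>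
           H1p_norm (\<psi>0 - phi l) < \<delta> \<and> H1p_norm (\<psi>1 - eigensol u0 l T) < \<delta> \<longrightarrow>
           (\<exists>u1 \<in> L2_fun 0 T. \<exists>\<psi>. mild_solution T u0 u1 \<mu> \<psi>0 \<psi> \<and> \<psi> 0 = \<psi>0 \<and> \<psi> T = \<psi>1)"
      by (rule local_control[OF refl])
  qed
qed

end
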